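(* Let $(G_{\mathbb C},\rho,V_{\mathbb C})$ be a prehomogeneous vector space over $\mathbb R$ with singular set $S_{\mathbb C}$, put $S_{\mathbb R}=S_{\mathbb C}\cap V_{\mathbb R}$, and let $(\pi,\mathrm C_0(V_{\mathbb R}))$ be the left regular representation of $G_{\mathbb R}$. Then, for $f\in\mathcal S(G)$, the operator $\pi(f):\mathrm C^\infty_c(V_{\mathbb R})\to\mathcal D'(V_{\mathbb R}-S_{\mathbb R})$ is a Fourier integral operator given by $$(\pi(f)\phi)(m)=\int\!\!\int e^{i(m-m')\cdot\xi}\,a_f(m,\xi)\,\phi(m')\,dm'\,\bar d\xi ,$$ with symbol $$a_f(m,\xi)=e^{-im\cdot\xi}\hat f(m,\xi)\in \mathrm S^{-\infty}\big((V_{\mathbb R}-S_{\mathbb R})\times V_{\mathbb R}^\ast\big).$$ On $V_{\mathbb R}-S_{\mathbb R}$, $\pi(f)$ is a pseudodifferential operator of class $\mathrm L^{-\infty}(V_{\mathbb R}-S_{\mathbb R})$.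
   Context: Setting. $G_{\mathbb C}\subset \mathrm{GL}(m,\mathbb C)$ is a connected linear algebraic group defined over $\mathbb R$, assumed symmetric, so that the group of $\mathbb R$-rational points $G_{\mathbb R}=G_{\mathbb C}\cap \mathrm{GL}(m,\mathbb R)$ is a real reductive algebraic group (in Wallach's sense). $G$ is the identity component of $G_{\mathbb R}$, $\mathfrak g$ its Lie algebra, $\mathfrak U$ the universal enveloping algebra of the complexification of $\mathfrak g$, $d_G$ left Haar measure on $G$. $V_{\mathbb C}$ is an $n$-dimensional complex vector space with $\mathbb R$-structure $V_{\mathbb R}$, and $\rho:G_{\mathbb C}\to\mathrm{GL}(V_{\mathbb C})$ an $\mathbb R$-rational representation with a Zariski-dense orbit; then $(G_{\mathbb C},\rho,V_{\mathbb C})$ is called a prehomogeneous vector space over $\mathbb R$, and the complement $S_{\mathbb C}$ of the dense orbit is its singular set. Identify $V_{\mathbb C}\simeq\mathbb C^n$, $V_{\mathbb R}\simeq\mathbb R^n$, $V_{\mathbb R}^\ast\simeq\mathbb R^n$ by a basis of $V_{\mathbb R}$ and write $gm$ for $\rho(g)m$. Rapidly decreasing functions. Fix a left invariant Riemannian metric on $G_{\mathbb R}$ with distance $d$ and put $|g|=d(g,e)$. Let $(L(h)f)(g)=f(h^{-1}g)$ and let $dL$ be the induced representation of $\mathfrak U$ (so $dL(X)f(g)=\frac d{dh}f(e^{-hX}g)|_{h=0}$ for $X\in\mathfrak g$). $\mathcal S(G)$ is the space of $f\in \mathrm C^\infty(G)$ such that for every $\kappa\ge0$ and $X\in\mathfrak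 U$: (i) there is a constant $C$ with $|dL(X)f(g)|\le Ce^{-\kappa|g|}$; (ii) $dL(X)f\in \mathrm L^1(G,e^{\kappa|g|}d_G)$. Operators. $\mathrm C_0(V_{\mathbb R})$ is the Banach space of continuous functions on $V_{\mathbb R}$ vanishing at infinity, $(\pi(g)\phi)(m)=\phi(g^{-1}m)$, and $\pi(f)=\int_G f(g)\pi(g)\,d_G(g)$. Put $\phi_\xi(m)=e^{im\cdot\xi}$ and $\hat f(m,\xi)=\int_G f(g)e^{i(g^{-1}m)\cdot\xi}\,d_G(g)$ for $m\in V_{\mathbb R}$, $\xi\in V_{\mathbb R}^\ast$. $\bar d\xi=(2\pi)^{-n}d\xi$. Symbols. For $U\subset\mathbb R^n$ open and $l\in\mathbb R$, $\mathrm S^l(U\times\mathbb R^n)$ is the set of $a\in \mathrm C^\infty(U\times\mathbb R^n)$ such that for all multiindices $\alpha,\beta$ and compact $K\subset U$ there is $C_{\alpha,\beta,K}$ with $|\partial_\xi^\alpha\partial_x^\beta a(x,\xi)|\le C_{\alpha,\beta,K}(1+|\xi|^2)^{(l-|\alpha|)/2}$ for $x\in K$, $\xi\in\mathbb R^n$; $\mathrm S^{-\infty}=\bigcap_l \mathrm S^l$. $\mathrm L^l(U)$ is the class of operators $A:\mathrm C_c^\infty(U)\to \mathrm C^\infty(U)$, $Au(x)=\int\!\int e^{i(x-y)\cdot\xi}a(x,\xi)u(y)\,dy\,\bar d\xi$ with $a\in \mathrm S^l(U\times\mathbb R^n)$, and $\mathrm L^{-\infty}(U)=\bigcap_l \mathrm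 L^l(U)$ (operators with smooth kernel). *)

theory Defs
  imports "HOL-Analysis.Analysis"
begin

section \<open>Linear algebraic groups over the reals\<close>

text \<open>The polynomial functions in the functions \<open>X\<close> with coefficients in \<open>K\<close>.\<close>

inductive_set poly_funs :: "complex set \<Rightarrow> ('a \<Rightarrow> complex) set \<Rightarrow> ('a \<Rightarrow> complex) set"
  for K X where
  const: "c \<in> K \<Longrightarrow> (\<lambda>_. c) \<in> poly_funs K X"
| gen: "x \<in> X \<Longrightarrow> x \<in> poly_funs K X"
| add: "p \<in> poly_funs K X \<Longrightarrow> q \<in> poly_funs K X \<Longrightarrow> (\<lambda>v. p v + q v) \<in> poly_funs K X"
| mult: "p \<in> poly_funs K X \<Longrightarrow> q \<in> poly_funs K X \<Longrightarrow> (\<lambda>v. p v * q v) \<in> poly_funs K X"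

definition vec_coords :: "(complex^'n \<Rightarrow> complex) set" where
  "vec_coords = range (\<lambda>i v. v $ i)"

definition mat_coords :: "(complex^'m^'m \<Rightarrow> complex) set" where
  "mat_coords = range (\<lambda>(i, j) g. g $ i $ j)"

definition zariski :: "('a \<Rightarrow> complex) set \<Rightarrow> 'a topology" where
  "zariski X = topology_generated_by {{v. p v \<noteq> 0} | p. p \<in> poly_funs UNIV X}"

text \<open>Over a perfect field, a closed set is defined over the field iff it is the zero locus
  of polynomials with coefficients in it.\<close>

definition algebraic_group_over_reals :: "(complex^'m^'m) set \<Rightarrow> bool" where
  "algebraic_group_over_reals GC \<longleftrightarrow>
     mat 1 \<in> GC \<and>
     (\<forall>g\<in>GC. \<forall>h\<in>GC. g ** h \<in> GC) \<and>
     (\<forall>g\<in>GC. matrix_inv g \<in> GC) \<and>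
     (\<exists>P \<subseteq> poly_funs \<real> mat_coords. GC = {g. invertible g \<and> (\<forall>p\<in>P. p g = 0)})"

definition symmetric_group :: "(complex^'m^'m) set \<Rightarrow> bool" where
  "symmetric_group GC \<longleftrightarrow> (\<forall>g\<in>GC. map_matrix cnj (transpose g) \<in> GC)"

text \<open>The regular functions on the general linear group are the polynomials in the entries
  and the inverse of the determinant.\<close>

definition rational_rep_over_reals ::
  "(complex^'m^'m) set \<Rightarrow> (complex^'m^'m \<Rightarrow> complex^'n^'n) \<Rightarrow> bool" where
  "rational_rep_over_reals GC \<rho> \<longleftrightarrow>
     \<rho> (mat 1) = mat 1 \<and>
     (\<forall>g\<in>GC. \<forall>h\<in>GC. \<rho> (g ** h) = \<rho> g ** \<rho> h) \<and>
     (\<forall>i j. \<exists>p \<in> poly_funs \<real> (insert (\<lambda>g. inverse (det g)) mat_coords).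
        \<forall>g\<in>GC. \<rho> g $ i $ j = p g)"

definition dense_orbit ::
  "(complex^'m^'m) set \<Rightarrow> (complex^'m^'m \<Rightarrow> complex^'n^'n) \<Rightarrow> (complex^'n) set \<Rightarrow> bool" where
  "dense_orbit GC \<rho> \<Omega> \<longleftrightarrow>
     (\<exists>v. \<Omega> = (\<lambda>g. \<rho> g *v v) ` GC) \<and> zariski vec_coords closure_of \<Omega> = UNIV"

definition prehomogeneous_over_reals ::
  "(complex^'m^'m) set \<Rightarrow> (complex^'m^'m \<Rightarrow> complex^'n^'n) \<Rightarrow> bool" where
  "prehomogeneous_over_reals GC \<rho> \<longleftrightarrow>
     algebraic_group_over_reals GC \<and>
     connectedin (zariski mat_coords) GC \<and>
     symmetric_group GC \<and>
     rational_rep_over_reals GC \<rho> \<and>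
     (\<exists>\<Omega>. dense_orbit GC \<rho> \<Omega>)"

definition singular_set ::
  "(complex^'m^'m) set \<Rightarrow> (complex^'m^'m \<Rightarrow> complex^'n^'n) \<Rightarrow> (complex^'n) set \<Rightarrow> bool" where
  "singular_set GC \<rho> SC \<longleftrightarrow> (\<exists>\<Omega>. dense_orbit GC \<rho> \<Omega> \<and> SC = - \<Omega>)"

definition real_points_group :: "(complex^'m^'m) set \<Rightarrow> (real^'m^'m) set" where
  "real_points_group GC = {g. map_matrix complex_of_real g \<in> GC}"

definition real_points :: "(complex^'n) set \<Rightarrow> (real^'n) set" where
  "real_points S = {x. (\<chi> i. complex_of_real (x $ i)) \<in> S}"

text \<open>For a representation defined over the reals, \<open>\<rho> g\<close> has real entries when \<open>g\<close> does, so
  that taking real parts only changes the type.\<close>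

definition real_rep :: "(complex^'m^'m \<Rightarrow> complex^'n^'n) \<Rightarrow> real^'m^'m \<Rightarrow> real^'n^'n" where
  "real_rep \<rho> g = map_matrix Re (\<rho> (map_matrix complex_of_real g))"

section \<open>Smooth functions\<close>

text \<open>Partial derivatives are indexed by finite lists of coordinate directions; for smooth
  functions these are the usual multiindex derivatives, the order being the length.\<close>

definition partial_deriv ::
  "'a::euclidean_space \<Rightarrow> ('a \<Rightarrow> 'b::real_normed_vector) \<Rightarrow> 'a \<Rightarrow> 'b" where
  "partial_deriv b F x = frechet_derivative F (at x) b"

definition partial_derivs ::
  "'a::euclidean_space list \<Rightarrow> ('a \<Rightarrow> 'b::real_normed_vector) \<Rightarrow> 'a \<Rightarrow> 'b" where
  "partial_derivs bs F = foldr partial_deriv bs F"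

text \<open>Intended for open \<open>U\<close>.\<close>

definition smooth_on :: "'a::euclidean_space set \<Rightarrow> ('a \<Rightarrow> 'b::real_normed_vector) \<Rightarrow> bool" where
  "smooth_on U F \<longleftrightarrow>
     (\<forall>bs. set bs \<subseteq> Basis \<longrightarrow> (\<forall>x\<in>U. partial_derivs bs F differentiable (at x)))"

definition test_functions :: "'a::euclidean_space set \<Rightarrow> ('a \<Rightarrow> complex) set" where
  "test_functions U =
     {u. smooth_on UNIV u \<and> compact (closure {x. u x \<noteq> 0}) \<and> closure {x. u x \<noteq> 0} \<subseteq> U}"

definition distribution_on :: "'a::euclidean_space set \<Rightarrow> (('a \<Rightarrow> complex) \<Rightarrow> complex) \<Rightarrow> bool" where
  "distribution_on U T \<longleftrightarrow>
     (\<forall>u\<in>test_functions U. \<forall>v\<in>test_functions U. \<forall>a b.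
        T (\<lambda>x. a * u x + b * v x) = a * T u + b * T v) \<and>
     (\<forall>K. compact K \<and> K \<subseteq> U \<longrightarrow>
        (\<exists>C N. \<forall>v\<in>test_functions K. \<forall>B.
           (\<forall>bs x. set bs \<subseteq> Basis \<and> length bs \<le> N \<longrightarrow> norm (partial_derivs bs v x) \<le> B) \<longrightarrow>
           norm (T v) \<le> C * B))"

section \<open>Structures on the real group\<close>

primrec mat_power :: "real^'m^'m \<Rightarrow> nat \<Rightarrow> real^'m^'m" where
  "mat_power X 0 = mat 1"
| "mat_power X (Suc k) = X ** mat_power X k"

definition mat_exp :: "real^'m^'m \<Rightarrow> real^'m^'m" where
  "mat_exp X = (\<Sum>k. mat_power X k /\<^sub>R fact k)"

definition lie_algebra :: "(real^'m^'m) set \<Rightarrow> (real^'m^'m) set" where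
  "lie_algebra G = {X. \<forall>t. mat_exp (t *\<^sub>R X) \<in> G}"

definition identity_component :: "(real^'m^'m) set \<Rightarrow> (real^'m^'m) set" where
  "identity_component GR = connected_component_set GR (mat 1)"

text \<open>Borel measures finite on compact subsets of the Lie group are regular automatically.\<close>

definition left_haar_measure :: "(real^'m^'m) set \<Rightarrow> (real^'m^'m) measure \<Rightarrow> bool" where
  "left_haar_measure G \<mu> \<longleftrightarrow>
     sets \<mu> = sets (restrict_space borel G) \<and>
     (\<forall>g\<in>G. \<forall>A\<in>sets \<mu>. emeasure \<mu> ((\<lambda>h. g ** h) ` A) = emeasure \<mu> A) \<and>
     (\<forall>K. compact K \<and> K \<subseteq> G \<longrightarrow> emeasure \<mu> K < \<infinity>) \<and>
     emeasure \<mu> G \<noteq> 0"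

definition tangent_space :: "(real^'m^'m) set \<Rightarrow> real^'m^'m \<Rightarrow> (real^'m^'m) set" where
  "tangent_space GR g = (\<lambda>X. g ** X) ` lie_algebra GR"

definition inner_product_on :: "'a::real_vector set \<Rightarrow> ('a \<Rightarrow> 'a \<Rightarrow> real) \<Rightarrow> bool" where
  "inner_product_on V B \<longleftrightarrow>
     (\<forall>X\<in>V. \<forall>Y\<in>V. B X Y = B Y X) \<and>
     (\<forall>X\<in>V. \<forall>Y\<in>V. \<forall>Z\<in>V. \<forall>a b. B (a *\<^sub>R X + b *\<^sub>R Y) Z = a * B X Z + b * B Y Z) \<and>
     (\<forall>X\<in>V. X \<noteq> 0 \<longrightarrow> B X X > 0)"

text \<open>Left invariance makes the metric smooth automatically.\<close>

definition left_invariant_metric ::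
  "(real^'m^'m) set \<Rightarrow> (real^'m^'m \<Rightarrow> real^'m^'m \<Rightarrow> real^'m^'m \<Rightarrow> real) \<Rightarrow> bool" where
  "left_invariant_metric GR R \<longleftrightarrow>
     (\<forall>g\<in>GR. inner_product_on (tangent_space GR g) (R g)) \<and>
     (\<forall>h\<in>GR. \<forall>g\<in>GR. \<forall>X\<in>tangent_space GR g. \<forall>Y\<in>tangent_space GR g.
        R (h ** g) (h ** X) (h ** Y) = R g X Y)"

text \<open>The derivative of a \<^const>\<open>valid_path\<close> may be unbounded near the exceptional points;
  \<^const>\<open>has_integral\<close> leaves out the paths of infinite length.\<close>

definition riemannian_dist ::
  "(real^'m^'m) set \<Rightarrow> (real^'m^'m \<Rightarrow> real^'m^'m \<Rightarrow> real^'m^'m \<Rightarrow> real) \<Rightarrow>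
   real^'m^'m \<Rightarrow> real^'m^'m \<Rightarrow> real" where
  "riemannian_dist GR R g h =
     Inf {l. \<exists>\<gamma>. valid_path \<gamma> \<and> path_image \<gamma> \<subseteq> GR \<and> pathstart \<gamma> = g \<and> pathfinish \<gamma> = h \<and>
        ((\<lambda>t. sqrt (R (\<gamma> t) (vector_derivative \<gamma> (at t)) (vector_derivative \<gamma> (at t))))
           has_integral l) {0..1}}"

definition group_norm ::
  "(real^'m^'m) set \<Rightarrow> (real^'m^'m \<Rightarrow> real^'m^'m \<Rightarrow> real^'m^'m \<Rightarrow> real) \<Rightarrow> real^'m^'m \<Rightarrow> real" where
  "group_norm GR R g = riemannian_dist GR R g (mat 1)"

text \<open>Smoothness on an embedded submanifold: locally the restriction of a smooth function of the
  ambient space.\<close>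

definition smooth_on_group :: "(real^'m^'m) set \<Rightarrow> (real^'m^'m \<Rightarrow> complex) \<Rightarrow> bool" where
  "smooth_on_group G f \<longleftrightarrow>
     (\<forall>g\<in>G. \<exists>W F. open W \<and> g \<in> W \<and> smooth_on W F \<and> (\<forall>h\<in>W \<inter> G. f h = F h))"

definition dL :: "real^'m^'m \<Rightarrow> (real^'m^'m \<Rightarrow> complex) \<Rightarrow> real^'m^'m \<Rightarrow> complex" where
  "dL X f g = vector_derivative (\<lambda>t. f (mat_exp (- t *\<^sub>R X) ** g)) (at 0)"

text \<open>The image of the universal enveloping algebra of the complexified Lie algebra under the
  extension of \<^const>\<open>dL\<close>: the unital complex algebra of operators generated by \<^term>\<open>dL X\<close>,
  \<open>X\<close> in the Lie algebra.\<close>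

inductive_set dL_enveloping ::
  "(real^'m^'m) set \<Rightarrow> ((real^'m^'m \<Rightarrow> complex) \<Rightarrow> (real^'m^'m \<Rightarrow> complex)) set"
  for G where
  one: "(\<lambda>f. f) \<in> dL_enveloping G"
| lie: "X \<in> lie_algebra G \<Longrightarrow> dL X \<in> dL_enveloping G"
| scale: "D \<in> dL_enveloping G \<Longrightarrow> (\<lambda>f g. c * D f g) \<in> dL_enveloping G"
| add: "D \<in> dL_enveloping G \<Longrightarrow> E \<in> dL_enveloping G \<Longrightarrow> (\<lambda>f g. D f g + E f g) \<in> dL_enveloping G"
| mult: "D \<in> dL_enveloping G \<Longrightarrow> E \<in> dL_enveloping G \<Longrightarrow> (\<lambda>f. D (E f)) \<in> dL_enveloping G"

definition rapidly_decreasing ::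
  "(real^'m^'m) set \<Rightarrow> (real^'m^'m \<Rightarrow> real^'m^'m \<Rightarrow> real^'m^'m \<Rightarrow> real) \<Rightarrow>
   (real^'m^'m) measure \<Rightarrow> (real^'m^'m \<Rightarrow> complex) set" where
  "rapidly_decreasing GR R \<mu> =
     {f. smooth_on_group (identity_component GR) f \<and>
         (\<forall>\<kappa>\<ge>0. \<forall>D\<in>dL_enveloping (identity_component GR).
            (\<exists>C. \<forall>g\<in>identity_component GR. norm (D f g) \<le> C * exp (- \<kappa> * group_norm GR R g)) \<and>
            integrable \<mu> (\<lambda>g. exp (\<kappa> * group_norm GR R g) *\<^sub>R D f g))}"

section \<open>The operators\<close>

definition left_regular ::
  "(complex^'m^'m \<Rightarrow> complex^'n^'n) \<Rightarrow> real^'m^'m \<Rightarrow> (real^'n \<Rightarrow> complex) \<Rightarrow> real^'n \<Rightarrow> complex" where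
  "left_regular \<rho> g \<phi> m = \<phi> (real_rep \<rho> (matrix_inv g) *v m)"

text \<open>Evaluation at a point is a continuous functional on the space of continuous functions
  vanishing at infinity, so the operator-valued integral is computed pointwise.\<close>

definition integrated_rep ::
  "(complex^'m^'m \<Rightarrow> complex^'n^'n) \<Rightarrow> (real^'m^'m) measure \<Rightarrow> (real^'m^'m \<Rightarrow> complex) \<Rightarrow>
   (real^'n \<Rightarrow> complex) \<Rightarrow> real^'n \<Rightarrow> complex" where
  "integrated_rep \<rho> \<mu> f \<phi> m = (\<integral>g. f g * left_regular \<rho> g \<phi> m \<partial>\<mu>)"

definition group_fourier ::
  "(complex^'m^'m \<Rightarrow> complex^'n^'n) \<Rightarrow> (real^'m^'m) measure \<Rightarrow> (real^'m^'m \<Rightarrow> complex) \<Rightarrow>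
   real^'n \<Rightarrow> real^'n \<Rightarrow> complex" where
  "group_fourier \<rho> \<mu> f m \<xi> =
     (\<integral>g. f g * exp (\<i> * complex_of_real ((real_rep \<rho> (matrix_inv g) *v m) \<bullet> \<xi>)) \<partial>\<mu>)"

definition symbol_of ::
  "(complex^'m^'m \<Rightarrow> complex^'n^'n) \<Rightarrow> (real^'m^'m) measure \<Rightarrow> (real^'m^'m \<Rightarrow> complex) \<Rightarrow>
   real^'n \<Rightarrow> real^'n \<Rightarrow> complex" where
  "symbol_of \<rho> \<mu> f m \<xi> = exp (- \<i> * complex_of_real (m \<bullet> \<xi>)) * group_fourier \<rho> \<mu> f m \<xi>"

section \<open>Symbols, pseudodifferential and Fourier integral operators\<close>

text \<open>Symbols on \<open>U \<times> \<real>\<^sup>N\<close>; the first variable lives in a general Euclidean space, so that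
  amplitudes depending on two space variables are included.\<close>

definition symbol_class ::
  "'a::euclidean_space set \<Rightarrow> real \<Rightarrow> ('a \<Rightarrow> 'c::euclidean_space \<Rightarrow> complex) set" where
  "symbol_class U l =
     {a. open U \<and> smooth_on (U \<times> UNIV) (\<lambda>(x, \<xi>). a x \<xi>) \<and>
         (\<forall>bs cs K. set bs \<subseteq> Basis \<and> set cs \<subseteq> Basis \<and> compact K \<and> K \<subseteq> U \<longrightarrow>
            (\<exists>C. \<forall>x\<in>K. \<forall>\<xi>.
               norm (partial_derivs (map (\<lambda>b. (0, b)) bs @ map (\<lambda>c. (c, 0)) cs)
                       (\<lambda>(x, \<xi>). a x \<xi>) (x, \<xi>))
               \<le> C * (1 + (norm \<xi>)\<^sup>2) powr ((l - real (length bs)) / 2)))}"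

definition smoothing_symbol_class ::
  "'a::euclidean_space set \<Rightarrow> ('a \<Rightarrow> 'c::euclidean_space \<Rightarrow> complex) set" where
  "smoothing_symbol_class U = (\<Inter>l. symbol_class U l)"

definition pseudodiff_class ::
  "(real^'n) set \<Rightarrow> real \<Rightarrow> ((real^'n \<Rightarrow> complex) \<Rightarrow> real^'n \<Rightarrow> complex) set" where
  "pseudodiff_class U l =
     {A. \<exists>a\<in>symbol_class U l. \<forall>u\<in>test_functions U.
           smooth_on U (A u) \<and>
           (\<forall>x\<in>U. A u x =
              complex_of_real ((2 * pi) powr - real CARD('n)) *
              (\<integral>\<xi>. (\<integral>y. exp (\<i> * complex_of_real ((x - y) \<bullet> \<xi>)) * a x \<xi> * u y \<partial>lborel) \<partial>lborel))}"

definition smoothing_pseudodiff_class ::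
  "(real^'n) set \<Rightarrow> ((real^'n \<Rightarrow> complex) \<Rightarrow> real^'n \<Rightarrow> complex) set" where
  "smoothing_pseudodiff_class U = (\<Inter>l. pseudodiff_class U l)"

definition phase_function ::
  "'a::euclidean_space set \<Rightarrow> ('a \<Rightarrow> 'c::euclidean_space \<Rightarrow> real) \<Rightarrow> bool" where
  "phase_function W \<psi> \<longleftrightarrow>
     smooth_on (W \<times> (- {0})) (\<lambda>(z, \<xi>). \<psi> z \<xi>) \<and>
     (\<forall>z\<in>W. \<forall>\<xi>. \<xi> \<noteq> 0 \<longrightarrow>
        (\<forall>t>0. \<psi> z (t *\<^sub>R \<xi>) = t * \<psi> z \<xi>) \<and>
        (\<exists>v. frechet_derivative (\<lambda>(z, \<xi>). \<psi> z \<xi>) (at (z, \<xi>)) v \<noteq> 0))"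

text \<open>The operator \<open>T\<close> from test functions on \<open>Y\<close> to distributions on \<open>X\<close> is the Fourier integral
  operator with phase \<open>\<psi>\<close> and amplitude \<open>a\<close> of order \<open>l\<close>:
  the pairing of \<open>T u\<close> with \<open>v\<close> is the oscillatory integral of
  \<open>exp (i\<psi>) a(x, y, \<xi>) u(y) v(x)\<close>, in its usual regularisation by a cutoff in \<open>\<xi>\<close>, with respect
  to \<open>dx dy d\<xi> / (2\<pi>)\<^sup>N\<close>.\<close>

definition fourier_integral_operator ::
  "'a::euclidean_space set \<Rightarrow> 'b::euclidean_space set \<Rightarrow>
   ('a \<times> 'b \<Rightarrow> 'c::euclidean_space \<Rightarrow> real) \<Rightarrow> real \<Rightarrow> ('a \<times> 'b \<Rightarrow> 'c \<Rightarrow> complex) \<Rightarrow>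
   (('b \<Rightarrow> complex) \<Rightarrow> ('a \<Rightarrow> complex) \<Rightarrow> complex) \<Rightarrow> bool" where
  "fourier_integral_operator X Y \<psi> l a T \<longleftrightarrow>
     open X \<and> open Y \<and> phase_function (X \<times> Y) \<psi> \<and> a \<in> symbol_class (X \<times> Y) l \<and>
     (\<forall>u\<in>test_functions Y. distribution_on X (T u) \<and>
        (\<forall>v\<in>test_functions X. \<forall>\<theta>\<in>test_functions UNIV.
           (\<forall>\<^sub>F \<xi> in nhds 0. \<theta> \<xi> = 1) \<longrightarrow>
           ((\<lambda>\<epsilon>. complex_of_real ((2 * pi) powr - real DIM('c)) *
              (\<integral>p. (case p of ((x, y), \<xi>) \<Rightarrow>
                  \<theta> (\<epsilon> *\<^sub>R \<xi>) * exp (\<i> * complex_of_real (\<psi> (x, y) \<xi>)) *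
                  a (x, y) \<xi> * u y * v x) \<partial>lborel))
            \<longlongrightarrow> T u v) (at_right 0)))"

end

theory Submission
  imports Defs
    "HOL-Computational_Algebra.Fundamental_Theorem_Algebra"
    "HOL-Complex_Analysis.Cauchy_Integral_Formula"
    "HOL-Probability.Characteristic_Functions"
    "HOL-Probability.Sinc_Integral"
begin

text \<open>Up to a unimodular factor the symbol is the integral of \<open>f g\<close> against the wave
\<open>exp (\<i> (\<rho>(g)\<^sup>-\<^sup>1 m) \<bullet> \<xi>)\<close> over the group. The heart of the matter is that this integral decays faster
than any power of \<open>\<xi>\<close>, locally uniformly in \<open>m\<close> outside the singular set
(\<open>wave_integral_decay\<close>). Where the vectors \<open>d\<rho>(X) m\<close>, \<open>X\<close> in the Lie algebra, fill the
whole space, every coordinate of \<open>\<xi>\<close> is a combination of derivatives of the phase: with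
\<open>e\<close> a basis vector, \<open>e \<bullet> \<xi> = (\<rho>(g)\<^sup>-\<^sup>1 \<rho>(g) e) \<bullet> \<xi>\<close>, and \<open>\<rho>(g) e\<close> is a combination of the vectors
\<open>d\<rho>(X) m\<close> whose coefficients are matrix entries of \<open>\<rho>(g)\<close> times bounded numbers, while
\<open>(\<rho>(g)\<^sup>-\<^sup>1 d\<rho>(X) m) \<bullet> \<xi>\<close> is the left derivative of the phase along \<open>X\<close>.
Left invariance of the measure moves this derivative to \<open>f\<close>
(\<open>integration_by_parts\<close>), so that each power of \<open>\<xi>\<close> is traded for a left derivative of \<open>f\<close>
and entries of \<open>\<rho>(g)\<close>. The derivatives of the symbol in \<open>m\<close> and \<open>\<xi>\<close> only bring in further
entries of \<open>\<rho>(g)\<^sup>-\<^sup>1\<close> and powers of the coordinates.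

Two facts about the group make this work.

First, the vectors \<open>d\<rho>(X) m\<close> do fill the space when \<open>m\<close> lies in the dense orbit
(\<open>infinitesimally_transitive\<close>, and \<open>dr_surjective\<close> over the reals). This is the statement that a
dominant morphism is smooth at some point in characteristic zero. It is proved by
elimination. No nonzero polynomial in the coordinates of the target vanishes on the graph of the orbit
map; a prime ideal that contains all equations of the graph and still has this property is
fixed, and the coordinates of the group are adjoined one at a time. Away from a hypersurface,
a point together with an arbitrary tangent vector lifts through each adjunction: a transcendental
coordinate is free, and an algebraic one is a simple root of its minimal equation, to which
the tangent vector extends by implicit differentiation (\<open>lift_one\<close>). At the end the lifted
tangent vector is tangent to the group and maps to the prescribed vector. Homogeneity
spreads the property over the orbit, and taking real parts carries it to real points.

Second, the entries of \<open>\<rho>(g)\<close> and its inverse are bounded by an exponential of the Riemannian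
distance of \<open>g\<close> to the identity (\<open>rr_growth\<close>, \<open>ri_growth\<close>), and hence harmless against the decay of
\<open>f\<close>. Along a path the logarithm of the norm of \<open>\<rho>(g)\<close> grows at most in proportion to the
length, since the velocity, translated to the identity, is an element of the Lie algebra. The
infimum over the paths is meaningful because every element of the identity component is
a product of exponentials (\<open>G_exp_prod\<close>) and is therefore reached by a path of finite length. The
inverse is treated by applying the same estimate to the contragredient representation.

Given the decay, the rest is Fourier inversion. The symbol is integrable in \<open>\<xi>\<close>, so the inversion
formula for the test function, regularised by a Gaussian, may be inserted into
the integral over the group and the regularisation removed by dominated convergence
(\<open>fourier_parseval\<close>). The limit defining the oscillatory integral is another instance of dominated
convergence.\<close>

section \<open>Polynomials and their first variation\<close>

text \<open>Polynomials are represented by their values. Since the field is infinite, nothing is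
lost, and polynomials in some of the variables are at the same time polynomials in all of them; this
makes it easy to adjoin variables one at a time.\<close>

abbreviation polys_in :: "'v set \<Rightarrow> (('v \<Rightarrow> complex) \<Rightarrow> complex) set" where
  "polys_in A \<equiv> poly_funs UNIV ((\<lambda>i x. x i) ` A)"

lemma poly_funs_uminus: "p \<in> poly_funs UNIV X \<Longrightarrow> (\<lambda>v. - p v) \<in> poly_funs UNIV X"
  using poly_funs.mult[OF poly_funs.const[of "-1" UNIV X]] by simp

lemma poly_funs_sum:
  assumes "\<And>i. i \<in> I \<Longrightarrow> p i \<in> poly_funs K X" "0 \<in> K"
  shows "(\<lambda>v. \<Sum>i\<in>I. p i v) \<in> poly_funs K X"
  using assms by (induction I rule: infinite_finite_induct) (auto intro: poly_funs.intros)

lemma poly_funs_prod: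
  assumes "\<And>i. i \<in> I \<Longrightarrow> p i \<in> poly_funs K X" "1 \<in> K"
  shows "(\<lambda>v. \<Prod>i\<in>I. p i v) \<in> poly_funs K X"
  using assms by (induction I rule: infinite_finite_induct) (auto intro: poly_funs.intros)

lemma poly_funs_power:
  assumes "p \<in> poly_funs K X" "1 \<in> K"
  shows "(\<lambda>v. p v ^ j) \<in> poly_funs K X"
  using assms by (induction j) (auto intro: poly_funs.intros)

lemma poly_funs_mono:
  assumes "p \<in> poly_funs K X" "K \<subseteq> L" "X \<subseteq> Y"
  shows "p \<in> poly_funs L Y"
  using assms by induction (auto intro: poly_funs.intros)

lemma poly_funs_comp:
  assumes "p \<in> poly_funs K X" "K \<subseteq> L" "\<And>x. x \<in> X \<Longrightarrow> (\<lambda>u. x (F u)) \<in> poly_funs L Y"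
  shows "(\<lambda>u. p (F u)) \<in> poly_funs L Y"
  using assms by induction (auto intro: poly_funs.intros)

text \<open>A polynomial in a given family of functions \<open>c u i\<close> becomes a polynomial in
independent variables. Matrix entries and the inverse determinant can thus be treated as coordinates.\<close>

lemma poly_funs_factor:
  assumes "p \<in> poly_funs K ((\<lambda>i u. c u i) ` A)"
  shows "\<exists>q\<in>poly_funs K ((\<lambda>i x. x i) ` A). \<forall>u. p u = q (c u)"
  using assms
proof induction
  case (const c) then show ?case by (intro bexI[of _ "\<lambda>_. c"]) (auto intro: poly_funs.intros)
next
  case (gen x)
  then obtain i where "i \<in> A" "x = (\<lambda>u. c u i)" by auto
  then show ?case by (intro bexI[of _ "\<lambda>x. x i"]) (auto intro: poly_funs.intros)
next
  case (add p q)
  then obtain p' q' where "p' \<in> poly_funs K ((\<lambda>i x. x i) ` A)" "q' \<in> poly_funs K ((\<lambda>i x. x i) ` A)" "\<forall>u. p u = p' (c u)" "\<forall>u. q u = q' (c u)" by blast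
  then show ?case by (intro bexI[of _ "\<lambda>x. p' x + q' x"]) (auto intro: poly_funs.intros)
next
  case (mult p q)
  then obtain p' q' where "p' \<in> poly_funs K ((\<lambda>i x. x i) ` A)" "q' \<in> poly_funs K ((\<lambda>i x. x i) ` A)" "\<forall>u. p u = p' (c u)" "\<forall>u. q u = q' (c u)" by blast
  then show ?case by (intro bexI[of _ "\<lambda>x. p' x * q' x"]) (auto intro: poly_funs.intros)
qed

lemma polys_in_mono: "A \<subseteq> B \<Longrightarrow> polys_in A \<subseteq> polys_in B"
  using poly_funs_mono[of _ UNIV _ UNIV] by (meson image_mono subset_UNIV subsetI)

lemma polys_in_cong:
  assumes "p \<in> polys_in A" "\<And>i. i \<in> A \<Longrightarrow> x i = y i"
  shows "p x = p y"
  using assms by induction auto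

definition dir_deriv :: "(('v \<Rightarrow> complex) \<Rightarrow> complex) \<Rightarrow> ('v \<Rightarrow> complex) \<Rightarrow> ('v \<Rightarrow> complex) \<Rightarrow> complex" where
  "dir_deriv p x t = deriv (\<lambda>z. p (\<lambda>i. x i + z * t i)) 0"

text \<open>Existence of the total derivative, with its dependence on the tangent vector linear
and on the curve only through its velocity, is proved in one induction; the uniqueness of derivatives then
identifies it with \<^const>\<open>dir_deriv\<close>.\<close>

lemma polys_in_formal_derivative:
  assumes "p \<in> polys_in A"
  shows "\<exists>d. (\<forall>c t. (\<forall>i\<in>A. ((\<lambda>z. c z i) has_field_derivative t i) (at 0)) \<longrightarrow>
      ((\<lambda>z. p (c z)) has_field_derivative d (c 0) t) (at 0)) \<and>
      (\<forall>x a t b s. d x (\<lambda>i. a * t i + b * s i) = a * d x t + b * d x s)"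
  using assms
proof induction
  case (const c)
  then show ?case by (intro exI[of _ "\<lambda>_ _. 0"]) auto
next
  case (gen x)
  then obtain i where i: "i \<in> A" "x = (\<lambda>x. x i)" by auto
  then show ?case by (intro exI[of _ "\<lambda>_ t. t i"]) auto
next
  case (add p q)
  then obtain d e where
    d: "\<forall>c t. (\<forall>i\<in>A. ((\<lambda>z. c z i) has_field_derivative t i) (at 0)) \<longrightarrow>
      ((\<lambda>z. p (c z)) has_field_derivative d (c 0) t) (at 0)"
    "\<forall>x a t b s. d x (\<lambda>i. a * t i + b * s i) = a * d x t + b * d x s"
    and e: "\<forall>c t. (\<forall>i\<in>A. ((\<lambda>z. c z i) has_field_derivative t i) (at 0)) \<longrightarrow>
      ((\<lambda>z. q (c z)) has_field_derivative e (c 0) t) (at 0)"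
    "\<forall>x a t b s. e x (\<lambda>i. a * t i + b * s i) = a * e x t + b * e x s" by (elim exE conjE)
  have "((\<lambda>z. p (c z) + q (c z)) has_field_derivative d (c 0) t + e (c 0) t) (at 0)"
    if "\<forall>i\<in>A. ((\<lambda>z. c z i) has_field_derivative t i) (at 0)" for c t
    using DERIV_add[OF d(1)[rule_format, of c t] e(1)[rule_format, of c t]] that by simp
  moreover have "d x (\<lambda>i. a * t i + b * s i) + e x (\<lambda>i. a * t i + b * s i) =
      a * (d x t + e x t) + b * (d x s + e x s)" for x a t b s
    using d(2)[rule_format, of x a t b s] e(2)[rule_format, of x a t b s] by (simp add: algebra_simps)
  ultimately show ?case
    by (intro exI[of _ "\<lambda>x t. d x t + e x t"]) blast
next
  case (mult p q)
  then obtain d e where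
    d: "\<forall>c t. (\<forall>i\<in>A. ((\<lambda>z. c z i) has_field_derivative t i) (at 0)) \<longrightarrow>
      ((\<lambda>z. p (c z)) has_field_derivative d (c 0) t) (at 0)"
    "\<forall>x a t b s. d x (\<lambda>i. a * t i + b * s i) = a * d x t + b * d x s"
    and e: "\<forall>c t. (\<forall>i\<in>A. ((\<lambda>z. c z i) has_field_derivative t i) (at 0)) \<longrightarrow>
      ((\<lambda>z. q (c z)) has_field_derivative e (c 0) t) (at 0)"
    "\<forall>x a t b s. e x (\<lambda>i. a * t i + b * s i) = a * e x t + b * e x s" by (elim exE conjE)
  have "((\<lambda>z. p (c z) * q (c z)) has_field_derivative d (c 0) t * q (c 0) + e (c 0) t * p (c 0)) (at 0)"
    if "\<forall>i\<in>A. ((\<lambda>z. c z i) has_field_derivative t i) (at 0)" for c t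
    using DERIV_mult[OF d(1)[rule_format, of c t] e(1)[rule_format, of c t]] that by simp
  moreover have "d x (\<lambda>i. a * t i + b * s i) * q x + e x (\<lambda>i. a * t i + b * s i) * p x =
      a * (d x t * q x + e x t * p x) + b * (d x s * q x + e x s * p x)" for x a t b s
    using d(2)[rule_format, of x a t b s] e(2)[rule_format, of x a t b s] by (simp add: algebra_simps)
  ultimately show ?case
    by (intro exI[of _ "\<lambda>x t. d x t * q x + e x t * p x"]) blast
qed

lemma polys_in_curve:
  assumes "p \<in> polys_in A" "\<And>i. i \<in> A \<Longrightarrow> ((\<lambda>z. c z i) has_field_derivative t i) (at 0)"
  shows "((\<lambda>z. p (c z)) has_field_derivative dir_deriv p (c 0) t) (at 0)"
proof -
  obtain d where d: "\<And>c t. (\<forall>i\<in>A. ((\<lambda>z. c z i) has_field_derivative t i) (at 0)) \<Longrightarrow>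
      ((\<lambda>z. p (c z)) has_field_derivative d (c 0) t) (at 0)"
    using polys_in_formal_derivative[OF assms(1)] by blast
  have "((\<lambda>z. p (\<lambda>i. c 0 i + z * t i)) has_field_derivative d (\<lambda>i. c 0 i + 0 * t i) t) (at 0)"
    by (rule d) (auto intro!: derivative_eq_intros)
  then have "dir_deriv p (c 0) t = d (c 0) t"
    unfolding dir_deriv_def by (simp add: DERIV_imp_deriv)
  with d[of c t] assms(2) show ?thesis by simp
qed

lemma dir_deriv_linear:
  assumes "p \<in> polys_in A"
  shows "dir_deriv p x (\<lambda>i. a * t i + b * s i) = a * dir_deriv p x t + b * dir_deriv p x s"
proof -
  obtain d where d: "\<And>c t. (\<forall>i\<in>A. ((\<lambda>z. c z i) has_field_derivative t i) (at 0)) \<Longrightarrow>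
      ((\<lambda>z. p (c z)) has_field_derivative d (c 0) t) (at 0)"
    "\<And>x a t b s. d x (\<lambda>i. a * t i + b * s i) = a * d x t + b * d x s"
    using polys_in_formal_derivative[OF assms(1)] by blast
  have "dir_deriv p x t = d x t" for t
  proof -
    have "((\<lambda>z. p (\<lambda>i. x i + z * t i)) has_field_derivative d (\<lambda>i. x i + 0 * t i) t) (at 0)"
      by (rule d) (auto intro!: derivative_eq_intros)
    then show ?thesis unfolding dir_deriv_def by (simp add: DERIV_imp_deriv)
  qed
  with d(2) show ?thesis by simp
qed

lemma dir_deriv_line:
  assumes "p \<in> polys_in A"
  shows "((\<lambda>z. p (\<lambda>i. x i + z * t i)) has_field_derivative dir_deriv p x t) (at 0)"
proof -
  have "((\<lambda>z. x i + z * t i) has_field_derivative t i) (at 0)" for i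
    by (auto intro!: derivative_eq_intros)
  from polys_in_curve[OF assms this] show ?thesis by simp
qed

lemma dir_deriv_add:
  assumes "p \<in> polys_in A" "q \<in> polys_in A"
  shows "dir_deriv (\<lambda>x. p x + q x) x t = dir_deriv p x t + dir_deriv q x t"
  using DERIV_unique[OF dir_deriv_line[OF poly_funs.add[OF assms]]
      DERIV_add[OF dir_deriv_line[OF assms(1)] dir_deriv_line[OF assms(2)]]] .

lemma dir_deriv_mult:
  assumes "p \<in> polys_in A" "q \<in> polys_in A"
  shows "dir_deriv (\<lambda>x. p x * q x) x t = dir_deriv p x t * q x + dir_deriv q x t * p x"
  using DERIV_unique[OF dir_deriv_line[OF poly_funs.mult[OF assms]]
      DERIV_mult[OF dir_deriv_line[OF assms(1)] dir_deriv_line[OF assms(2)]]] by simp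

section \<open>Families of univariate polynomials\<close>

text \<open>A polynomial in the variables \<open>insert k A\<close> is read as a univariate polynomial in the variable
\<open>k\<close> whose coefficients are polynomials in the variables \<open>A\<close>. The degrees are bounded uniformly in the
point, which makes evaluation a finite sum.\<close>

definition poly_families :: "'v set \<Rightarrow> (('v \<Rightarrow> complex) \<Rightarrow> complex poly) set" where
  "poly_families A = {U. (\<exists>D. \<forall>x. degree (U x) \<le> D) \<and> (\<forall>j. (\<lambda>x. coeff (U x) j) \<in> polys_in A)}"

lemma coeff_family: "U \<in> poly_families A \<Longrightarrow> (\<lambda>x. coeff (U x) j) \<in> polys_in A"
  by (auto simp: poly_families_def)

lemma const_family: "c \<in> polys_in A \<Longrightarrow> (\<lambda>x. [:c x:]) \<in> poly_families A"
proof -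
  assume c: "c \<in> polys_in A"
  have "(\<lambda>x. coeff [:c x:] j) \<in> polys_in A" for j
    using c by (cases j) (auto intro: poly_funs.const)
  then show ?thesis by (auto simp: poly_families_def intro!: exI[of _ 0])
qed

lemma monom_family: "c \<in> polys_in A \<Longrightarrow> (\<lambda>x. monom (c x) n) \<in> poly_families A"
proof -
  assume c: "c \<in> polys_in A"
  have "(\<lambda>x. coeff (monom (c x) n) j) \<in> polys_in A" for j
    using c by (cases "n = j") (auto intro: poly_funs.const)
  then show ?thesis by (auto simp: poly_families_def degree_monom_le intro!: exI[of _ n])
qed

lemma add_family:
  assumes "U \<in> poly_families A" "W \<in> poly_families A"
  shows "(\<lambda>x. U x + W x) \<in> poly_families A"
proof -
  obtain D E where "\<forall>x. degree (U x) \<le> D" "\<forall>x. degree (W x) \<le> E"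
    using assms by (auto simp: poly_families_def)
  then have "\<forall>x. degree (U x + W x) \<le> max D E"
    by (metis degree_add_le le_max_iff_disj)
  then show ?thesis using assms
    by (auto simp: poly_families_def intro!: poly_funs.add)
qed

lemma mult_family:
  assumes "U \<in> poly_families A" "W \<in> poly_families A"
  shows "(\<lambda>x. U x * W x) \<in> poly_families A"
proof -
  obtain D E where "\<forall>x. degree (U x) \<le> D" "\<forall>x. degree (W x) \<le> E"
    using assms by (auto simp: poly_families_def)
  then have "\<forall>x. degree (U x * W x) \<le> D + E"
    by (metis degree_mult_le add_mono le_trans)
  then show ?thesis using assms
    by (auto simp: poly_families_def coeff_mult intro!: poly_funs.mult poly_funs_sum)
qed

lemma uminus_family:
  assumes "U \<in> poly_families A"
  shows "(\<lambda>x. - U x) \<in> poly_families A"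
  using assms by (auto simp: poly_families_def intro!: poly_funs_uminus)

lemma power_family:
  assumes "U \<in> poly_families A"
  shows "(\<lambda>x. U x ^ n) \<in> poly_families A"
proof (induction n)
  case 0
  then show ?case using const_family[of "\<lambda>_. 1"] by (simp add: poly_funs.const flip: one_pCons)
next
  case (Suc n)
  then show ?case using mult_family[OF assms] by simp
qed

lemma pderiv_family:
  assumes "U \<in> poly_families A"
  shows "(\<lambda>x. pderiv (U x)) \<in> poly_families A"
proof -
  obtain D where "\<forall>x. degree (U x) \<le> D" using assms by (auto simp: poly_families_def)
  then have "\<forall>x. degree (pderiv (U x)) \<le> D" by (metis degree_pderiv le_trans diff_le_self)
  moreover have "(\<lambda>x. coeff (pderiv (U x)) j) \<in> polys_in A" for j
    using assms unfolding coeff_pderiv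
    by (intro poly_funs.mult poly_funs.const) (auto simp: poly_families_def)
  ultimately show ?thesis by (auto simp: poly_families_def)
qed

lemma cutoff_family:
  assumes "U \<in> poly_families A"
  shows "(\<lambda>x. poly_cutoff n (U x)) \<in> poly_families A"
proof -
  have "degree (poly_cutoff n p) \<le> n" for p :: "complex poly"
    by (rule degree_le) (auto simp: coeff_poly_cutoff)
  moreover have "(\<lambda>x. coeff (poly_cutoff n (U x)) j) \<in> polys_in A" for j
    using assms by (cases "j < n") (auto simp: coeff_poly_cutoff poly_families_def intro: poly_funs.const)
  ultimately show ?thesis by (auto simp: poly_families_def)
qed

lemma poly_eq_sum_upto:
  fixes p :: "'a::comm_semiring_1 poly"
  assumes "degree p \<le> D"
  shows "poly p y = (\<Sum>j\<le>D. coeff p j * y ^ j)"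
proof -
  have "poly p y = poly (\<Sum>j\<le>D. monom (coeff p j) j) y"
    using poly_as_sum_of_monoms'[OF assms] by simp
  then show ?thesis by (simp add: poly_sum poly_monom)
qed

lemma poly_family_value:
  assumes "U \<in> poly_families A" "\<eta> \<in> polys_in B" "A \<subseteq> B"
  shows "(\<lambda>x. poly (U x) (\<eta> x)) \<in> polys_in B"
proof -
  obtain D where D: "\<forall>x. degree (U x) \<le> D" using assms by (auto simp: poly_families_def)
  have "(\<lambda>x. \<Sum>j\<le>D. coeff (U x) j * \<eta> x ^ j) \<in> polys_in B"
    using assms(2) coeff_family[OF assms(1)] polys_in_mono[OF assms(3)]
    by (intro poly_funs_sum poly_funs.mult poly_funs_power) auto
  moreover have "poly (U x) (\<eta> x) = (\<Sum>j\<le>D. coeff (U x) j * \<eta> x ^ j)" for x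
    using D by (intro poly_eq_sum_upto) auto
  ultimately show ?thesis by simp
qed

lemma poly_family_exists:
  assumes "s \<in> polys_in (insert k A)"
  shows "\<exists>U\<in>poly_families A. \<forall>x. s x = poly (U x) (x k)"
  using assms
proof induction
  case (const c)
  then show ?case using const_family[of "\<lambda>_. c" A]
    by (intro bexI[of _ "\<lambda>x. [:c:]"]) (auto intro: poly_funs.intros)
next
  case (gen s)
  then obtain i where i: "i \<in> insert k A" "s = (\<lambda>x. x i)" by auto
  show ?case
  proof (cases "i = k")
    case True
    then show ?thesis using i monom_family[of "\<lambda>_. 1" A 1]
      by (intro bexI[of _ "\<lambda>x. monom 1 1"]) (auto simp: poly_monom intro: poly_funs.intros)
  next
    case False
    then have "s \<in> polys_in A" using i by (auto intro: poly_funs.intros)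
    then show ?thesis using i const_family[of s A]
      by (intro bexI[of _ "\<lambda>x. [:s x:]"]) auto
  qed
next
  case (add p q)
  then obtain U W where "U \<in> poly_families A" "\<forall>x. p x = poly (U x) (x k)"
    "W \<in> poly_families A" "\<forall>x. q x = poly (W x) (x k)" by blast
  then show ?case by (intro bexI[of _ "\<lambda>x. U x + W x"]) (auto intro: add_family)
next
  case (mult p q)
  then obtain U W where "U \<in> poly_families A" "\<forall>x. p x = poly (U x) (x k)"
    "W \<in> poly_families A" "\<forall>x. q x = poly (W x) (x k)" by blast
  then show ?case by (intro bexI[of _ "\<lambda>x. U x * W x"]) (auto intro: mult_family)
qed

text \<open>The chain rule that separates the variation of the coefficients from the variation of the
distinguished variable.\<close>

lemma dir_deriv_poly_family:
  assumes "U \<in> poly_families A" "k \<notin> A"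
  shows "dir_deriv (\<lambda>y. poly (U y) (y k)) (x(k := \<eta>)) (t(k := \<tau>)) =
    dir_deriv (\<lambda>y. poly (U y) \<eta>) x t + poly (pderiv (U x)) \<eta> * \<tau>"
proof -
  obtain D where D: "\<forall>x. degree (U x) \<le> D" using assms by (auto simp: poly_families_def)
  define u where "u j x = coeff (U x) j" for j x
  have u: "u j \<in> polys_in A" for j using coeff_family[OF assms(1)] by (simp add: u_def[abs_def])
  define c where "c z i = (x(k := \<eta>)) i + z * (t(k := \<tau>)) i" for z i
  have ck: "c z k = \<eta> + z * \<tau>" for z by (simp add: c_def)
  have cu: "u j (c z) = u j (\<lambda>i. x i + z * t i)" for j z
    by (rule polys_in_cong[OF u]) (use assms(2) in \<open>auto simp: c_def\<close>)
  have val: "poly (U y) w = (\<Sum>j\<le>D. u j y * w ^ j)" for y w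
    using D by (simp add: poly_eq_sum_upto u_def)
  have p1: "((\<lambda>z. poly (U (\<lambda>i. x i + z * t i)) \<eta>) has_field_derivative (\<Sum>j\<le>D. dir_deriv (u j) x t * \<eta> ^ j)) (at 0)"
    unfolding val by (intro DERIV_sum DERIV_cmult_right dir_deriv_line[OF u])
  have pd: "poly (pderiv (U x)) \<eta> = (\<Sum>j\<le>D. u j x * (of_nat j * \<eta> ^ (j - 1)))"
  proof -
    have "((\<lambda>w. \<Sum>j\<le>D. u j x * w ^ j) has_field_derivative (\<Sum>j\<le>D. u j x * (of_nat j * \<eta> ^ (j - 1)))) (at \<eta>)"
      by (intro DERIV_sum) (auto intro!: derivative_eq_intros)
    moreover have "((\<lambda>w. \<Sum>j\<le>D. u j x * w ^ j) has_field_derivative poly (pderiv (U x)) \<eta>) (at \<eta>)"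
      using poly_DERIV[of "U x" \<eta>] by (simp add: val)
    ultimately show ?thesis using DERIV_unique by blast
  qed
  have "((\<lambda>z. \<Sum>j\<le>D. u j (\<lambda>i. x i + z * t i) * (\<eta> + z * \<tau>) ^ j) has_field_derivative
      (\<Sum>j\<le>D. dir_deriv (u j) x t * \<eta> ^ j + u j x * (of_nat j * \<eta> ^ (j - 1)) * \<tau>)) (at 0)"
    by (intro DERIV_sum) (auto intro!: derivative_eq_intros dir_deriv_line[OF u] simp: algebra_simps)
  then have "((\<lambda>z. poly (U (c z)) (c z k)) has_field_derivative
      (\<Sum>j\<le>D. dir_deriv (u j) x t * \<eta> ^ j) + poly (pderiv (U x)) \<eta> * \<tau>) (at 0)"
    by (simp add: val cu ck pd sum.distrib sum_distrib_right)
  moreover have "(\<lambda>z. poly (U (c z)) (c z k)) = (\<lambda>z. (\<lambda>y. poly (U y) (y k)) (\<lambda>i. (x(k := \<eta>)) i + z * (t(k := \<tau>)) i))"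
    by (simp add: c_def[abs_def])
  moreover have "dir_deriv (\<lambda>y. poly (U y) \<eta>) x t = (\<Sum>j\<le>D. dir_deriv (u j) x t * \<eta> ^ j)"
    using p1 unfolding dir_deriv_def by (rule DERIV_imp_deriv)
  ultimately show ?thesis
    unfolding dir_deriv_def[of "\<lambda>y. poly (U y) (y k)"] by (metis (no_types, lifting) DERIV_imp_deriv)
qed

text \<open>The leading coefficient \<open>coeff (P x) d\<close> varies with the point and may vanish, so the dividend
is multiplied by a power of it before dividing.\<close>

lemma pseudo_division_family:
  assumes P: "P \<in> poly_families A" "\<forall>x. degree (P x) \<le> d" "d > 0" and U: "U \<in> poly_families A"
  shows "\<exists>K. \<exists>Q\<in>poly_families A. \<exists>R\<in>poly_families A.
    \<forall>x. smult (coeff (P x) d ^ K) (U x) = Q x * P x + R x \<and> degree (R x) < d"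
proof -
  obtain D where "\<forall>x. degree (U x) \<le> D" using U by (auto simp: poly_families_def)
  then show ?thesis using U
  proof (induction D arbitrary: U)
    case 0
    have "(\<lambda>x. [:0:]) \<in> poly_families A" by (rule const_family) (auto intro: poly_funs.intros)
    then show ?case using 0 \<open>d > 0\<close>
      by (intro exI[of _ 0] bexI[of _ "\<lambda>x. [:0:]"] bexI[of _ U]) auto
  next
    case (Suc D)
    show ?case
    proof (cases "Suc D < d")
      case True
      have "(\<lambda>x. [:0:]) \<in> poly_families A" by (rule const_family) (auto intro: poly_funs.intros)
      moreover have "degree (U x) < d" for x using Suc.prems(1) True by (metis le_less_trans)
      ultimately show ?thesis using Suc.prems
        by (intro exI[of _ 0] bexI[of _ "\<lambda>x. [:0:]"] bexI[of _ U]) auto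
    next
      case False
      define M where "M x = monom (coeff (U x) (Suc D)) (Suc D - d)" for x
      have M: "M \<in> poly_families A" unfolding M_def[abs_def] by (intro monom_family coeff_family Suc.prems)
      define W where "W x = [:coeff (P x) d:] * U x + - (M x * P x)" for x
      have W: "W \<in> poly_families A"
        unfolding W_def[abs_def]
        by (intro add_family uminus_family mult_family const_family coeff_family Suc.prems P M)
      have "degree (W x) \<le> D" for x
      proof (rule degree_le, intro allI impI)
        fix i assume i: "D < i"
        have dm: "degree (M x * P x) \<le> Suc D"
        proof -
          have "degree (M x) \<le> Suc D - d" "degree (P x) \<le> d"
            using P(2) by (auto simp: M_def degree_monom_le)
          then show ?thesis using degree_mult_le[of "M x" "P x"] False by linarith
        qed
        show "coeff (W x) i = 0"
        proof (cases "i = Suc D")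
          case True
          then show ?thesis using False by (simp add: W_def M_def coeff_monom_mult)
        next
          case False
          then have "i > Suc D" using i by simp
          then have "coeff (U x) i = 0" "coeff (M x * P x) i = 0"
            using Suc.prems(1) dm by (meson coeff_eq_0 le_less_trans)+
          then show ?thesis by (simp add: W_def)
        qed
      qed
      then obtain K Q R where QR: "Q \<in> poly_families A" "R \<in> poly_families A"
        "\<forall>x. smult (coeff (P x) d ^ K) (W x) = Q x * P x + R x \<and> degree (R x) < d"
        using Suc.IH[of W] W by blast
      define Q' where "Q' x = Q x + [:coeff (P x) d ^ K:] * M x" for x
      have Q': "Q' \<in> poly_families A"
        unfolding Q'_def[abs_def]
        by (intro add_family mult_family const_family QR M poly_funs_power coeff_family P) auto
      have "smult (coeff (P x) d ^ Suc K) (U x) = Q' x * P x + R x" for x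
      proof -
        have "smult (coeff (P x) d ^ K) (W x) = smult (coeff (P x) d ^ Suc K) (U x) - smult (coeff (P x) d ^ K) (M x) * P x"
          by (simp add: W_def smult_diff_right smult_add_right mult.commute)
        then show ?thesis using QR(3)[rule_format, of x] by (simp add: Q'_def algebra_simps)
      qed
      then show ?thesis using QR Q' by (intro exI[of _ "Suc K"] bexI[of _ Q'] bexI[of _ R]) auto
    qed
  qed
qed

section \<open>Lifting points and tangent vectors\<close>

locale prime_poly_ideal =
  fixes J :: "(('v \<Rightarrow> complex) \<Rightarrow> complex) set"
  assumes zero: "(\<lambda>_. 0) \<in> J"
    and add: "p \<in> J \<Longrightarrow> q \<in> J \<Longrightarrow> (\<lambda>x. p x + q x) \<in> J"
    and absorb: "p \<in> polys_in UNIV \<Longrightarrow> q \<in> J \<Longrightarrow> (\<lambda>x. p x * q x) \<in> J"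
    and one: "(\<lambda>_. 1) \<notin> J"
    and prime: "p \<in> polys_in UNIV \<Longrightarrow> q \<in> polys_in UNIV \<Longrightarrow> (\<lambda>x. p x * q x) \<in> J \<Longrightarrow> p \<in> J \<or> q \<in> J"
begin

lemma sum_mem: "(\<And>i. i \<in> I \<Longrightarrow> p i \<in> J) \<Longrightarrow> (\<lambda>x. \<Sum>i\<in>I. p i x) \<in> J"
  by (induction I rule: infinite_finite_induct) (auto intro: zero add)

lemma diff_mem: "p \<in> J \<Longrightarrow> q \<in> J \<Longrightarrow> (\<lambda>x. p x - q x) \<in> J"
  using add[of p "\<lambda>x. -1 * q x"] absorb[of "\<lambda>_. -1" q] by (simp add: poly_funs.const)

lemma power_nmem:
  assumes "p \<in> polys_in UNIV" "p \<notin> J"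
  shows "(\<lambda>x. p x ^ n) \<notin> J"
proof (induction n)
  case 0
  then show ?case using one by simp
next
  case (Suc n)
  then show ?case using prime[of p "\<lambda>x. p x ^ n"] assms by (auto intro: poly_funs_power)
qed

lemma polys_in_UNIV: "p \<in> polys_in A \<Longrightarrow> p \<in> polys_in UNIV"
  using polys_in_mono[of A UNIV] by auto

lemma value_mem:
  assumes "U \<in> poly_families A" "\<And>j. (\<lambda>x. coeff (U x) j) \<in> J"
  shows "(\<lambda>x. poly (U x) \<eta>) \<in> J" "(\<lambda>x. poly (U x) (x k)) \<in> J"
proof -
  obtain D where D: "\<forall>x. degree (U x) \<le> D" using assms by (auto simp: poly_families_def)
  have eq: "poly (U x) y = (\<Sum>j\<le>D. y ^ j * coeff (U x) j)" for x y
    using poly_eq_sum_upto[OF D[rule_format, of x]] by (simp add: mult.commute)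
  show "(\<lambda>x. poly (U x) \<eta>) \<in> J"
    unfolding eq by (intro sum_mem absorb assms poly_funs.const) auto
  show "(\<lambda>x. poly (U x) (x k)) \<in> J"
    unfolding eq by (intro sum_mem absorb assms poly_funs_power poly_funs.gen) auto
qed

text \<open>The pair \<open>(x, t)\<close> is a point together with a tangent vector of the closure of the projection of
the zero locus of \<open>J\<close> to the coordinates in \<open>A\<close>.\<close>

definition tangent_pair :: "'v set \<Rightarrow> ('v \<Rightarrow> complex) \<Rightarrow> ('v \<Rightarrow> complex) \<Rightarrow> bool" where
  "tangent_pair A x t \<longleftrightarrow> (\<forall>p\<in>J \<inter> polys_in A. p x = 0 \<and> dir_deriv p x t = 0)"

lemma tangent_pair_family:
  assumes "tangent_pair A x t" "U \<in> poly_families A" "\<And>j. (\<lambda>x. coeff (U x) j) \<in> J"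
  shows "U x = 0" "dir_deriv (\<lambda>y. poly (U y) \<eta>) x t = 0"
proof -
  have "coeff (U x) j = 0" for j
    using assms coeff_family[of U A j] by (auto simp: tangent_pair_def)
  then show "U x = 0" by (simp add: poly_eq_iff)
  have "(\<lambda>y. poly (U y) \<eta>) \<in> polys_in A"
    by (rule poly_family_value) (auto intro: assms poly_funs.const)
  then show "dir_deriv (\<lambda>y. poly (U y) \<eta>) x t = 0"
    using assms value_mem(1)[of U A \<eta>] by (auto simp: tangent_pair_def)
qed

text \<open>An equation of degree \<open>d\<close> for the variable \<open>k\<close> over the variables \<open>A\<close>, modulo \<open>J\<close>.\<close>

definition relation_of_degree :: "'v set \<Rightarrow> 'v \<Rightarrow> nat \<Rightarrow> (('v \<Rightarrow> complex) \<Rightarrow> complex poly) \<Rightarrow> bool" where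
  "relation_of_degree A k d P \<longleftrightarrow> P \<in> poly_families A \<and> (\<lambda>x. poly (P x) (x k)) \<in> J \<and>
     (\<forall>x. degree (P x) \<le> d) \<and> (\<lambda>x. coeff (P x) d) \<notin> J"

text \<open>Dropping the leading coefficients that lie in \<open>J\<close> leaves an equation whose leading
coefficient does not.\<close>

lemma relation_from_nonzero_coeff:
  assumes "P \<in> poly_families A" "(\<lambda>x. poly (P x) (x k)) \<in> J" "\<forall>x. degree (P x) \<le> D"
    "(\<lambda>x. coeff (P x) j) \<notin> J"
  shows "\<exists>e\<le>D. \<exists>R. relation_of_degree A k e R"
proof -
  let ?S = "{j. (\<lambda>x. coeff (P x) j) \<notin> J}"
  have sub: "?S \<subseteq> {..D}"
  proof
    fix j assume "j \<in> ?S"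
    then have "(\<lambda>x. coeff (P x) j) \<noteq> (\<lambda>_. 0)" using zero by (metis mem_Collect_eq)
    then have "\<exists>x. coeff (P x) j \<noteq> 0" by auto
    then show "j \<in> {..D}" using assms(3) le_degree order_trans by (metis atMost_iff)
  qed
  then have fin: "finite ?S" using finite_subset by blast
  define e where "e = Max ?S"
  have ne: "?S \<noteq> {}" using assms(4) by blast
  have e: "e \<in> ?S" unfolding e_def using fin ne by (rule Max_in)
  have big: "(\<lambda>x. coeff (P x) i) \<in> J" if "i > e" for i
    using that Max_ge[OF fin, of i] unfolding e_def by (metis (mono_tags, lifting) mem_Collect_eq not_less)
  define R where "R x = poly_cutoff (Suc e) (P x)" for x
  have R: "R \<in> poly_families A" unfolding R_def[abs_def] by (rule cutoff_family[OF assms(1)])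
  define T where "T x = P x + - R x" for x
  have T: "T \<in> poly_families A" unfolding T_def[abs_def] by (intro add_family uminus_family R assms)
  have "(\<lambda>x. coeff (T x) i) \<in> J" for i
    using big[of i] zero by (cases "i \<le> e") (auto simp: T_def R_def coeff_poly_cutoff)
  from value_mem(2)[OF T this, of k] have "(\<lambda>x. poly (P x) (x k) - poly (T x) (x k)) \<in> J"
    using assms(2) by (intro diff_mem)
  then have "(\<lambda>x. poly (R x) (x k)) \<in> J" by (simp add: T_def)
  moreover have "degree (R x) \<le> e" for x
    unfolding R_def by (rule degree_le) (auto simp: coeff_poly_cutoff)
  moreover have "(\<lambda>x. coeff (R x) e) \<notin> J" using e by (simp add: R_def coeff_poly_cutoff)
  ultimately have "relation_of_degree A k e R" using R by (simp add: relation_of_degree_def)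
  then show ?thesis using e sub by auto
qed

lemma tangent_pair_extend:
  assumes "\<And>S. S \<in> poly_families A \<Longrightarrow> (\<lambda>x. poly (S x) (x k)) \<in> J \<Longrightarrow>
      poly (S x) \<eta> = 0 \<and> dir_deriv (\<lambda>y. poly (S y) \<eta>) x t + poly (pderiv (S x)) \<eta> * \<tau> = 0"
    and "k \<notin> A"
  shows "tangent_pair (insert k A) (x(k := \<eta>)) (t(k := \<tau>))"
  unfolding tangent_pair_def
proof
  fix s assume s: "s \<in> J \<inter> polys_in (insert k A)"
  then obtain S where S: "S \<in> poly_families A" "\<And>x. s x = poly (S x) (x k)"
    using poly_family_exists[of s k A] by blast
  have seq: "s = (\<lambda>x. poly (S x) (x k))" using S(2) by auto
  have Sx: "S (x(k := \<eta>)) = S x"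
    using S(1) assms(2) by (intro poly_eqI) (auto intro!: polys_in_cong[OF coeff_family])
  show "s (x(k := \<eta>)) = 0 \<and> dir_deriv s (x(k := \<eta>)) (t(k := \<tau>)) = 0"
    using assms(1)[OF S(1)] s unfolding seq by (simp add: Sx dir_deriv_poly_family[OF S(1) assms(2)])
qed

text \<open>If the variable \<open>k\<close> satisfies no equation modulo \<open>J\<close>, then every element of \<open>J\<close> in the
variables \<open>insert k A\<close> has all its coefficients in \<open>J\<close>, and the value of \<open>k\<close> can be chosen freely. Only
\<open>q\<close> restricts the choice: the hypersurface to avoid is a coefficient of \<open>q\<close> outside \<open>J\<close>.\<close>

lemma lift_transcendental:
  assumes "k \<notin> A" "q \<in> polys_in (insert k A)" "q \<notin> J"
    and no_rel: "\<And>d R. \<not> relation_of_degree A k d R"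
  shows "\<exists>h\<in>polys_in A. h \<notin> J \<and> (\<forall>x t. tangent_pair A x t \<longrightarrow> h x \<noteq> 0 \<longrightarrow>
    (\<exists>\<eta> \<tau>. tangent_pair (insert k A) (x(k := \<eta>)) (t(k := \<tau>)) \<and> q (x(k := \<eta>)) \<noteq> 0))"
proof -
  obtain U where U: "U \<in> poly_families A" "\<And>x. q x = poly (U x) (x k)"
    using poly_family_exists[OF assms(2)] by blast
  have qeq: "q = (\<lambda>x. poly (U x) (x k))" using U(2) by auto
  obtain j where j: "(\<lambda>x. coeff (U x) j) \<notin> J"
    using value_mem(2)[OF U(1), of k] assms(3) qeq by blast
  have Ux: "U (x(k := \<eta>)) = U x" for x \<eta>
    using U(1) assms(1) by (intro poly_eqI) (auto intro!: polys_in_cong[OF coeff_family])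
  show ?thesis
  proof (intro bexI[of _ "\<lambda>x. coeff (U x) j"] conjI allI impI j coeff_family[OF U(1)])
    fix x t assume x: "tangent_pair A x t" "coeff (U x) j \<noteq> 0"
    then have "U x \<noteq> 0" by auto
    then obtain \<eta> where \<eta>: "poly (U x) \<eta> \<noteq> 0" using poly_all_0_iff_0 by blast
    have "tangent_pair (insert k A) (x(k := \<eta>)) (t(k := 0))"
    proof (rule tangent_pair_extend[OF _ assms(1)])
      fix S assume S: "S \<in> poly_families A" "(\<lambda>x. poly (S x) (x k)) \<in> J"
      then obtain D where D: "\<forall>x. degree (S x) \<le> D" by (auto simp: poly_families_def)
      have "(\<lambda>x. coeff (S x) i) \<in> J" for i
        using relation_from_nonzero_coeff[OF S D] no_rel by blast
      from tangent_pair_family[OF x(1) S(1) this]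
      show "poly (S x) \<eta> = 0 \<and> dir_deriv (\<lambda>y. poly (S y) \<eta>) x t + poly (pderiv (S x)) \<eta> * 0 = 0"
        by simp
    qed
    then show "\<exists>\<eta> \<tau>. tangent_pair (insert k A) (x(k := \<eta>)) (t(k := \<tau>)) \<and> q (x(k := \<eta>)) \<noteq> 0"
      using \<eta> by (intro exI[of _ \<eta>] exI[of _ 0]) (simp add: U(2) Ux)
  qed
qed

text \<open>Let \<open>P\<close> be an equation of least degree for the variable \<open>k\<close>. In characteristic zero its
derivative has smaller degree and therefore does not vanish modulo \<open>J\<close>. Hence generically \<open>P\<close> has a root at
which neither its derivative nor \<open>q\<close> vanishes, and implicit differentiation determines the
component \<open>\<tau>\<close> of the tangent vector. Every other element of \<open>J\<close> is a multiple of \<open>P\<close> up to a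
power of the leading coefficient and a remainder that vanishes to first order, again by
minimality of the degree; so it vanishes to first order at the lifted pair.\<close>

lemma lift_algebraic:
  assumes "k \<notin> A" "q \<in> polys_in (insert k A)" "q \<notin> J"
    and P: "relation_of_degree A k d P"
    and least: "\<And>e R. e < d \<Longrightarrow> \<not> relation_of_degree A k e R"
  shows "\<exists>h\<in>polys_in A. h \<notin> J \<and> (\<forall>x t. tangent_pair A x t \<longrightarrow> h x \<noteq> 0 \<longrightarrow>
    (\<exists>\<eta> \<tau>. tangent_pair (insert k A) (x(k := \<eta>)) (t(k := \<tau>)) \<and> q (x(k := \<eta>)) \<noteq> 0))"
proof -
  obtain U where U: "U \<in> poly_families A" "\<And>x. q x = poly (U x) (x k)"
    using poly_family_exists[OF assms(2)] by blast
  have P': "P \<in> poly_families A" "(\<lambda>x. poly (P x) (x k)) \<in> J" "\<forall>x. degree (P x) \<le> d"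
    "(\<lambda>x. coeff (P x) d) \<notin> J" using P by (auto simp: relation_of_degree_def)
  define c where "c x = coeff (P x) d" for x
  have cA: "c \<in> polys_in A" unfolding c_def[abs_def] by (rule coeff_family[OF P'(1)])
  have cJ: "c \<notin> J" unfolding c_def[abs_def] by (rule P')
  have low: "(\<lambda>x. coeff (R x) i) \<in> J"
    if R: "R \<in> poly_families A" "(\<lambda>x. poly (R x) (x k)) \<in> J" "\<And>x. degree (R x) < d" for R i
  proof (rule ccontr)
    assume "(\<lambda>x. coeff (R x) i) \<notin> J"
    moreover have "\<forall>x. degree (R x) \<le> d - 1" using R(3) by (metis Suc_diff_1 bot_nat_0.not_eq_extremum less_Suc_eq_le not_less_zero)
    ultimately obtain e R' where "e \<le> d - 1" "relation_of_degree A k e R'"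
      using relation_from_nonzero_coeff[OF R(1,2)] by blast
    moreover have "d > 0" using R(3)[of undefined] by simp
    ultimately show False using least[of e R'] by simp
  qed
  have d: "d > 0"
  proof (rule ccontr)
    assume "\<not> 0 < d"
    then have "degree (P x) = 0" for x using P'(3) by simp
    then have "poly (P x) (x k) = c x" for x
      using \<open>\<not> 0 < d\<close> by (metis c_def degree_0_id gr0I poly_const_conv coeff_pCons_0)
    then show False using P'(2) cJ by simp
  qed
  let ?dP = "\<lambda>x. pderiv (P x)"
  have dP: "?dP \<in> poly_families A" by (rule pderiv_family[OF P'(1)])
  have dPJ: "(\<lambda>x. poly (?dP x) (x k)) \<notin> J"
  proof
    assume "(\<lambda>x. poly (?dP x) (x k)) \<in> J"
    moreover have "degree (?dP x) < d" for x
      using P'(3)[rule_format, of x] d by (simp add: degree_pderiv)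
    ultimately have "(\<lambda>x. coeff (?dP x) (d - 1)) \<in> J" using low[OF dP] by blast
    moreover have "coeff (?dP x) (d - 1) = of_nat d * c x" for x
      using d by (simp add: coeff_pderiv c_def)
    ultimately have "(\<lambda>x. of_nat d * c x) \<in> J" by simp
    from absorb[OF _ this, of "\<lambda>_. 1 / of_nat d"] d show False
      using cJ by (simp add: poly_funs.const)
  qed
  \<comment> \<open>A root of \<open>P x\<close> that is not a root of \<open>Q x\<close> is sought. If there is none, \<open>P x\<close> divides the \<open>d\<close>-th power
  of \<open>Q x\<close>, which is detected by the remainder \<open>R x\<close>.\<close>
  define Q where "Q x = U x * ?dP x" for x
  have Q: "Q \<in> poly_families A" unfolding Q_def[abs_def] by (intro mult_family U dP)
  have valU: "(\<lambda>x. poly (W x) (x k)) \<in> polys_in UNIV" if "W \<in> poly_families A" for W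
    by (rule poly_family_value[OF that]) (auto intro: poly_funs.gen)
  have QJ: "(\<lambda>x. poly (Q x) (x k)) \<notin> J"
    using prime[OF valU[OF U(1)] valU[OF dP]] dPJ assms(3) by (auto simp: Q_def U(2)[symmetric])
  obtain K B R where R: "B \<in> poly_families A" "R \<in> poly_families A"
    "\<And>x. smult (c x ^ K) (Q x ^ d) = B x * P x + R x" "\<And>x. degree (R x) < d"
    using pseudo_division_family[OF P'(1,3) d power_family[OF Q, of d]] unfolding c_def by metis
  have "(\<lambda>x. poly (R x) (x k)) \<notin> J"
  proof
    assume "(\<lambda>x. poly (R x) (x k)) \<in> J"
    from add[OF absorb[OF valU[OF R(1)] P'(2)] this]
    have "(\<lambda>x. c x ^ K * poly (Q x) (x k) ^ d) \<in> J"
      by (simp add: R(3)[symmetric] flip: poly_mult poly_add)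
    moreover have "(\<lambda>x. c x ^ K) \<notin> J" by (rule power_nmem[OF polys_in_UNIV[OF cA] cJ])
    moreover have "(\<lambda>x. poly (Q x) (x k) ^ d) \<notin> J" by (rule power_nmem[OF valU[OF Q] QJ])
    ultimately show False
      using prime[of "\<lambda>x. c x ^ K" "\<lambda>x. poly (Q x) (x k) ^ d"]
        poly_funs_power[OF valU[OF Q], of d] poly_funs_power[OF polys_in_UNIV[OF cA], of K] by blast
  qed
  then obtain j where j: "(\<lambda>x. coeff (R x) j) \<notin> J" using value_mem(2)[OF R(2), of k] by blast
  define h where "h x = c x * coeff (R x) j" for x
  have hA: "h \<in> polys_in A" unfolding h_def[abs_def] by (intro poly_funs.mult cA coeff_family R)
  have hJ: "h \<notin> J"
    using prime[of c "\<lambda>x. coeff (R x) j"] cJ j polys_in_UNIV[OF cA] polys_in_UNIV[OF coeff_family[OF R(2)]]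
    by (auto simp: h_def[abs_def])
  have Ux: "U (x(k := \<eta>)) = U x" for x \<eta>
    using U(1) assms(1) by (intro poly_eqI) (auto intro!: polys_in_cong[OF coeff_family])
  show ?thesis
  proof (intro bexI[of _ h] conjI allI impI hJ hA)
    fix x t assume x: "tangent_pair A x t" "h x \<noteq> 0"
    then have cx: "c x \<noteq> 0" and Rx: "R x \<noteq> 0" by (auto simp: h_def)
    have dPx: "degree (P x) = d"
      using cx P'(3)[rule_format, of x] le_degree[of "P x" d] unfolding c_def by simp
    have "\<exists>\<eta>. poly (P x) \<eta> = 0 \<and> poly (Q x) \<eta> \<noteq> 0"
    proof (rule ccontr)
      assume "\<not> ?thesis"
      then have "P x dvd Q x ^ d \<or> (P x = 0 \<and> Q x = 0)"
        using nullstellensatz_univariate[of "P x" "Q x"] dPx by auto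
      then have "P x dvd Q x ^ d" using d dPx by auto
      then have "P x dvd smult (c x ^ K) (Q x ^ d) - B x * P x" by (simp add: dvd_smult)
      then have "P x dvd R x" by (simp add: R(3))
      then show False using dvd_imp_degree_le[of "P x" "R x"] Rx R(4)[of x] dPx by simp
    qed
    then obtain \<eta> where \<eta>: "poly (P x) \<eta> = 0" "poly (U x) \<eta> \<noteq> 0" "poly (?dP x) \<eta> \<noteq> 0"
      by (auto simp: Q_def)
    define \<tau> where "\<tau> = - dir_deriv (\<lambda>y. poly (P y) \<eta>) x t / poly (?dP x) \<eta>"
    have "tangent_pair (insert k A) (x(k := \<eta>)) (t(k := \<tau>))"
    proof (rule tangent_pair_extend[OF _ assms(1)])
      fix S assume S: "S \<in> poly_families A" "(\<lambda>x. poly (S x) (x k)) \<in> J"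
      obtain L E T where T: "E \<in> poly_families A" "T \<in> poly_families A"
        "\<And>x. smult (c x ^ L) (S x) = E x * P x + T x" "\<And>x. degree (T x) < d"
        using pseudo_division_family[OF P'(1,3) d S(1)] unfolding c_def by metis
      have "(\<lambda>x. c x ^ L * poly (S x) (x k) - poly (E x) (x k) * poly (P x) (x k)) \<in> J"
        by (intro diff_mem absorb S P' valU T poly_funs_power polys_in_UNIV[OF cA]) auto
      moreover have "c x ^ L * poly (S x) (x k) - poly (E x) (x k) * poly (P x) (x k) = poly (T x) (x k)" for x
        using T(3)[of x] by (metis add_diff_cancel_left' poly_add poly_mult poly_smult)
      ultimately have "(\<lambda>x. poly (T x) (x k)) \<in> J" by simp
      from low[OF T(2) this T(4)] have "(\<lambda>x. coeff (T x) i) \<in> J" for i .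
      note kT = tangent_pair_family[OF x(1) T(2) this]
      have s0: "poly (S x) \<eta> = 0"
        using arg_cong[OF T(3)[of x], of "\<lambda>p. poly p \<eta>"] kT(1) \<eta>(1) cx by simp
      have fam: "(\<lambda>y. poly (W y) \<eta>) \<in> polys_in A" if "W \<in> poly_families A" for W
        by (rule poly_family_value[OF that]) (auto intro: poly_funs.const)
      have cL: "(\<lambda>y. c y ^ L) \<in> polys_in A" by (intro poly_funs_power cA) auto
      have "dir_deriv (\<lambda>y. c y ^ L * poly (S y) \<eta>) x t = dir_deriv (\<lambda>y. poly (E y) \<eta> * poly (P y) \<eta> + poly (T y) \<eta>) x t"
        using T(3) by (metis poly_add poly_mult poly_smult)
      then have "dir_deriv (\<lambda>y. poly (S y) \<eta>) x t * c x ^ L = dir_deriv (\<lambda>y. poly (P y) \<eta>) x t * poly (E x) \<eta>"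
        using s0 \<eta>(1) kT(2)[of \<eta>]
        by (simp add: dir_deriv_add[OF poly_funs.mult[OF fam[OF T(1)] fam[OF P'(1)]] fam[OF T(2)]]
            dir_deriv_mult[OF cL fam[OF S(1)]] dir_deriv_mult[OF fam[OF T(1)] fam[OF P'(1)]])
      then have e1: "c x ^ L * dir_deriv (\<lambda>y. poly (S y) \<eta>) x t = dir_deriv (\<lambda>y. poly (P y) \<eta>) x t * poly (E x) \<eta>"
        by (simp add: mult.commute)
      have "pderiv (smult (c x ^ L) (S x)) = pderiv (E x * P x)"
        using T(3)[of x] kT(1) by simp
      then have "c x ^ L * poly (pderiv (S x)) \<eta> = poly (E x) \<eta> * poly (?dP x) \<eta>"
        using \<eta>(1) by (metis (no_types, lifting) add.right_neutral mult_zero_left pderiv_mult pderiv_smult poly_add poly_mult poly_smult)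
      then have "c x ^ L * (dir_deriv (\<lambda>y. poly (S y) \<eta>) x t + poly (pderiv (S x)) \<eta> * \<tau>) = 0"
      proof -
        have "c x ^ L * (dir_deriv (\<lambda>y. poly (S y) \<eta>) x t + poly (pderiv (S x)) \<eta> * \<tau>) =
            c x ^ L * dir_deriv (\<lambda>y. poly (S y) \<eta>) x t + (c x ^ L * poly (pderiv (S x)) \<eta>) * \<tau>"
          by (simp add: algebra_simps)
        also have "\<dots> = poly (E x) \<eta> * (dir_deriv (\<lambda>y. poly (P y) \<eta>) x t + poly (?dP x) \<eta> * \<tau>)"
          if "c x ^ L * poly (pderiv (S x)) \<eta> = poly (E x) \<eta> * poly (?dP x) \<eta>"
          using e1 unfolding that by (simp add: algebra_simps)
        also have "dir_deriv (\<lambda>y. poly (P y) \<eta>) x t + poly (?dP x) \<eta> * \<tau> = 0"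
          using \<eta>(3) by (simp add: \<tau>_def)
        finally show ?thesis using \<open>c x ^ L * poly (pderiv (S x)) \<eta> = _\<close> by simp
      qed
      then show "poly (S x) \<eta> = 0 \<and> dir_deriv (\<lambda>y. poly (S y) \<eta>) x t + poly (pderiv (S x)) \<eta> * \<tau> = 0"
        using s0 cx by simp
    qed
    then show "\<exists>\<eta> \<tau>. tangent_pair (insert k A) (x(k := \<eta>)) (t(k := \<tau>)) \<and> q (x(k := \<eta>)) \<noteq> 0"
      using \<eta> by (intro exI[of _ \<eta>] exI[of _ \<tau>]) (simp add: U(2) Ux)
  qed
qed

lemma lift_one:
  assumes "k \<notin> A" "q \<in> polys_in (insert k A)" "q \<notin> J"
  shows "\<exists>h\<in>polys_in A. h \<notin> J \<and> (\<forall>x t. tangent_pair A x t \<longrightarrow> h x \<noteq> 0 \<longrightarrow>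
    (\<exists>\<eta> \<tau>. tangent_pair (insert k A) (x(k := \<eta>)) (t(k := \<tau>)) \<and> q (x(k := \<eta>)) \<noteq> 0))"
proof (cases "\<exists>d R. relation_of_degree A k d R")
  case True
  define d where "d = (LEAST d. \<exists>R. relation_of_degree A k d R)"
  have "\<exists>R. relation_of_degree A k d R" unfolding d_def using True by (rule LeastI_ex)
  moreover have "\<not> relation_of_degree A k e R" if "e < d" for e R
    using not_less_Least that unfolding d_def by blast
  ultimately show ?thesis using lift_algebraic[OF assms] by blast
next
  case False
  then show ?thesis using lift_transcendental[OF assms] by blast
qed

text \<open>The condition \<open>q x' \<noteq> 0\<close> makes the steps fit together: the hypersurface to avoid when a
variable is adjoined becomes the condition asked of the variables adjoined before it.\<close>

lemma lift_many:
  assumes "finite B" "A \<inter> B = {}" "q \<in> polys_in (A \<union> B)" "q \<notin> J"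
  shows "\<exists>h\<in>polys_in A. h \<notin> J \<and> (\<forall>x t. tangent_pair A x t \<longrightarrow> h x \<noteq> 0 \<longrightarrow>
    (\<exists>x' t'. (\<forall>i\<in>A. x' i = x i \<and> t' i = t i) \<and> tangent_pair (A \<union> B) x' t' \<and> q x' \<noteq> 0))"
  using assms
proof (induction B arbitrary: q rule: finite_induct)
  case empty
  then show ?case by (intro bexI[of _ q]) auto
next
  case (insert k B)
  have "q \<in> polys_in (insert k (A \<union> B))" "k \<notin> A \<union> B" using insert by auto
  from lift_one[OF this(2,1) insert.prems(3)] obtain h where h: "h \<in> polys_in (A \<union> B)" "h \<notin> J"
    "\<And>x t. tangent_pair (A \<union> B) x t \<Longrightarrow> h x \<noteq> 0 \<Longrightarrow>
      (\<exists>\<eta> \<tau>. tangent_pair (insert k (A \<union> B)) (x(k := \<eta>)) (t(k := \<tau>)) \<and> q (x(k := \<eta>)) \<noteq> 0)"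
    by blast
  from insert.IH[OF _ h(1,2)] insert.prems obtain h' where h': "h' \<in> polys_in A" "h' \<notin> J"
    "\<And>x t. tangent_pair A x t \<Longrightarrow> h' x \<noteq> 0 \<Longrightarrow>
      (\<exists>x' t'. (\<forall>i\<in>A. x' i = x i \<and> t' i = t i) \<and> tangent_pair (A \<union> B) x' t' \<and> h x' \<noteq> 0)"
    by auto
  show ?case
  proof (intro bexI[of _ h'] conjI allI impI h')
    fix x t assume "tangent_pair A x t" "h' x \<noteq> 0"
    from h'(3)[OF this] obtain x' t' where x': "\<forall>i\<in>A. x' i = x i \<and> t' i = t i" "tangent_pair (A \<union> B) x' t'" "h x' \<noteq> 0"
      by blast
    from h(3)[OF x'(2,3)] obtain \<eta> \<tau> where
      "tangent_pair (insert k (A \<union> B)) (x'(k := \<eta>)) (t'(k := \<tau>))" "q (x'(k := \<eta>)) \<noteq> 0" by blast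
    then show "\<exists>x' t'. (\<forall>i\<in>A. x' i = x i \<and> t' i = t i) \<and> tangent_pair (A \<union> insert k B) x' t' \<and> q x' \<noteq> 0"
      using x'(1) insert.prems(1)
      by (intro exI[of _ "x'(k := \<eta>)"] exI[of _ "t'(k := \<tau>)"]) auto
  qed
qed

end

section \<open>Complex one-parameter groups\<close>

primrec cpow :: "complex^'m^'m \<Rightarrow> nat \<Rightarrow> complex^'m^'m" where
  "cpow Y 0 = mat 1"
| "cpow Y (Suc k) = Y ** cpow Y k"

lemma cpow_commute: "cpow Y k ** Y = Y ** cpow Y k"
  by (induction k) (simp_all flip: matrix_mul_assoc)

lemma norm_cpow_le: "norm (cpow Y k $ i $ j) \<le> (\<Sum>i\<in>UNIV. \<Sum>j\<in>UNIV. norm (Y $ i $ j)) ^ k"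
proof (induction k arbitrary: i j)
  case 0
  then show ?case by (simp add: mat_def)
next
  case (Suc k)
  let ?M = "\<Sum>i\<in>UNIV. \<Sum>j\<in>UNIV. norm (Y $ i $ j)"
  have "norm (cpow Y (Suc k) $ i $ j) \<le> (\<Sum>l\<in>UNIV. norm (Y $ i $ l) * norm (cpow Y k $ l $ j))"
    by (simp add: matrix_matrix_mult_def norm_mult sum_norm_le)
  also have "\<dots> \<le> (\<Sum>l\<in>UNIV. norm (Y $ i $ l) * ?M ^ k)"
    by (intro sum_mono mult_left_mono Suc.IH) auto
  also have "\<dots> = (\<Sum>l\<in>UNIV. norm (Y $ i $ l)) * ?M ^ k" by (simp add: sum_distrib_right)
  also have "\<dots> \<le> ?M * ?M ^ k"
    by (intro mult_right_mono zero_le_power sum_nonneg)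
      (auto intro!: member_le_sum[where f="\<lambda>i. \<Sum>l\<in>UNIV. norm (Y $ i $ l)"] sum_nonneg)
  finally show ?case by simp
qed

text \<open>The matrix exponential of \<open>z Y\<close>, entry by entry, so that the theory of complex power series in
one variable applies.\<close>

definition cexp :: "complex^'m^'m \<Rightarrow> complex \<Rightarrow> complex^'m^'m" where
  "cexp Y z = (\<chi> i j. \<Sum>k. cpow Y k $ i $ j / fact k * z ^ k)"

lemma summable_cexp: "summable (\<lambda>k. cpow Y k $ i $ j / fact k * z ^ k)"
proof (rule summable_comparison_test)
  let ?M = "\<Sum>i\<in>UNIV. \<Sum>j\<in>UNIV. norm (Y $ i $ j)"
  have "norm (cpow Y k $ i $ j / fact k * z ^ k) \<le> inverse (fact k) * (?M * norm z) ^ k" for k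
  proof -
    have "norm (cpow Y k $ i $ j / fact k * z ^ k) = norm (cpow Y k $ i $ j) * (inverse (fact k) * norm z ^ k)"
      by (simp add: norm_mult norm_divide norm_power divide_inverse norm_inverse norm_fact)
    also have "\<dots> \<le> ?M ^ k * (inverse (fact k) * norm z ^ k)"
      by (intro mult_right_mono norm_cpow_le) auto
    finally show ?thesis by (simp add: power_mult_distrib mult_ac)
  qed
  then show "\<exists>N. \<forall>n\<ge>N. norm (cpow Y n $ i $ j / fact n * z ^ n) \<le> inverse (fact n) * (?M * norm z) ^ n"
    by blast
  show "summable (\<lambda>n. inverse (fact n) * (?M * norm z) ^ n)" by (rule summable_exp)
qed

lemma cexp_sums: "(\<lambda>k. cpow Y k $ i $ j / fact k * z ^ k) sums (cexp Y z $ i $ j)"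
  using summable_sums[OF summable_cexp] by (simp add: cexp_def)

lemma cexp_has_derivative:
  "((\<lambda>z. cexp Y z $ i $ j) has_field_derivative (Y ** cexp Y z) $ i $ j) (at z)"
proof -
  have "((\<lambda>z. \<Sum>k. cpow Y k $ i $ j / fact k * z ^ k) has_field_derivative
      (\<Sum>k. diffs (\<lambda>k. cpow Y k $ i $ j / fact k) k * z ^ k)) (at z)"
    by (rule termdiffs_strong_converges_everywhere) (rule summable_cexp)
  moreover have "diffs (\<lambda>k. cpow Y k $ i $ j / fact k) k * z ^ k =
      (\<Sum>l\<in>UNIV. Y $ i $ l * (cpow Y k $ l $ j / fact k * z ^ k))" for k
    by (simp add: diffs_def matrix_matrix_mult_def sum_divide_distrib sum_distrib_right
        fact_Suc mult.assoc sum_distrib_left divide_simps del: of_nat_Suc)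
  moreover have "(\<lambda>k. \<Sum>l\<in>UNIV. Y $ i $ l * (cpow Y k $ l $ j / fact k * z ^ k)) sums
      (\<Sum>l\<in>UNIV. Y $ i $ l * cexp Y z $ l $ j)"
    by (intro sums_sum sums_mult cexp_sums)
  then have "(\<Sum>k. \<Sum>l\<in>UNIV. Y $ i $ l * (cpow Y k $ l $ j / fact k * z ^ k)) = (Y ** cexp Y z) $ i $ j"
    by (simp add: sums_iff matrix_matrix_mult_def)
  ultimately show ?thesis by (simp add: cexp_def)
qed

lemma cexp_0: "cexp Y 0 = mat 1"
proof -
  have "(\<Sum>k. cpow Y k $ i $ j / fact k * 0 ^ k) = cpow Y 0 $ i $ j" for i j
    by (subst powser_zero[of "\<lambda>k. cpow Y k $ i $ j / fact k"]) simp
  then show ?thesis by (simp add: cexp_def vec_eq_iff)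
qed

lemma cexp_commute: "cexp Y z ** Y = Y ** cexp Y z"
proof -
  have eq: "(\<Sum>l\<in>UNIV. cpow Y k $ i $ l * Y $ l $ j) = (\<Sum>l\<in>UNIV. Y $ i $ l * cpow Y k $ l $ j)" for k i j
    using cpow_commute[of Y k] by (simp add: matrix_matrix_mult_def vec_eq_iff)
  have "(\<lambda>k. \<Sum>l\<in>UNIV. (cpow Y k $ i $ l / fact k * z ^ k) * Y $ l $ j) sums
      (\<Sum>l\<in>UNIV. cexp Y z $ i $ l * Y $ l $ j)" for i j
    by (intro sums_sum sums_mult2 cexp_sums)
  moreover have "(\<lambda>k. \<Sum>l\<in>UNIV. Y $ i $ l * (cpow Y k $ l $ j / fact k * z ^ k)) sums
      (\<Sum>l\<in>UNIV. Y $ i $ l * cexp Y z $ l $ j)" for i j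
    by (intro sums_sum sums_mult cexp_sums)
  moreover have "(\<Sum>l\<in>UNIV. (cpow Y k $ i $ l / fact k * z ^ k) * Y $ l $ j) =
      (\<Sum>l\<in>UNIV. Y $ i $ l * (cpow Y k $ l $ j / fact k * z ^ k))" for i j k
  proof -
    have "(\<Sum>l\<in>UNIV. (cpow Y k $ i $ l / fact k * z ^ k) * Y $ l $ j) =
        (\<Sum>l\<in>UNIV. cpow Y k $ i $ l * Y $ l $ j) * (z ^ k / fact k)"
      by (simp add: sum_distrib_left sum_distrib_right sum_divide_distrib mult_ac)
    also have "\<dots> = (\<Sum>l\<in>UNIV. Y $ i $ l * (cpow Y k $ l $ j / fact k * z ^ k))"
      unfolding eq by (simp add: sum_distrib_left sum_distrib_right sum_divide_distrib mult_ac)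
    finally show ?thesis .
  qed
  ultimately have "(\<Sum>l\<in>UNIV. cexp Y z $ i $ l * Y $ l $ j) = (\<Sum>l\<in>UNIV. Y $ i $ l * cexp Y z $ l $ j)" for i j
    using sums_unique2 by (metis (no_types, lifting) sums_cong)
  then show ?thesis by (simp add: vec_eq_iff matrix_matrix_mult_def)
qed

lemma matrix_product_derivative:
  fixes A B :: "'f::real_normed_field \<Rightarrow> 'f^'m^'m"
  assumes "\<And>i j. ((\<lambda>z. A z $ i $ j) has_field_derivative A' $ i $ j) (at z)"
    "\<And>i j. ((\<lambda>z. B z $ i $ j) has_field_derivative B' $ i $ j) (at z)"
  shows "((\<lambda>z. (A z ** B z) $ i $ j) has_field_derivative (A' ** B z + A z ** B') $ i $ j) (at z)"
proof -
  have "((\<lambda>z. \<Sum>l\<in>UNIV. A z $ i $ l * B z $ l $ j) has_field_derivative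
      (\<Sum>l\<in>UNIV. A' $ i $ l * B z $ l $ j + B' $ l $ j * A z $ i $ l)) (at z)"
    by (intro DERIV_sum DERIV_mult assms)
  then show ?thesis by (simp add: matrix_matrix_mult_def sum.distrib mult.commute)
qed

lemma cexp_minus: "cexp Y z ** cexp Y (- z) = mat 1"
proof -
  have "((\<lambda>z. cexp Y (- z) $ i $ j) has_field_derivative (- (Y ** cexp Y (- z))) $ i $ j) (at z)" for i j z
    using DERIV_chain2[OF cexp_has_derivative[of Y i j "- z"] DERIV_minus[OF DERIV_ident]] by simp
  from matrix_product_derivative[OF cexp_has_derivative this]
  have "((\<lambda>z. (cexp Y z ** cexp Y (- z)) $ i $ j) has_field_derivative
      ((Y ** cexp Y z) ** cexp Y (- z) + cexp Y z ** - (Y ** cexp Y (- z))) $ i $ j) (at z)" for z i j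
    by this
  moreover have "(Y ** cexp Y z) ** cexp Y (- z) + cexp Y z ** - (Y ** cexp Y (- z)) = 0" for z
  proof -
    have "cexp Y z ** - (Y ** cexp Y (- z)) = - (cexp Y z ** (Y ** cexp Y (- z)))"
      by (simp add: matrix_matrix_mult_def vec_eq_iff sum_negf)
    then show ?thesis by (simp add: matrix_mul_assoc cexp_commute)
  qed
  ultimately have "\<exists>c. \<forall>z. (cexp Y z ** cexp Y (- z)) $ i $ j = c" for i j
    using has_field_derivative_zero_constant[of UNIV "\<lambda>z. (cexp Y z ** cexp Y (- z)) $ i $ j"]
    by (auto simp: has_field_derivative_def)
  then have "(cexp Y z ** cexp Y (- z)) $ i $ j = (cexp Y 0 ** cexp Y (- 0)) $ i $ j" for i j
    by metis
  then show ?thesis by (simp add: vec_eq_iff cexp_0)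
qed

lemma invertible_cexp: "invertible (cexp Y z)"
  using cexp_minus[of Y z] cexp_minus[of Y "- z"] unfolding invertible_def by auto

section \<open>Prime ideals\<close>

text \<open>Restricting to lines reduces identities between polynomials in arbitrarily many variables to
univariate ones.\<close>

lemma polys_in_line:
  assumes "p \<in> polys_in A"
  shows "\<exists>P. \<forall>z. p (\<lambda>i. x i + z * t i) = poly P z"
  using assms
proof induction
  case (const c) show ?case by (intro exI[of _ "[:c:]"]) simp
next
  case (gen p)
  then obtain i where "p = (\<lambda>x. x i)" by auto
  then show ?case by (intro exI[of _ "[:x i, t i:]"]) simp
next
  case (add p q) then show ?case by (metis poly_add)
next
  case (mult p q) then show ?case by (metis poly_mult)
qed

lemma polys_in_no_zero_divisors:
  assumes "p \<in> polys_in A" "q \<in> polys_in A" "\<And>x. p x * q x = 0"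
  shows "(\<forall>x. p x = 0) \<or> (\<forall>x. q x = 0)"
proof (rule ccontr)
  assume "\<not> ?thesis"
  then obtain x y where xy: "p x \<noteq> 0" "q y \<noteq> 0" by blast
  define t where "t i = y i - x i" for i
  obtain P Q where P: "\<And>z. p (\<lambda>i. x i + z * t i) = poly P z" and Q: "\<And>z. q (\<lambda>i. x i + z * t i) = poly Q z"
    using polys_in_line[OF assms(1)] polys_in_line[OF assms(2)] by metis
  have "poly P 0 \<noteq> 0" using xy(1) P[of 0] by simp
  moreover have "poly Q 1 \<noteq> 0" using xy(2) Q[of 1] by (simp add: t_def)
  ultimately have "P * Q \<noteq> 0" by auto
  then obtain z where "poly (P * Q) z \<noteq> 0" using poly_all_0_iff_0 by blast
  then show False using assms(3)[of "\<lambda>i. x i + z * t i"] by (simp add: P Q)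
qed

definition poly_ideal :: "(('v \<Rightarrow> complex) \<Rightarrow> complex) set \<Rightarrow> bool" where
  "poly_ideal J \<longleftrightarrow> J \<subseteq> polys_in UNIV \<and> (\<lambda>_. 0) \<in> J \<and> (\<forall>p\<in>J. \<forall>q\<in>J. (\<lambda>x. p x + q x) \<in> J) \<and>
     (\<forall>p\<in>polys_in UNIV. \<forall>q\<in>J. (\<lambda>x. p x * q x) \<in> J)"

lemma poly_ideal_adjoin:
  fixes M :: "(('v \<Rightarrow> complex) \<Rightarrow> complex) set"
  assumes "poly_ideal M" "p \<in> polys_in UNIV"
  shows "poly_ideal {\<lambda>x. m x + a x * p x | m a. m \<in> M \<and> a \<in> polys_in UNIV}" (is "poly_ideal ?N")
    and "M \<subseteq> {\<lambda>x. m x + a x * p x | m a. m \<in> M \<and> a \<in> polys_in UNIV}"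
    and "p \<in> {\<lambda>x. m x + a x * p x | m a. m \<in> M \<and> a \<in> polys_in UNIV}"
proof -
  have M: "M \<subseteq> polys_in UNIV" "(\<lambda>_. 0) \<in> M" "\<And>p q. p \<in> M \<Longrightarrow> q \<in> M \<Longrightarrow> (\<lambda>x. p x + q x) \<in> M"
    "\<And>p q. p \<in> polys_in UNIV \<Longrightarrow> q \<in> M \<Longrightarrow> (\<lambda>x. p x * q x) \<in> M"
    using assms(1) by (auto simp: poly_ideal_def)
  have c: "(\<lambda>_. c) \<in> polys_in UNIV" for c by (auto intro: poly_funs.const)
  have I: "(\<lambda>x. m x + a x * p x) \<in> ?N" if "m \<in> M" "a \<in> polys_in UNIV" for m a using that by blast
  show sub: "M \<subseteq> ?N" using I[OF _ c[of 0]] by auto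
  show "p \<in> ?N" using I[OF M(2) c[of 1]] by simp
  show "poly_ideal ?N"
    unfolding poly_ideal_def
  proof (intro conjI ballI)
    show "?N \<subseteq> polys_in UNIV" using M(1) assms(2) by (auto intro!: poly_funs.add poly_funs.mult)
    show "(\<lambda>_. 0) \<in> ?N" using sub M(2) by blast
  next
    fix u v assume "u \<in> ?N" "v \<in> ?N"
    then obtain m a m' a' where *: "u = (\<lambda>x. m x + a x * p x)" "m \<in> M" "a \<in> polys_in UNIV"
      "v = (\<lambda>x. m' x + a' x * p x)" "m' \<in> M" "a' \<in> polys_in UNIV" by blast
    have "(\<lambda>x. (m x + m' x) + (a x + a' x) * p x) \<in> ?N"
      using * by (intro I M poly_funs.add)
    then show "(\<lambda>x. u x + v x) \<in> ?N" by (simp add: * algebra_simps)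
  next
    fix u v :: "('v \<Rightarrow> complex) \<Rightarrow> complex"
    assume u: "u \<in> polys_in UNIV" and "v \<in> ?N"
    then obtain m a where *: "v = (\<lambda>x. m x + a x * p x)" "m \<in> M" "a \<in> polys_in UNIV" by blast
    have "(\<lambda>x. (u x * m x) + (u x * a x) * p x) \<in> ?N"
      using * u by (intro I M poly_funs.mult)
    then show "(\<lambda>x. u x * v x) \<in> ?N" by (simp add: * algebra_simps)
  qed
qed

text \<open>An ideal that is maximal among those meeting the polynomials in the variables \<open>W\<close> only in
zero is prime: two elements outside it would each produce, modulo the ideal, a nonzero polynomial
in the variables \<open>W\<close>, and the product of these would be nonzero as well.\<close>

lemma exists_prime_ideal_over:
  fixes J0 :: "(('v \<Rightarrow> complex) \<Rightarrow> complex) set"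
  assumes "poly_ideal J0" "\<And>p. p \<in> J0 \<inter> polys_in W \<Longrightarrow> p = (\<lambda>_. 0)"
  shows "\<exists>J. J0 \<subseteq> J \<and> prime_poly_ideal J \<and> (\<forall>p\<in>J \<inter> polys_in W. p = (\<lambda>_. 0))"
proof -
  define \<A> where "\<A> = {J. J0 \<subseteq> J \<and> poly_ideal J \<and> (\<forall>p\<in>J \<inter> polys_in W. p = (\<lambda>_. 0))}"
  have "\<exists>M\<in>\<A>. \<forall>X\<in>\<A>. M \<subseteq> X \<longrightarrow> X = M"
  proof (rule subset_Zorn_nonempty)
    show "\<A> \<noteq> {}" using assms by (auto simp: \<A>_def)
    fix C assume C: "C \<noteq> {}" "subset.chain \<A> C"
    then have CA: "C \<subseteq> \<A>" and lin: "\<And>X Y. X \<in> C \<Longrightarrow> Y \<in> C \<Longrightarrow> X \<subseteq> Y \<or> Y \<subseteq> X"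
      by (auto simp: subset_chain_def)
    have "poly_ideal (\<Union>C)"
      unfolding poly_ideal_def
    proof (intro conjI ballI)
      show "\<Union>C \<subseteq> polys_in UNIV" "(\<lambda>_. 0) \<in> \<Union>C" using CA C(1) by (auto simp: \<A>_def poly_ideal_def)
      fix p q assume "p \<in> \<Union>C" "q \<in> \<Union>C"
      then obtain X where "X \<in> C" "p \<in> X" "q \<in> X" using lin by blast
      moreover from this CA have "poly_ideal X" by (auto simp: \<A>_def)
      ultimately have "(\<lambda>x. p x + q x) \<in> X" by (simp add: poly_ideal_def)
      then show "(\<lambda>x. p x + q x) \<in> \<Union>C" using \<open>X \<in> C\<close> by blast
    next
      fix p q :: "('v \<Rightarrow> complex) \<Rightarrow> complex"
      assume p: "p \<in> polys_in UNIV" and "q \<in> \<Union>C"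
      then obtain X where X: "X \<in> C" "q \<in> X" by blast
      then have "poly_ideal X" using CA by (auto simp: \<A>_def)
      then have "(\<lambda>x. p x * q x) \<in> X" using p X by (simp add: poly_ideal_def)
      then show "(\<lambda>x. p x * q x) \<in> \<Union>C" using X by blast
    qed
    moreover have "J0 \<subseteq> \<Union>C" using CA C(1) by (auto simp: \<A>_def)
    moreover have "\<forall>p\<in>\<Union>C \<inter> polys_in W. p = (\<lambda>_. 0)" using CA by (auto simp: \<A>_def)
    ultimately show "\<Union>C \<in> \<A>" by (simp add: \<A>_def)
  qed
  then obtain M where M: "M \<in> \<A>" and max: "\<And>X. X \<in> \<A> \<Longrightarrow> M \<subseteq> X \<Longrightarrow> X = M" by blast
  have id: "poly_ideal M" and J0: "J0 \<subseteq> M" and W0: "\<And>p. p \<in> M \<Longrightarrow> p \<in> polys_in W \<Longrightarrow> p = (\<lambda>_. 0)"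
    using M by (auto simp: \<A>_def)
  have M': "M \<subseteq> polys_in UNIV" "(\<lambda>_. 0) \<in> M" "\<And>p q. p \<in> M \<Longrightarrow> q \<in> M \<Longrightarrow> (\<lambda>x. p x + q x) \<in> M"
    "\<And>p q. p \<in> polys_in UNIV \<Longrightarrow> q \<in> M \<Longrightarrow> (\<lambda>x. p x * q x) \<in> M"
    using id by (auto simp: poly_ideal_def)
  have escape: "\<exists>m\<in>M. \<exists>a\<in>polys_in UNIV. (\<lambda>x. m x + a x * p x) \<in> polys_in W \<and> (\<exists>x. m x + a x * p x \<noteq> 0)"
    if p: "p \<in> polys_in UNIV" "p \<notin> M" for p
  proof -
    let ?N = "{\<lambda>x. m x + a x * p x | m a. m \<in> M \<and> a \<in> polys_in UNIV}"
    have "?N \<notin> \<A>" using max[of ?N] poly_ideal_adjoin[OF id p(1)] p(2) by auto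
    then obtain u where "u \<in> ?N" "u \<in> polys_in W" "u \<noteq> (\<lambda>_. 0)"
      using poly_ideal_adjoin[OF id p(1)] J0 unfolding \<A>_def by blast
    then show ?thesis by fast
  qed
  have "prime_poly_ideal M"
  proof
    show "(\<lambda>_. 1) \<notin> M"
    proof
      assume "(\<lambda>_. 1) \<in> M"
      from W0[OF this poly_funs.const] have "(\<lambda>_. 1 :: complex) = (\<lambda>_ :: 'v \<Rightarrow> complex. 0)" by simp
      then show False by (metis zero_neq_one)
    qed
    fix p q assume p: "p \<in> polys_in UNIV" "q \<in> polys_in UNIV" "(\<lambda>x. p x * q x) \<in> M"
    show "p \<in> M \<or> q \<in> M"
    proof (rule ccontr)
      assume "\<not> ?thesis"
      then obtain m a m' a' where *: "m \<in> M" "a \<in> polys_in UNIV" "(\<lambda>x. m x + a x * p x) \<in> polys_in W" "\<exists>x. m x + a x * p x \<noteq> 0"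
        "m' \<in> M" "a' \<in> polys_in UNIV" "(\<lambda>x. m' x + a' x * q x) \<in> polys_in W" "\<exists>x. m' x + a' x * q x \<noteq> 0"
        using escape[OF p(1)] escape[OF p(2)] by blast
      have "(\<lambda>x. (m' x + a' x * q x) * m x + (a x * p x) * m' x + (a x * a' x) * (p x * q x)) \<in> M"
      proof (intro M'(3))
        show "(\<lambda>x. (m' x + a' x * q x) * m x) \<in> M"
          using * p M'(1) by (intro M'(4) poly_funs.add poly_funs.mult) auto
        show "(\<lambda>x. (a x * p x) * m' x) \<in> M" "(\<lambda>x. (a x * a' x) * (p x * q x)) \<in> M"
          using * p by (auto intro!: M'(4) poly_funs.mult)
      qed
      then have "(\<lambda>x. (m x + a x * p x) * (m' x + a' x * q x)) \<in> M" by (simp add: algebra_simps)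
      from W0[OF this poly_funs.mult[OF *(3,7)]] show False
        using polys_in_no_zero_divisors[OF *(3,7)] *(4,8) by (metis (mono_tags, lifting))
    qed
  qed (use M' in auto)
  then show ?thesis using J0 W0 by blast
qed

section \<open>Tangent vectors of an algebraic group\<close>

lemma dir_deriv_const: "dir_deriv (\<lambda>_. c) x t = 0"
  by (simp add: dir_deriv_def)

lemma dir_deriv_coord: "dir_deriv (\<lambda>x. x i) x t = t i"
  unfolding dir_deriv_def by (rule DERIV_imp_deriv) (auto intro!: derivative_eq_intros)

lemma dir_deriv_mem:
  assumes "p \<in> polys_in UNIV" "\<And>i. (\<lambda>x. T x i) \<in> polys_in UNIV"
  shows "(\<lambda>x. dir_deriv p x (T x)) \<in> polys_in UNIV"
  using assms(1)
proof induction
  case (add p q)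
  then show ?case using dir_deriv_add[OF add(1,2)] by (simp add: poly_funs.add)
next
  case (mult p q)
  then show ?case using dir_deriv_mult[OF mult(1,2)] by (simp add: poly_funs.add poly_funs.mult)
qed (auto simp: dir_deriv_const dir_deriv_coord assms(2) poly_funs.const)

lemma poly_funs_cnj:
  assumes "p \<in> polys_in UNIV"
  shows "(\<lambda>x. cnj (p (\<lambda>i. cnj (x i)))) \<in> polys_in UNIV"
  using assms by induction (auto intro: poly_funs.intros)

lemma dir_deriv_cnj:
  assumes "p \<in> polys_in UNIV"
  shows "dir_deriv (\<lambda>x. cnj (p (\<lambda>i. cnj (x i)))) x t = cnj (dir_deriv p (\<lambda>i. cnj (x i)) (\<lambda>i. cnj (t i)))"
  using assms
proof induction
  case (add p q)
  then show ?case
    using dir_deriv_add[OF add(1,2)] dir_deriv_add[OF poly_funs_cnj[OF add(1)] poly_funs_cnj[OF add(2)]] by simp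
next
  case (mult p q)
  then show ?case
    using dir_deriv_mult[OF mult(1,2)] dir_deriv_mult[OF poly_funs_cnj[OF mult(1)] poly_funs_cnj[OF mult(2)]] by simp
qed (auto simp: dir_deriv_const dir_deriv_coord)

lemma real_poly_funs_cnj:
  assumes "p \<in> poly_funs \<real> ((\<lambda>i x. x i) ` A)"
  shows "cnj (p x) = p (\<lambda>i. cnj (x i))"
  using assms by induction (auto simp: Reals_cnj_iff)

definition entries :: "complex^'m^'m \<Rightarrow> 'm \<times> 'm \<Rightarrow> complex" where
  "entries g = (\<lambda>(i, j). g $ i $ j)"

definition of_entries :: "('m::finite \<times> 'm \<Rightarrow> complex) \<Rightarrow> complex^'m^'m" where
  "of_entries x = (\<chi> i j. x (i, j))"

lemma entries_of_entries [simp]: "entries (of_entries x) = x" and of_entries_entries [simp]: "of_entries (entries g) = g"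
  by (auto simp: entries_def of_entries_def vec_eq_iff)

lemma mat_coords_eq: "mat_coords = (\<lambda>i u. entries u i) ` UNIV"
proof -
  have "(\<lambda>(i, j) g. g $ i $ j) = (\<lambda>i u. entries u i)" by (auto simp: entries_def fun_eq_iff)
  then show ?thesis unfolding mat_coords_def by (rule arg_cong)
qed

definition det_poly :: "('m::finite \<times> 'm \<Rightarrow> complex) \<Rightarrow> complex" where
  "det_poly x = det (of_entries x)"

lemma det_poly_mem: "det_poly \<in> poly_funs \<real> ((\<lambda>i x. x i) ` UNIV)"
  unfolding det_poly_def[abs_def] det_def
  by (intro poly_funs_sum poly_funs.mult poly_funs_prod poly_funs.const)
    (auto simp: of_entries_def intro!: poly_funs.gen)

lemma linear_matrix_poly:
  fixes k h :: "complex^'m^'m"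
  assumes "p \<in> polys_in UNIV"
  shows "(\<lambda>x. p (entries (k ** of_entries x ** h))) \<in> polys_in UNIV"
    and "dir_deriv (\<lambda>x. p (entries (k ** of_entries x ** h))) x t = dir_deriv p (entries (k ** of_entries x ** h)) (entries (k ** of_entries t ** h))"
proof -
  show "(\<lambda>x. p (entries (k ** of_entries x ** h))) \<in> polys_in UNIV"
  proof (rule poly_funs_comp[OF assms])
    fix c :: "('m \<times> 'm \<Rightarrow> complex) \<Rightarrow> complex"
    assume "c \<in> range (\<lambda>i x. x i)"
    then obtain i j where "c = (\<lambda>x. x (i, j))" by auto
    then show "(\<lambda>x. c (entries (k ** of_entries x ** h))) \<in> polys_in UNIV"
      by (auto simp: entries_def of_entries_def matrix_matrix_mult_def intro!: poly_funs_sum poly_funs.mult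
          intro: poly_funs.const poly_funs.gen)
  qed auto
  have "entries (k ** of_entries (\<lambda>i. x i + z * t i) ** h) = (\<lambda>i. entries (k ** of_entries x ** h) i + z * entries (k ** of_entries t ** h) i)" for z
    by (auto simp: entries_def of_entries_def matrix_matrix_mult_def fun_eq_iff sum.distrib sum_distrib_left
        distrib_left distrib_right mult_ac)
  then show "dir_deriv (\<lambda>x. p (entries (k ** of_entries x ** h))) x t = dir_deriv p (entries (k ** of_entries x ** h)) (entries (k ** of_entries t ** h))"
    by (simp add: dir_deriv_def)
qed

lemma matrix_curve:
  assumes "p \<in> polys_in UNIV" "\<And>i j. ((\<lambda>z. c z $ i $ j) has_field_derivative C $ i $ j) (at 0)"
  shows "((\<lambda>z. p (entries (c z))) has_field_derivative dir_deriv p (entries (c 0)) (entries C)) (at 0)"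
  by (rule polys_in_curve[OF assms(1)]) (use assms(2) in \<open>auto simp: entries_def\<close>)

lemma matrix_curve_at:
  assumes "p \<in> polys_in UNIV" "\<And>i j. ((\<lambda>z. c z $ i $ j) has_field_derivative C $ i $ j) (at w)"
  shows "((\<lambda>z. p (entries (c z))) has_field_derivative dir_deriv p (entries (c w)) (entries C)) (at w)"
proof -
  have "((\<lambda>z. c (z + w) $ i $ j) has_field_derivative C $ i $ j) (at 0)" for i j
    using assms(2)[of i j] DERIV_shift[of "\<lambda>z. c z $ i $ j" _ 0 w] by simp
  from matrix_curve[OF assms(1) this] show ?thesis
    using DERIV_shift[of "\<lambda>z. p (entries (c z))" _ 0 w] by simp
qed

text \<open>The coordinates of the general linear group as a closed subvariety of affine space: the
entries (\<open>Some\<close>) and the inverse of the determinant (\<open>None\<close>).\<close>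

definition gl_coords :: "complex^'m^'m \<Rightarrow> ('m \<times> 'm) option \<Rightarrow> complex" where
  "gl_coords g = (\<lambda>c. case c of None \<Rightarrow> inverse (det g) | Some ij \<Rightarrow> entries g ij)"

text \<open>The velocity in these coordinates of a curve through \<open>g\<close> with velocity \<open>C\<close>; the component
\<open>None\<close> is the derivative of the inverse determinant.\<close>

definition gl_tangent :: "complex^'m^'m \<Rightarrow> complex^'m^'m \<Rightarrow> ('m \<times> 'm) option \<Rightarrow> complex" where
  "gl_tangent g C = (\<lambda>c. case c of None \<Rightarrow> - dir_deriv det_poly (entries g) (entries C) / (det g)\<^sup>2 | Some ij \<Rightarrow> entries C ij)"

lemma det_poly_polys_in: "det_poly \<in> polys_in UNIV"
  using poly_funs_mono[OF det_poly_mem] by auto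

lemma gl_curve:
  assumes "q \<in> polys_in UNIV" "\<And>i j. ((\<lambda>z. c z $ i $ j) has_field_derivative C $ i $ j) (at 0)" "det (c 0) \<noteq> 0"
  shows "((\<lambda>z. q (gl_coords (c z))) has_field_derivative dir_deriv q (gl_coords (c 0)) (gl_tangent (c 0) C)) (at 0)"
proof (rule polys_in_curve[OF assms(1)])
  fix k
  have "((\<lambda>z. det_poly (entries (c z))) has_field_derivative dir_deriv det_poly (entries (c 0)) (entries C)) (at 0)"
    by (rule matrix_curve[OF det_poly_polys_in assms(2)])
  then have "((\<lambda>z. det (c z)) has_field_derivative dir_deriv det_poly (entries (c 0)) (entries C)) (at 0)"
    by (simp add: det_poly_def)
  from DERIV_inverse_fun[OF this assms(3)]
  have "((\<lambda>z. inverse (det (c z))) has_field_derivative - dir_deriv det_poly (entries (c 0)) (entries C) / (det (c 0))\<^sup>2) (at 0)"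
    by (simp add: divide_inverse power2_eq_square mult_ac)
  then show "((\<lambda>z. gl_coords (c z) k) has_field_derivative gl_tangent (c 0) C k) (at 0)"
    using assms(2) by (cases k) (auto simp: gl_coords_def gl_tangent_def entries_def)
qed

lemma inverse_det_mat_coords_eq:
  "insert (\<lambda>g. inverse (det g)) mat_coords = (\<lambda>i u. gl_coords u i) ` UNIV"
proof -
  have "(\<lambda>i u. gl_coords u i) ` UNIV = insert (\<lambda>u. gl_coords u None) ((\<lambda>i u. gl_coords u (Some i)) ` UNIV)"
    by (auto simp: UNIV_option_conv)
  also have "\<dots> = insert (\<lambda>g. inverse (det g)) mat_coords" by (simp add: gl_coords_def mat_coords_eq)
  finally show ?thesis by (rule sym)
qed

locale alg_rep =
  fixes GC :: "(complex^'m^'m) set" and \<rho> :: "complex^'m^'m \<Rightarrow> complex^'n^'n"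
  assumes alg: "algebraic_group_over_reals GC" and rat: "rational_rep_over_reals GC \<rho>"
begin

lemma one_GC: "mat 1 \<in> GC" and mult_GC: "g \<in> GC \<Longrightarrow> h \<in> GC \<Longrightarrow> g ** h \<in> GC"
  and inv_GC: "g \<in> GC \<Longrightarrow> matrix_inv g \<in> GC"
  using alg by (auto simp: algebraic_group_over_reals_def)

lemma rho_one: "\<rho> (mat 1) = mat 1" and rho_mult: "g \<in> GC \<Longrightarrow> h \<in> GC \<Longrightarrow> \<rho> (g ** h) = \<rho> g ** \<rho> h"
  using rat by (auto simp: rational_rep_over_reals_def)

lemma invertible_GC: "g \<in> GC \<Longrightarrow> invertible g"
  using alg by (auto simp: algebraic_group_over_reals_def)

lemma det_GC: "g \<in> GC \<Longrightarrow> det g \<noteq> 0"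
  using invertible_GC invertible_det_nz by blast

lemma inv_right: "g \<in> GC \<Longrightarrow> g ** matrix_inv g = mat 1" and inv_left: "g \<in> GC \<Longrightarrow> matrix_inv g ** g = mat 1"
  using someI_ex[OF invertible_GC[unfolded invertible_def]] by (auto simp: matrix_inv_def)

lemma GC_equations:
  obtains P where "P \<subseteq> poly_funs \<real> ((\<lambda>i x. x i) ` UNIV)" "GC = {g. invertible g \<and> (\<forall>p\<in>P. p (entries g) = 0)}"
proof -
  obtain P where P: "P \<subseteq> poly_funs \<real> mat_coords" "GC = {g. invertible g \<and> (\<forall>p\<in>P. p g = 0)}"
    using alg by (auto simp: algebraic_group_over_reals_def)
  have "\<forall>p\<in>P. \<exists>q\<in>poly_funs \<real> ((\<lambda>i x. x i) ` UNIV). \<forall>u. p u = q (entries u)"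
    using P(1) poly_funs_factor[of _ \<real> entries UNIV] unfolding mat_coords_eq by blast
  then obtain Q where Q: "\<And>p. p \<in> P \<Longrightarrow> Q p \<in> poly_funs \<real> ((\<lambda>i x. x i) ` UNIV)" "\<And>p u. p \<in> P \<Longrightarrow> p u = Q p (entries u)"
    by metis
  show thesis by (rule that[of "Q ` P"]) (use Q P(2) in auto)
qed

definition vanishing :: "(('m \<times> 'm \<Rightarrow> complex) \<Rightarrow> complex) set" where
  "vanishing = {p \<in> polys_in UNIV. \<forall>g\<in>GC. p (entries g) = 0}"

lemma GC_iff_vanishing: "g \<in> GC \<longleftrightarrow> invertible g \<and> (\<forall>p\<in>vanishing. p (entries g) = 0)"
proof
  assume "invertible g \<and> (\<forall>p\<in>vanishing. p (entries g) = 0)"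
  moreover obtain P where P: "P \<subseteq> poly_funs \<real> ((\<lambda>i x. x i) ` UNIV)" "GC = {g. invertible g \<and> (\<forall>p\<in>P. p (entries g) = 0)}"
    by (rule GC_equations)
  moreover have "P \<subseteq> vanishing"
  proof
    fix p assume "p \<in> P"
    then have "p \<in> polys_in UNIV" using poly_funs_mono[of p \<real> _ UNIV] P(1) by blast
    moreover have "\<forall>g\<in>GC. p (entries g) = 0" using \<open>p \<in> P\<close> P(2) by blast
    ultimately show "p \<in> vanishing" by (simp add: vanishing_def)
  qed
  ultimately show "g \<in> GC" by auto
qed (auto simp: vanishing_def invertible_GC)

lemma cnj_GC: "g \<in> GC \<Longrightarrow> map_matrix cnj g \<in> GC"
proof -
  assume g: "g \<in> GC"
  obtain P where P: "P \<subseteq> poly_funs \<real> ((\<lambda>i x. x i) ` UNIV)" "GC = {g. invertible g \<and> (\<forall>p\<in>P. p (entries g) = 0)}"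
    by (rule GC_equations)
  have e: "entries (map_matrix cnj g) = (\<lambda>i. cnj (entries g i))" by (auto simp: entries_def fun_eq_iff)
  have "p (entries (map_matrix cnj g)) = 0" if "p \<in> P" for p
  proof -
    have "p (entries g) = 0" using that P(2) g by blast
    moreover have "cnj (p (entries g)) = p (\<lambda>i. cnj (entries g i))"
      using real_poly_funs_cnj[of p UNIV "entries g"] subsetD[OF P(1) that] by blast
    ultimately show ?thesis by (simp add: e)
  qed
  moreover have "det_poly (entries (map_matrix cnj g)) = cnj (det_poly (entries g))"
    unfolding e by (rule real_poly_funs_cnj[OF det_poly_mem, symmetric])
  then have "det (map_matrix cnj g) = cnj (det g)" by (simp add: det_poly_def)
  then have "invertible (map_matrix cnj g)" using det_GC[OF g] by (simp add: invertible_det_nz)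
  ultimately show ?thesis using P by auto
qed

text \<open>The Zariski tangent space of the group at the identity, that is, the complexified Lie algebra in its
algebraic description.\<close>

definition tangent :: "(complex^'m^'m) set" where
  "tangent = {Y. \<forall>p\<in>vanishing. dir_deriv p (entries (mat 1)) (entries Y) = 0}"

lemma tangent_linear:
  assumes "Y \<in> tangent" "Z \<in> tangent" "\<And>i j. W $ i $ j = a * Y $ i $ j + b * Z $ i $ j"
  shows "W \<in> tangent"
proof -
  have "entries W = (\<lambda>i. a * entries Y i + b * entries Z i)" by (auto simp: entries_def assms(3) fun_eq_iff)
  then show ?thesis using assms(1,2) by (auto simp: tangent_def vanishing_def dir_deriv_linear)
qed

lemma tangent_cnj:
  assumes "Y \<in> tangent"
  shows "map_matrix cnj Y \<in> tangent"
  unfolding tangent_def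
proof (intro CollectI ballI)
  fix p assume p: "p \<in> vanishing"
  let ?q = "\<lambda>x. cnj (p (\<lambda>i. cnj (x i)))"
  have e: "entries (map_matrix cnj g) = (\<lambda>i. cnj (entries g i))" for g :: "complex^'m^'m"
    by (auto simp: entries_def fun_eq_iff)
  have "?q \<in> vanishing" using p cnj_GC by (auto simp: vanishing_def poly_funs_cnj simp flip: e)
  then have "dir_deriv ?q (entries (mat 1)) (entries Y) = 0" using assms by (auto simp: tangent_def)
  then have "dir_deriv p (\<lambda>i. cnj (entries (mat 1) i)) (entries (map_matrix cnj Y)) = 0"
    using p dir_deriv_cnj[of p "entries (mat 1)" "entries Y"] by (auto simp: vanishing_def e)
  moreover have "(\<lambda>i. cnj (entries (mat 1) i)) = entries (mat 1 :: complex^'m^'m)"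
    by (auto simp: entries_def mat_def fun_eq_iff)
  ultimately show "dir_deriv p (entries (mat 1)) (entries (map_matrix cnj Y)) = 0" by simp
qed

lemma vanishing_translate:
  assumes "p \<in> vanishing" "k \<in> GC" "h \<in> GC"
  shows "(\<lambda>x. p (entries (k ** of_entries x ** h))) \<in> vanishing"
  using assms linear_matrix_poly(1)[of p k h] by (auto simp: vanishing_def mult_GC)

lemma tangent_translate:
  assumes "Y \<in> tangent" "p \<in> vanishing" "g \<in> GC"
  shows "dir_deriv p (entries g) (entries (Y ** g)) = 0"
proof -
  have "dir_deriv (\<lambda>x. p (entries (mat 1 ** of_entries x ** g))) (entries (mat 1)) (entries Y) = 0"
    using vanishing_translate[OF assms(2) one_GC assms(3)] assms(1) by (simp add: tangent_def)
  then show ?thesis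
    using linear_matrix_poly(2)[of p "mat 1" g "entries (mat 1)" "entries Y"] assms(2)
    by (simp add: vanishing_def)
qed

text \<open>Conjugation by an element of the group is linear in the entries and preserves the ideal of
the group.\<close>

lemma tangent_Ad:
  assumes "Y \<in> tangent" "k \<in> GC"
  shows "k ** Y ** matrix_inv k \<in> tangent"
  unfolding tangent_def
proof (intro CollectI ballI)
  fix p assume p: "p \<in> vanishing"
  have "dir_deriv (\<lambda>x. p (entries (k ** of_entries x ** matrix_inv k))) (entries (mat 1)) (entries Y) = 0"
    using vanishing_translate[OF p assms(2) inv_GC[OF assms(2)]] assms(1) by (simp add: tangent_def)
  then show "dir_deriv p (entries (mat 1)) (entries (k ** Y ** matrix_inv k)) = 0"
    using linear_matrix_poly(2)[of p k "matrix_inv k" "entries (mat 1)" "entries Y"] p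
    by (simp add: vanishing_def inv_right[OF assms(2)])
qed

text \<open>The right invariant vector field \<open>D\<close> given by \<open>Y\<close> maps the ideal of the group to itself.
Hence all derivatives at \<open>0\<close> of an equation along the one-parameter group are values at the identity of elements
of the ideal, and an entire function with vanishing Taylor series is zero.\<close>

lemma cexp_in_GC:
  assumes Y: "Y \<in> tangent"
  shows "cexp Y z \<in> GC"
proof -
  define D where "D p x = dir_deriv p x (entries (Y ** of_entries x))" for p x
  have D: "D p \<in> vanishing" if "p \<in> vanishing" for p
  proof -
    have "(\<lambda>x. entries (Y ** of_entries x) i) \<in> polys_in UNIV" for i
      by (cases i) (auto simp: entries_def of_entries_def matrix_matrix_mult_def intro!: poly_funs_sum poly_funs.mult
          intro: poly_funs.const poly_funs.gen)
    then have "D p \<in> polys_in UNIV"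
      using dir_deriv_mem[of p "\<lambda>x. entries (Y ** of_entries x)"] that by (auto simp: D_def[abs_def] vanishing_def)
    then show ?thesis using tangent_translate[OF Y that] by (auto simp: vanishing_def D_def)
  qed
  have der: "((\<lambda>z. p (entries (cexp Y z))) has_field_derivative D p (entries (cexp Y w))) (at w)"
    if "p \<in> vanishing" for p w
    using matrix_curve_at[of p "cexp Y" "Y ** cexp Y w" w] that cexp_has_derivative
    by (auto simp: vanishing_def D_def)
  have iter: "(deriv ^^ n) (\<lambda>z. p (entries (cexp Y z))) = (\<lambda>z. (D ^^ n) p (entries (cexp Y z)))"
    if "p \<in> vanishing" for p n
    using that
  proof (induction n arbitrary: p)
    case (Suc n)
    have "deriv (\<lambda>z. p (entries (cexp Y z))) = (\<lambda>z. D p (entries (cexp Y z)))"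
      using DERIV_imp_deriv[OF der[OF Suc.prems]] by auto
    then show ?case using Suc.IH[OF D[OF Suc.prems]] by (simp add: funpow_swap1)
  qed simp
  have "p (entries (cexp Y z)) = 0" if p: "p \<in> vanishing" for p
  proof (rule holomorphic_fun_eq_0_on_connected[of "\<lambda>z. p (entries (cexp Y z))" UNIV 0])
    show "(\<lambda>z. p (entries (cexp Y z))) holomorphic_on UNIV"
      using der[OF p] by (auto simp: holomorphic_on_def field_differentiable_def intro: has_field_derivative_at_within)
    fix n
    have "(D ^^ n) p \<in> vanishing" by (induction n) (auto simp: p D)
    then show "(deriv ^^ n) (\<lambda>z. p (entries (cexp Y z))) 0 = 0"
      unfolding iter[OF p] using one_GC by (auto simp: cexp_0 vanishing_def)
  qed auto
  then show ?thesis using GC_iff_vanishing invertible_cexp by blast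
qed

text \<open>The polynomials in the coordinates of the general linear group that express the entries of \<open>\<rho>\<close>; they
are not unique, but any two have the same values and the same variations along the group.\<close>

definition rho_poly :: "'n \<Rightarrow> 'n \<Rightarrow> (('m \<times> 'm) option \<Rightarrow> complex) \<Rightarrow> complex" where
  "rho_poly i j = (SOME q. q \<in> poly_funs \<real> ((\<lambda>i x. x i) ` UNIV) \<and> (\<forall>g\<in>GC. \<rho> g $ i $ j = q (gl_coords g)))"

lemma rho_poly: "rho_poly i j \<in> poly_funs \<real> ((\<lambda>i x. x i) ` UNIV)"
    "g \<in> GC \<Longrightarrow> \<rho> g $ i $ j = rho_poly i j (gl_coords g)"
proof -
  obtain p where p: "p \<in> poly_funs \<real> (insert (\<lambda>g. inverse (det g)) mat_coords)" "\<forall>g\<in>GC. \<rho> g $ i $ j = p g"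
    using rat unfolding rational_rep_over_reals_def by blast
  from poly_funs_factor[OF p(1)[unfolded inverse_det_mat_coords_eq]] p(2)
  have "\<exists>q. q \<in> poly_funs \<real> ((\<lambda>i x. x i) ` UNIV) \<and> (\<forall>g\<in>GC. \<rho> g $ i $ j = q (gl_coords g))" by auto
  from someI_ex[OF this]
  show "rho_poly i j \<in> poly_funs \<real> ((\<lambda>i x. x i) ` UNIV)"
    "g \<in> GC \<Longrightarrow> \<rho> g $ i $ j = rho_poly i j (gl_coords g)"
    unfolding rho_poly_def by blast+
qed

lemma rho_poly_polys_in: "rho_poly i j \<in> polys_in UNIV"
  using poly_funs_mono[OF rho_poly(1)] by auto

definition drho :: "complex^'m^'m \<Rightarrow> complex^'n^'n" where
  "drho Y = (\<chi> i j. dir_deriv (rho_poly i j) (gl_coords (mat 1)) (gl_tangent (mat 1) Y))"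

lemma rho_curve:
  assumes "\<And>z. c z \<in> GC" "\<And>i j. ((\<lambda>z. c z $ i $ j) has_field_derivative C $ i $ j) (at 0)"
  shows "((\<lambda>z. \<rho> (c z) $ i $ j) has_field_derivative
    dir_deriv (rho_poly i j) (gl_coords (c 0)) (gl_tangent (c 0) C)) (at 0)"
  using gl_curve[OF rho_poly_polys_in assms(2) det_GC[OF assms(1)]] rho_poly(2)[OF assms(1)] by simp

lemma rho_curve_one:
  assumes "\<And>z. c z \<in> GC" "\<And>i j. ((\<lambda>z. c z $ i $ j) has_field_derivative Y $ i $ j) (at 0)" "c 0 = mat 1"
  shows "((\<lambda>z. \<rho> (c z) $ i $ j) has_field_derivative drho Y $ i $ j) (at 0)"
  using rho_curve[OF assms(1,2)] assms(3) by (simp add: drho_def)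

lemma rho_cexp:
  assumes "Y \<in> tangent"
  shows "((\<lambda>z. \<rho> (cexp Y z) $ i $ j) has_field_derivative drho Y $ i $ j) (at 0)"
  using cexp_has_derivative[of Y _ _ 0] cexp_in_GC[OF assms]
  by (intro rho_curve_one) (auto simp: cexp_0)

lemma drho_linear:
  assumes "\<And>i j. W $ i $ j = a * Y $ i $ j + b * Z $ i $ j"
  shows "drho W $ i $ j = a * drho Y $ i $ j + b * drho Z $ i $ j"
proof -
  have e: "entries W = (\<lambda>i. a * entries Y i + b * entries Z i)" by (auto simp: entries_def assms fun_eq_iff)
  have "gl_tangent (mat 1) W = (\<lambda>c. a * gl_tangent (mat 1) Y c + b * gl_tangent (mat 1) Z c)"
    by (auto simp: gl_tangent_def e fun_eq_iff dir_deriv_linear[OF det_poly_polys_in] split: option.splits)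
  then show ?thesis by (simp add: drho_def dir_deriv_linear[OF rho_poly_polys_in])
qed

text \<open>The polynomials expressing \<open>\<rho>\<close> have real coefficients. This is what later lets the
real part of a complex tangent vector be taken.\<close>

lemma drho_cnj: "drho (map_matrix cnj Y) = map_matrix cnj (drho Y)"
proof -
  have one: "(\<lambda>i. cnj (entries (mat 1) i)) = entries (mat 1 :: complex^'m^'m)"
    by (auto simp: entries_def mat_def fun_eq_iff)
  have real: "dir_deriv q (\<lambda>i. cnj (x i)) (\<lambda>i. cnj (t i)) = cnj (dir_deriv q x t)"
    if "q \<in> poly_funs \<real> ((\<lambda>i x. x i) ` UNIV)" for q :: "('x \<Rightarrow> complex) \<Rightarrow> complex" and x t
  proof -
    have "q \<in> polys_in UNIV" using poly_funs_mono[OF that] by auto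
    moreover have "(\<lambda>x. cnj (q (\<lambda>i. cnj (x i)))) = q" using real_poly_funs_cnj[OF that] by (auto simp: fun_eq_iff)
    ultimately show ?thesis using dir_deriv_cnj[of q x t] by (metis complex_cnj_cnj)
  qed
  have e: "entries (map_matrix cnj Y) = (\<lambda>i. cnj (entries Y i))" by (auto simp: entries_def fun_eq_iff)
  have "dir_deriv det_poly (entries (mat 1)) (entries (map_matrix cnj Y)) = cnj (dir_deriv det_poly (entries (mat 1)) (entries Y))"
    using real[OF det_poly_mem, of "entries (mat 1)" "entries Y"] by (simp add: one e)
  then have e1: "gl_tangent (mat 1) (map_matrix cnj Y) = (\<lambda>c. cnj (gl_tangent (mat 1) Y c))"
    by (auto simp: gl_tangent_def e fun_eq_iff split: option.splits)
  have e2: "(\<lambda>c. cnj (gl_coords (mat 1 :: complex^'m^'m) c)) = gl_coords (mat 1)"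
    using fun_cong[OF one] by (auto simp: gl_coords_def fun_eq_iff split: option.splits)
  have "drho (map_matrix cnj Y) $ i $ j = cnj (drho Y $ i $ j)" for i j
  proof -
    have "drho (map_matrix cnj Y) $ i $ j =
        dir_deriv (rho_poly i j) (\<lambda>c. cnj (gl_coords (mat 1) c)) (\<lambda>c. cnj (gl_tangent (mat 1) Y c))"
      by (simp only: drho_def vec_lambda_beta e1 e2)
    also have "\<dots> = cnj (dir_deriv (rho_poly i j) (gl_coords (mat 1)) (gl_tangent (mat 1) Y))"
      by (rule real[OF rho_poly(1)])
    finally show ?thesis by (simp only: drho_def vec_lambda_beta)
  qed
  then show ?thesis by (simp add: vec_eq_iff)
qed

lemma drho_Ad:
  assumes "Y \<in> tangent" "k \<in> GC"
  shows "drho (k ** Y ** matrix_inv k) = \<rho> k ** drho Y ** \<rho> (matrix_inv k)"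
proof -
  let ?c = "\<lambda>z. k ** cexp Y z ** matrix_inv k"
  have const: "((\<lambda>z. g $ i $ j) has_field_derivative (0 :: complex^'k^'k) $ i $ j) (at 0)" for g :: "complex^'k^'k" and i j
    by simp
  have d: "((\<lambda>z. ?c z $ i $ j) has_field_derivative (k ** Y ** matrix_inv k) $ i $ j) (at 0)" for i j
    using matrix_product_derivative[OF matrix_product_derivative[OF const[of k] cexp_has_derivative[of Y _ _ 0]] const[of "matrix_inv k"], of i j]
    by (simp add: cexp_0)
  have d1: "((\<lambda>z. \<rho> (?c z) $ i $ j) has_field_derivative drho (k ** Y ** matrix_inv k) $ i $ j) (at 0)" for i j
    using d cexp_in_GC[OF assms(1)] assms(2)
    by (intro rho_curve_one) (auto simp: mult_GC inv_GC cexp_0 inv_right)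
  have eq: "\<rho> (?c z) = \<rho> k ** \<rho> (cexp Y z) ** \<rho> (matrix_inv k)" for z
    using assms cexp_in_GC by (simp add: rho_mult mult_GC inv_GC)
  have d2: "((\<lambda>z. (\<rho> k ** \<rho> (cexp Y z) ** \<rho> (matrix_inv k)) $ i $ j) has_field_derivative
      (\<rho> k ** drho Y ** \<rho> (matrix_inv k)) $ i $ j) (at 0)" for i j
    using matrix_product_derivative[OF matrix_product_derivative[OF const[of "\<rho> k"] rho_cexp[OF assms(1)]] const[of "\<rho> (matrix_inv k)"], of i j]
    by simp
  have "drho (k ** Y ** matrix_inv k) $ i $ j = (\<rho> k ** drho Y ** \<rho> (matrix_inv k)) $ i $ j" for i j
    by (rule DERIV_unique[OF d1[unfolded eq] d2])
  then show ?thesis by (simp add: vec_eq_iff)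
qed

end

section \<open>Infinitesimal transitivity on the dense orbit\<close>

lemma dense_orbit_polynomial_zero:
  assumes "dense_orbit GC \<rho> \<Omega>" "p \<in> poly_funs UNIV vec_coords" "\<And>w. w \<in> \<Omega> \<Longrightarrow> p w = 0"
  shows "p w = 0"
proof (rule ccontr)
  assume "p w \<noteq> 0"
  let ?S = "{v. p v \<noteq> 0}"
  have "openin (zariski vec_coords) ?S"
    unfolding zariski_def by (rule topology_generated_by_Basis) (use assms(2) in blast)
  moreover have "w \<in> zariski vec_coords closure_of \<Omega>" using assms(1) by (simp add: dense_orbit_def)
  then have "\<forall>T. w \<in> T \<and> openin (zariski vec_coords) T \<longrightarrow> (\<exists>y. y \<in> \<Omega> \<and> y \<in> T)"
    by (simp add: in_closure_of)
  then have "w \<in> ?S \<and> openin (zariski vec_coords) ?S \<longrightarrow> (\<exists>y. y \<in> \<Omega> \<and> y \<in> ?S)" by (rule spec)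
  ultimately have "\<exists>y. y \<in> \<Omega> \<and> y \<in> ?S" using \<open>p w \<noteq> 0\<close> by simp
  then obtain y where "y \<in> \<Omega>" "y \<in> ?S" by blast
  then show False using assms(3) by simp
qed

context alg_rep
begin

text \<open>The lifting of tangent vectors is applied to the graph of the orbit map, with the
coordinates of the vector space as base (\<open>Inr\<close>) and those of the general linear group (\<open>Inl\<close>) to
be adjoined. The density of the orbit says that no nonzero polynomial in the base coordinates
vanishes on the graph, so that any base point off one hypersurface, with any tangent vector \<open>e\<close>, lifts.\<close>

lemma exists_infinitesimally_transitive_point:
  assumes dense: "dense_orbit GC \<rho> \<Omega>"
  shows "\<exists>w\<in>\<Omega>. \<forall>e. \<exists>Y\<in>tangent. drho Y *v w = e"
proof -
  obtain v where \<Omega>: "\<Omega> = (\<lambda>g. \<rho> g *v v) ` GC" using dense by (auto simp: dense_orbit_def)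
  define Pt :: "complex^'m^'m \<Rightarrow> ('m \<times> 'm) option + 'n \<Rightarrow> complex" where
    "Pt g = (\<lambda>k. case k of Inl c \<Rightarrow> gl_coords g c | Inr i \<Rightarrow> (\<rho> g *v v) $ i)" for g
  define J0 where "J0 = {p \<in> polys_in UNIV. \<forall>g\<in>GC. p (Pt g) = 0}"
  have "poly_ideal J0"
    by (auto simp: poly_ideal_def J0_def poly_funs.add poly_funs.mult poly_funs.const)
  moreover have "p = (\<lambda>_. 0)" if p: "p \<in> J0 \<inter> polys_in (range Inr)" for p
  proof -
    define x where "x w = (\<lambda>k :: ('m \<times> 'm) option + 'n. case k of Inl c \<Rightarrow> 0 | Inr i \<Rightarrow> w $ i)" for w :: "complex^'n"
    have "(\<lambda>w. p (x w)) \<in> poly_funs UNIV vec_coords"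
    proof (rule poly_funs_comp[of p UNIV])
      show "p \<in> polys_in (range Inr)" using p by blast
      fix c :: "(('m \<times> 'm) option + 'n \<Rightarrow> complex) \<Rightarrow> complex"
      assume "c \<in> (\<lambda>i x. x i) ` range Inr"
      then obtain i where "c = (\<lambda>x. x (Inr i))" by auto
      then show "(\<lambda>w. c (x w)) \<in> poly_funs UNIV vec_coords"
        by (auto simp: x_def vec_coords_def intro: poly_funs.gen)
    qed auto
    moreover have "p (x w) = 0" if w: "w \<in> \<Omega>" for w
    proof -
      obtain g where g: "g \<in> GC" "w = \<rho> g *v v" using w \<Omega> by auto
      have "p (x w) = p (Pt g)"
        by (rule polys_in_cong[of p "range Inr"]) (use p g in \<open>auto simp: x_def Pt_def\<close>)
      then show ?thesis using p g by (auto simp: J0_def)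
    qed
    ultimately have z: "p (x w) = 0" for w using dense_orbit_polynomial_zero[OF dense] by blast
    have "p y = 0" for y
    proof -
      have "p y = p (x (\<chi> i. y (Inr i)))"
        by (rule polys_in_cong[of p "range Inr"]) (use p in \<open>auto simp: x_def\<close>)
      then show ?thesis using z by simp
    qed
    then show ?thesis by auto
  qed
  ultimately obtain J where J: "J0 \<subseteq> J" "prime_poly_ideal J" "\<And>p. p \<in> J \<inter> polys_in (range Inr) \<Longrightarrow> p = (\<lambda>_. 0)"
    using exists_prime_ideal_over[of J0 "range Inr"] by blast
  interpret prime_poly_ideal J by (rule J)
  have "range Inr \<union> range Inl = (UNIV :: (('m \<times> 'm) option + 'n) set)"
    by (auto intro: sum.exhaust) (metis rangeI sum.exhaust)
  with lift_many[of "range Inl" "range Inr" "\<lambda>_. 1"] one obtain h where h: "h \<notin> J"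
    "\<And>x t. tangent_pair (range Inr) x t \<Longrightarrow> h x \<noteq> 0 \<Longrightarrow>
      (\<exists>x' t'. (\<forall>i\<in>range Inr. x' i = x i \<and> t' i = t i) \<and> tangent_pair UNIV x' t')"
    by (auto simp: poly_funs.const)
  have "h \<noteq> (\<lambda>_. 0)" using h(1) zero by auto
  then obtain x0 where x0: "h x0 \<noteq> 0" by auto
  define w where "w = (\<chi> i. x0 (Inr i))"
  have key: "w \<in> \<Omega> \<and> (\<exists>Y\<in>tangent. drho Y *v w = e)" for e
  proof -
    define t0 where "t0 = (\<lambda>k :: ('m \<times> 'm) option + 'n. case k of Inl c \<Rightarrow> 0 | Inr i \<Rightarrow> e $ i)"
    \<comment> \<open>Over the base nothing has to be checked: the ideal contains no nonzero polynomial in the base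
    coordinates.\<close>
    have "tangent_pair (range Inr) x0 t0" using J(3) unfolding tangent_pair_def by (metis dir_deriv_const)
    from h(2)[OF this x0] obtain x t where x: "\<And>i. x (Inr i) = w $ i" "\<And>i. t (Inr i) = e $ i" "tangent_pair UNIV x t"
      by (auto simp: w_def t0_def)
    have kill: "p x = 0" "dir_deriv p x t = 0" if "p \<in> polys_in UNIV" "\<And>g. g \<in> GC \<Longrightarrow> p (Pt g) = 0" for p
      using x(3) J(1) that by (auto simp: tangent_pair_def J0_def)
    define g where "g = of_entries (\<lambda>ij. x (Inl (Some ij)))"
    define \<delta> where "\<delta> = of_entries (\<lambda>ij. t (Inl (Some ij)))"
    have eg: "entries g = (\<lambda>ij. x (Inl (Some ij)))" and ed: "entries \<delta> = (\<lambda>ij. t (Inl (Some ij)))"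
      by (auto simp: g_def \<delta>_def)
    have sub: "(\<lambda>x. p (\<lambda>c. x (f c))) \<in> polys_in UNIV" if "p \<in> polys_in UNIV"
      for p :: "('a \<Rightarrow> complex) \<Rightarrow> complex" and f :: "'a \<Rightarrow> ('m \<times> 'm) option + 'n"
      by (rule poly_funs_comp[OF that]) (auto intro: poly_funs.gen)
    have pe: "p (entries g) = 0" "dir_deriv p (entries g) (entries \<delta>) = 0" if "p \<in> vanishing" for p
    proof -
      have *: "(\<lambda>x :: ('m \<times> 'm) option + 'n \<Rightarrow> complex. p (\<lambda>ij. x (Inl (Some ij)))) \<in> polys_in UNIV" "\<And>g. g \<in> GC \<Longrightarrow> p (\<lambda>ij. Pt g (Inl (Some ij))) = 0"
        using that sub[of p "\<lambda>ij. Inl (Some ij)"] by (auto simp: vanishing_def Pt_def gl_coords_def)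
      from kill[OF *] show "p (entries g) = 0" "dir_deriv p (entries g) (entries \<delta>) = 0" by (auto simp: eg ed dir_deriv_def)
    qed
    have dp: "(\<lambda>x :: ('m \<times> 'm) option + 'n \<Rightarrow> complex. det_poly (\<lambda>ij. x (Inl (Some ij)))) \<in> polys_in UNIV"
      using sub[OF det_poly_polys_in, of "\<lambda>ij. Inl (Some ij)"] by simp
    have sp: "(\<lambda>x :: ('m \<times> 'm) option + 'n \<Rightarrow> complex. x (Inl None)) \<in> polys_in UNIV" by (auto intro: poly_funs.gen)
    let ?s = "\<lambda>x :: ('m \<times> 'm) option + 'n \<Rightarrow> complex. x (Inl None) * det_poly (\<lambda>ij. x (Inl (Some ij)))"
    have sd: "?s \<in> polys_in UNIV" by (intro poly_funs.mult sp dp)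
    have s1: "(\<lambda>x. ?s x + -1) \<in> polys_in UNIV" by (intro poly_funs.add sd poly_funs.const) auto
    have s2: "?s (Pt g) + -1 = 0" if "g \<in> GC" for g
      using det_GC[OF that] by (simp add: Pt_def gl_coords_def det_poly_def)
    \<comment> \<open>The equation of the inverse determinant shows that \<open>g\<close> is invertible; its first variation determines
    the component \<open>None\<close> of the tangent vector.\<close>
    have one_s: "x (Inl None) * det g = 1"
      using kill(1)[OF s1 s2] by (simp add: det_poly_def g_def)
    then have dg: "det g \<noteq> 0" by auto
    then have gG: "g \<in> GC" using GC_iff_vanishing pe(1) by (auto simp: invertible_det_nz)
    have xN: "x (Inl None) = inverse (det g)" using one_s by (metis inverse_unique mult.commute)
    have "0 = dir_deriv (\<lambda>x. ?s x + -1) x t" using kill(2)[OF s1 s2] by simp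
    also have "\<dots> = t (Inl None) * det g + dir_deriv det_poly (entries g) (entries \<delta>) * x (Inl None)"
      unfolding dir_deriv_add[OF sd poly_funs.const[of "-1", OF UNIV_I]] dir_deriv_mult[OF sp dp] dir_deriv_const dir_deriv_coord
      by (simp add: eg ed det_poly_def dir_deriv_def g_def)
    finally have "t (Inl None) * det g = - dir_deriv det_poly (entries g) (entries \<delta>) * inverse (det g)"
      by (simp add: xN eq_neg_iff_add_eq_0)
    then have "t (Inl None) = - dir_deriv det_poly (entries g) (entries \<delta>) / (det g)\<^sup>2"
      using dg by (simp add: field_simps power2_eq_square)
    then have tl: "(\<lambda>c. t (Inl c)) = gl_tangent g \<delta>"
      by (auto simp: gl_tangent_def ed fun_eq_iff split: option.splits)
    have xl: "(\<lambda>c. x (Inl c)) = gl_coords g"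
      by (auto simp: gl_coords_def eg xN fun_eq_iff split: option.splits)
    \<comment> \<open>A tangent vector at \<open>g\<close> is moved to the identity by right translation.\<close>
    define Y where "Y = \<delta> ** matrix_inv g"
    have Yg: "Y ** g = \<delta>" by (simp add: Y_def inv_left[OF gG] flip: matrix_mul_assoc)
    have Y: "Y \<in> tangent"
      unfolding tangent_def
    proof (intro CollectI ballI)
      fix p assume p: "p \<in> vanishing"
      have "dir_deriv (\<lambda>x. p (entries (mat 1 ** of_entries x ** matrix_inv g))) (entries g) (entries \<delta>) = 0"
        by (rule pe(2)[OF vanishing_translate[OF p one_GC inv_GC[OF gG]]])
      then show "dir_deriv p (entries (mat 1)) (entries Y) = 0"
        using linear_matrix_poly(2)[of p "mat 1" "matrix_inv g" "entries g" "entries \<delta>"] p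
        by (simp add: vanishing_def inv_right[OF gG] Y_def)
    qed
    have comp: "w $ i = (\<rho> g *v v) $ i \<and> e $ i = (\<Sum>j\<in>UNIV. dir_deriv (rho_poly i j) (gl_coords g) (gl_tangent g \<delta>) * v $ j)" for i
    proof -
      let ?r = "\<lambda>j (x :: ('m \<times> 'm) option + 'n \<Rightarrow> complex). rho_poly i j (\<lambda>c. x (Inl c))"
      let ?f = "\<lambda>x :: ('m \<times> 'm) option + 'n \<Rightarrow> complex. (\<Sum>j\<in>UNIV. ?r j x * v $ j) + -1 * x (Inr i)"
      have r: "?r j \<in> polys_in UNIV" for j using sub[of "rho_poly i j" Inl, OF rho_poly_polys_in] by simp
      have f: "?f \<in> polys_in UNIV"
        by (intro poly_funs.add poly_funs_sum poly_funs.mult r poly_funs.const poly_funs.gen) auto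
      have fz: "?f (Pt g) = 0" if "g \<in> GC" for g
        using rho_poly(2)[OF that, of i] by (simp add: Pt_def matrix_vector_mult_def)
      have "((\<lambda>z. ?f (\<lambda>i. x i + z * t i)) has_field_derivative
          (\<Sum>j\<in>UNIV. dir_deriv (?r j) x t * v $ j) + -1 * t (Inr i)) (at 0)"
        by (intro DERIV_add DERIV_sum DERIV_cmult_right dir_deriv_line[OF r]) (auto intro!: derivative_eq_intros)
      then have "dir_deriv ?f x t = (\<Sum>j\<in>UNIV. dir_deriv (?r j) x t * v $ j) + -1 * t (Inr i)"
        unfolding dir_deriv_def[of ?f] by (rule DERIV_imp_deriv)
      moreover have "dir_deriv (?r j) x t = dir_deriv (rho_poly i j) (gl_coords g) (gl_tangent g \<delta>)" for j
        by (simp add: dir_deriv_def flip: xl tl)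
      ultimately have "e $ i = (\<Sum>j\<in>UNIV. dir_deriv (rho_poly i j) (gl_coords g) (gl_tangent g \<delta>) * v $ j)"
        using kill(2)[OF f fz] x(2) by simp
      moreover have "w $ i = (\<rho> g *v v) $ i"
        using kill(1)[OF f fz] x(1) rho_poly(2)[OF gG, of i]
        by (simp add: xl[symmetric] matrix_vector_mult_def)
      ultimately show ?thesis by blast
    qed
    then have w: "w = \<rho> g *v v" by (simp add: vec_eq_iff)
    have const: "((\<lambda>z. g $ i $ j) has_field_derivative (0 :: complex^'k^'k) $ i $ j) (at 0)" for g :: "complex^'k^'k" and i j
      by simp
    have d0: "((\<lambda>z. (cexp Y z ** g) $ i $ j) has_field_derivative \<delta> $ i $ j) (at 0)" for i j
      using matrix_product_derivative[OF cexp_has_derivative[of Y _ _ 0] const[of g], of i j]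
      by (simp add: cexp_0 Yg)
    have d1: "((\<lambda>z. \<rho> (cexp Y z ** g) $ i $ j) has_field_derivative
        dir_deriv (rho_poly i j) (gl_coords g) (gl_tangent g \<delta>)) (at 0)" for i j
      using rho_curve[OF _ d0, of i j] cexp_in_GC[OF Y] gG by (simp add: mult_GC cexp_0)
    have d2: "((\<lambda>z. (\<rho> (cexp Y z) ** \<rho> g) $ i $ j) has_field_derivative (drho Y ** \<rho> g) $ i $ j) (at 0)" for i j
      using matrix_product_derivative[OF rho_cexp[OF Y] const[of "\<rho> g"], of i j] by simp
    have "dir_deriv (rho_poly i j) (gl_coords g) (gl_tangent g \<delta>) = (drho Y ** \<rho> g) $ i $ j" for i j
      by (rule DERIV_unique[OF d1 d2[folded rho_mult[OF cexp_in_GC[OF Y] gG]]])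
    then have "e = (drho Y ** \<rho> g) *v v"
      using comp by (simp add: vec_eq_iff matrix_vector_mult_def)
    then have "drho Y *v w = e" by (simp add: w matrix_vector_mul_assoc)
    then show ?thesis using Y w gG \<Omega> by auto
  qed
  then show ?thesis by blast
qed

text \<open>The adjoint action carries the property from one point to the whole orbit.\<close>

lemma infinitesimally_transitive:
  assumes "dense_orbit GC \<rho> \<Omega>" "x \<in> \<Omega>"
  shows "\<exists>Y\<in>tangent. drho Y *v x = e"
proof -
  obtain w where w: "w \<in> \<Omega>" "\<And>e. \<exists>Y\<in>tangent. drho Y *v w = e"
    using exists_infinitesimally_transitive_point[OF assms(1)] by blast
  obtain v where \<Omega>: "\<Omega> = (\<lambda>g. \<rho> g *v v) ` GC" using assms(1) by (auto simp: dense_orbit_def)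
  obtain g h where g: "g \<in> GC" "x = \<rho> g *v v" and h: "h \<in> GC" "w = \<rho> h *v v"
    using assms(2) w(1) \<Omega> by auto
  define k where "k = g ** matrix_inv h"
  have k: "k \<in> GC" unfolding k_def by (intro mult_GC inv_GC g h)
  have "\<rho> k ** \<rho> h = \<rho> g"
    using rho_mult[OF k h(1)] by (simp add: k_def inv_left[OF h(1)] flip: matrix_mul_assoc)
  then have x: "x = \<rho> k *v w" using g h by (simp add: matrix_vector_mul_assoc)
  have r: "\<rho> (matrix_inv k) ** \<rho> k = mat 1" "\<rho> k ** \<rho> (matrix_inv k) = mat 1"
    using rho_mult[OF inv_GC[OF k] k] rho_mult[OF k inv_GC[OF k]] by (simp_all add: inv_left[OF k] inv_right[OF k] rho_one)
  obtain Y where Y: "Y \<in> tangent" "drho Y *v w = \<rho> (matrix_inv k) *v e" using w(2) by blast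
  have "drho (k ** Y ** matrix_inv k) *v x = \<rho> k *v (drho Y *v ((\<rho> (matrix_inv k) ** \<rho> k) *v w))"
    by (simp only: drho_Ad[OF Y(1) k] x matrix_vector_mul_assoc matrix_mul_assoc)
  also have "\<dots> = e" by (simp add: r Y(2) matrix_vector_mul_assoc)
  finally show ?thesis using tangent_Ad[OF Y(1) k] by blast
qed

end

section \<open>Real one-parameter groups\<close>

abbreviation cmat :: "real^'k^'m \<Rightarrow> complex^'k^'m" where
  "cmat \<equiv> map_matrix complex_of_real"

lemma cmat_mult: "cmat (A ** B) = cmat A ** cmat B"
  by (simp add: vec_eq_iff matrix_matrix_mult_def)

lemma cmat_one: "cmat (mat 1) = mat 1"
  by (simp add: vec_eq_iff mat_def)

lemma cmat_inj: "cmat A = cmat B \<Longrightarrow> A = B"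
  by (simp add: vec_eq_iff)

lemma Re_cmat [simp]: "map_matrix Re (cmat A) = A"
  by (simp add: vec_eq_iff)

lemma det_cmat: "det (cmat A) = complex_of_real (det A)"
  by (simp add: det_def)

lemma bounded_bilinear_matrix_mult: "bounded_bilinear ((**) :: real^'k^'m \<Rightarrow> real^'l^'k \<Rightarrow> real^'l^'m)"
  by (rule bilinear_conv_bounded_bilinear[THEN iffD1])
    (auto simp: bilinear_def linear_iff vec_eq_iff matrix_matrix_mult_def sum.distrib algebra_simps sum_distrib_left)

lemma bounded_bilinear_matrix_vector_mult: "bounded_bilinear ((*v) :: real^'k^'m \<Rightarrow> real^'k \<Rightarrow> real^'m)"
  by (rule bilinear_conv_bounded_bilinear[THEN iffD1])
    (auto simp: bilinear_def linear_iff vec_eq_iff matrix_vector_mult_def sum.distrib algebra_simps sum_distrib_left)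

lemmas matrix_mult_has_derivative = bounded_bilinear.FDERIV[OF bounded_bilinear_matrix_mult]
lemmas matrix_mult_continuous_on = bounded_bilinear.continuous_on[OF bounded_bilinear_matrix_mult]
lemmas matrix_mult_has_vector_derivative =
  bounded_bilinear.has_vector_derivative[OF bounded_bilinear_matrix_mult]

lemma matrix_has_vector_derivativeI:
  fixes f :: "real \<Rightarrow> real^'k^'m"
  assumes "\<And>i j. ((\<lambda>t. f t $ i $ j) has_real_derivative D $ i $ j) (at t within S)"
  shows "(f has_vector_derivative D) (at t within S)"
proof -
  have eq: "A = (\<Sum>i\<in>UNIV. \<Sum>j\<in>UNIV. A $ i $ j *\<^sub>R axis i (axis j 1))" for A :: "real^'k^'m"
    by (simp add: vec_eq_iff axis_def if_distrib[of "\<lambda>x. x $ _"] if_distrib[of "(*) _"] sum.If_cases cong: if_cong)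
  have "((\<lambda>t. \<Sum>i\<in>UNIV. \<Sum>j\<in>UNIV. f t $ i $ j *\<^sub>R axis i (axis j 1) :: real^'k^'m) has_vector_derivative
      (\<Sum>i\<in>UNIV. \<Sum>j\<in>UNIV. D $ i $ j *\<^sub>R axis i (axis j 1))) (at t within S)"
  proof (intro has_vector_derivative_sum)
    fix i j
    show "((\<lambda>t. f t $ i $ j *\<^sub>R axis i (axis j 1) :: real^'k^'m) has_vector_derivative
        D $ i $ j *\<^sub>R axis i (axis j 1)) (at t within S)"
      using has_vector_derivative_scaleR[OF assms[of i j] has_vector_derivative_const[of "axis i (axis j 1) :: real^'k^'m"]]
      by simp
  qed
  then show ?thesis by (simp flip: eq)
qed

lemma Re_curve_has_vector_derivative:
  assumes "\<And>i j. ((\<lambda>z. c z $ i $ j) has_field_derivative C $ i $ j) (at (complex_of_real t))"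
  shows "((\<lambda>t. map_matrix Re (c (complex_of_real t))) has_vector_derivative map_matrix Re C) (at t within S)"
proof (rule matrix_has_vector_derivativeI)
  fix i j
  have "((\<lambda>t. c (complex_of_real t) $ i $ j) has_vector_derivative C $ i $ j) (at t within S)"
    by (rule has_vector_derivative_real_field[OF assms])
  from bounded_linear.has_vector_derivative[OF bounded_linear_Re this]
  show "((\<lambda>t. map_matrix Re (c (complex_of_real t)) $ i $ j) has_real_derivative map_matrix Re C $ i $ j) (at t within S)"
    by (simp add: has_real_derivative_iff_has_vector_derivative)
qed

lemma mat_power_scaleR: "mat_power (t *\<^sub>R X) k = t ^ k *\<^sub>R mat_power X k"
  by (induction k) (simp_all add: scalar_matrix_assoc matrix_scalar_ac flip: scaleR_scaleR, simp add: mult.commute)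

lemma cpow_cmat: "cpow (cmat X) k = cmat (mat_power X k)"
  by (induction k) (simp_all add: cmat_one cmat_mult)

lemma cmat_mat_exp: "cmat (mat_exp (t *\<^sub>R X)) = cexp (cmat X) (complex_of_real t)"
proof -
  define A where "A = map_matrix Re (cexp (cmat X) (complex_of_real t))"
  have trm: "cpow (cmat X) k $ i $ j / fact k * complex_of_real t ^ k =
      complex_of_real ((mat_power (t *\<^sub>R X) k /\<^sub>R fact k) $ i $ j)" for k i j
    by (simp add: cpow_cmat mat_power_scaleR divide_inverse mult_ac)
  have s: "(\<lambda>k. complex_of_real ((mat_power (t *\<^sub>R X) k /\<^sub>R fact k) $ i $ j)) sums (cexp (cmat X) (complex_of_real t) $ i $ j)" for i j
    using cexp_sums[of "cmat X" i j "complex_of_real t"] unfolding trm .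
  have r: "(\<lambda>k. (mat_power (t *\<^sub>R X) k /\<^sub>R fact k) $ i $ j) sums (A $ i $ j)" for i j
  proof -
    have "A $ i $ j = Re (cexp (cmat X) (complex_of_real t) $ i $ j)" by (simp add: A_def)
    then show ?thesis using sums_Re[OF s[of i j]] by (simp only: Re_complex_of_real)
  qed
  have "(\<lambda>k. mat_power (t *\<^sub>R X) k /\<^sub>R fact k) sums A"
    unfolding sums_def
    by (intro vec_tendstoI) (use r in \<open>simp add: sums_def\<close>)
  then have A: "mat_exp (t *\<^sub>R X) = A" by (simp add: mat_exp_def sums_iff)
  have "complex_of_real (A $ i $ j) = cexp (cmat X) (complex_of_real t) $ i $ j" for i j
    using sums_unique2[OF sums_of_real[OF r[of i j]] s[of i j]] .
  then show ?thesis by (simp add: A vec_eq_iff)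
qed

lemma mat_exp_eq: "mat_exp (t *\<^sub>R X) = map_matrix Re (cexp (cmat X) (complex_of_real t))"
  by (metis Re_cmat cmat_mat_exp)

lemma mat_exp_has_vector_derivative:
  "((\<lambda>t. mat_exp (t *\<^sub>R X)) has_vector_derivative X ** mat_exp (t *\<^sub>R X)) (at t within S)"
proof -
  have "map_matrix Re (cmat X ** cexp (cmat X) (complex_of_real t)) = X ** mat_exp (t *\<^sub>R X)"
    by (simp flip: cmat_mat_exp cmat_mult)
  then show ?thesis
    using Re_curve_has_vector_derivative[OF cexp_has_derivative, of "cmat X" t S] by (simp add: mat_exp_eq)
qed

lemma mat_exp_0 [simp]: "mat_exp 0 = mat 1"
  using mat_exp_eq[of 0 0] by (simp add: cexp_0 flip: cmat_one)

lemma mat_exp_minus: "mat_exp (t *\<^sub>R X) ** mat_exp (- t *\<^sub>R X) = mat 1"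
  using cexp_minus[of "cmat X" "complex_of_real t"] cmat_mat_exp[of t X] cmat_mat_exp[of "- t" X]
  by (intro cmat_inj) (simp add: cmat_mult cmat_one)

lemma mat_exp_continuous: "continuous_on S (\<lambda>t. mat_exp (t *\<^sub>R X))"
  by (intro continuous_at_imp_continuous_on ballI has_vector_derivative_continuous[OF mat_exp_has_vector_derivative])

lemma mat_exp_commute: "mat_exp (t *\<^sub>R X) ** X = X ** mat_exp (t *\<^sub>R X)"
  by (rule cmat_inj) (simp add: cmat_mult cmat_mat_exp cexp_commute)

lemma mat_exp_add: "mat_exp ((s + t) *\<^sub>R X) = mat_exp (s *\<^sub>R X) ** mat_exp (t *\<^sub>R X)"
proof -
  have lin: "((\<lambda>u. a * u + t) has_vector_derivative a) (at u)" for a t u :: real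
    unfolding has_real_derivative_iff_has_vector_derivative[symmetric] by (auto intro!: derivative_eq_intros)
  define \<phi> where "\<phi> u = mat_exp ((u + s) *\<^sub>R X) ** mat_exp (- u *\<^sub>R X)" for u
  have d1: "((\<lambda>u. mat_exp ((u + s) *\<^sub>R X)) has_vector_derivative X ** mat_exp ((u + s) *\<^sub>R X)) (at u)" for u
    using vector_diff_chain_at[OF lin[of 1 s u] mat_exp_has_vector_derivative[of X]] by (simp add: o_def)
  have d2: "((\<lambda>u. mat_exp (- u *\<^sub>R X)) has_vector_derivative - (X ** mat_exp (- u *\<^sub>R X))) (at u)" for u
    using vector_diff_chain_at[OF lin[of "-1" 0 u] mat_exp_has_vector_derivative[of X]] by (simp add: o_def)
  have neg: "A ** - B = - (A ** B)" for A B :: "real^'k^'k"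
    by (simp add: matrix_matrix_mult_def vec_eq_iff sum_negf)
  have "(\<phi> has_vector_derivative 0) (at u)" for u
    using matrix_mult_has_vector_derivative[OF d1 d2, of u]
    by (simp add: \<phi>_def[abs_def] neg matrix_mul_assoc mat_exp_commute)
  then have "\<And>u. (\<phi> has_derivative (\<lambda>h. 0)) (at u)" by (simp add: has_vector_derivative_def)
  then have "\<phi> t = \<phi> 0" using has_derivative_zero_constant[of UNIV \<phi>] by auto
  then have "mat_exp ((t + s) *\<^sub>R X) ** mat_exp (- t *\<^sub>R X) = mat_exp (s *\<^sub>R X)" by (simp add: \<phi>_def)
  then have "mat_exp ((t + s) *\<^sub>R X) ** (mat_exp (- t *\<^sub>R X) ** mat_exp (- (- t) *\<^sub>R X)) = mat_exp (s *\<^sub>R X) ** mat_exp (t *\<^sub>R X)"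
    by (simp add: matrix_mul_assoc)
  then show ?thesis unfolding mat_exp_minus by (simp add: add.commute)
qed

text \<open>Paths in the group are differentiable curves of a real variable, possibly one-sided at the
end points, so the chain rule is needed in this form as well.\<close>

lemma polys_in_real_curve:
  assumes "p \<in> polys_in UNIV" "\<And>i. ((\<lambda>s. c s i) has_vector_derivative t i) (at s0 within S)"
  shows "((\<lambda>s. p (c s)) has_vector_derivative dir_deriv p (c s0) t) (at s0 within S)"
  using assms(1)
proof induction
  case (add p q)
  then show ?case using dir_deriv_add[OF add(1,2)] by (simp add: has_vector_derivative_add)
next
  case (mult p q)
  then show ?case
    using dir_deriv_mult[OF mult(1,2)] has_vector_derivative_mult[OF mult(3,4)] by (simp add: mult_ac add_ac)
qed (auto simp: dir_deriv_const dir_deriv_coord assms(2))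

lemma polys_in_continuous_on:
  assumes "p \<in> polys_in UNIV" "\<And>i. continuous_on S (\<lambda>s. c s i)"
  shows "continuous_on S (\<lambda>s. p (c s))"
  using assms(1) by induction (auto intro!: continuous_intros assms(2))

lemma cmat_curve:
  fixes \<gamma> :: "real \<Rightarrow> real^'k^'k"
  assumes "(\<gamma> has_vector_derivative D) (at s within S)"
  shows "((\<lambda>s. entries (cmat (\<gamma> s)) ij) has_vector_derivative entries (cmat D) ij) (at s within S)"
proof -
  obtain i j where ij: "ij = (i, j)" by force
  have "((\<lambda>s. complex_of_real (\<gamma> s $ i $ j)) has_vector_derivative complex_of_real (D $ i $ j)) (at s within S)"
    using assms
    by (intro bounded_linear.has_vector_derivative[OF bounded_linear_of_real]
        bounded_linear.has_vector_derivative[OF bounded_linear_vec_nth])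
  then show ?thesis by (simp add: ij entries_def)
qed

lemma gl_real_curve:
  fixes \<gamma> :: "real \<Rightarrow> real^'k^'k"
  assumes "q \<in> polys_in UNIV" "(\<gamma> has_vector_derivative D) (at s within S)" "det (\<gamma> s) \<noteq> 0"
  shows "((\<lambda>s. q (gl_coords (cmat (\<gamma> s)))) has_vector_derivative
    dir_deriv q (gl_coords (cmat (\<gamma> s))) (gl_tangent (cmat (\<gamma> s)) (cmat D))) (at s within S)"
proof (rule polys_in_real_curve[OF assms(1)])
  fix c
  show "((\<lambda>s. gl_coords (cmat (\<gamma> s)) c) has_vector_derivative gl_tangent (cmat (\<gamma> s)) (cmat D) c) (at s within S)"
  proof (cases c)
    case None
    have "((\<lambda>s. det_poly (entries (cmat (\<gamma> s)))) has_vector_derivative dir_deriv det_poly (entries (cmat (\<gamma> s))) (entries (cmat D))) (at s within S)"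
      by (rule polys_in_real_curve[OF det_poly_polys_in cmat_curve[OF assms(2)]])
    then have "((\<lambda>s. det (cmat (\<gamma> s))) has_vector_derivative dir_deriv det_poly (entries (cmat (\<gamma> s))) (entries (cmat D))) (at s within S)"
      by (simp add: det_poly_def)
    moreover have "det (cmat (\<gamma> s)) \<noteq> 0" using assms(3) by (simp add: det_cmat)
    ultimately have "((\<lambda>s. inverse (det (cmat (\<gamma> s)))) has_vector_derivative
        - dir_deriv det_poly (entries (cmat (\<gamma> s))) (entries (cmat D)) / (det (cmat (\<gamma> s)))\<^sup>2) (at s within S)"
      unfolding has_vector_derivative_def
      by (auto intro!: derivative_eq_intros simp: fun_eq_iff power2_eq_square divide_inverse mult_ac)
    then show ?thesis by (simp add: None gl_coords_def gl_tangent_def)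
  next
    case (Some ij)
    then show ?thesis using cmat_curve[OF assms(2)] by (simp add: gl_coords_def gl_tangent_def)
  qed
qed

section \<open>The group of real points\<close>

context alg_rep
begin

definition GR :: "(real^'m^'m) set" where "GR = real_points_group GC"

definition G :: "(real^'m^'m) set" where "G = identity_component GR"

definition lie :: "(real^'m^'m) set" where "lie = lie_algebra GR"

abbreviation rr :: "real^'m^'m \<Rightarrow> real^'n^'n" where "rr \<equiv> real_rep \<rho>"

definition dr :: "real^'m^'m \<Rightarrow> real^'n^'n" where "dr X = map_matrix Re (drho (cmat X))"

lemma GR_iff: "g \<in> GR \<longleftrightarrow> cmat g \<in> GC"
  by (simp add: GR_def real_points_group_def)

lemma one_GR: "mat 1 \<in> GR" by (simp add: GR_iff cmat_one one_GC)

lemma mult_GR: "g \<in> GR \<Longrightarrow> h \<in> GR \<Longrightarrow> g ** h \<in> GR" by (simp add: GR_iff cmat_mult mult_GC)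

lemma det_GR: "g \<in> GR \<Longrightarrow> det g \<noteq> 0" using det_GC[of "cmat g"] by (simp add: GR_iff det_cmat)

lemma inv_GR_right: "g \<in> GR \<Longrightarrow> g ** matrix_inv g = mat 1"
  and inv_GR_left: "g \<in> GR \<Longrightarrow> matrix_inv g ** g = mat 1"
proof -
  assume "g \<in> GR"
  then have "invertible g" using det_GR by (simp add: invertible_det_nz)
  then have "\<exists>h. g ** h = mat 1 \<and> h ** g = mat 1" by (auto simp: invertible_def)
  from someI_ex[OF this] show "g ** matrix_inv g = mat 1" "matrix_inv g ** g = mat 1"
    by (auto simp: matrix_inv_def)
qed

lemma matrix_inv_unique: "g \<in> GR \<Longrightarrow> g ** h = mat 1 \<Longrightarrow> matrix_inv g = h"
  by (metis inv_GR_left matrix_mul_assoc matrix_mul_lid matrix_mul_rid)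

lemma cmat_inv: "g \<in> GR \<Longrightarrow> cmat (matrix_inv g) = matrix_inv (cmat g)"
proof -
  assume g: "g \<in> GR"
  have "cmat g ** cmat (matrix_inv g) = mat 1" by (simp add: inv_GR_right[OF g] cmat_one flip: cmat_mult)
  then show ?thesis
    using inv_left[of "cmat g"] g unfolding GR_iff
    by (metis matrix_mul_assoc matrix_mul_lid matrix_mul_rid)
qed

lemma inv_GR: "g \<in> GR \<Longrightarrow> matrix_inv g \<in> GR"
  using inv_GC[of "cmat g"] cmat_inv[of g] by (simp add: GR_iff)

lemma inv_mult_GR: "g \<in> GR \<Longrightarrow> h \<in> GR \<Longrightarrow> matrix_inv (g ** h) = matrix_inv h ** matrix_inv g"
proof (rule matrix_inv_unique[OF mult_GR])
  assume g: "g \<in> GR" and h: "h \<in> GR"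
  have "g ** h ** (matrix_inv h ** matrix_inv g) = g ** (h ** matrix_inv h) ** matrix_inv g"
    by (simp add: matrix_mul_assoc)
  then show "g ** h ** (matrix_inv h ** matrix_inv g) = mat 1" using g h by (simp add: inv_GR_right)
qed

text \<open>The representation is given by polynomials with real coefficients, so \<open>\<rho>\<close> has real entries at
real points and \<^const>\<open>real_rep\<close> loses nothing.\<close>

lemma cmat_rr: "g \<in> GR \<Longrightarrow> cmat (rr g) = \<rho> (cmat g)"
proof -
  assume g: "g \<in> GR"
  have "cnj (\<rho> (cmat g) $ i $ j) = \<rho> (cmat g) $ i $ j" for i j
  proof -
    have "(\<lambda>c. cnj (gl_coords (cmat g) c)) = gl_coords (cmat g)"
      by (auto simp: gl_coords_def entries_def det_cmat fun_eq_iff split: option.splits)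
    then show ?thesis
      using real_poly_funs_cnj[OF rho_poly(1), of i j "gl_coords (cmat g)"] rho_poly(2)[of "cmat g" i j] g
      by (simp add: GR_iff)
  qed
  then have "\<rho> (cmat g) $ i $ j \<in> \<real>" for i j by (simp add: Reals_cnj_iff)
  then show ?thesis by (simp add: real_rep_def vec_eq_iff)
qed

lemma rr_mult: "g \<in> GR \<Longrightarrow> h \<in> GR \<Longrightarrow> rr (g ** h) = rr g ** rr h"
  by (rule cmat_inj) (simp add: cmat_rr mult_GR cmat_mult rho_mult GR_iff[symmetric] rho_mult[OF GR_iff[THEN iffD1] GR_iff[THEN iffD1]])

lemma rr_one: "rr (mat 1) = mat 1"
  by (rule cmat_inj) (simp add: cmat_rr one_GR cmat_one rho_one)

lemma rr_inv: "g \<in> GR \<Longrightarrow> rr g ** rr (matrix_inv g) = mat 1" "g \<in> GR \<Longrightarrow> rr (matrix_inv g) ** rr g = mat 1"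
  by (simp_all add: inv_GR inv_GR_left inv_GR_right rr_one flip: rr_mult)

lemma rr_continuous: "continuous_on GR rr"
proof -
  have c: "continuous_on GR (\<lambda>g. gl_coords (cmat g) c)" for c
  proof (cases c)
    case None
    have "continuous_on GR (\<lambda>g. det g)" unfolding det_def by (intro continuous_intros)
    then show ?thesis using det_GR unfolding None gl_coords_def by (auto simp: det_cmat intro!: continuous_intros)
  next
    case (Some ij)
    then show ?thesis by (cases ij) (auto simp: gl_coords_def entries_def intro!: continuous_intros)
  qed
  have "continuous_on GR (\<lambda>g. \<chi> i j. Re (rho_poly i j (gl_coords (cmat g))))"
    by (intro continuous_on_vec_lambda continuous_intros polys_in_continuous_on[OF rho_poly_polys_in c])
  moreover have "(\<chi> i j. Re (rho_poly i j (gl_coords (cmat g)))) = rr g" if "g \<in> GR" for g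
    using that rho_poly(2)[of "cmat g"] by (simp add: real_rep_def vec_eq_iff GR_iff)
  ultimately show ?thesis using continuous_on_cong by (metis (no_types, lifting))
qed

text \<open>An equation of the group vanishes along the one-parameter group of a Lie algebra element, so
its first variation vanishes; the converse is \<open>cexp_in_GC\<close>.\<close>

lemma lie_iff: "X \<in> lie \<longleftrightarrow> cmat X \<in> tangent"
proof
  assume X: "X \<in> lie"
  show "cmat X \<in> tangent"
    unfolding tangent_def
  proof (intro CollectI ballI)
    fix p assume p: "p \<in> vanishing"
    have "((\<lambda>t. p (entries (cmat (mat_exp (t *\<^sub>R X))))) has_vector_derivative
        dir_deriv p (entries (cmat (mat_exp (0 *\<^sub>R X)))) (entries (cmat (X ** mat_exp (0 *\<^sub>R X))))) (at 0)"
      using p by (intro polys_in_real_curve cmat_curve mat_exp_has_vector_derivative) (simp add: vanishing_def)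
    moreover have "p (entries (cmat (mat_exp (t *\<^sub>R X)))) = 0" for t
      using X p by (auto simp: lie_def lie_algebra_def GR_iff vanishing_def)
    ultimately have "((\<lambda>t. 0) has_vector_derivative dir_deriv p (entries (mat 1)) (entries (cmat X))) (at (0 :: real))"
      by (simp add: cmat_one)
    then show "dir_deriv p (entries (mat 1)) (entries (cmat X)) = 0"
      using vector_derivative_at by fastforce
  qed
next
  assume "cmat X \<in> tangent"
  then show "X \<in> lie" using cexp_in_GC by (simp add: lie_def lie_algebra_def GR_iff cmat_mat_exp)
qed

lemma mat_exp_GR: "X \<in> lie \<Longrightarrow> mat_exp (t *\<^sub>R X) \<in> GR"
  by (simp add: lie_def lie_algebra_def)

lemma G_sub_GR: "G \<subseteq> GR" and one_G: "mat 1 \<in> G"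
  using one_GR by (auto simp: G_def identity_component_def connected_component_subset[THEN subsetD])

lemma connected_sub_G: "connected T \<Longrightarrow> mat 1 \<in> T \<Longrightarrow> T \<subseteq> GR \<Longrightarrow> T \<subseteq> G"
  unfolding G_def identity_component_def by (rule connected_component_maximal)

lemma connected_G: "connected G"
  by (simp add: G_def identity_component_def)

lemma mat_exp_G: "X \<in> lie \<Longrightarrow> mat_exp (t *\<^sub>R X) \<in> G"
proof -
  assume X: "X \<in> lie"
  have "connected ((\<lambda>t. mat_exp (t *\<^sub>R X)) ` UNIV)"
    by (intro connected_continuous_image mat_exp_continuous) simp
  moreover have "mat 1 \<in> (\<lambda>t. mat_exp (t *\<^sub>R X)) ` UNIV" by (auto intro!: image_eqI[of _ _ 0])
  ultimately show ?thesis using connected_sub_G mat_exp_GR[OF X] by blast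
qed

lemma lie_algebra_G: "lie_algebra G = lie"
  using G_sub_GR mat_exp_G by (auto simp: lie_algebra_def lie_def)

text \<open>The translate of the component by \<open>g\<close> is connected and meets the component in \<open>g\<close>.\<close>

lemma left_mult_G: "g \<in> G \<Longrightarrow> h \<in> G \<Longrightarrow> g ** h \<in> G"
proof -
  assume g: "g \<in> G" and h: "h \<in> G"
  let ?T = "G \<union> (\<lambda>h. g ** h) ` G"
  have "continuous_on G (\<lambda>h. g ** h)" by (intro matrix_mult_continuous_on continuous_intros)
  then have "connected ((\<lambda>h. g ** h) ` G)" by (rule connected_continuous_image[OF _ connected_G])
  moreover have "g \<in> G \<inter> (\<lambda>h. g ** h) ` G" using g one_G by (auto intro!: image_eqI[of _ _ "mat 1"])
  ultimately have "connected ?T" using connected_G by (intro connected_Un) auto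
  then have "?T \<subseteq> G" using one_G G_sub_GR g by (intro connected_sub_G) (auto intro: mult_GR)
  then show ?thesis using h by blast
qed

lemma inv_G: "g \<in> G \<Longrightarrow> matrix_inv g \<in> G"
proof -
  assume g: "g \<in> G"
  then have gR: "g \<in> GR" using G_sub_GR by blast
  let ?T = "(\<lambda>h. matrix_inv g ** h) ` G"
  have "continuous_on G (\<lambda>h. matrix_inv g ** h)" by (intro matrix_mult_continuous_on continuous_intros)
  then have "connected ?T" by (rule connected_continuous_image[OF _ connected_G])
  moreover have "mat 1 \<in> ?T" using g inv_GR_left[OF gR] by (auto intro!: image_eqI[of _ _ g])
  ultimately have "?T \<subseteq> G" using G_sub_GR inv_GR[OF gR] by (intro connected_sub_G) (auto intro: mult_GR)
  then show ?thesis using one_G by (auto simp: image_subset_iff dest: bspec[of _ _ "mat 1"])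
qed

lemma cmat_dr: "cmat (dr X) = drho (cmat X)"
proof -
  have "map_matrix cnj (cmat X) = cmat X" by (simp add: vec_eq_iff)
  then have "map_matrix cnj (drho (cmat X)) = drho (cmat X)" using drho_cnj[of "cmat X"] by simp
  then have "cnj (drho (cmat X) $ i $ j) = drho (cmat X) $ i $ j" for i j by (simp add: vec_eq_iff)
  then have "drho (cmat X) $ i $ j \<in> \<real>" for i j by (simp add: Reals_cnj_iff)
  then show ?thesis by (simp add: dr_def vec_eq_iff)
qed

lemma linear_dr: "linear dr"
proof (rule linearI)
  fix X Y :: "real^'m^'m" and a :: real
  have "drho (cmat (X + Y)) $ i $ j = 1 * drho (cmat X) $ i $ j + 1 * drho (cmat Y) $ i $ j" for i j
    by (rule drho_linear) simp
  then show "dr (X + Y) = dr X + dr Y" by (simp add: dr_def vec_eq_iff)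
  have "drho (cmat (a *\<^sub>R X)) $ i $ j = complex_of_real a * drho (cmat X) $ i $ j + 0 * drho (cmat X) $ i $ j" for i j
    by (rule drho_linear) simp
  then show "dr (a *\<^sub>R X) = a *\<^sub>R dr X" by (simp add: dr_def vec_eq_iff)
qed

lemma subspace_lie: "subspace lie"
proof (rule subspaceI)
  have "vanishing \<subseteq> polys_in UNIV" by (auto simp: vanishing_def)
  then have "dir_deriv p (entries (mat 1)) (\<lambda>i. 0) = 0" if "p \<in> vanishing" for p
    using dir_deriv_linear[of p UNIV "entries (mat 1)" 0 "\<lambda>_. 0" 0 "\<lambda>_. 0"] that by auto
  moreover have "entries (cmat (0 :: real^'m^'m)) = (\<lambda>i. 0)" by (auto simp: entries_def fun_eq_iff)
  ultimately have z: "cmat 0 \<in> tangent" by (simp add: tangent_def)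
  then show "0 \<in> lie" by (simp add: lie_iff)
  fix X Y :: "real^'m^'m" and a :: real assume X: "X \<in> lie"
  show "a *\<^sub>R X \<in> lie" using X tangent_linear[of "cmat X" "cmat X" "cmat (a *\<^sub>R X)" "complex_of_real a" 0]
    by (simp add: lie_iff)
  assume "Y \<in> lie"
  then show "X + Y \<in> lie" using X tangent_linear[of "cmat X" "cmat Y" "cmat (X + Y)" 1 1]
    by (simp add: lie_iff)
qed

lemma rr_mat_exp:
  assumes "X \<in> lie"
  shows "((\<lambda>t. rr (mat_exp (t *\<^sub>R X))) has_vector_derivative dr X) (at 0)"
  using Re_curve_has_vector_derivative[of "\<lambda>z. \<rho> (cexp (cmat X) z)" "drho (cmat X)" 0 UNIV] rho_cexp[of "cmat X"] assms
  by (simp add: lie_iff real_rep_def cmat_mat_exp dr_def)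

text \<open>Translating the curve to the identity, where equations and representation have the first
variations that define \<open>lie\<close> and \<open>dr\<close>.\<close>

lemma curve_tangent:
  fixes \<gamma> :: "real \<Rightarrow> real^'m^'m"
  assumes "\<And>s. s \<in> S \<Longrightarrow> \<gamma> s \<in> GR" "(\<gamma> has_vector_derivative D) (at s within S)" "s \<in> S" "at s within S \<noteq> bot"
  shows "matrix_inv (\<gamma> s) ** D \<in> lie"
    and "((\<lambda>s. rr (\<gamma> s)) has_vector_derivative rr (\<gamma> s) ** dr (matrix_inv (\<gamma> s) ** D)) (at s within S)"
proof -
  let ?X = "matrix_inv (\<gamma> s) ** D"
  have gs: "\<gamma> s \<in> GR" by (rule assms(1,3))+
  define c where "c u = matrix_inv (\<gamma> s) ** \<gamma> u" for u
  have c: "(c has_vector_derivative ?X) (at s within S)"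
    unfolding c_def[abs_def]
    using bounded_linear.has_vector_derivative[OF bounded_bilinear.bounded_linear_right[OF bounded_bilinear_matrix_mult] assms(2)] .
  have cs: "c s = mat 1" unfolding c_def by (rule inv_GR_left[OF gs])
  have cG: "c u \<in> GR" if "u \<in> S" for u unfolding c_def by (intro mult_GR inv_GR gs assms(1) that)
  have "dir_deriv p (entries (mat 1)) (entries (cmat ?X)) = 0" if p: "p \<in> vanishing" for p
  proof -
    have "((\<lambda>t. p (entries (cmat (c t)))) has_vector_derivative dir_deriv p (entries (cmat (c s))) (entries (cmat ?X))) (at s within S)"
      using p by (intro polys_in_real_curve cmat_curve c) (simp add: vanishing_def)
    then have "((\<lambda>t. 0) has_vector_derivative dir_deriv p (entries (mat 1)) (entries (cmat ?X))) (at s within S)"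
      unfolding cs cmat_one
      by (rule has_vector_derivative_transform[OF assms(3), rotated]) (use cG p in \<open>auto simp: GR_iff vanishing_def\<close>)
    from vector_derivative_within[OF assms(4) this] vector_derivative_within[OF assms(4) has_vector_derivative_const[of "0 :: complex"]]
    show ?thesis by simp
  qed
  then show "?X \<in> lie" by (simp add: lie_iff tangent_def)
  have "((\<lambda>u. rr (c u)) has_vector_derivative dr ?X) (at s within S)"
  proof (rule matrix_has_vector_derivativeI)
    fix i j
    have "((\<lambda>u. rho_poly i j (gl_coords (cmat (c u)))) has_vector_derivative
        dir_deriv (rho_poly i j) (gl_coords (cmat (c s))) (gl_tangent (cmat (c s)) (cmat ?X))) (at s within S)"
      by (rule gl_real_curve[OF rho_poly_polys_in c]) (simp add: cs)
    from bounded_linear.has_vector_derivative[OF bounded_linear_Re this]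
    have "((\<lambda>u. Re (rho_poly i j (gl_coords (cmat (c u))))) has_vector_derivative dr ?X $ i $ j) (at s within S)"
      by (simp add: cs cmat_one dr_def drho_def)
    then have "((\<lambda>u. rr (c u) $ i $ j) has_vector_derivative dr ?X $ i $ j) (at s within S)"
      by (rule has_vector_derivative_transform[OF assms(3), rotated])
        (use cG rho_poly(2) in \<open>auto simp: GR_iff real_rep_def\<close>)
    then show "((\<lambda>u. rr (c u) $ i $ j) has_real_derivative dr ?X $ i $ j) (at s within S)"
      by (simp add: has_real_derivative_iff_has_vector_derivative)
  qed
  from bounded_linear.has_vector_derivative[OF bounded_bilinear.bounded_linear_right[OF bounded_bilinear_matrix_mult] this, of "rr (\<gamma> s)"]
  show "((\<lambda>s. rr (\<gamma> s)) has_vector_derivative rr (\<gamma> s) ** dr ?X) (at s within S)"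
  proof (rule has_vector_derivative_transform[OF assms(3), rotated])
    fix u assume u: "u \<in> S"
    have "rr (\<gamma> s) ** rr (c u) = rr (\<gamma> s ** matrix_inv (\<gamma> s) ** \<gamma> u)"
      using rr_mult[OF gs cG[OF u]] by (simp add: c_def matrix_mul_assoc)
    then show "rr (\<gamma> u) = rr (\<gamma> s) ** rr (c u)" by (simp add: inv_GR_right[OF gs])
  qed
qed

end

section \<open>Products of one-parameter groups\<close>

lemma polys_in_has_derivative:
  assumes "p \<in> polys_in UNIV" "\<And>i. ((\<lambda>s. c s i) has_derivative c' i) (at s0 within S)"
  shows "((\<lambda>s. p (c s)) has_derivative (\<lambda>h. dir_deriv p (c s0) (\<lambda>i. c' i h))) (at s0 within S)"
  using assms(1)
proof induction
  case (add p q)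
  then show ?case using dir_deriv_add[OF add(1,2)] by (simp add: has_derivative_add)
next
  case (mult p q)
  then show ?case
    using dir_deriv_mult[OF mult(1,2)] has_derivative_mult[OF mult(3,4)] by (simp add: mult_ac add_ac)
qed (auto simp: dir_deriv_const dir_deriv_coord assms(2))

text \<open>Products of one-parameter families \<open>c k\<close> in a fixed order, each at its own time: the
coordinates of the second kind. The derivative at the origin is the sum of the generators.\<close>

definition flow_prod :: "('k \<Rightarrow> real \<Rightarrow> real^'a^'a) \<Rightarrow> 'k list \<Rightarrow> ('k \<Rightarrow> real) \<Rightarrow> real^'a^'a" where
  "flow_prod c ks a = foldr (\<lambda>k M. c k (a k) ** M) ks (mat 1)"

lemma flow_prod_simps [simp]:
  "flow_prod c [] a = mat 1" "flow_prod c (k # ks) a = c k (a k) ** flow_prod c ks a"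
  by (simp_all add: flow_prod_def)

lemma flow_prod_zero:
  assumes "\<And>k. k \<in> set ks \<Longrightarrow> c k 0 = mat 1"
  shows "flow_prod c ks (\<lambda>k. 0) = mat 1"
  using assms by (induction ks) auto

lemma flow_prod_has_derivative:
  fixes a :: "'k \<Rightarrow> 'z::euclidean_space \<Rightarrow> real"
  assumes "\<And>k. k \<in> set ks \<Longrightarrow> c k 0 = mat 1" "\<And>k. k \<in> set ks \<Longrightarrow> (c k has_vector_derivative D k) (at 0)"
    "\<And>k. bounded_linear (a k)"
  shows "((\<lambda>z. flow_prod c ks (\<lambda>k. a k z)) has_derivative (\<lambda>z. \<Sum>k\<leftarrow>ks. a k z *\<^sub>R D k)) (at 0)"
  using assms(1,2)
proof (induction ks)
  case (Cons k ks)
  have a0: "a k 0 = 0" for k using assms(3) by (simp add: linear_0 bounded_linear.linear)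
  have "(c k has_derivative (\<lambda>x. x *\<^sub>R D k)) (at (a k 0))"
    using Cons.prems(2)[of k] by (simp add: a0 has_vector_derivative_def)
  from has_derivative_compose[OF bounded_linear_imp_has_derivative[OF assms(3)[of k]] this]
  have 1: "((\<lambda>z. c k (a k z)) has_derivative (\<lambda>z. a k z *\<^sub>R D k)) (at 0)" by simp
  have "flow_prod c ks (\<lambda>k. a k 0) = mat 1" using flow_prod_zero[of ks c] Cons.prems(1) by (simp add: a0)
  then show ?case
    using matrix_mult_has_derivative[OF 1 Cons.IH] Cons.prems by (simp add: a0 add.commute)
qed simp

lemma flow_prod_continuous_on:
  assumes "\<And>k. k \<in> set ks \<Longrightarrow> continuous_on UNIV (c k)" "\<And>k. continuous_on S (a k)"
  shows "continuous_on S (\<lambda>z. flow_prod c ks (\<lambda>k. a k z))"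
  using assms(1)
proof (induction ks)
  case (Cons k ks)
  have "continuous_on S (\<lambda>z. c k (a k z))"
    using continuous_on_compose2[OF Cons.prems[of k] assms(2)[of k]] by simp
  then show ?case using Cons by (auto intro!: matrix_mult_continuous_on)
qed simp

text \<open>The same product with one common time, which is a curve from the identity to the product of
exponentials.\<close>

definition exp_prod :: "(real^'a^'a) list \<Rightarrow> real \<Rightarrow> real^'a^'a" where
  "exp_prod Xs s = flow_prod (\<lambda>X s. mat_exp (s *\<^sub>R X)) Xs (\<lambda>_. s)"

lemma exp_prod_simps [simp]:
  "exp_prod [] s = mat 1" "exp_prod (X # Xs) s = mat_exp (s *\<^sub>R X) ** exp_prod Xs s"
  by (simp_all add: exp_prod_def)

lemma exp_prod_append: "exp_prod (Xs @ Ys) s = exp_prod Xs s ** exp_prod Ys s"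
  by (induction Xs) (simp_all add: matrix_mul_assoc)

lemma exp_prod_0: "exp_prod Xs 0 = mat 1"
  by (induction Xs) simp_all

lemma exp_prod_inverse: "exp_prod Xs s ** exp_prod (rev (map uminus Xs)) s = mat 1"
proof (induction Xs)
  case (Cons X Xs)
  have "exp_prod (X # Xs) s ** exp_prod (rev (map uminus (X # Xs))) s =
      mat_exp (s *\<^sub>R X) ** (exp_prod Xs s ** exp_prod (rev (map uminus Xs)) s) ** mat_exp (- s *\<^sub>R X)"
    by (simp add: exp_prod_append matrix_mul_assoc)
  then show ?case using mat_exp_minus[of s X] by (simp add: Cons)
qed simp

lemma flow_prod_exp_prod:
  "flow_prod (\<lambda>b s. mat_exp (s *\<^sub>R b)) bs a = exp_prod (map (\<lambda>b. a b *\<^sub>R b) bs) 1"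
  by (induction bs) simp_all

lemma exp_prod_C1:
  "\<exists>D. (\<forall>s. (exp_prod Xs has_vector_derivative D s) (at s)) \<and> continuous_on UNIV D"
proof (induction Xs)
  case Nil
  have "exp_prod [] = (\<lambda>s. mat 1 :: real^'a^'a)" by auto
  then show ?case by (intro exI[of _ "\<lambda>_. 0"]) auto
next
  case (Cons X Xs)
  then obtain D where D: "\<And>s. (exp_prod Xs has_vector_derivative D s) (at s)" "continuous_on UNIV D" by blast
  have c: "continuous_on UNIV (exp_prod Xs)"
    by (intro continuous_at_imp_continuous_on ballI has_vector_derivative_continuous[OF D(1)])
  have "(exp_prod (X # Xs) has_vector_derivative
      mat_exp (s *\<^sub>R X) ** D s + X ** mat_exp (s *\<^sub>R X) ** exp_prod Xs s) (at s)" for s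
    using matrix_mult_has_vector_derivative[OF mat_exp_has_vector_derivative D(1), of X s]
    by (simp flip: exp_prod_simps(2))
  moreover have "continuous_on UNIV (\<lambda>s. mat_exp (s *\<^sub>R X) ** D s + X ** mat_exp (s *\<^sub>R X) ** exp_prod Xs s)"
    by (intro continuous_on_add matrix_mult_continuous_on mat_exp_continuous D(2) c continuous_on_const)
  ultimately show ?case
    by (intro exI[of _ "\<lambda>s. mat_exp (s *\<^sub>R X) ** D s + X ** mat_exp (s *\<^sub>R X) ** exp_prod Xs s"]) blast
qed

lemma exp_prod_continuous: "continuous_on S (exp_prod Xs)"
proof -
  obtain D where "\<And>s. (exp_prod Xs has_vector_derivative D s) (at s)" using exp_prod_C1[of Xs] by blast
  then show ?thesis by (intro continuous_at_imp_continuous_on ballI has_vector_derivative_continuous)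
qed

section \<open>Comparison of inner products\<close>

text \<open>All norms on a finite-dimensional space are equivalent: the quadratic form is continuous, being
a polynomial in coordinates, and attains a positive minimum on the unit sphere of the subspace.\<close>

lemma inner_product_on_subspace:
  fixes V :: "'a::euclidean_space set"
  assumes V: "subspace V" and B: "inner_product_on V B"
  shows "continuous_on V (\<lambda>X. B X X)" "\<exists>c>0. \<forall>X\<in>V. norm X \<le> c * sqrt (B X X)"
proof -
  obtain E where E: "E \<subseteq> V" "pairwise orthogonal E" "\<And>x. x \<in> E \<Longrightarrow> norm x = 1" "independent E" "span E = V"
    using orthonormal_basis_subspace[OF V] by metis
  have fin: "finite E" using E(4) by (rule independent_imp_finite)
  have sub: "\<And>S f. S \<subseteq> E \<Longrightarrow> (\<Sum>e\<in>S. f e *\<^sub>R e) \<in> V"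
    using V E(1) by (auto intro!: subspace_sum subspace_scale)
  have sym: "\<And>X Y. X \<in> V \<Longrightarrow> Y \<in> V \<Longrightarrow> B X Y = B Y X"
    and lin: "\<And>X Y Z a b. X \<in> V \<Longrightarrow> Y \<in> V \<Longrightarrow> Z \<in> V \<Longrightarrow> B (a *\<^sub>R X + b *\<^sub>R Y) Z = a * B X Z + b * B Y Z"
    and pos: "\<And>X. X \<in> V \<Longrightarrow> X \<noteq> 0 \<Longrightarrow> B X X > 0"
    using B by (auto simp: inner_product_on_def)
  have V0: "0 \<in> V" using V by (rule subspace_0)
  have B0: "B 0 Z = 0" if "Z \<in> V" for Z using lin[OF V0 V0 that, of 0 0] by simp
  have Bsum: "B (\<Sum>e\<in>S. f e *\<^sub>R e) Z = (\<Sum>e\<in>S. f e * B e Z)" if "S \<subseteq> E" "Z \<in> V" for S f Z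
    using finite_subset[OF that(1) fin] that(1)
  proof (induction S rule: finite_induct)
    case (insert e S)
    then have "B (f e *\<^sub>R e + 1 *\<^sub>R (\<Sum>e\<in>S. f e *\<^sub>R e)) Z = f e * B e Z + 1 * B (\<Sum>e\<in>S. f e *\<^sub>R e) Z"
      using E(1) sub that(2) by (intro lin) auto
    then show ?case using insert by simp
  qed (simp add: B0[OF that(2)])
  have exp: "X = (\<Sum>e\<in>E. (X \<bullet> e) *\<^sub>R e)" if "X \<in> V" for X
  proof -
    have "X \<in> span E" using that E(5) by simp
    then obtain u where u: "X = (\<Sum>e\<in>E. u e *\<^sub>R e)" using span_finite[OF fin] by auto
    have "X \<bullet> e = u e" if "e \<in> E" for e
    proof -
      have "X \<bullet> e = (\<Sum>d\<in>E. u d * (d \<bullet> e))" by (simp add: u inner_sum_left)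
      also have "\<dots> = (\<Sum>d\<in>E. if d = e then u e else 0)"
      proof (rule sum.cong)
        fix d assume "d \<in> E"
        then show "u d * (d \<bullet> e) = (if d = e then u e else 0)"
          using E(2,3) that by (auto simp: pairwise_def orthogonal_def dot_square_norm)
      qed simp
      finally show ?thesis using fin that by simp
    qed
    then show ?thesis using u by simp
  qed
  have Beq: "B X X = (\<Sum>e\<in>E. (X \<bullet> e) * (\<Sum>d\<in>E. (X \<bullet> d) * B d e))" if X: "X \<in> V" for X
  proof -
    have "B X X = B (\<Sum>e\<in>E. (X \<bullet> e) *\<^sub>R e) X" using exp[OF X] by simp
    also have "\<dots> = (\<Sum>e\<in>E. (X \<bullet> e) * B e X)" by (rule Bsum[OF _ X]) simp
    also have "\<dots> = (\<Sum>e\<in>E. (X \<bullet> e) * B X e)" using sym X E(1) by (intro sum.cong) auto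
    also have "\<dots> = (\<Sum>e\<in>E. (X \<bullet> e) * B (\<Sum>d\<in>E. (X \<bullet> d) *\<^sub>R d) e)" using exp[OF X] by simp
    also have "\<dots> = (\<Sum>e\<in>E. (X \<bullet> e) * (\<Sum>d\<in>E. (X \<bullet> d) * B d e))"
      using E(1) by (intro sum.cong) (auto simp: Bsum)
    finally show ?thesis .
  qed
  have cont: "continuous_on UNIV (\<lambda>X. \<Sum>e\<in>E. (X \<bullet> e) * (\<Sum>d\<in>E. (X \<bullet> d) * B d e))"
    by (intro continuous_intros)
  show cV: "continuous_on V (\<lambda>X. B X X)"
    by (rule continuous_on_eq[OF continuous_on_subset[OF cont]]) (auto simp: Beq)
  show "\<exists>c>0. \<forall>X\<in>V. norm X \<le> c * sqrt (B X X)"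
  proof (cases "V \<inter> sphere 0 1 = {}")
    case True
    have "X = 0" if "X \<in> V" for X
    proof (rule ccontr)
      assume "X \<noteq> 0"
      then have "(1 / norm X) *\<^sub>R X \<in> V \<inter> sphere 0 1" using that V by (auto intro: subspace_scale)
      then show False using True by blast
    qed
    then have "\<forall>X\<in>V. norm X \<le> 1 * sqrt (B X X)" using B0[OF V0] by force
    then show ?thesis using zero_less_one by blast
  next
    case False
    have "compact (V \<inter> sphere 0 1)" using closed_subspace[OF V] by (intro closed_Int_compact) auto
    moreover have "continuous_on (V \<inter> sphere 0 1) (\<lambda>X. B X X)" by (rule continuous_on_subset[OF cV]) auto
    ultimately obtain X0 where X0: "X0 \<in> V \<inter> sphere 0 1" "\<And>X. X \<in> V \<inter> sphere 0 1 \<Longrightarrow> B X0 X0 \<le> B X X"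
      using continuous_attains_inf[OF _ False] by blast
    define \<delta> where "\<delta> = B X0 X0"
    have \<delta>: "\<delta> > 0" unfolding \<delta>_def using X0(1) by (intro pos) auto
    have "norm X \<le> (1 / sqrt \<delta>) * sqrt (B X X)" if X: "X \<in> V" for X
    proof (cases "X = 0")
      case False
      let ?Y = "(1 / norm X) *\<^sub>R X"
      have YV: "?Y \<in> V" using X V by (auto intro: subspace_scale)
      then have Y: "?Y \<in> V \<inter> sphere 0 1" using False by auto
      have "X = norm X *\<^sub>R ?Y" using False by simp
      have s1: "B (a *\<^sub>R Z) W = a * B Z W" if "Z \<in> V" "W \<in> V" for a Z W
        using lin[OF that(1) V0 that(2), of a 0] by simp
      have "B ?Y ?Y = (1 / norm X) * B X ?Y" by (rule s1[OF X YV])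
      also have "B X ?Y = (1 / norm X) * B X X" using s1[OF X X, of "1 / norm X"] sym[OF X YV] by simp
      finally have "B X X = (norm X)\<^sup>2 * B ?Y ?Y" using False by (simp add: power2_eq_square)
      moreover have "B ?Y ?Y \<ge> \<delta>" using X0(2)[OF Y] by (simp add: \<delta>_def)
      ultimately have "B X X \<ge> (norm X)\<^sup>2 * \<delta>" by (simp add: mult_left_mono)
      then have "sqrt (B X X) \<ge> norm X * sqrt \<delta>"
        by (metis norm_ge_zero real_sqrt_le_mono real_sqrt_mult real_sqrt_pow2_iff real_sqrt_unique)
      then show ?thesis using \<delta> by (simp add: field_simps)
    qed (use B0[OF V0] in simp)
    then show ?thesis using \<delta> by (intro exI[of _ "1 / sqrt \<delta>"]) auto
  qed
qed

section \<open>The group near the identity\<close>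

context alg_rep
begin

text \<open>If there were group elements \<open>mat 1 + Y\<close> with \<open>Y\<close> orthogonal to the Lie algebra and
arbitrarily small, a limit of the directions of \<open>Y\<close> would be annihilated by the first variation of all
equations. It would lie in the Lie algebra and be orthogonal to it.\<close>

lemma complement_isolated:
  "\<exists>r>0. \<forall>Y. norm Y < r \<longrightarrow> (\<forall>b\<in>lie. Y \<bullet> b = 0) \<longrightarrow> mat 1 + Y \<in> GR \<longrightarrow> Y = 0"
proof (rule ccontr)
  assume "\<not> ?thesis"
  then have "\<exists>Y. norm Y < inverse (real (Suc n)) \<and> (\<forall>b\<in>lie. Y \<bullet> b = 0) \<and> mat 1 + Y \<in> GR \<and> Y \<noteq> 0" for n
    by (metis inverse_positive_iff_positive of_nat_0_less_iff zero_less_Suc)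
  then obtain Y where Y: "\<And>n. norm (Y n) < inverse (real (Suc n))" "\<And>n b. b \<in> lie \<Longrightarrow> Y n \<bullet> b = 0"
    "\<And>n. mat 1 + Y n \<in> GR" "\<And>n. Y n \<noteq> 0" by metis
  define y where "y n = (1 / norm (Y n)) *\<^sub>R Y n" for n
  have "y n \<in> sphere 0 1" for n using Y(4) by (simp add: y_def)
  then obtain l r where l: "l \<in> sphere 0 1" "strict_mono r" "(y \<circ> r) \<longlonglongrightarrow> l"
    using compact_sphere[of "0 :: real^'m^'m" 1, unfolded compact_def] by meson
  have "(\<lambda>n. norm (Y n)) \<longlonglongrightarrow> 0"
    by (rule Lim_null_comparison[OF always_eventually LIMSEQ_inverse_real_of_nat])
      (use Y(1) in \<open>simp add: less_imp_le\<close>)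
  then have "Y \<longlonglongrightarrow> 0" by (simp add: tendsto_norm_zero_iff)
  then have Y0: "(Y \<circ> r) \<longlonglongrightarrow> 0" using l(2) by (rule LIMSEQ_subseq_LIMSEQ)
  have "l \<bullet> b = 0" if "b \<in> lie" for b
  proof -
    have "(\<lambda>n. (y \<circ> r) n \<bullet> b) \<longlonglongrightarrow> l \<bullet> b" by (intro tendsto_intros l)
    moreover have "(\<lambda>n. (y \<circ> r) n \<bullet> b) = (\<lambda>n. 0)" using Y(2)[OF that] by (simp add: y_def)
    ultimately show ?thesis by (simp add: LIMSEQ_const_iff)
  qed
  moreover have "l \<in> lie"
    unfolding lie_iff tangent_def
  proof (intro CollectI ballI)
    fix p assume p: "p \<in> vanishing"
    define q where "q Z = p (entries (cmat (mat 1 + Z)))" for Z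
    define L where "L Z = dir_deriv p (entries (mat 1)) (entries (cmat Z))" for Z
    have "((\<lambda>Z :: real^'m^'m. entries (cmat (mat 1 + Z)) ij) has_derivative (\<lambda>Z. entries (cmat Z) ij)) (at 0)" for ij
    proof -
      obtain i j where "ij = (i, j)" by force
      have "bounded_linear (\<lambda>Z :: real^'m^'m. complex_of_real (Z $ i $ j))"
        by (intro bounded_linear_compose[OF bounded_linear_of_real] bounded_linear_compose[OF bounded_linear_vec_nth bounded_linear_vec_nth])
      from has_derivative_add[OF has_derivative_const bounded_linear_imp_has_derivative[OF this], of "complex_of_real (mat 1 $ i $ j)"]
      show ?thesis by (simp add: \<open>ij = (i, j)\<close> entries_def)
    qed
    from polys_in_has_derivative[OF _ this, of p] p have q: "(q has_derivative L) (at 0)"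
      by (simp add: q_def[abs_def] L_def[abs_def] vanishing_def cmat_one)
    have "q 0 = 0" "q (Y n) = 0" for n
      using p Y(3) one_GR by (auto simp: q_def vanishing_def GR_iff)
    moreover have "((\<lambda>Z. norm (q Z - q 0 - L (Z - 0)) / norm (Z - 0)) \<longlongrightarrow> 0) (at 0)"
      using q by (simp add: has_derivative_iff_norm)
    moreover have "filterlim (Y \<circ> r) (at 0) sequentially"
      using Y0 Y(4) by (auto simp: filterlim_at)
    ultimately have "(\<lambda>n. norm (L ((Y \<circ> r) n)) / norm ((Y \<circ> r) n)) \<longlonglongrightarrow> 0"
      using filterlim_compose[of "\<lambda>Z. norm (q Z - q 0 - L (Z - 0)) / norm (Z - 0)" "nhds 0" "at 0" "Y \<circ> r" sequentially]
      by simp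
    moreover have bl: "bounded_linear L" using q by (rule has_derivative_bounded_linear)
    then have "norm (L ((y \<circ> r) n)) = norm (L ((Y \<circ> r) n)) / norm ((Y \<circ> r) n)" for n
      by (simp add: y_def linear_cmul bounded_linear.linear)
    ultimately have "(\<lambda>n. norm (L ((y \<circ> r) n))) \<longlonglongrightarrow> 0" by simp
    moreover have "(\<lambda>n. norm (L ((y \<circ> r) n))) \<longlonglongrightarrow> norm (L l)"
      by (intro tendsto_norm bounded_linear.tendsto[OF bl] l)
    ultimately have "L l = 0" using LIMSEQ_unique by fastforce
    then show "dir_deriv p (entries (mat 1)) (entries (cmat l)) = 0" by (simp add: L_def)
  qed
  ultimately have "l \<bullet> l = 0" by blast
  then show False using l(1) by simp
qed

lemma exp_prod_GR: "set Xs \<subseteq> lie \<Longrightarrow> exp_prod Xs s \<in> GR"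
  by (induction Xs) (auto intro: one_GR mult_GR mat_exp_GR)

text \<open>The map \<open>\<Psi>\<close> multiplies a product of exponentials by a displacement orthogonal to the Lie algebra. Its
derivative at the origin is the identity, so its image contains a neighbourhood of the identity matrix. For a group element
\<open>\<Psi> Z\<close> the displacement is itself a group element, hence trivial by \<open>complement_isolated\<close>. Differentiability
at a single point is enough because the open mapping theorem rests on Brouwer's fixed point
theorem.\<close>

lemma near_identity_exp_prod:
  "\<exists>W. open W \<and> mat 1 \<in> W \<and> (\<forall>k\<in>W \<inter> GR. \<exists>Xs. set Xs \<subseteq> lie \<and> k = exp_prod Xs 1)"
proof -
  obtain r where r: "r > 0" "\<And>Y. norm Y < r \<Longrightarrow> (\<And>b. b \<in> lie \<Longrightarrow> Y \<bullet> b = 0) \<Longrightarrow> mat 1 + Y \<in> GR \<Longrightarrow> Y = 0"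
    using complement_isolated by blast
  obtain E where E: "E \<subseteq> lie" "pairwise orthogonal E" "\<And>x. x \<in> E \<Longrightarrow> norm x = 1" "independent E" "span E = lie"
    using orthonormal_basis_subspace[OF subspace_lie] by metis
  have fin: "finite E" using E(4) by (rule independent_imp_finite)
  obtain bs where bs: "set bs = E" "distinct bs" using finite_distinct_list[OF fin] by blast
  define pr where "pr Z = (\<Sum>b\<in>E. (Z \<bullet> b) *\<^sub>R b)" for Z
  define A where "A Z = flow_prod (\<lambda>b s. mat_exp (s *\<^sub>R b)) bs (\<lambda>b. Z \<bullet> b)" for Z
  define \<Psi> where "\<Psi> Z = A Z ** (mat 1 + (Z - pr Z))" for Z
  have bl: "bounded_linear pr" unfolding pr_def[abs_def]
    by (intro bounded_linear_sum bounded_linear_scaleR_const bounded_linear_inner_left)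
  have perp: "(Z - pr Z) \<bullet> b = 0" if "b \<in> lie" for Z b
  proof -
    have e: "(Z - pr Z) \<bullet> e = 0" if "e \<in> E" for e
    proof -
      have "pr Z \<bullet> e = (\<Sum>d\<in>E. (Z \<bullet> d) * (d \<bullet> e))" by (simp add: pr_def inner_sum_left)
      also have "\<dots> = (\<Sum>d\<in>E. if d = e then Z \<bullet> e else 0)"
      proof (rule sum.cong)
        fix d assume "d \<in> E"
        then show "(Z \<bullet> d) * (d \<bullet> e) = (if d = e then Z \<bullet> e else 0)"
          using E(2,3) that by (auto simp: pairwise_def orthogonal_def dot_square_norm)
      qed simp
      finally show ?thesis using fin that by (simp add: inner_diff_left)
    qed
    have "b \<in> span E" using that E(5) by simp
    then show ?thesis using e orthogonal_to_span[of b E "Z - pr Z"] by (auto simp: orthogonal_def)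
  qed
  have small: "norm (Z - pr Z) \<le> norm Z" for Z
  proof -
    have "pr Z \<in> lie" unfolding pr_def using E(1) subspace_lie by (auto intro!: subspace_sum subspace_scale)
    then have "(Z - pr Z) \<bullet> pr Z = 0" by (rule perp)
    then have "(norm (Z - pr Z))\<^sup>2 = (Z - pr Z) \<bullet> Z" by (simp add: power2_norm_eq_inner inner_diff_right)
    also have "\<dots> \<le> norm (Z - pr Z) * norm Z" by (rule norm_cauchy_schwarz)
    finally show ?thesis by (simp add: power2_eq_square) (metis mult_le_cancel_left_pos norm_ge_zero order_le_less)
  qed
  have A0: "A 0 = mat 1" unfolding A_def using flow_prod_zero[of bs "\<lambda>b s. mat_exp (s *\<^sub>R b)"]
    by (simp add: inner_zero_left[abs_def])
  have exp0: "((\<lambda>s. mat_exp (s *\<^sub>R b)) has_vector_derivative b) (at 0)" for b :: "real^'m^'m"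
    using mat_exp_has_vector_derivative[of b 0 UNIV] by simp
  have dA: "(A has_derivative pr) (at 0)"
  proof -
    have "(A has_derivative (\<lambda>z. \<Sum>b\<leftarrow>bs. (z \<bullet> b) *\<^sub>R b)) (at 0)"
      unfolding A_def[abs_def]
      by (rule flow_prod_has_derivative) (auto intro: exp0 bounded_linear_inner_left)
    moreover have "(\<lambda>z. \<Sum>b\<leftarrow>bs. (z \<bullet> b) *\<^sub>R b) = pr"
      by (auto simp: pr_def sum_list_distinct_conv_sum_set bs)
    ultimately show ?thesis by simp
  qed
  have "((\<lambda>Z. mat 1 + (Z - pr Z)) has_derivative (\<lambda>Z. 0 + (Z - pr Z))) (at 0)"
    by (intro has_derivative_add has_derivative_const has_derivative_diff has_derivative_ident
        bounded_linear_imp_has_derivative bl)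
  from matrix_mult_has_derivative[OF dA this]
  have d: "(\<Psi> has_derivative (\<lambda>Z. Z)) (at 0)"
    using bounded_linear.linear[OF bl] by (simp add: \<Psi>_def[abs_def] A0 linear_0)
  have "continuous_on UNIV A" unfolding A_def[abs_def]
    by (intro flow_prod_continuous_on mat_exp_continuous continuous_intros)
  then have c: "continuous_on UNIV \<Psi>" unfolding \<Psi>_def[abs_def]
    using linear_continuous_on[OF bl]
    by (intro matrix_mult_continuous_on continuous_on_add continuous_on_diff continuous_on_const continuous_on_id)
  have "\<Psi> 0 \<in> interior (\<Psi> ` ball 0 r)"
    by (rule sussmann_open_mapping[OF open_UNIV c _ d, of "\<lambda>Z. Z"]) (use r(1) in auto)
  moreover have "\<Psi> 0 = mat 1" using bounded_linear.linear[OF bl] by (simp add: \<Psi>_def A0 linear_0)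
  moreover have "\<exists>Xs. set Xs \<subseteq> lie \<and> k = exp_prod Xs 1" if k: "k \<in> interior (\<Psi> ` ball 0 r) \<inter> GR" for k
  proof -
    obtain Z where Z: "norm Z < r" "k = \<Psi> Z" using k interior_subset by force
    define Xs where "Xs = map (\<lambda>b. (Z \<bullet> b) *\<^sub>R b) bs"
    have Xs: "set Xs \<subseteq> lie" using bs(1) E(1) subspace_lie by (auto simp: Xs_def intro: subspace_scale)
    have A: "A Z = exp_prod Xs 1" by (simp add: A_def Xs_def flow_prod_exp_prod)
    then have AG: "A Z \<in> GR" using exp_prod_GR[OF Xs] by simp
    have "matrix_inv (A Z) ** k = matrix_inv (A Z) ** A Z ** (mat 1 + (Z - pr Z))"
      unfolding Z(2) \<Psi>_def by (simp add: matrix_mul_assoc)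
    then have "mat 1 + (Z - pr Z) = matrix_inv (A Z) ** k" by (simp add: inv_GR_left[OF AG])
    then have "mat 1 + (Z - pr Z) \<in> GR" using k AG by (simp add: mult_GR inv_GR)
    then have "Z - pr Z = 0" using r(2)[OF _ perp] small[of Z] Z(1) by (meson le_less_trans)
    then have "k = exp_prod Xs 1" using Z(2) A by (simp add: \<Psi>_def)
    then show ?thesis using Xs by blast
  qed
  ultimately show ?thesis by (intro exI[of _ "interior (\<Psi> ` ball 0 r)"]) auto
qed

text \<open>To differ by a product of exponentials is an equivalence relation with open classes, and
the identity component is connected.\<close>

lemma G_exp_prod:
  assumes "g \<in> G"
  shows "\<exists>Xs. set Xs \<subseteq> lie \<and> g = exp_prod Xs 1"
proof -
  let ?R = "\<lambda>a b. \<exists>Xs. set Xs \<subseteq> lie \<and> b = a ** exp_prod Xs 1"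
  obtain W where W: "open W" "mat 1 \<in> W" "\<And>k. k \<in> W \<Longrightarrow> k \<in> GR \<Longrightarrow> \<exists>Xs. set Xs \<subseteq> lie \<and> k = exp_prod Xs 1"
    using near_identity_exp_prod by blast
  have "?R (mat 1) g"
  proof (rule connected_equivalence_relation[OF connected_G one_G assms])
    fix x y assume "?R x y"
    then obtain Xs where Xs: "set Xs \<subseteq> lie" "y = x ** exp_prod Xs 1" by blast
    have "y ** exp_prod (rev (map uminus Xs)) 1 = x ** (exp_prod Xs 1 ** exp_prod (rev (map uminus Xs)) 1)"
      by (simp add: Xs(2) matrix_mul_assoc)
    then have "x = y ** exp_prod (rev (map uminus Xs)) 1" by (simp add: exp_prod_inverse)
    moreover have "set (rev (map uminus Xs)) \<subseteq> lie" using Xs(1) subspace_lie by (auto intro: subspace_neg)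
    ultimately show "?R y x" by blast
  next
    fix x y z assume "?R x y" "?R y z"
    then obtain Xs Ys where "set Xs \<subseteq> lie" "y = x ** exp_prod Xs 1" "set Ys \<subseteq> lie" "z = y ** exp_prod Ys 1" by blast
    then show "?R x z" by (intro exI[of _ "Xs @ Ys"]) (simp add: exp_prod_append matrix_mul_assoc)
  next
    fix a assume a: "a \<in> G"
    then have aR: "a \<in> GR" using G_sub_GR by blast
    let ?f = "\<lambda>x. matrix_inv a ** x"
    have "continuous_on UNIV ?f" by (intro matrix_mult_continuous_on continuous_intros)
    then have "open (?f -` W)" using W(1) by (intro continuous_open_vimage) (auto simp: continuous_on_eq_continuous_at)
    moreover have "?R a x" if x: "x \<in> G" "?f x \<in> W" for x
    proof -
      have "?f x \<in> GR" using x(1) G_sub_GR aR by (auto intro: mult_GR inv_GR)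
      then obtain Xs where "set Xs \<subseteq> lie" "?f x = exp_prod Xs 1" using W(3)[OF x(2)] by blast
      moreover have "x = a ** ?f x" by (simp add: matrix_mul_assoc inv_GR_right[OF aR])
      ultimately show ?thesis by metis
    qed
    ultimately show "\<exists>T. openin (top_of_set G) T \<and> a \<in> T \<and> (\<forall>x\<in>T. ?R a x)"
      using a W(2) inv_GR_left[OF aR] by (intro exI[of _ "G \<inter> ?f -` W"]) (auto simp: openin_open_Int)
  qed
  then show ?thesis by simp
qed

text \<open>The real part of a complex tangent vector with real image is tangent and has the same
image.\<close>

lemma dr_surjective:
  assumes "dense_orbit GC \<rho> \<Omega>" "x \<in> real_points \<Omega>"
  shows "\<exists>X\<in>lie. dr X *v x = e"
proof -
  let ?c = "\<lambda>x :: real^'n. \<chi> i. complex_of_real (x $ i)"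
  obtain Y where Y: "Y \<in> tangent" "drho Y *v ?c x = ?c e"
    using infinitesimally_transitive[OF assms(1), of "?c x" "?c e"] assms(2) by (auto simp: real_points_def)
  define X where "X = map_matrix Re Y"
  have "cmat X $ i $ j = 1 / 2 * Y $ i $ j + 1 / 2 * map_matrix cnj Y $ i $ j" for i j
    using complex_add_cnj[of "Y $ i $ j"] by (simp add: X_def field_simps)
  note c = this
  have X: "X \<in> lie" unfolding lie_iff by (rule tangent_linear[OF Y(1) tangent_cnj[OF Y(1)] c])
  have "drho (cmat X) $ i $ j = 1 / 2 * drho Y $ i $ j + 1 / 2 * cnj (drho Y $ i $ j)" for i j
    using drho_linear[OF c, of i j] by (simp add: drho_cnj)
  then have "(drho (cmat X) *v ?c x) $ i = 1 / 2 * (drho Y *v ?c x) $ i + 1 / 2 * cnj ((drho Y *v ?c x) $ i)" for i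
    by (simp add: matrix_vector_mult_def sum.distrib sum_distrib_left algebra_simps)
  then have "(drho (cmat X) *v ?c x) $ i = ?c e $ i" for i by (simp add: Y(2))
  moreover have "(drho (cmat X) *v ?c x) $ i = complex_of_real ((dr X *v x) $ i)" for i
    by (simp add: matrix_vector_mult_def flip: cmat_dr)
  ultimately have "dr X *v x = e" by (simp add: vec_eq_iff)
  then show ?thesis using X by blast
qed

text \<open>Near \<open>x\<close> the orbit of the real group contains the image of a product of one-parameter groups in
directions \<open>Xf i\<close> that move \<open>x\<close> along the coordinate axes; its derivative at the origin is the identity.\<close>

lemma open_real_points:
  assumes dense: "dense_orbit GC \<rho> \<Omega>"
  shows "open (real_points \<Omega>)"
proof -
  let ?c = "\<lambda>x :: real^'n. \<chi> i. complex_of_real (x $ i)"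
  obtain v where \<Omega>: "\<Omega> = (\<lambda>g. \<rho> g *v v) ` GC" using dense by (auto simp: dense_orbit_def)
  have "x \<in> interior (real_points \<Omega>)" if x: "x \<in> real_points \<Omega>" for x
  proof -
    have orbit: "rr g *v x \<in> real_points \<Omega>" if g: "g \<in> GR" for g
    proof -
      obtain h where h: "h \<in> GC" "?c x = \<rho> h *v v" using x \<Omega> by (auto simp: real_points_def)
      have "?c (rr g *v x) = cmat (rr g) *v ?c x" by (simp add: vec_eq_iff matrix_vector_mult_def)
      also have "\<dots> = \<rho> (cmat g ** h) *v v"
        using g h by (simp add: cmat_rr matrix_vector_mul_assoc rho_mult GR_iff)
      finally show ?thesis using \<Omega> g h by (auto simp: real_points_def GR_iff mult_GC)
    qed
    have "\<forall>i. \<exists>X. X \<in> lie \<and> dr X *v x = axis i 1" using dr_surjective[OF dense x] by blast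
    then obtain Xf where Xf: "\<And>i. Xf i \<in> lie" "\<And>i. dr (Xf i) *v x = axis i 1" by metis
    obtain ix where ix: "set ix = (UNIV :: 'n set)" "distinct ix" using finite_distinct_list[of "UNIV :: 'n set"] by auto
    define c where "c i s = rr (mat_exp (s *\<^sub>R Xf i))" for i s
    define A where "A z = flow_prod c ix (\<lambda>i. z $ i)" for z :: "real^'n"
    have cont: "continuous_on UNIV (c i)" for i
      unfolding c_def[abs_def]
      by (rule continuous_on_compose2[OF rr_continuous mat_exp_continuous]) (use mat_exp_GR Xf in auto)
    have "(c i has_vector_derivative dr (Xf i)) (at 0)" for i
      using rr_mat_exp[OF Xf(1)] by (simp add: c_def[abs_def])
    then have dA: "(A has_derivative (\<lambda>z. \<Sum>i\<leftarrow>ix. z $ i *\<^sub>R dr (Xf i))) (at 0)"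
      unfolding A_def[abs_def]
      by (intro flow_prod_has_derivative) (auto simp: c_def rr_one bounded_linear_vec_nth)
    have "((\<lambda>z. A z *v x) has_derivative (\<lambda>z. (\<Sum>i\<leftarrow>ix. z $ i *\<^sub>R dr (Xf i)) *v x)) (at 0)"
      using bounded_linear.has_derivative[OF bounded_bilinear.bounded_linear_left[OF bounded_bilinear_matrix_vector_mult] dA] .
    moreover have "(\<Sum>i\<leftarrow>ix. z $ i *\<^sub>R dr (Xf i)) *v x = z" for z
    proof -
      interpret bounded_linear "\<lambda>M. M *v x"
        by (rule bounded_bilinear.bounded_linear_left[OF bounded_bilinear_matrix_vector_mult])
      show ?thesis
        by (simp add: sum_list_distinct_conv_sum_set ix sum scale Xf(2))
          (simp add: vec_eq_iff axis_def if_distrib[of "(*) _"] cong: if_cong)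
    qed
    ultimately have d: "((\<lambda>z. A z *v x) has_derivative (\<lambda>z. z)) (at 0)" by simp
    have "continuous_on UNIV A" unfolding A_def[abs_def]
      by (intro flow_prod_continuous_on cont continuous_intros)
    then have c: "continuous_on UNIV (\<lambda>z. A z *v x)"
      by (intro bounded_bilinear.continuous_on[OF bounded_bilinear_matrix_vector_mult] continuous_on_const)
    have "A 0 *v x \<in> interior ((\<lambda>z. A z *v x) ` UNIV)"
      by (rule sussmann_open_mapping[OF open_UNIV c _ d, of "\<lambda>z. z"]) auto
    moreover have "A 0 = mat 1" unfolding A_def using flow_prod_zero[of ix c]
      by (simp add: c_def rr_one zero_index[abs_def])
    moreover have "A z \<in> rr ` GR" for z
    proof -
      have "flow_prod c ix a \<in> rr ` GR" for ix a
      proof (induction ix)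
        case Nil then show ?case using rr_one one_GR by (auto intro!: image_eqI[of _ _ "mat 1"])
      next
        case (Cons i js)
        then obtain g where "g \<in> GR" "flow_prod c js a = rr g" by blast
        then have "flow_prod c (i # js) a = rr (mat_exp (a i *\<^sub>R Xf i) ** g)"
          by (simp add: c_def rr_mult mat_exp_GR Xf)
        then show ?case using \<open>g \<in> GR\<close> by (auto intro: mult_GR mat_exp_GR Xf)
      qed
      then show ?thesis by (simp add: A_def)
    qed
    then have "(\<lambda>z. A z *v x) ` UNIV \<subseteq> real_points \<Omega>"
    proof (intro image_subsetI)
      fix z
      obtain g where "g \<in> GR" "A z = rr g" using \<open>\<And>z. A z \<in> rr ` GR\<close>[of z] by blast
      then show "A z *v x \<in> real_points \<Omega>" using orbit by simp
    qed
    then have "interior ((\<lambda>z. A z *v x) ` UNIV) \<subseteq> interior (real_points \<Omega>)" by (rule interior_mono)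
    ultimately show ?thesis by auto
  qed
  then have "interior (real_points \<Omega>) = real_points \<Omega>" using interior_subset by blast
  then show ?thesis by (simp add: interior_eq)
qed

section \<open>Growth of the representation\<close>

text \<open>The set whose infimum is the distance of \<open>g\<close> to the identity.\<close>

definition path_lengths :: "(real^'m^'m \<Rightarrow> real^'m^'m \<Rightarrow> real^'m^'m \<Rightarrow> real) \<Rightarrow> real^'m^'m \<Rightarrow> real set" where
  "path_lengths R g = {l. \<exists>\<gamma>. valid_path \<gamma> \<and> path_image \<gamma> \<subseteq> GR \<and> pathstart \<gamma> = g \<and> pathfinish \<gamma> = mat 1 \<and>
     ((\<lambda>t. sqrt (R (\<gamma> t) (vector_derivative \<gamma> (at t)) (vector_derivative \<gamma> (at t)))) has_integral l) {0..1}}"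

lemma group_norm_eq: "group_norm GR R g = Inf (path_lengths R g)"
  by (simp add: group_norm_def riemannian_dist_def path_lengths_def)

lemma metric_translate:
  assumes "left_invariant_metric GR R" "g \<in> GR" "matrix_inv g ** D \<in> lie"
  shows "R g D D = R (mat 1) (matrix_inv g ** D) (matrix_inv g ** D)"
proof -
  have t: "tangent_space GR (mat 1) = lie" by (simp add: tangent_space_def lie_def)
  have "R (g ** mat 1) (g ** (matrix_inv g ** D)) (g ** (matrix_inv g ** D)) =
      R (mat 1) (matrix_inv g ** D) (matrix_inv g ** D)"
    using assms one_GR unfolding left_invariant_metric_def t[symmetric] by blast
  then show ?thesis by (simp add: matrix_mul_assoc inv_GR_right[OF assms(2)])
qed

lemma metric_at_one:
  assumes "left_invariant_metric GR R"
  shows "inner_product_on lie (R (mat 1))"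
proof -
  have t: "tangent_space GR (mat 1) = lie" by (simp add: tangent_space_def lie_def)
  show ?thesis using assms one_GR unfolding left_invariant_metric_def t[symmetric] by blast
qed

text \<open>For a product of exponentials the path is continuously differentiable with
continuous speed. Without such a path the infimum would be taken over the empty set and carry no
information.\<close>

lemma path_lengths_nonempty:
  assumes R: "left_invariant_metric GR R" and g: "g \<in> G"
  shows "path_lengths R g \<noteq> {}"
proof -
  obtain Xs where Xs: "set Xs \<subseteq> lie" "g = exp_prod Xs 1" using G_exp_prod[OF g] by blast
  obtain D where D: "\<And>s. (exp_prod Xs has_vector_derivative D s) (at s)" "continuous_on UNIV D"
    using exp_prod_C1 by blast
  define \<gamma> where "\<gamma> s = exp_prod Xs (1 - s)" for s
  have lin: "((\<lambda>u. 1 - u) has_vector_derivative -1) (at s)" for s :: real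
    unfolding has_real_derivative_iff_has_vector_derivative[symmetric] by (auto intro!: derivative_eq_intros)
  have d: "(\<gamma> has_vector_derivative - D (1 - s)) (at s)" for s
    using vector_diff_chain_at[OF lin D(1)] by (simp add: \<gamma>_def[abs_def] o_def)
  have cD: "continuous_on UNIV (\<lambda>s. - D (1 - s))"
    by (intro continuous_intros continuous_on_compose2[OF D(2)]) auto
  have \<gamma>G: "\<gamma> s \<in> GR" for s unfolding \<gamma>_def by (rule exp_prod_GR[OF Xs(1)])
  define X where "X s = matrix_inv (\<gamma> s) ** - D (1 - s)" for s
  have inv: "matrix_inv (\<gamma> s) = exp_prod (rev (map uminus Xs)) (1 - s)" for s
    by (rule matrix_inv_unique[OF \<gamma>G]) (simp add: \<gamma>_def exp_prod_inverse)
  have Xl: "X s \<in> lie" for s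
    unfolding X_def using curve_tangent(1)[of UNIV \<gamma> "- D (1 - s)" s] \<gamma>G d by simp
  have "continuous_on UNIV X"
    unfolding X_def[abs_def] inv
    by (intro matrix_mult_continuous_on cD continuous_on_compose2[OF exp_prod_continuous[of UNIV]] continuous_intros) auto
  then have "continuous_on UNIV (\<lambda>s. sqrt (R (mat 1) (X s) (X s)))"
    using inner_product_on_subspace(1)[OF subspace_lie metric_at_one[OF R]] Xl
    by (intro continuous_on_real_sqrt continuous_on_compose2[of lie "\<lambda>X. R (mat 1) X X" UNIV X]) auto
  then have "(\<lambda>s. sqrt (R (mat 1) (X s) (X s))) integrable_on {0..1}"
    by (intro integrable_continuous_interval) (auto intro: continuous_on_subset)
  moreover have "sqrt (R (\<gamma> s) (vector_derivative \<gamma> (at s)) (vector_derivative \<gamma> (at s))) = sqrt (R (mat 1) (X s) (X s))" for s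
    using metric_translate[OF R \<gamma>G, of s "- D (1 - s)"] Xl[of s] vector_derivative_at[OF d] by (simp add: X_def)
  ultimately obtain l where "((\<lambda>t. sqrt (R (\<gamma> t) (vector_derivative \<gamma> (at t)) (vector_derivative \<gamma> (at t)))) has_integral l) {0..1}"
    by (auto simp: integrable_on_def)
  moreover have "valid_path \<gamma>"
    unfolding valid_path_def
    by (intro C1_differentiable_imp_piecewise)
      (auto simp: C1_differentiable_on_def intro!: exI[of _ "\<lambda>s. - D (1 - s)"] d continuous_on_subset[OF cD])
  moreover have "pathstart \<gamma> = g" "pathfinish \<gamma> = mat 1" "path_image \<gamma> \<subseteq> GR"
    using \<gamma>G by (auto simp: pathstart_def pathfinish_def path_image_def \<gamma>_def Xs(2) exp_prod_0)
  ultimately show ?thesis by (auto simp: path_lengths_def)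
qed

lemma rr_nonzero: "g \<in> GR \<Longrightarrow> rr g \<noteq> 0"
proof
  assume g: "g \<in> GR" "rr g = 0"
  have "(mat 1 :: real^'n^'n) = 0"
    using rr_inv(1)[OF g(1)] g(2) by (simp add: matrix_matrix_mult_def vec_eq_iff)
  then have "(mat 1 :: real^'n^'n) $ undefined $ undefined = 0" by simp
  then show False by (simp add: mat_def)
qed

text \<open>The quantity estimated is the logarithm of the squared norm of \<open>rr\<close> along a path. By
\<open>curve_tangent\<close> its derivative is at most a constant times the norm of the velocity translated to the
identity, that is, by left invariance, a constant times the speed.\<close>

lemma length_bound:
  assumes R: "left_invariant_metric GR R"
  shows "\<exists>K>0. \<forall>g\<in>GR. \<forall>l\<in>path_lengths R g. ln ((norm (rr g))\<^sup>2) \<le> ln ((norm (rr (mat 1)))\<^sup>2) + K * l"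
proof -
  obtain c where c: "c > 0" "\<And>X. X \<in> lie \<Longrightarrow> norm X \<le> c * sqrt (R (mat 1) X X)"
    using inner_product_on_subspace(2)[OF subspace_lie metric_at_one[OF R]] by blast
  obtain K0 where K0: "K0 > 0" "\<And>(A :: real^'n^'n) (B :: real^'n^'n). norm (A ** B) \<le> norm A * norm B * K0"
    using bounded_bilinear.pos_bounded[OF bounded_bilinear_matrix_mult] by blast
  obtain K1 where K1: "K1 > 0" "\<And>X. norm (dr X) \<le> norm X * K1"
    using bounded_linear.pos_bounded[of dr] linear_dr linear_conv_bounded_linear by blast
  define K where "K = 2 * K0 * K1 * c"
  have "ln ((norm (rr g))\<^sup>2) \<le> ln ((norm (rr (mat 1)))\<^sup>2) + K * l" if g: "g \<in> GR" and l: "l \<in> path_lengths R g" for g l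
  proof -
    obtain \<gamma> where \<gamma>: "valid_path \<gamma>" "path_image \<gamma> \<subseteq> GR" "pathstart \<gamma> = g" "pathfinish \<gamma> = mat 1"
      "((\<lambda>t. sqrt (R (\<gamma> t) (vector_derivative \<gamma> (at t)) (vector_derivative \<gamma> (at t)))) has_integral l) {0..1}"
      using l by (auto simp: path_lengths_def)
    obtain S where S: "finite S" "\<gamma> C1_differentiable_on ({0..1} - S)" and cont: "continuous_on {0..1} \<gamma>"
      using \<gamma>(1) by (auto simp: valid_path_def piecewise_C1_differentiable_on_def)
    have \<gamma>G: "\<gamma> s \<in> GR" if "s \<in> {0..1}" for s using \<gamma>(2) that by (auto simp: path_image_def)
    define A where "A s = rr (\<gamma> s)" for s
    define V where "V s = vector_derivative \<gamma> (at s)" for s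
    define X where "X s = matrix_inv (\<gamma> s) ** V s" for s
    define f' where "f' s = (2 * (A s \<bullet> (A s ** dr (X s)))) / (A s \<bullet> A s)" for s
    have cA: "continuous_on {0..1} A"
      unfolding A_def[abs_def] by (rule continuous_on_compose2[OF rr_continuous cont]) (use \<gamma>G in auto)
    have pos: "A s \<bullet> A s > 0" if "s \<in> {0..1}" for s
      using rr_nonzero[OF \<gamma>G[OF that]] by (simp add: A_def)
    have inner: "X s \<in> lie \<and> (A has_vector_derivative A s ** dr (X s)) (at s)" if s: "s \<in> {0<..<1} - S" for s
    proof -
      have s': "s \<in> {0..1}" using s by auto
      have "(\<gamma> has_vector_derivative V s) (at s)"
        using S(2) s by (auto simp: C1_differentiable_on_eq V_def vector_derivative_works)
      then have v: "(\<gamma> has_vector_derivative V s) (at s within {0..1})" by (rule has_vector_derivative_at_within)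
      have at: "at s within {0..1} = at s" using s by (intro at_within_interior) auto
      show ?thesis
        using curve_tangent[of "{0..1}" \<gamma>, OF \<gamma>G v s'] by (simp add: at X_def A_def[abs_def])
    qed
    \<comment> \<open>The derivative of a valid path need not be bounded near its exceptional points, so the fundamental
    theorem of calculus is used for gauge integrals, which asks only for continuity at those points.\<close>
    have "(f' has_integral ln (A 1 \<bullet> A 1) - ln (A 0 \<bullet> A 0)) {0..1}"
    proof (rule fundamental_theorem_of_calculus_interior_strong[OF S(1)])
      show "continuous_on {0..1} (\<lambda>s. ln (A s \<bullet> A s))"
        using pos by (intro continuous_on_ln continuous_intros cA) force
      fix s assume s: "s \<in> {0<..<1} - S"
      have "((\<lambda>s. A s \<bullet> A s) has_derivative (\<lambda>h. A s \<bullet> (h *\<^sub>R (A s ** dr (X s))) + (h *\<^sub>R (A s ** dr (X s))) \<bullet> A s)) (at s)"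
        using inner[OF s] unfolding has_vector_derivative_def by (intro has_derivative_inner) auto
      then have "((\<lambda>s. A s \<bullet> A s) has_real_derivative 2 * (A s \<bullet> (A s ** dr (X s)))) (at s)"
        by (rule has_derivative_imp_has_field_derivative) (simp add: inner_commute)
      then have "((\<lambda>s. ln (A s \<bullet> A s)) has_real_derivative f' s) (at s)"
        using pos[of s] s DERIV_chain2[OF DERIV_ln] by (fastforce simp: f'_def divide_inverse mult.commute)
      then show "((\<lambda>s. ln (A s \<bullet> A s)) has_vector_derivative f' s) (at s)"
        by (simp add: has_real_derivative_iff_has_vector_derivative)
    qed simp
    then have i1: "((\<lambda>s. - f' s) has_integral - (ln (A 1 \<bullet> A 1) - ln (A 0 \<bullet> A 0))) {0..1}"
      by (rule has_integral_neg)
    have i2: "((\<lambda>s. K * sqrt (R (\<gamma> s) (V s) (V s))) has_integral K * l) {0..1}"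
      using has_integral_mult_right[OF \<gamma>(5), of K] by (simp add: V_def)
    \<comment> \<open>At the end points and at the finitely many exceptional points of the path the integrands are
    not under control; they are replaced by zero there.\<close>
    let ?N = "insert 0 (insert 1 S)"
    have i1': "((\<lambda>s. if s \<in> ?N then 0 else - f' s) has_integral - (ln (A 1 \<bullet> A 1) - ln (A 0 \<bullet> A 0))) {0..1}"
      by (rule has_integral_spike_finite[OF _ _ i1, of ?N]) (use S(1) in auto)
    have i2': "((\<lambda>s. if s \<in> ?N then 0 else K * sqrt (R (\<gamma> s) (V s) (V s))) has_integral K * l) {0..1}"
      by (rule has_integral_spike_finite[OF _ _ i2, of ?N]) (use S(1) in auto)
    have "- f' s \<le> K * sqrt (R (\<gamma> s) (V s) (V s))" if s: "s \<in> {0..1}" "s \<notin> ?N" for s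
    proof -
      have s': "s \<in> {0<..<1} - S" using s by auto
      have "\<bar>A s \<bullet> (A s ** dr (X s))\<bar> \<le> norm (A s) * norm (A s ** dr (X s))" by (rule Cauchy_Schwarz_ineq2)
      also have "\<dots> \<le> norm (A s) * (norm (A s) * (norm (X s) * K1) * K0)"
      proof (rule mult_left_mono)
        have "norm (A s ** dr (X s)) \<le> norm (A s) * norm (dr (X s)) * K0" by (rule K0(2))
        also have "\<dots> \<le> norm (A s) * (norm (X s) * K1) * K0"
          using K0(1) K1(2) by (intro mult_right_mono mult_left_mono) auto
        finally show "norm (A s ** dr (X s)) \<le> norm (A s) * (norm (X s) * K1) * K0" .
      qed simp
      also have "\<dots> = (A s \<bullet> A s) * (norm (X s) * K1 * K0)"
        by (simp add: power2_norm_eq_inner[symmetric] power2_eq_square)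
      finally have "\<bar>f' s\<bar> \<le> 2 * (norm (X s) * K1 * K0)"
        using pos[OF s(1)] by (simp add: f'_def abs_mult field_simps)
      also have "\<dots> \<le> 2 * ((c * sqrt (R (mat 1) (X s) (X s))) * K1 * K0)"
        using c(2) inner[OF s'] K0 K1 by (intro mult_left_mono mult_right_mono) auto
      also have "R (mat 1) (X s) (X s) = R (\<gamma> s) (V s) (V s)"
        using metric_translate[OF R \<gamma>G[OF s(1)], of "V s"] inner[OF s'] by (simp add: X_def)
      finally show ?thesis by (simp add: K_def mult_ac)
    qed
    then have "- (ln (A 1 \<bullet> A 1) - ln (A 0 \<bullet> A 0)) \<le> K * l"
      by (intro has_integral_le[OF i1' i2']) auto
    moreover have "A 0 = rr g" "A 1 = rr (mat 1)" using \<gamma>(3,4) by (auto simp: A_def pathstart_def pathfinish_def)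
    ultimately show ?thesis by (simp add: power2_norm_eq_inner)
  qed
  moreover have "K > 0" using K0 K1 c by (simp add: K_def)
  ultimately show ?thesis by blast
qed

text \<open>The bound for each path passes to the infimum over all paths.\<close>

lemma rr_growth:
  assumes R: "left_invariant_metric GR R"
  shows "\<exists>C c. c \<ge> 0 \<and> (\<forall>g\<in>G. norm (rr g) \<le> C * exp (c * group_norm GR R g))"
proof -
  obtain K where K: "K > 0" "\<And>g l. g \<in> GR \<Longrightarrow> l \<in> path_lengths R g \<Longrightarrow> ln ((norm (rr g))\<^sup>2) \<le> ln ((norm (rr (mat 1)))\<^sup>2) + K * l"
    using length_bound[OF R] by blast
  have "norm (rr g) \<le> norm (rr (mat 1)) * exp ((K / 2) * group_norm GR R g)" if g: "g \<in> G" for g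
  proof -
    have gR: "g \<in> GR" using g G_sub_GR by blast
    have n: "norm (rr g) > 0" "norm (rr (mat 1)) > 0" using rr_nonzero gR one_GR by auto
    have "(ln (norm (rr g)) - ln (norm (rr (mat 1)))) * 2 / K \<le> l" if "l \<in> path_lengths R g" for l
      using K(2)[OF gR that] n K(1) by (simp add: ln_realpow field_simps)
    then have "(ln (norm (rr g)) - ln (norm (rr (mat 1)))) * 2 / K \<le> group_norm GR R g"
      unfolding group_norm_eq by (intro cInf_greatest path_lengths_nonempty[OF R g]) auto
    then have "ln (norm (rr g)) \<le> ln (norm (rr (mat 1))) + K / 2 * group_norm GR R g"
      using K(1) by (simp add: field_simps)
    then have "exp (ln (norm (rr g))) \<le> exp (ln (norm (rr (mat 1))) + K / 2 * group_norm GR R g)" by simp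
    then show ?thesis using n by (simp add: exp_add)
  qed
  then show ?thesis using K(1) by (intro exI[of _ "norm (rr (mat 1))"] exI[of _ "K / 2"]) auto
qed

end

section \<open>The contragredient representation\<close>

text \<open>Cramer's rule.\<close>

lemma inverse_entry_poly:
  "\<exists>q \<in> poly_funs \<real> ((\<lambda>c x. x c) ` UNIV). \<forall>g :: complex^'m^'m. invertible g \<longrightarrow> matrix_inv g $ i $ j = q (gl_coords g)"
proof -
  define N :: "(('m \<times> 'm) option \<Rightarrow> complex) \<Rightarrow> complex^'m^'m" where
    "N x = (\<chi> k l. if l = i then axis j 1 $ k else x (Some (k, l)))" for x
  define q where "q x = det (N x) * x None" for x
  have "(\<lambda>x. N x $ k $ l) \<in> poly_funs \<real> ((\<lambda>c x. x c) ` UNIV)" for k l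
  proof (cases "l = i")
    case True
    have "axis j 1 $ k \<in> (\<real> :: complex set)" by (simp add: axis_def)
    then show ?thesis using True by (simp add: N_def poly_funs.const)
  next
    case False
    then show ?thesis by (auto simp: N_def intro: poly_funs.gen)
  qed
  then have q: "q \<in> poly_funs \<real> ((\<lambda>c x. x c) ` UNIV)"
    unfolding q_def[abs_def] det_def
    by (intro poly_funs.mult poly_funs_sum poly_funs_prod) (auto intro: poly_funs.const poly_funs.gen)
  have "matrix_inv g $ i $ j = q (gl_coords g)" if g: "invertible g" for g :: "complex^'m^'m"
  proof -
    have d: "det g \<noteq> 0" using g by (simp add: invertible_det_nz)
    have "g ** matrix_inv g = mat 1"
      using someI_ex[OF g[unfolded invertible_def]] by (auto simp: matrix_inv_def)
    then have "g *v (\<chi> k. matrix_inv g $ k $ j) = axis j 1"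
      by (auto simp: vec_eq_iff matrix_vector_mult_def matrix_matrix_mult_def mat_def axis_def)
    from cramer[OF d, THEN iffD1, OF this]
    have "(\<chi> k. matrix_inv g $ k $ j) $ i = det (\<chi> k l. if l = i then axis j 1 $ k else g $ k $ l) / det g"
      by simp
    moreover have "N (gl_coords g) = (\<chi> k l. if l = i then axis j 1 $ k else g $ k $ l)"
      by (simp add: N_def vec_eq_iff gl_coords_def entries_def)
    ultimately show ?thesis by (simp add: q_def gl_coords_def divide_inverse)
  qed
  then show ?thesis using q by blast
qed

context alg_rep
begin

text \<open>Transposition makes the inverse a homomorphism, so that all results for \<open>rr\<close> apply to its
inverse as well.\<close>

lemma contragredient: "alg_rep GC (\<lambda>g. transpose (\<rho> (matrix_inv g)))"
proof
  show "algebraic_group_over_reals GC" by (rule alg)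
  have inv_mult: "matrix_inv (g ** h) = matrix_inv h ** matrix_inv g" if "g \<in> GC" "h \<in> GC" for g h
  proof -
    have "g ** h ** (matrix_inv h ** matrix_inv g) = g ** (h ** matrix_inv h) ** matrix_inv g"
      by (simp add: matrix_mul_assoc)
    also have "\<dots> = mat 1" using that by (simp add: inv_right)
    finally have "matrix_inv (g ** h) ** (g ** h) ** (matrix_inv h ** matrix_inv g) = matrix_inv (g ** h) ** mat 1"
      by (simp only: matrix_mul_assoc[symmetric])
    then show ?thesis using that by (simp add: inv_left mult_GC)
  qed
  have inv1: "matrix_inv (mat 1) = (mat 1 :: complex^'m^'m)"
    using inv_left[OF one_GC] by simp
  show "rational_rep_over_reals GC (\<lambda>g. transpose (\<rho> (matrix_inv g)))"
    unfolding rational_rep_over_reals_def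
  proof (intro conjI ballI allI)
    show "transpose (\<rho> (matrix_inv (mat 1))) = mat 1" by (simp add: inv1 rho_one transpose_mat)
    fix g h assume "g \<in> GC" "h \<in> GC"
    then show "transpose (\<rho> (matrix_inv (g ** h))) = transpose (\<rho> (matrix_inv g)) ** transpose (\<rho> (matrix_inv h))"
      by (simp add: inv_mult rho_mult inv_GC matrix_transpose_mul)
  next
    fix i j
    have "\<forall>c. \<exists>q \<in> poly_funs \<real> ((\<lambda>c x. x c) ` UNIV). \<forall>g\<in>GC. gl_coords (matrix_inv g) c = q (gl_coords g)"
    proof
      fix c :: "('m \<times> 'm) option"
      show "\<exists>q \<in> poly_funs \<real> ((\<lambda>c x. x c) ` UNIV). \<forall>g\<in>GC. gl_coords (matrix_inv g) c = q (gl_coords g)"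
      proof (cases c)
        case None
        have "gl_coords (matrix_inv g) None = det g" if "g \<in> GC" for g
        proof -
          have "det g * det (matrix_inv g) = 1" using inv_right[OF that] by (metis det_I det_mul)
          then have "inverse (det (matrix_inv g)) = det g" by (metis inverse_unique mult.commute)
          then show ?thesis by (simp add: gl_coords_def)
        qed
        moreover have "(\<lambda>x. det_poly (\<lambda>ij. x (Some ij))) \<in> poly_funs \<real> ((\<lambda>c (x :: ('m \<times> 'm) option \<Rightarrow> complex). x c) ` UNIV)"
          by (rule poly_funs_comp[OF det_poly_mem]) (auto intro: poly_funs.gen)
        moreover have "det_poly (\<lambda>ij. gl_coords g (Some ij)) = det g" for g :: "complex^'m^'m"
          by (simp add: gl_coords_def det_poly_def)
        ultimately show ?thesis
          unfolding None by (intro bexI[of _ "\<lambda>x. det_poly (\<lambda>ij. x (Some ij))"]) auto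
      next
        case (Some ij)
        obtain k l where kl: "ij = (k, l)" by force
        from inverse_entry_poly[of k l] obtain q where q: "q \<in> poly_funs \<real> ((\<lambda>c x. x c) ` UNIV)"
          "\<And>g :: complex^'m^'m. invertible g \<Longrightarrow> matrix_inv g $ k $ l = q (gl_coords g)" by blast
        show ?thesis
          by (intro bexI[of _ q] ballI q(1)) (simp add: Some kl gl_coords_def[of "matrix_inv _"] entries_def q(2) invertible_GC)
      qed
    qed
    then obtain Q where Q: "\<And>c. Q c \<in> poly_funs \<real> ((\<lambda>c x. x c) ` UNIV)"
      "\<And>c g. g \<in> GC \<Longrightarrow> gl_coords (matrix_inv g) c = Q c (gl_coords g)" by metis
    have "(\<lambda>g. rho_poly j i (\<lambda>c. Q c (gl_coords g))) \<in> poly_funs \<real> (insert (\<lambda>g. inverse (det g)) mat_coords)"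
    proof (rule poly_funs_comp[OF rho_poly(1)])
      fix y :: "(('m \<times> 'm) option \<Rightarrow> complex) \<Rightarrow> complex"
      assume "y \<in> range (\<lambda>c x. x c)"
      then obtain c where c: "y = (\<lambda>x. x c)" by auto
      have "(\<lambda>g. Q c (gl_coords g)) \<in> poly_funs \<real> ((\<lambda>c (g :: complex^'m^'m). gl_coords g c) ` UNIV)"
        by (rule poly_funs_comp[OF Q(1)]) (auto intro: poly_funs.gen)
      then show "(\<lambda>g. y (\<lambda>c. Q c (gl_coords g))) \<in> poly_funs \<real> (insert (\<lambda>g. inverse (det g)) mat_coords)"
        by (simp add: c inverse_det_mat_coords_eq)
    qed simp
    moreover have "transpose (\<rho> (matrix_inv g)) $ i $ j = rho_poly j i (\<lambda>c. Q c (gl_coords g))" if "g \<in> GC" for g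
    proof -
      have "gl_coords (matrix_inv g) = (\<lambda>c. Q c (gl_coords g))" using Q(2)[OF that] by auto
      then show ?thesis using rho_poly(2)[OF inv_GC[OF that], of j i] by (simp add: transpose_def)
    qed
    ultimately show "\<exists>p\<in>poly_funs \<real> (insert (\<lambda>g. inverse (det g)) mat_coords).
        \<forall>g\<in>GC. transpose (\<rho> (matrix_inv g)) $ i $ j = p g"
      by (intro bexI[of _ "\<lambda>g. rho_poly j i (\<lambda>c. Q c (gl_coords g))"]) auto
  qed
qed

definition ri :: "real^'m^'m \<Rightarrow> real^'n^'n" where "ri g = rr (matrix_inv g)"

lemma real_rep_contragredient: "g \<in> GR \<Longrightarrow> real_rep (\<lambda>g. transpose (\<rho> (matrix_inv g))) g = transpose (ri g)"
  by (simp add: real_rep_def ri_def cmat_inv vec_eq_iff transpose_def)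

lemma norm_transpose: "norm (transpose A) = norm (A :: real^'n^'n)"
  by (simp add: norm_vec_def L2_set_def sum_nonneg transpose_def) (rule sum.swap)

lemma ri_continuous: "continuous_on GR ri"
proof -
  interpret dual: alg_rep GC "\<lambda>g. transpose (\<rho> (matrix_inv g))" by (rule contragredient)
  have bl: "bounded_linear (transpose :: real^'n^'n \<Rightarrow> real^'n^'n)"
    by (intro linear_conv_bounded_linear[THEN iffD1] linearI) (auto simp: transpose_def vec_eq_iff)
  have "continuous_on GR (\<lambda>g. transpose (real_rep (\<lambda>g. transpose (\<rho> (matrix_inv g))) g))"
    by (rule bounded_linear.continuous_on[OF bl dual.rr_continuous])
  then show ?thesis
    by (rule continuous_on_eq) (simp only: real_rep_contragredient transpose_transpose)
qed

lemma ri_growth: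
  assumes R: "left_invariant_metric GR R"
  shows "\<exists>C c. c \<ge> 0 \<and> (\<forall>g\<in>G. norm (ri g) \<le> C * exp (c * group_norm GR R g))"
proof -
  interpret dual: alg_rep GC "\<lambda>g. transpose (\<rho> (matrix_inv g))" by (rule contragredient)
  obtain C c where "c \<ge> 0"
    "\<And>g. g \<in> G \<Longrightarrow> norm (real_rep (\<lambda>g. transpose (\<rho> (matrix_inv g))) g) \<le> C * exp (c * group_norm GR R g)"
    using dual.rr_growth[OF R] by blast
  then show ?thesis
    using G_sub_GR by (intro exI[of _ C] exI[of _ c]) (auto simp: real_rep_contragredient norm_transpose subset_iff)
qed

end

section \<open>Smooth functions\<close>

lemma differentiable_imp_partial_derivs:
  assumes "F differentiable (at x)"
  shows "(F has_derivative (\<lambda>v. \<Sum>b\<in>Basis. (v \<bullet> b) *\<^sub>R partial_deriv b F x)) (at x)"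
proof -
  have d: "(F has_derivative frechet_derivative F (at x)) (at x)"
    using assms frechet_derivative_works by blast
  then interpret bounded_linear "frechet_derivative F (at x)" by (rule has_derivative_bounded_linear)
  have "frechet_derivative F (at x) v = (\<Sum>b\<in>Basis. (v \<bullet> b) *\<^sub>R partial_deriv b F x)" for v
  proof -
    have "frechet_derivative F (at x) v = frechet_derivative F (at x) (\<Sum>b\<in>Basis. (v \<bullet> b) *\<^sub>R b)"
      by (simp add: euclidean_representation)
    then show ?thesis by (simp add: sum scale partial_deriv_def)
  qed
  then have "frechet_derivative F (at x) = (\<lambda>v. \<Sum>b\<in>Basis. (v \<bullet> b) *\<^sub>R partial_deriv b F x)" by auto
  then show ?thesis using d by simp
qed

lemma partial_deriv_eq:
  assumes "(F has_derivative F') (at x)"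
  shows "partial_deriv b F x = F' b"
  using frechet_derivative_at[OF assms] by (simp add: partial_deriv_def)

text \<open>A set of functions that is closed under partial differentiation consists of smooth
functions. The second part records that the iterated derivatives stay in the set, which is how they are
estimated.\<close>

lemma smooth_on_coinduct:
  assumes W: "open W"
    and diff: "\<And>F x. F \<in> S \<Longrightarrow> x \<in> W \<Longrightarrow> F differentiable (at x)"
    and closed: "\<And>F b. F \<in> S \<Longrightarrow> b \<in> Basis \<Longrightarrow> \<exists>F'\<in>S. \<forall>x\<in>W. partial_deriv b F x = F' x"
    and F: "F \<in> S"
  shows "smooth_on W F"
    and "set bs \<subseteq> Basis \<Longrightarrow> \<exists>F'\<in>S. \<forall>x\<in>W. partial_derivs bs F x = F' x"
proof -
  have step: "partial_deriv b H x = partial_deriv b F' x" "H differentiable (at x)"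
    if "F' \<in> S" "\<forall>x\<in>W. H x = F' x" "x \<in> W" for F' H x b
  proof -
    have d: "(F' has_derivative frechet_derivative F' (at x)) (at x)"
      using diff that(1,3) frechet_derivative_works by blast
    then have d': "(H has_derivative frechet_derivative F' (at x)) (at x)"
      using has_derivative_transform_within_open[OF _ W that(3)] that(2) by metis
    then show "H differentiable (at x)" by (auto simp: differentiable_def)
    show "partial_deriv b H x = partial_deriv b F' x"
      using partial_deriv_eq[OF d] partial_deriv_eq[OF d'] by simp
  qed
  have main: "\<exists>F'\<in>S. \<forall>x\<in>W. partial_derivs bs F x = F' x" if "set bs \<subseteq> Basis" for bs
    using that
  proof (induction bs)
    case Nil
    then show ?case using F by (auto simp: partial_derivs_def)
  next
    case (Cons b bs)
    then obtain F' where F': "F' \<in> S" "\<forall>x\<in>W. partial_derivs bs F x = F' x" by auto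
    have "partial_derivs (b # bs) F x = partial_deriv b F' x" if "x \<in> W" for x
      using step(1)[OF F' that, of b] by (simp add: partial_derivs_def)
    moreover obtain F'' where "F'' \<in> S" "\<forall>x\<in>W. partial_deriv b F' x = F'' x"
      using closed[OF F'(1), of b] Cons.prems by auto
    ultimately show ?case by auto
  qed
  then show "set bs \<subseteq> Basis \<Longrightarrow> \<exists>F'\<in>S. \<forall>x\<in>W. partial_derivs bs F x = F' x" .
  show "smooth_on W F"
    unfolding smooth_on_def using main step(2) by metis
qed

lemma smooth_on_differentiable: "smooth_on W F \<Longrightarrow> x \<in> W \<Longrightarrow> F differentiable (at x)"
  unfolding smooth_on_def by (metis empty_subsetI foldr.simps(1) id_apply list.set(1) partial_derivs_def)

lemma smooth_on_partial_deriv: "smooth_on W F \<Longrightarrow> b \<in> Basis \<Longrightarrow> smooth_on W (partial_deriv b F)"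
  unfolding smooth_on_def
proof (intro allI impI)
  fix bs :: "'a list"
  assume *: "\<forall>bs. set bs \<subseteq> Basis \<longrightarrow> (\<forall>x\<in>W. partial_derivs bs F differentiable (at x))"
    and "b \<in> Basis" "set bs \<subseteq> Basis"
  moreover have "partial_derivs bs (partial_deriv b F) = partial_derivs (bs @ [b]) F"
    by (simp add: partial_derivs_def)
  ultimately show "\<forall>x\<in>W. partial_derivs bs (partial_deriv b F) differentiable (at x)"
    using *[rule_format, of "bs @ [b]"] by simp
qed

lemma smooth_on_add_scaled:
  fixes F H :: "'a::euclidean_space \<Rightarrow> complex"
  assumes "open W" "smooth_on W F" "smooth_on W H"
  shows "smooth_on W (\<lambda>x. c * F x + d * H x)"
proof (rule smooth_on_coinduct(1)[OF assms(1), of "{\<lambda>x. c * F x + d * H x | F H. smooth_on W F \<and> smooth_on W H}"])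
  have der: "((\<lambda>x. c * F x + d * H x) has_derivative
      (\<lambda>v. c * frechet_derivative F (at x) v + d * frechet_derivative H (at x) v)) (at x)"
    if "smooth_on W F" "smooth_on W H" "x \<in> W" for F H :: "'a \<Rightarrow> complex" and x
    using that smooth_on_differentiable
    by (auto intro!: derivative_eq_intros simp: frechet_derivative_works[symmetric])
  fix K :: "'a \<Rightarrow> complex"
  assume "K \<in> {\<lambda>x. c * F x + d * H x | F H. smooth_on W F \<and> smooth_on W H}"
  then obtain F H where K: "K = (\<lambda>x. c * F x + d * H x)" "smooth_on W F" "smooth_on W H" by blast
  show "K differentiable (at x)" if "x \<in> W" for x
    using der[OF K(2,3) that] K(1) by (auto simp: differentiable_def)
  fix b :: 'a assume b: "b \<in> Basis"
  have "\<forall>x\<in>W. partial_deriv b K x = c * partial_deriv b F x + d * partial_deriv b H x"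
    using partial_deriv_eq[OF der[OF K(2,3)]] K(1) by (auto simp: partial_deriv_def)
  then show "\<exists>F'\<in>{\<lambda>x. c * F x + d * H x | F H. smooth_on W F \<and> smooth_on W H}. \<forall>x\<in>W. partial_deriv b K x = F' x"
    using smooth_on_partial_deriv[OF K(2) b] smooth_on_partial_deriv[OF K(3) b]
    by (intro bexI[of _ "\<lambda>x. c * partial_deriv b F x + d * partial_deriv b H x"]) auto
qed (use assms in blast)

text \<open>The set used for the coinduction has to absorb the terms in which the linear factor has been
differentiated; hence the summand \<open>H\<close>.\<close>

lemma smooth_on_linear_mult:
  fixes F :: "'a::euclidean_space \<Rightarrow> complex"
  assumes W: "open W" and l: "bounded_linear l" and F: "smooth_on W F"
  shows "smooth_on W (\<lambda>x. complex_of_real (l x) * F x)"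
proof -
  define S where "S = {\<lambda>x. complex_of_real (l x) * F x + H x | F H. smooth_on W F \<and> smooth_on W H}"
  have zero: "smooth_on W (\<lambda>x. 0 :: complex)"
    using smooth_on_add_scaled[OF W F F, of 0 0] by simp
  have der: "((\<lambda>x. complex_of_real (l x) * F x + H x) has_derivative
      (\<lambda>v. (complex_of_real (l x) * frechet_derivative F (at x) v + complex_of_real (l v) * F x) + frechet_derivative H (at x) v)) (at x)"
    if "smooth_on W F" "smooth_on W H" "x \<in> W" for F H :: "'a \<Rightarrow> complex" and x
    using that smooth_on_differentiable bounded_linear_imp_has_derivative[OF bounded_linear_compose[OF bounded_linear_of_real l]]
    by (intro has_derivative_add has_derivative_mult) (auto simp: frechet_derivative_works[symmetric])
  have "smooth_on W (\<lambda>x. complex_of_real (l x) * F x + 0)"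
  proof (rule smooth_on_coinduct(1)[OF W, of S])
    fix K :: "'a \<Rightarrow> complex"
    assume "K \<in> S"
    then obtain F H where K: "K = (\<lambda>x. complex_of_real (l x) * F x + H x)" "smooth_on W F" "smooth_on W H"
      unfolding S_def by blast
    show "K differentiable (at x)" if "x \<in> W" for x
      using der[OF K(2,3) that] K(1) by (auto simp: differentiable_def)
    fix b :: 'a assume b: "b \<in> Basis"
    have "\<forall>x\<in>W. partial_deriv b K x = complex_of_real (l x) * partial_deriv b F x +
        (complex_of_real (l b) * F x + 1 * partial_deriv b H x)"
      using partial_deriv_eq[OF der[OF K(2,3)]] K(1) by (auto simp: partial_deriv_def)
    then show "\<exists>F'\<in>S. \<forall>x\<in>W. partial_deriv b K x = F' x"
      using smooth_on_partial_deriv[OF K(2) b] smooth_on_add_scaled[OF W K(2) smooth_on_partial_deriv[OF K(3) b]]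
      unfolding S_def by fast
  next
    show "(\<lambda>x. complex_of_real (l x) * F x + 0) \<in> S" unfolding S_def using F zero by fast
  qed
  then show ?thesis by simp
qed

lemma smooth_on_sum:
  fixes F :: "'i \<Rightarrow> 'a::euclidean_space \<Rightarrow> complex"
  assumes W: "open W" and "finite I" "\<And>i. i \<in> I \<Longrightarrow> smooth_on W (F i)" "smooth_on W (\<lambda>x. 0 :: complex)"
  shows "smooth_on W (\<lambda>x. \<Sum>i\<in>I. F i x)"
  using assms(2,3)
proof (induction I rule: finite_induct)
  case (insert i I)
  then show ?case using smooth_on_add_scaled[OF W, of "F i" "\<lambda>x. \<Sum>i\<in>I. F i x" 1 1] by simp
qed (simp add: assms(4))

section \<open>Left derivatives of smooth functions on the group\<close>

context alg_rep
begin

text \<open>In terms of a local extension of \<open>f\<close> the left derivative is a first-order differential operator with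
linear coefficients, because the flow stays in the group.\<close>

lemma smooth_on_group_flow:
  assumes f: "smooth_on_group G f" and X: "X \<in> lie"
  shows "smooth_on_group G (dL X f)"
    and "g \<in> G \<Longrightarrow> ((\<lambda>t. f (mat_exp (- t *\<^sub>R X) ** g)) has_vector_derivative dL X f g) (at 0)"
proof -
  have flow: "((\<lambda>t. f (mat_exp (- t *\<^sub>R X) ** h)) has_vector_derivative
      (\<Sum>b\<in>Basis. complex_of_real (- (X ** h) \<bullet> b) * partial_deriv b F h)) (at 0)"
    if W: "open W" "smooth_on W F" "\<And>h. h \<in> W \<inter> G \<Longrightarrow> f h = F h" and h: "h \<in> W \<inter> G" for W F h
  proof -
    let ?c = "\<lambda>t. mat_exp (- t *\<^sub>R X) ** h"
    have lin: "((\<lambda>u. - u) has_vector_derivative -1) (at (0 :: real))"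
      unfolding has_real_derivative_iff_has_vector_derivative[symmetric] by (auto intro!: derivative_eq_intros)
    have "((\<lambda>t. mat_exp (- t *\<^sub>R X)) has_vector_derivative - X) (at 0)"
      using vector_diff_chain_at[OF lin mat_exp_has_vector_derivative[of X]] by (simp add: o_def)
    from bounded_linear.has_vector_derivative[OF bounded_bilinear.bounded_linear_left[OF bounded_bilinear_matrix_mult] this]
    have c: "(?c has_vector_derivative (- X) ** h) (at 0)" .
    have neg: "(- X) ** h = - (X ** h)" by (simp add: matrix_matrix_mult_def vec_eq_iff sum_negf)
    have c0: "?c 0 = h" by simp
    have "(F has_derivative (\<lambda>v. \<Sum>b\<in>Basis. (v \<bullet> b) *\<^sub>R partial_deriv b F h)) (at (?c 0))"
      unfolding c0 by (rule differentiable_imp_partial_derivs) (use smooth_on_differentiable[OF W(2)] h in auto)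
    then have d: "((\<lambda>t. F (?c t)) has_vector_derivative (\<Sum>b\<in>Basis. complex_of_real (- (X ** h) \<bullet> b) * partial_deriv b F h)) (at 0)"
    proof -
      have conv: "r *\<^sub>R w = complex_of_real r * w" for r and w :: complex by (simp add: scaleR_conv_of_real)
      have "(\<Sum>b\<in>Basis. ((t *\<^sub>R ((- X) ** h)) \<bullet> b) *\<^sub>R partial_deriv b F h) =
          t *\<^sub>R (\<Sum>b\<in>Basis. complex_of_real (- (X ** h) \<bullet> b) * partial_deriv b F h)" for t
        unfolding neg inner_scaleR_left scaleR_scaleR[symmetric] scaleR_sum_right[symmetric]
        by (simp only: conv)
      then show ?thesis
        using has_derivative_compose[OF c[unfolded has_vector_derivative_def] \<open>(F has_derivative _) _\<close>]
        unfolding has_vector_derivative_def by simp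
    qed
    have "continuous (at 0) ?c" using c by (rule has_vector_derivative_continuous)
    then have "\<forall>\<^sub>F t in at 0. ?c t \<in> W"
      using W(1) h c0 by (auto simp: continuous_at eventually_at_topological tendsto_def)
    moreover have "?c t \<in> G" for t using h left_mult_G mat_exp_G[OF X, of "- t"] by simp
    ultimately have "\<forall>\<^sub>F t in at 0. F (?c t) = f (?c t)"
      using W(3) by (auto elim!: eventually_mono)
    moreover have "F (?c 0) = f (?c 0)" using W(3) h by simp
    ultimately show ?thesis
      using d unfolding has_vector_derivative_def
      by (auto intro: has_derivative_transform_eventually)
  qed
  have loc: "\<exists>W F. open W \<and> g \<in> W \<and> smooth_on W F \<and> (\<forall>h\<in>W \<inter> G. f h = F h)" if "g \<in> G" for g
    using f that by (auto simp: smooth_on_group_def)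
  show "((\<lambda>t. f (mat_exp (- t *\<^sub>R X) ** g)) has_vector_derivative dL X f g) (at 0)" if g: "g \<in> G" for g
  proof -
    obtain W F where "open W" "g \<in> W" "smooth_on W F" "\<forall>h\<in>W \<inter> G. f h = F h" using loc[OF g] by blast
    then have "((\<lambda>t. f (mat_exp (- t *\<^sub>R X) ** g)) has_vector_derivative
      (\<Sum>b\<in>Basis. complex_of_real (- (X ** g) \<bullet> b) * partial_deriv b F g)) (at 0)"
      using g by (intro flow[of W F]) auto
    then show ?thesis unfolding dL_def by (simp add: vector_derivative_at)
  qed
  show "smooth_on_group G (dL X f)"
    unfolding smooth_on_group_def
  proof
    fix g assume g: "g \<in> G"
    obtain W F where W: "open W" "g \<in> W" "smooth_on W F" "\<forall>h\<in>W \<inter> G. f h = F h" using loc[OF g] by blast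
    define H where "H h = (\<Sum>b\<in>Basis. complex_of_real (- (X ** h) \<bullet> b) * partial_deriv b F h)" for h
    have zero: "smooth_on W (\<lambda>x. 0 :: complex)"
      using smooth_on_add_scaled[OF W(1,3,3), of 0 0] by simp
    have bl: "bounded_linear (\<lambda>h. - (X ** h) \<bullet> b)" for b
      by (intro bounded_linear_compose[OF bounded_linear_inner_left] bounded_linear_minus
          bounded_bilinear.bounded_linear_right[OF bounded_bilinear_matrix_mult])
    have "smooth_on W H"
      unfolding H_def[abs_def]
      by (intro smooth_on_sum smooth_on_linear_mult bl smooth_on_partial_deriv W zero) auto
    moreover have "dL X f h = H h" if "h \<in> W \<inter> G" for h
      using vector_derivative_at[OF flow[of W F h]] W that by (simp add: dL_def H_def)
    ultimately show "\<exists>W F. open W \<and> g \<in> W \<and> smooth_on W F \<and> (\<forall>h\<in>W \<inter> G. dL X f h = F h)"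
      using W by blast
  qed
qed

lemma smooth_on_group_add_scaled:
  assumes "smooth_on_group G F" "smooth_on_group G H"
  shows "smooth_on_group G (\<lambda>g. c * F g + d * H g)"
  unfolding smooth_on_group_def
proof
  fix g assume g: "g \<in> G"
  obtain V P where V: "open V" "g \<in> V" "smooth_on V P" "\<forall>h\<in>V \<inter> G. F h = P h"
    using assms(1) g unfolding smooth_on_group_def by blast
  obtain W Q where W: "open W" "g \<in> W" "smooth_on W Q" "\<forall>h\<in>W \<inter> G. H h = Q h"
    using assms(2) g unfolding smooth_on_group_def by blast
  have "smooth_on (V \<inter> W) P" "smooth_on (V \<inter> W) Q" using V W by (auto simp: smooth_on_def)
  then have "smooth_on (V \<inter> W) (\<lambda>x. c * P x + d * Q x)" using V W by (intro smooth_on_add_scaled) auto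
  then show "\<exists>W' F'. open W' \<and> g \<in> W' \<and> smooth_on W' F' \<and> (\<forall>h\<in>W' \<inter> G. c * F h + d * H h = F' h)"
    using V W by (intro exI[of _ "V \<inter> W"] exI[of _ "\<lambda>x. c * P x + d * Q x"]) auto
qed

lemma smooth_on_group_enveloping:
  assumes "D \<in> dL_enveloping G" "smooth_on_group G f"
  shows "smooth_on_group G (D f)"
  using assms
proof (induction arbitrary: f)
  case (lie X)
  then show ?case using smooth_on_group_flow(1) by (simp add: lie_algebra_G)
next
  case (scale D c)
  then show ?case using smooth_on_group_add_scaled[of "D f" "D f" c 0] by simp
next
  case (add D E)
  then show ?case using smooth_on_group_add_scaled[of "D f" "E f" 1 1] by simp
qed simp_all

lemma smooth_on_group_continuous:
  assumes "smooth_on_group G F"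
  shows "continuous_on G F"
  unfolding continuous_on_eq_continuous_within
proof
  fix g assume g: "g \<in> G"
  obtain W P where W: "open W" "g \<in> W" "smooth_on W P" "\<forall>h\<in>W \<inter> G. F h = P h"
    using assms g unfolding smooth_on_group_def by blast
  have "continuous (at g within G) P"
    using smooth_on_differentiable[OF W(3,2)] differentiable_imp_continuous_within continuous_at_imp_continuous_within by blast
  moreover have "\<forall>\<^sub>F h in at g within G. P h = F h"
    unfolding eventually_at_topological using W by (intro exI[of _ W]) auto
  ultimately show "continuous (at g within G) F"
    unfolding continuous_within using W(2,4) g by (auto intro: Lim_transform_eventually)
qed

end

section \<open>Integration over the group\<close>

locale haar_rep = alg_rep +
  fixes \<mu> :: "(real^'a^'a) measure"
  assumes haar: "left_haar_measure G \<mu>"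
begin

lemma sets_mu [measurable_cong]: "sets \<mu> = sets (restrict_space borel G)"
  and emeasure_translate: "g \<in> G \<Longrightarrow> A \<in> sets \<mu> \<Longrightarrow> emeasure \<mu> ((\<lambda>h. g ** h) ` A) = emeasure \<mu> A"
  and emeasure_compact: "compact K \<Longrightarrow> K \<subseteq> G \<Longrightarrow> emeasure \<mu> K < \<infinity>"
  using haar by (auto simp: left_haar_measure_def)

lemma space_mu: "space \<mu> = G"
  using sets_eq_imp_space_eq[OF sets_mu] by (simp add: space_restrict_space)

lemma continuous_measurable: "continuous_on G F \<Longrightarrow> F \<in> borel_measurable \<mu>"
  using borel_measurable_continuous_on_restrict[of G F] measurable_cong_sets[OF sets_mu refl, of borel] by simp

lemma translate_measurable:
  assumes "h \<in> G"
  shows "(\<lambda>g. h ** g) \<in> measurable \<mu> \<mu>"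
proof -
  have "(\<lambda>g. h ** g) \<in> borel_measurable \<mu>"
    by (intro continuous_measurable matrix_mult_continuous_on continuous_intros)
  then have "(\<lambda>g. h ** g) \<in> measurable \<mu> (restrict_space borel G)"
    by (rule measurable_restrict_space2[rotated]) (use assms left_mult_G space_mu in auto)
  then show ?thesis using measurable_cong_sets[OF refl sets_mu, of \<mu>] by simp
qed

lemma distr_translate:
  assumes h: "h \<in> G"
  shows "distr \<mu> \<mu> (\<lambda>g. h ** g) = \<mu>"
proof (rule measure_eqI)
  fix A assume "A \<in> sets (distr \<mu> \<mu> (\<lambda>g. h ** g))"
  then have A: "A \<in> sets \<mu>" by simp
  then have AG: "A \<subseteq> G" using sets.sets_into_space space_mu by blast
  have hR: "h \<in> GR" using h G_sub_GR by blast
  have "(\<lambda>g. h ** g) -` A \<inter> space \<mu> = (\<lambda>g. matrix_inv h ** g) ` A"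
  proof (intro equalityI subsetI)
    fix g assume "g \<in> (\<lambda>g. h ** g) -` A \<inter> space \<mu>"
    then show "g \<in> (\<lambda>g. matrix_inv h ** g) ` A"
      by (intro image_eqI[of _ _ "h ** g"]) (auto simp: matrix_mul_assoc inv_GR_left[OF hR])
  next
    fix k assume "k \<in> (\<lambda>g. matrix_inv h ** g) ` A"
    then obtain g where "g \<in> A" "k = matrix_inv h ** g" by blast
    then show "k \<in> (\<lambda>g. h ** g) -` A \<inter> space \<mu>"
      using AG left_mult_G inv_G[OF h] by (auto simp: matrix_mul_assoc inv_GR_right[OF hR] space_mu)
  qed
  then show "emeasure (distr \<mu> \<mu> (\<lambda>g. h ** g)) A = emeasure \<mu> A"
    using A by (simp add: emeasure_distr translate_measurable[OF h] emeasure_translate[OF inv_G[OF h]])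
qed simp

lemma integrable_translate:
  fixes F :: "real^'a^'a \<Rightarrow> complex"
  assumes "h \<in> G" "F \<in> borel_measurable \<mu>"
  shows "integrable \<mu> (\<lambda>g. F (h ** g)) \<longleftrightarrow> integrable \<mu> F"
    and "(\<integral>g. F (h ** g) \<partial>\<mu>) = (\<integral>g. F g \<partial>\<mu>)"
    and "(\<integral>g. norm (F (h ** g)) \<partial>\<mu>) = (\<integral>g. norm (F g) \<partial>\<mu>)"
  using integrable_distr_eq[OF translate_measurable[OF assms(1)] assms(2)]
    integral_distr[OF translate_measurable[OF assms(1)] assms(2)]
    integral_distr[OF translate_measurable[OF assms(1)], of "\<lambda>g. norm (F g)"] assms(2)
  by (simp_all add: distr_translate[OF assms(1)])

lemma closed_in_GR: "\<exists>C. closed C \<and> G = GR \<inter> C"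
proof -
  have "closedin (top_of_set GR) G"
    unfolding G_def identity_component_def by (rule closedin_connected_component)
  then show ?thesis by (auto simp: closedin_closed)
qed

text \<open>The real group is closed in the general linear group, and the component is closed in it; so the
component is exhausted by the compact sets on which the entries and the inverse determinant are bounded.\<close>

lemma sigma_finite_mu: "sigma_finite_measure \<mu>"
proof
  obtain C where C: "closed C" "G = GR \<inter> C" using closed_in_GR by blast
  define Z where "Z = {g. \<forall>p\<in>vanishing. p (entries (cmat g)) = 0}"
  have "closed {g. p (entries (cmat g)) = 0}" if "p \<in> vanishing" for p
  proof (rule closed_Collect_eq)
    show "continuous_on UNIV (\<lambda>g. p (entries (cmat g)))"
      by (rule polys_in_continuous_on) (use that in \<open>auto simp: vanishing_def entries_def intro!: continuous_intros split: prod.splits\<close>)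
  qed auto
  then have "closed (\<Inter>p\<in>vanishing. {g. p (entries (cmat g)) = 0})" by (intro closed_INT) auto
  moreover have "Z = (\<Inter>p\<in>vanishing. {g. p (entries (cmat g)) = 0})" by (auto simp: Z_def)
  ultimately have Z: "closed Z" by simp
  define K where "K n = C \<inter> Z \<inter> {g. \<bar>det g\<bar> \<ge> inverse (real (Suc n))} \<inter> cball 0 (real n)" for n
  have cd: "continuous_on UNIV (\<lambda>g :: real^'a^'a. \<bar>det g\<bar>)" unfolding det_def by (intro continuous_intros)
  have GReq: "g \<in> GR \<longleftrightarrow> det g \<noteq> 0 \<and> g \<in> Z" for g
    using GC_iff_vanishing[of "cmat g"] by (simp add: GR_iff invertible_det_nz det_cmat Z_def)
  have K: "compact (K n)" for n
    unfolding K_def using C(1) Z by (intro closed_Int_compact closed_Int closed_Collect_le cd compact_cball) auto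
  have KG: "K n \<subseteq> G" for n
  proof
    fix g assume g: "g \<in> K n"
    then have "\<bar>det g\<bar> \<ge> inverse (real (Suc n))" by (auto simp: K_def)
    then have "det g \<noteq> 0" by (smt (verit) inverse_positive_iff_positive of_nat_0_less_iff zero_less_Suc)
    then show "g \<in> G" using g by (auto simp: C(2) GReq K_def)
  qed
  have "G \<subseteq> (\<Union>n. K n)"
  proof
    fix g assume g: "g \<in> G"
    then have "\<bar>det g\<bar> > 0" by (simp add: C(2) GReq)
    then obtain n where n: "inverse (real (Suc n)) < \<bar>det g\<bar>" using reals_Archimedean by blast
    obtain k where k: "norm g \<le> real k" using real_arch_simple by blast
    have "inverse (real (Suc (max n k))) \<le> inverse (real (Suc n))" by (intro le_imp_inverse_le) auto
    then have "inverse (real (Suc (max n k))) \<le> \<bar>det g\<bar>" using n by linarith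
    moreover have "norm g \<le> real (max n k)" using k by simp
    ultimately have "g \<in> K (max n k)" using g by (simp add: K_def C(2) GReq del: of_nat_Suc of_nat_max)
    then show "g \<in> (\<Union>n. K n)" by blast
  qed
  moreover have "K n \<in> sets \<mu>" for n
    using K KG by (auto simp: sets_mu sets_restrict_space compact_imp_closed intro!: image_eqI[of _ _ "K n"] borel_closed)
  moreover have "\<Union> (range K) = G" using calculation(1) KG by blast
  ultimately show "\<exists>A. countable A \<and> A \<subseteq> sets \<mu> \<and> \<Union>A = space \<mu> \<and> (\<forall>a\<in>A. emeasure \<mu> a \<noteq> \<infinity>)"
    using emeasure_compact[OF K KG]
    by (intro exI[of _ "range K"]) (auto simp: space_mu less_top)
qed

sublocale mu: sigma_finite_measure \<mu> by (rule sigma_finite_mu)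

text \<open>The derivative is integrated over the flow for times in the unit interval: by the fundamental
theorem of calculus this gives a difference of two translates of \<open>F\<close>, whose integrals agree, and by invariance and
Fubini it gives the integral of \<open>F'\<close>. Differentiating under the integral would need a uniform
bound for the difference quotients; this argument needs only integrability.\<close>

lemma integral_left_derivative_zero:
  fixes F F' :: "real^'a^'a \<Rightarrow> complex"
  assumes X: "X \<in> lie" and c: "continuous_on G F" "continuous_on G F'"
    and i: "integrable \<mu> F" "integrable \<mu> F'"
    and d: "\<And>g. g \<in> G \<Longrightarrow> ((\<lambda>t. F (mat_exp (- t *\<^sub>R X) ** g)) has_vector_derivative F' g) (at 0)"
  shows "(\<integral>g. F' g \<partial>\<mu>) = 0"
proof -
  interpret P: pair_sigma_finite lborel \<mu> ..
  define e where "e t = mat_exp (- t *\<^sub>R X)" for t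
  have eG: "e t \<in> G" for t unfolding e_def by (rule mat_exp_G[OF X])
  have ce: "continuous_on UNIV e"
    unfolding e_def[abs_def] by (intro continuous_on_compose2[OF mat_exp_continuous[of UNIV]] continuous_intros) auto
  have e0: "e 0 = mat 1" by (simp add: e_def)
  have m: "F \<in> borel_measurable \<mu>" "F' \<in> borel_measurable \<mu>" using c by (auto intro: continuous_measurable)
  have ds: "((\<lambda>t. F (e t ** g)) has_vector_derivative F' (e s ** g)) (at s)" if g: "g \<in> G" for g s
  proof -
    have lin: "((\<lambda>u. u - s) has_vector_derivative 1) (at s)"
      unfolding has_real_derivative_iff_has_vector_derivative[symmetric] by (auto intro!: derivative_eq_intros)
    have "((\<lambda>t. F (mat_exp (- t *\<^sub>R X) ** (e s ** g))) has_vector_derivative F' (e s ** g)) (at (s - s))"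
      using d[OF left_mult_G[OF eG g], of s] by simp
    from vector_diff_chain_at[OF lin this]
    have "((\<lambda>t. F (mat_exp (- (t - s) *\<^sub>R X) ** (e s ** g))) has_vector_derivative F' (e s ** g)) (at s)"
      unfolding o_def scaleR_one .
    moreover have "mat_exp (- (t - s) *\<^sub>R X) ** (e s ** g) = e t ** g" for t
    proof -
      have "- (t - s) + - s = - t" by simp
      then show ?thesis using mat_exp_add[of "- (t - s)" "- s" X] by (simp only: e_def matrix_mul_assoc)
    qed
    ultimately show ?thesis by (simp only:)
  qed
  define k where "k s g = indicator {0..1} s *\<^sub>R F' (e s ** g)" for s :: real and g
  have ftc: "(\<integral>s. k s g \<partial>lborel) = F (e 1 ** g) - F (e 0 ** g)" if g: "g \<in> G" for g
    unfolding k_def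
  proof (rule integral_FTC_atLeastAtMost)
    show "continuous_on {0..1} (\<lambda>s. F' (e s ** g))"
      using continuous_on_subset[OF ce] left_mult_G[OF eG g]
      by (intro continuous_on_compose2[OF c(2)] matrix_mult_continuous_on) auto
  qed (auto intro: has_vector_derivative_at_within[OF ds[OF g]])
  have meas: "case_prod k \<in> borel_measurable (lborel \<Otimes>\<^sub>M \<mu>)"
  proof -
    have id: "(\<lambda>g. g) \<in> borel_measurable \<mu>" by (intro continuous_measurable continuous_intros)
    have "(\<lambda>p. (e (fst p), snd p)) \<in> measurable (lborel \<Otimes>\<^sub>M \<mu>) (borel \<Otimes>\<^sub>M borel)"
      using borel_measurable_continuous_onI[OF ce] id by measurable
    then have p: "(\<lambda>p. (e (fst p), snd p)) \<in> measurable (lborel \<Otimes>\<^sub>M \<mu>) borel" by (simp add: borel_prod)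
    have "(\<lambda>p :: (real^'a^'a) \<times> (real^'a^'a). fst p ** snd p) \<in> borel_measurable borel"
      by (intro borel_measurable_continuous_onI matrix_mult_continuous_on continuous_intros)
    from measurable_compose[OF p this]
    have "(\<lambda>p. e (fst p) ** snd p) \<in> borel_measurable (lborel \<Otimes>\<^sub>M \<mu>)" by simp
    then have "(\<lambda>p. e (fst p) ** snd p) \<in> measurable (lborel \<Otimes>\<^sub>M \<mu>) (restrict_space borel G)"
      by (rule measurable_restrict_space2[rotated]) (use left_mult_G eG in \<open>auto simp: space_pair_measure space_mu\<close>)
    then have "(\<lambda>p. e (fst p) ** snd p) \<in> measurable (lborel \<Otimes>\<^sub>M \<mu>) \<mu>"
      using measurable_cong_sets[OF refl sets_mu] by blast
    from measurable_compose[OF this m(2)]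
    have [measurable]: "(\<lambda>p. F' (e (fst p) ** snd p)) \<in> borel_measurable (lborel \<Otimes>\<^sub>M \<mu>)" .
    show ?thesis unfolding k_def case_prod_beta by measurable
  qed
  have "integrable (lborel \<Otimes>\<^sub>M \<mu>) (case_prod k)"
  proof (rule P.Fubini_integrable[OF meas])
    have "(\<integral>g. norm (k s g) \<partial>\<mu>) = indicator {0..1} s * (\<integral>g. norm (F' g) \<partial>\<mu>)" for s
      using integrable_translate(3)[OF eG m(2), of s] by (simp add: k_def)
    then show "integrable lborel (\<lambda>s. \<integral>g. norm (case (s, g) of (s, g) \<Rightarrow> k s g) \<partial>\<mu>)"
      by simp
    show "AE s in lborel. integrable \<mu> (\<lambda>g. case (s, g) of (s, g) \<Rightarrow> k s g)"
      using integrable_translate(1)[OF eG m(2)] i(2) by (simp add: k_def)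
  qed
  from P.Fubini_integral[OF this]
  have fubini: "(\<integral>g. (\<integral>s. k s g \<partial>lborel) \<partial>\<mu>) = (\<integral>s. (\<integral>g. k s g \<partial>\<mu>) \<partial>lborel)" .
  have inner: "(\<integral>g. k s g \<partial>\<mu>) = indicator {0..1} s *\<^sub>R (\<integral>g. F' g \<partial>\<mu>)" for s
    using integrable_translate(2)[OF eG m(2), of s] by (simp add: k_def)
  have outer: "(\<integral>s. indicator {0..1::real} s *\<^sub>R (\<integral>g. F' g \<partial>\<mu>) \<partial>lborel) = (\<integral>g. F' g \<partial>\<mu>)"
    by (subst integral_scaleR_left) (auto simp: integrable_indicator_iff)
  have "(\<integral>g. F' g \<partial>\<mu>) = (\<integral>g. (\<integral>s. k s g \<partial>lborel) \<partial>\<mu>)"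
    unfolding fubini inner outer ..
  also have "\<dots> = (\<integral>g. F (e 1 ** g) - F g \<partial>\<mu>)"
    by (intro Bochner_Integration.integral_cong refl) (simp add: ftc space_mu e0)
  also have "\<dots> = (\<integral>g. F (e 1 ** g) \<partial>\<mu>) - (\<integral>g. F g \<partial>\<mu>)"
    using integrable_translate(1)[OF eG m(1)] i(1) by (intro Bochner_Integration.integral_diff) auto
  also have "\<dots> = 0" using integrable_translate(2)[OF eG m(1)] by simp
  finally show ?thesis .
qed

end

section \<open>Differentiation under the integral sign\<close>

text \<open>A quadratic bound for the Taylor remainder with integrable constant is all that the later applications
have to provide.\<close>

lemma has_derivative_integral:
  fixes \<Phi> :: "'g \<Rightarrow> 'z::euclidean_space \<Rightarrow> complex"
  assumes int: "\<And>z. integrable M (\<lambda>g. \<Phi> g z)" "\<And>w. integrable M (\<lambda>g. L g w)"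
    and lin: "\<And>g. g \<in> space M \<Longrightarrow> linear (L g)"
    and B: "integrable M B"
    and rem: "\<And>g w. g \<in> space M \<Longrightarrow> norm w \<le> 1 \<Longrightarrow> norm (\<Phi> g (z + w) - \<Phi> g z - L g w) \<le> B g * (norm w)\<^sup>2"
  shows "((\<lambda>z. \<integral>g. \<Phi> g z \<partial>M) has_derivative (\<lambda>w. \<integral>g. L g w \<partial>M)) (at z)"
  unfolding has_derivative_at
proof
  have "linear (\<lambda>w. \<integral>g. L g w \<partial>M)"
  proof (rule linearI)
    fix u v :: 'z and c :: real
    have "(\<integral>g. L g (u + v) \<partial>M) = (\<integral>g. L g u + L g v \<partial>M)"
      by (intro Bochner_Integration.integral_cong refl) (simp add: lin linear_add)
    then show "(\<integral>g. L g (u + v) \<partial>M) = (\<integral>g. L g u \<partial>M) + (\<integral>g. L g v \<partial>M)" using int(2) by simp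
    have "(\<integral>g. L g (c *\<^sub>R u) \<partial>M) = (\<integral>g. c *\<^sub>R L g u \<partial>M)"
      by (intro Bochner_Integration.integral_cong refl) (simp add: lin linear_scale)
    then show "(\<integral>g. L g (c *\<^sub>R u) \<partial>M) = c *\<^sub>R (\<integral>g. L g u \<partial>M)" by simp
  qed
  then show "bounded_linear (\<lambda>w. \<integral>g. L g w \<partial>M)" by (simp add: linear_conv_bounded_linear)
  define b where "b = \<bar>\<integral>g. B g \<partial>M\<bar>"
  have est: "norm ((\<integral>g. \<Phi> g (z + w) \<partial>M) - (\<integral>g. \<Phi> g z \<partial>M) - (\<integral>g. L g w \<partial>M)) \<le> b * (norm w)\<^sup>2"
    if w: "norm w \<le> 1" for w
  proof -
    have "(\<integral>g. \<Phi> g (z + w) \<partial>M) - (\<integral>g. \<Phi> g z \<partial>M) - (\<integral>g. L g w \<partial>M) = (\<integral>g. \<Phi> g (z + w) - \<Phi> g z - L g w \<partial>M)"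
      using int by simp
    also have "norm \<dots> \<le> (\<integral>g. B g * (norm w)\<^sup>2 \<partial>M)"
    proof (rule order_trans[OF integral_norm_bound], rule integral_mono)
      show "integrable M (\<lambda>g. norm (\<Phi> g (z + w) - \<Phi> g z - L g w))" using int by simp
    qed (use B rem[OF _ w] in auto)
    also have "\<dots> \<le> b * (norm w)\<^sup>2" by (simp add: b_def mult_right_mono)
    finally show ?thesis .
  qed
  show "((\<lambda>w. norm ((\<integral>g. \<Phi> g (z + w) \<partial>M) - (\<integral>g. \<Phi> g z \<partial>M) - (\<integral>g. L g w \<partial>M)) / norm w) \<longlongrightarrow> 0) (at 0)"
  proof (rule Lim_null_comparison)
    show "\<forall>\<^sub>F w in at 0. norm (norm ((\<integral>g. \<Phi> g (z + w) \<partial>M) - (\<integral>g. \<Phi> g z \<partial>M) - (\<integral>g. L g w \<partial>M)) / norm w) \<le> b * norm w"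
      unfolding eventually_at
    proof (intro exI[of _ 1] conjI ballI impI)
      fix w :: 'z assume "w \<noteq> 0 \<and> dist w 0 < 1"
      then show "norm (norm ((\<integral>g. \<Phi> g (z + w) \<partial>M) - (\<integral>g. \<Phi> g z \<partial>M) - (\<integral>g. L g w \<partial>M)) / norm w) \<le> b * norm w"
        using est[of w] by (simp add: divide_le_eq power2_eq_square mult.assoc)
    qed simp
    show "((\<lambda>w. b * norm w) \<longlongrightarrow> 0) (at (0 :: 'z))"
      by (rule tendsto_eq_intros tendsto_norm_zero tendsto_ident_at refl | simp)+
  qed
qed

lemma norm_exp_remainder: "norm (exp (\<i> * complex_of_real s) - 1 - \<i> * complex_of_real s) \<le> s\<^sup>2"
proof -
  have "norm (exp (\<i> * complex_of_real s) - (\<Sum>k\<le>1. (\<i> * complex_of_real s) ^ k / fact k)) \<le> \<bar>s\<bar> ^ (Suc 1) / fact (Suc 1)"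
    by (rule iexp_approx1)
  then have "norm (exp (\<i> * complex_of_real s) - 1 - \<i> * complex_of_real s) \<le> s\<^sup>2 / 2"
    by (simp add: diff_diff_eq numeral_2_eq_2)
  then show ?thesis by (rule order_trans) simp
qed

section \<open>Rapidly decreasing functions\<close>

locale rapid_rep = haar_rep GC \<rho> \<mu>
  for GC :: "(complex^'m^'m) set" and \<rho> :: "complex^'m^'m \<Rightarrow> complex^'n^'n" and \<mu> +
  fixes R :: "real^'m^'m \<Rightarrow> real^'m^'m \<Rightarrow> real^'m^'m \<Rightarrow> real" and f :: "real^'m^'m \<Rightarrow> complex"
    and \<Omega> :: "(complex^'n) set"
  assumes dense: "dense_orbit GC \<rho> \<Omega>" and metric: "left_invariant_metric GR R"
    and rapid: "f \<in> rapidly_decreasing GR R \<mu>"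
begin

abbreviation gn :: "real^'m^'m \<Rightarrow> real" where "gn \<equiv> group_norm GR R"

definition U :: "(real^'n) set" where "U = real_points \<Omega>"

lemma open_U: "open U" unfolding U_def by (rule open_real_points[OF dense])

text \<open>The functions that arise from \<open>f\<close> by left derivatives and by multiplication with entries of
\<open>rr\<close> and \<open>ri\<close>. The class is closed under left derivatives (\<open>rapid_class_left_derivative\<close>), and its members
remain integrable against every exponential of the distance (\<open>rapid_class_bound\<close>), because the entries
grow at most exponentially.\<close>

inductive_set rapid_class :: "(real^'m^'m \<Rightarrow> complex) set" where
  base: "D \<in> dL_enveloping G \<Longrightarrow> D f \<in> rapid_class"
| add: "F \<in> rapid_class \<Longrightarrow> H \<in> rapid_class \<Longrightarrow> (\<lambda>g. F g + H g) \<in> rapid_class"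
| scale: "F \<in> rapid_class \<Longrightarrow> (\<lambda>g. c * F g) \<in> rapid_class"
| rr_coeff: "F \<in> rapid_class \<Longrightarrow> (\<lambda>g. complex_of_real (rr g $ i $ j) * F g) \<in> rapid_class"
| ri_coeff: "F \<in> rapid_class \<Longrightarrow> (\<lambda>g. complex_of_real (ri g $ i $ j) * F g) \<in> rapid_class"

lemma f_rapid_class: "f \<in> rapid_class"
  using rapid_class.base[OF dL_enveloping.one] by simp

lemma rapid_class_zero: "(\<lambda>g. 0) \<in> rapid_class"
  using rapid_class.scale[OF f_rapid_class, of 0] by simp

lemma rapid_class_sum: "(\<And>i. i \<in> I \<Longrightarrow> F i \<in> rapid_class) \<Longrightarrow> (\<lambda>g. \<Sum>i\<in>I. F i g) \<in> rapid_class"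
  by (induction I rule: infinite_finite_induct) (auto intro: rapid_class_zero rapid_class.add)

lemma smooth_f: "smooth_on_group G f"
  using rapid by (simp add: rapidly_decreasing_def G_def)

lemma rr_continuous_G: "continuous_on G rr" and ri_continuous_G: "continuous_on G ri"
  using rr_continuous ri_continuous G_sub_GR by (auto intro: continuous_on_subset)

lemma rapid_class_continuous: "F \<in> rapid_class \<Longrightarrow> continuous_on G F"
proof (induction rule: rapid_class.induct)
  case (base D)
  show ?case by (rule smooth_on_group_continuous[OF smooth_on_group_enveloping[OF base smooth_f]])
next
  case (add F H)
  then show ?case by (intro continuous_on_add)
next
  case (scale F c)
  then show ?case by (intro continuous_on_mult continuous_on_const)
next
  case (rr_coeff F i j)
  then show ?case
    by (intro continuous_on_mult continuous_on_of_real continuous_on_component rr_continuous_G)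
next
  case (ri_coeff F i j)
  then show ?case
    by (intro continuous_on_mult continuous_on_of_real continuous_on_component ri_continuous_G)
qed

lemma entry_le_norm: "\<bar>A $ i $ j\<bar> \<le> norm A" for A :: "real^'k^'l"
  using order_trans[OF Finite_Cartesian_Product.norm_nth_le[of "A $ i" j] Finite_Cartesian_Product.norm_nth_le[of A i]]
  by (simp only: real_norm_def)

text \<open>The weight is kept arbitrary in the induction, since every factor uses up part of it.\<close>

lemma rapid_class_bound:
  assumes "F \<in> rapid_class"
  shows "\<kappa> \<ge> 0 \<Longrightarrow> \<exists>B. integrable \<mu> B \<and> (\<forall>g\<in>G. exp (\<kappa> * gn g) * norm (F g) \<le> B g)"
  using assms
proof (induction arbitrary: \<kappa> rule: rapid_class.induct)
  case (base D)
  have "integrable \<mu> (\<lambda>g. exp (\<kappa> * gn g) *\<^sub>R D f g)"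
    using rapid base by (auto simp: rapidly_decreasing_def G_def)
  then have "integrable \<mu> (\<lambda>g. norm (exp (\<kappa> * gn g) *\<^sub>R D f g))" by (rule integrable_norm)
  then show ?case by (intro exI[of _ "\<lambda>g. norm (exp (\<kappa> * gn g) *\<^sub>R D f g)"]) simp
next
  case (add F H)
  obtain B1 B2 where B: "integrable \<mu> B1" "\<forall>g\<in>G. exp (\<kappa> * gn g) * norm (F g) \<le> B1 g"
    "integrable \<mu> B2" "\<forall>g\<in>G. exp (\<kappa> * gn g) * norm (H g) \<le> B2 g"
    using add by meson
  have "exp (\<kappa> * gn g) * norm (F g + H g) \<le> B1 g + B2 g" if "g \<in> G" for g
  proof -
    have "exp (\<kappa> * gn g) * norm (F g + H g) \<le> exp (\<kappa> * gn g) * norm (F g) + exp (\<kappa> * gn g) * norm (H g)"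
      by (simp add: norm_triangle_ineq flip: distrib_left)
    then show ?thesis using B that by fastforce
  qed
  then show ?case using B by (intro exI[of _ "\<lambda>g. B1 g + B2 g"]) auto
next
  case (scale F c)
  then obtain B where B: "integrable \<mu> B" "\<forall>g\<in>G. exp (\<kappa> * gn g) * norm (F g) \<le> B g" by meson
  then have "\<forall>g\<in>G. exp (\<kappa> * gn g) * norm (c * F g) \<le> norm c * B g"
    by (simp add: norm_mult mult.left_commute mult_left_mono)
  then show ?case using B by (intro exI[of _ "\<lambda>g. norm c * B g"]) auto
next
  case (rr_coeff F i j)
  obtain C c where c: "c \<ge> 0" "\<And>g. g \<in> G \<Longrightarrow> norm (rr g) \<le> C * exp (c * gn g)"
    using rr_growth[OF metric] by blast
  have C: "C \<ge> 0" using c(2)[OF one_G] by (smt (verit) exp_gt_zero mult_neg_pos norm_ge_zero)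
  obtain B where B: "integrable \<mu> B" "\<And>g. g \<in> G \<Longrightarrow> exp ((\<kappa> + c) * gn g) * norm (F g) \<le> B g"
    using rr_coeff.IH[of "\<kappa> + c"] rr_coeff.prems c(1) by auto
  have "exp (\<kappa> * gn g) * norm (complex_of_real (rr g $ i $ j) * F g) \<le> C * B g" if g: "g \<in> G" for g
  proof -
    have "exp (\<kappa> * gn g) * norm (complex_of_real (rr g $ i $ j) * F g) \<le> exp (\<kappa> * gn g) * ((C * exp (c * gn g)) * norm (F g))"
      using order_trans[OF entry_le_norm c(2)[OF g]] by (simp add: norm_mult mult_left_mono mult_right_mono)
    also have "\<dots> = C * (exp ((\<kappa> + c) * gn g) * norm (F g))" by (simp add: distrib_right exp_add)
    also have "\<dots> \<le> C * B g" using C B(2)[OF g] by (intro mult_left_mono) auto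
    finally show ?thesis .
  qed
  then show ?case using B(1) by (intro exI[of _ "\<lambda>g. C * B g"]) auto
next
  case (ri_coeff F i j)
  obtain C c where c: "c \<ge> 0" "\<And>g. g \<in> G \<Longrightarrow> norm (ri g) \<le> C * exp (c * gn g)"
    using ri_growth[OF metric] by blast
  have C: "C \<ge> 0" using c(2)[OF one_G] by (smt (verit) exp_gt_zero mult_neg_pos norm_ge_zero)
  obtain B where B: "integrable \<mu> B" "\<And>g. g \<in> G \<Longrightarrow> exp ((\<kappa> + c) * gn g) * norm (F g) \<le> B g"
    using ri_coeff.IH[of "\<kappa> + c"] ri_coeff.prems c(1) by auto
  have "exp (\<kappa> * gn g) * norm (complex_of_real (ri g $ i $ j) * F g) \<le> C * B g" if g: "g \<in> G" for g
  proof -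
    have "exp (\<kappa> * gn g) * norm (complex_of_real (ri g $ i $ j) * F g) \<le> exp (\<kappa> * gn g) * ((C * exp (c * gn g)) * norm (F g))"
      using order_trans[OF entry_le_norm c(2)[OF g]] by (simp add: norm_mult mult_left_mono mult_right_mono)
    also have "\<dots> = C * (exp ((\<kappa> + c) * gn g) * norm (F g))" by (simp add: distrib_right exp_add)
    also have "\<dots> \<le> C * B g" using C B(2)[OF g] by (intro mult_left_mono) auto
    finally show ?thesis .
  qed
  then show ?case using B(1) by (intro exI[of _ "\<lambda>g. C * B g"]) auto
qed

lemma rapid_class_measurable [measurable]: "F \<in> rapid_class \<Longrightarrow> F \<in> borel_measurable \<mu>"
  by (intro continuous_measurable rapid_class_continuous)

lemma rapid_class_integrable_ri_power:
  assumes F: "F \<in> rapid_class"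
  shows "integrable \<mu> (\<lambda>g. norm (ri g) ^ n * norm (F g))"
proof -
  obtain C c where c: "c \<ge> 0" "\<And>g. g \<in> G \<Longrightarrow> norm (ri g) \<le> C * exp (c * gn g)"
    using ri_growth[OF metric] by blast
  obtain B where B: "integrable \<mu> B" "\<And>g. g \<in> G \<Longrightarrow> exp ((real n * c) * gn g) * norm (F g) \<le> B g"
    using rapid_class_bound[OF F, of "real n * c"] c(1) by auto
  have C: "C \<ge> 0" using c(2)[OF one_G] by (smt (verit) exp_gt_zero mult_neg_pos norm_ge_zero)
  show ?thesis
  proof (rule Bochner_Integration.integrable_bound[of \<mu> "\<lambda>g. C ^ n * B g"])
    show "(\<lambda>g. norm (ri g) ^ n * norm (F g)) \<in> borel_measurable \<mu>"
      by (intro continuous_measurable continuous_intros ri_continuous_G rapid_class_continuous F)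
    have "norm (norm (ri g) ^ n * norm (F g)) \<le> norm (C ^ n * B g)" if g: "g \<in> G" for g
    proof -
      have "norm (ri g) ^ n * norm (F g) \<le> (C * exp (c * gn g)) ^ n * norm (F g)"
        by (intro mult_right_mono power_mono c(2) g) auto
      also have "\<dots> = C ^ n * (exp ((real n * c) * gn g) * norm (F g))"
        by (simp add: power_mult_distrib exp_of_nat_mult[symmetric] mult_ac)
      also have "\<dots> \<le> C ^ n * B g" using C B(2)[OF g] by (intro mult_left_mono) auto
      finally show ?thesis by simp
    qed
    then show "AE g in \<mu>. norm (norm (ri g) ^ n * norm (F g)) \<le> norm (C ^ n * B g)"
      by (intro AE_I2) (simp add: space_mu)
  qed (use B(1) in simp)
qed

lemma rapid_class_integrable: "F \<in> rapid_class \<Longrightarrow> integrable \<mu> F"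
  using rapid_class_integrable_ri_power[of F 0] integrable_norm_cancel[of \<mu> F] rapid_class_measurable by simp

text \<open>Along the left flow of \<open>X\<close> the entries of \<open>rr\<close> and \<open>ri\<close> are again multiplied by constant
matrices, so their derivatives are combinations of entries.\<close>

lemma flow_rr:
  assumes X: "X \<in> lie" and g: "g \<in> G"
  shows "((\<lambda>t. rr (mat_exp (- t *\<^sub>R X) ** g)) has_vector_derivative - (dr X ** rr g)) (at 0)"
    and "((\<lambda>t. ri (mat_exp (- t *\<^sub>R X) ** g)) has_vector_derivative ri g ** dr X) (at 0)"
proof -
  have gR: "g \<in> GR" using g G_sub_GR by blast
  have lin: "((\<lambda>u. - u) has_vector_derivative -1) (at (0 :: real))"
    unfolding has_real_derivative_iff_has_vector_derivative[symmetric] by (auto intro!: derivative_eq_intros)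
  have "((\<lambda>t. rr (mat_exp (t *\<^sub>R X))) has_vector_derivative dr X) (at (- 0))" using rr_mat_exp[OF X] by simp
  from vector_diff_chain_at[OF lin this]
  have "((\<lambda>t. rr (mat_exp (- t *\<^sub>R X))) has_vector_derivative - dr X) (at 0)" by (simp add: o_def)
  from bounded_linear.has_vector_derivative[OF bounded_bilinear.bounded_linear_left[OF bounded_bilinear_matrix_mult] this, of "rr g"]
  have "((\<lambda>t. rr (mat_exp (- t *\<^sub>R X)) ** rr g) has_vector_derivative - dr X ** rr g) (at 0)" .
  moreover have "- dr X ** rr g = - (dr X ** rr g)" by (simp add: matrix_matrix_mult_def vec_eq_iff sum_negf)
  moreover have "rr (mat_exp (- t *\<^sub>R X) ** g) = rr (mat_exp (- t *\<^sub>R X)) ** rr g" for t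
    by (rule rr_mult[OF mat_exp_GR[OF X] gR])
  ultimately show "((\<lambda>t. rr (mat_exp (- t *\<^sub>R X) ** g)) has_vector_derivative - (dr X ** rr g)) (at 0)"
    by (simp only:)
  from bounded_linear.has_vector_derivative[OF bounded_bilinear.bounded_linear_right[OF bounded_bilinear_matrix_mult] rr_mat_exp[OF X], of "ri g"]
  have "((\<lambda>t. ri g ** rr (mat_exp (t *\<^sub>R X))) has_vector_derivative ri g ** dr X) (at 0)" .
  moreover have "ri (mat_exp (- t *\<^sub>R X) ** g) = ri g ** rr (mat_exp (t *\<^sub>R X))" for t
  proof -
    have e: "mat_exp (- t *\<^sub>R X) \<in> GR" "mat_exp (t *\<^sub>R X) \<in> GR" by (rule mat_exp_GR[OF X])+
    have "matrix_inv (mat_exp (- t *\<^sub>R X)) = mat_exp (t *\<^sub>R X)"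
      using mat_exp_minus[of "- t" X] by (intro matrix_inv_unique[OF e(1)]) simp
    then show ?thesis using inv_mult_GR[OF e(1) gR] rr_mult[OF inv_GR[OF gR] e(2)] by (simp add: ri_def)
  qed
  ultimately show "((\<lambda>t. ri (mat_exp (- t *\<^sub>R X) ** g)) has_vector_derivative ri g ** dr X) (at 0)"
    by (simp only:)
qed

lemma entry_has_vector_derivative:
  fixes M :: "real \<Rightarrow> real^'k^'l"
  assumes "(M has_vector_derivative D) (at t)"
  shows "((\<lambda>t. complex_of_real (M t $ i $ j)) has_vector_derivative complex_of_real (D $ i $ j)) (at t)"
  using assms
  by (intro bounded_linear.has_vector_derivative[OF bounded_linear_of_real]
      bounded_linear.has_vector_derivative[OF bounded_linear_vec_nth])

lemma rapid_class_left_derivative: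
  assumes F: "F \<in> rapid_class" and X: "X \<in> lie"
  shows "\<exists>F'\<in>rapid_class. \<forall>g\<in>G. ((\<lambda>t. F (mat_exp (- t *\<^sub>R X) ** g)) has_vector_derivative F' g) (at 0)"
  using F
proof (induction rule: rapid_class.induct)
  case (base D)
  have "dL X \<in> dL_enveloping G" using X by (intro dL_enveloping.lie) (simp add: lie_algebra_G)
  from rapid_class.base[OF dL_enveloping.mult[OF this base]] have "dL X (D f) \<in> rapid_class" .
  then show ?case
    using smooth_on_group_flow(2)[OF smooth_on_group_enveloping[OF base smooth_f] X] by blast
next
  case (add F H)
  then obtain F' H' where "F' \<in> rapid_class" "\<forall>g\<in>G. ((\<lambda>t. F (mat_exp (- t *\<^sub>R X) ** g)) has_vector_derivative F' g) (at 0)"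
    "H' \<in> rapid_class" "\<forall>g\<in>G. ((\<lambda>t. H (mat_exp (- t *\<^sub>R X) ** g)) has_vector_derivative H' g) (at 0)" by blast
  then show ?case by (intro bexI[of _ "\<lambda>g. F' g + H' g"]) (auto intro: has_vector_derivative_add rapid_class.add)
next
  case (scale F c)
  then obtain F' where "F' \<in> rapid_class" "\<forall>g\<in>G. ((\<lambda>t. F (mat_exp (- t *\<^sub>R X) ** g)) has_vector_derivative F' g) (at 0)" by blast
  then show ?case
    by (intro bexI[of _ "\<lambda>g. c * F' g"]) (auto intro: has_vector_derivative_mult_right rapid_class.scale)
next
  case (rr_coeff F i j)
  then obtain F' where F': "F' \<in> rapid_class" "\<And>g. g \<in> G \<Longrightarrow> ((\<lambda>t. F (mat_exp (- t *\<^sub>R X) ** g)) has_vector_derivative F' g) (at 0)" by blast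
  let ?H = "\<lambda>g. complex_of_real (rr g $ i $ j) * F' g +
      (\<Sum>k\<in>UNIV. complex_of_real (- dr X $ i $ k) * (complex_of_real (rr g $ k $ j) * F g))"
  have "?H \<in> rapid_class" by (intro rapid_class.add rapid_class.rr_coeff rapid_class_sum rapid_class.scale F' rr_coeff)
  moreover have "((\<lambda>t. complex_of_real (rr (mat_exp (- t *\<^sub>R X) ** g) $ i $ j) * F (mat_exp (- t *\<^sub>R X) ** g))
      has_vector_derivative ?H g) (at 0)" if g: "g \<in> G" for g
  proof -
    have z: "mat_exp (- 0 *\<^sub>R X) ** g = g" by simp
    have e: "complex_of_real ((- (dr X ** rr g)) $ i $ j) = (\<Sum>k\<in>UNIV. complex_of_real (- dr X $ i $ k) * complex_of_real (rr g $ k $ j))"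
      by (simp add: matrix_matrix_mult_def sum_negf)
    have "complex_of_real (rr (mat_exp (- 0 *\<^sub>R X) ** g) $ i $ j) * F' g +
        complex_of_real ((- (dr X ** rr g)) $ i $ j) * F (mat_exp (- 0 *\<^sub>R X) ** g) = ?H g"
      unfolding z e by (simp only: sum_distrib_right mult.assoc)
    then show ?thesis
      using has_vector_derivative_mult[OF entry_has_vector_derivative[OF flow_rr(1)[OF X g], of i j] F'(2)[OF g]]
      by (simp only:)
  qed
  ultimately show ?case by (intro bexI[of _ ?H] ballI)
next
  case (ri_coeff F i j)
  then obtain F' where F': "F' \<in> rapid_class" "\<And>g. g \<in> G \<Longrightarrow> ((\<lambda>t. F (mat_exp (- t *\<^sub>R X) ** g)) has_vector_derivative F' g) (at 0)" by blast
  let ?H = "\<lambda>g. complex_of_real (ri g $ i $ j) * F' g +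
      (\<Sum>k\<in>UNIV. complex_of_real (dr X $ k $ j) * (complex_of_real (ri g $ i $ k) * F g))"
  have "?H \<in> rapid_class" by (intro rapid_class.add rapid_class.ri_coeff rapid_class_sum rapid_class.scale F' ri_coeff)
  moreover have "((\<lambda>t. complex_of_real (ri (mat_exp (- t *\<^sub>R X) ** g) $ i $ j) * F (mat_exp (- t *\<^sub>R X) ** g))
      has_vector_derivative ?H g) (at 0)" if g: "g \<in> G" for g
  proof -
    have z: "mat_exp (- 0 *\<^sub>R X) ** g = g" by simp
    have e: "complex_of_real ((ri g ** dr X) $ i $ j) = (\<Sum>k\<in>UNIV. complex_of_real (dr X $ k $ j) * complex_of_real (ri g $ i $ k))"
      by (simp add: matrix_matrix_mult_def mult.commute)
    have "complex_of_real (ri (mat_exp (- 0 *\<^sub>R X) ** g) $ i $ j) * F' g +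
        complex_of_real ((ri g ** dr X) $ i $ j) * F (mat_exp (- 0 *\<^sub>R X) ** g) = ?H g"
      unfolding z e by (simp only: sum_distrib_right mult.assoc)
    then show ?thesis
      using has_vector_derivative_mult[OF entry_has_vector_derivative[OF flow_rr(2)[OF X g], of i j] F'(2)[OF g]]
      by (simp only:)
  qed
  ultimately show ?case by (intro bexI[of _ ?H] ballI)
qed

section \<open>Decay of the group Fourier transform\<close>

text \<open>The integrand of the group Fourier transform; \<open>wave_integral f\<close> is \<^const>\<open>group_fourier\<close>.\<close>

definition wave :: "real^'n \<Rightarrow> real^'n \<Rightarrow> real^'m^'m \<Rightarrow> complex" where
  "wave m \<xi> g = exp (\<i> * complex_of_real ((ri g *v m) \<bullet> \<xi>))"

definition wave_integral :: "(real^'m^'m \<Rightarrow> complex) \<Rightarrow> real^'n \<Rightarrow> real^'n \<Rightarrow> complex" where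
  "wave_integral F m \<xi> = (\<integral>g. F g * wave m \<xi> g \<partial>\<mu>)"

lemma norm_wave [simp]: "norm (wave m \<xi> g) = 1"
  by (simp add: wave_def)

lemma wave_continuous: "continuous_on G (wave m \<xi>)"
  unfolding wave_def
  by (intro continuous_intros bounded_bilinear.continuous_on[OF bounded_bilinear_matrix_vector_mult] ri_continuous_G)

lemma wave_integrable: "F \<in> rapid_class \<Longrightarrow> integrable \<mu> (\<lambda>g. F g * wave m \<xi> g)"
  using continuous_measurable[OF wave_continuous]
  by (intro Bochner_Integration.integrable_bound[OF rapid_class_integrable]) (auto simp: norm_mult)

lemma rapid_class_pairing: "F \<in> rapid_class \<Longrightarrow> (\<lambda>g. complex_of_real ((ri g *v y) \<bullet> \<xi>) * F g) \<in> rapid_class"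
proof -
  assume F: "F \<in> rapid_class"
  have "(\<lambda>g. \<Sum>k\<in>UNIV. \<Sum>l\<in>UNIV. complex_of_real (y $ l * \<xi> $ k) * (complex_of_real (ri g $ k $ l) * F g)) \<in> rapid_class"
    by (intro rapid_class_sum rapid_class.scale rapid_class.ri_coeff F)
  then show ?thesis
    by (simp add: inner_vec_def matrix_vector_mult_def sum_distrib_left sum_distrib_right mult_ac)
qed

text \<open>Applied to \<open>F\<close> times the wave, whose left derivative along \<open>X\<close> produces the factor
\<open>(ri g *v (dr X *v m)) \<bullet> \<xi>\<close>.\<close>

lemma integration_by_parts:
  assumes F: "F \<in> rapid_class" "F' \<in> rapid_class" and X: "X \<in> lie"
    and d: "\<And>g. g \<in> G \<Longrightarrow> ((\<lambda>t. F (mat_exp (- t *\<^sub>R X) ** g)) has_vector_derivative F' g) (at 0)"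
  shows "wave_integral (\<lambda>g. complex_of_real ((ri g *v (dr X *v m)) \<bullet> \<xi>) * F g) m \<xi> = \<i> * wave_integral F' m \<xi>"
proof -
  let ?q = "\<lambda>g. complex_of_real ((ri g *v (dr X *v m)) \<bullet> \<xi>)"
  define H where "H g = F g * wave m \<xi> g" for g
  define H' where "H' g = F' g * wave m \<xi> g + \<i> * ((?q g * F g) * wave m \<xi> g)" for g
  note i = wave_integrable[OF F(2), of m \<xi>] wave_integrable[OF rapid_class_pairing[OF F(1), of "dr X *v m" \<xi>], of m \<xi>]
  have "(\<integral>g. H' g \<partial>\<mu>) = 0"
  proof (rule integral_left_derivative_zero[OF X])
    show "continuous_on G H" unfolding H_def[abs_def]
      by (intro continuous_intros rapid_class_continuous F wave_continuous)
    show "continuous_on G H'" unfolding H'_def[abs_def]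
      by (intro continuous_intros rapid_class_continuous F wave_continuous bounded_bilinear.continuous_on[OF bounded_bilinear_matrix_vector_mult] ri_continuous_G)
    show "integrable \<mu> H" unfolding H_def[abs_def] by (rule wave_integrable[OF F(1)])
    show "integrable \<mu> H'" unfolding H'_def[abs_def]
      by (intro Bochner_Integration.integrable_add integrable_mult_right i)
    fix g assume g: "g \<in> G"
    have "((\<lambda>t. (ri (mat_exp (- t *\<^sub>R X) ** g) *v m) \<bullet> \<xi>) has_vector_derivative ((ri g ** dr X) *v m) \<bullet> \<xi>) (at 0)"
      by (rule bounded_linear.has_vector_derivative[OF bounded_linear_inner_left],
          rule bounded_linear.has_vector_derivative[OF bounded_bilinear.bounded_linear_left[OF bounded_bilinear_matrix_vector_mult]],
          rule flow_rr(2)[OF X g])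
    then have "((\<lambda>t. \<i> * complex_of_real ((ri (mat_exp (- t *\<^sub>R X) ** g) *v m) \<bullet> \<xi>)) has_vector_derivative \<i> * ?q g) (at 0)"
      by (intro has_vector_derivative_mult_right bounded_linear.has_vector_derivative[OF bounded_linear_of_real])
        (simp add: matrix_vector_mul_assoc)
    from field_vector_diff_chain_at[OF this DERIV_exp]
    have "((\<lambda>t. wave m \<xi> (mat_exp (- t *\<^sub>R X) ** g)) has_vector_derivative \<i> * ?q g * wave m \<xi> g) (at 0)"
      by (simp add: o_def wave_def)
    from has_vector_derivative_mult[OF d[OF g] this]
    show "((\<lambda>t. H (mat_exp (- t *\<^sub>R X) ** g)) has_vector_derivative H' g) (at 0)"
      by (simp add: H_def H'_def algebra_simps)
  qed
  moreover have "(\<integral>g. H' g \<partial>\<mu>) = wave_integral F' m \<xi> + \<i> * wave_integral (\<lambda>g. ?q g * F g) m \<xi>"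
    unfolding H'_def wave_integral_def using i by (simp add: Bochner_Integration.integral_add)
  ultimately have "\<i> * (wave_integral F' m \<xi> + \<i> * wave_integral (\<lambda>g. ?q g * F g) m \<xi>) = 0" by simp
  then show ?thesis by (simp add: distrib_left mult.assoc[symmetric])
qed

text \<open>For fixed \<open>m\<close> this is \<open>dr_surjective\<close>. The bound on the coefficients that is uniform on a
compact set comes from the positive definite form \<open>q m\<close>, which is bounded below on the product of the compact
set with the unit sphere: the coefficients are chosen as those of least norm.\<close>

lemma uniform_spanning:
  assumes K: "compact K" "K \<subseteq> U"
  shows "\<exists>E M. finite E \<and> E \<subseteq> lie \<and> (\<forall>m\<in>K. \<forall>e. norm e \<le> 1 \<longrightarrow> (\<exists>c. e = (\<Sum>b\<in>E. c b *\<^sub>R (dr b *v m)) \<and> (\<forall>b\<in>E. \<bar>c b\<bar> \<le> M)))"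
proof -
  obtain E where E: "E \<subseteq> lie" "independent E" "span E = lie"
    using orthonormal_basis_subspace[OF subspace_lie] by metis
  have fin: "finite E" using E(2) by (rule independent_imp_finite)
  show ?thesis
  proof (cases "K = {}")
    case True
    then show ?thesis using fin E(1) by blast
  next
    case False
    define q where "q m \<eta> = (\<Sum>b\<in>E. ((dr b *v m) \<bullet> \<eta>)\<^sup>2)" for m \<eta>
    have cont: "continuous_on UNIV (\<lambda>m. dr b *v m)" for b
      by (intro linear_continuous_on bounded_bilinear.bounded_linear_right[OF bounded_bilinear_matrix_vector_mult])
    have qc: "continuous_on S (\<lambda>p. q (fst p) (snd p))" for S
      unfolding q_def
      by (intro continuous_intros continuous_on_compose2[OF cont]) auto
    have qpos: "q m \<eta> > 0" if m: "m \<in> U" and \<eta>: "\<eta> \<noteq> 0" for m \<eta>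
    proof (rule ccontr)
      assume "\<not> q m \<eta> > 0"
      then have "q m \<eta> = 0" by (simp add: q_def sum_nonneg order_antisym not_less)
      then have z: "(dr b *v m) \<bullet> \<eta> = 0" if "b \<in> E" for b
        using that fin by (simp add: q_def sum_nonneg_eq_0_iff)
      obtain X where X: "X \<in> lie" "dr X *v m = \<eta>" using dr_surjective[OF dense m[unfolded U_def]] by blast
      have "linear (\<lambda>X. (dr X *v m) \<bullet> \<eta>)"
        by (intro linearI) (simp_all add: linear_add[OF linear_dr] linear_scale[OF linear_dr]
            matrix_vector_mult_add_rdistrib inner_add_left scaleR_matrix_vector_assoc[symmetric])
      then have "(dr X *v m) \<bullet> \<eta> = 0"
        using linear_eq_0_on_span[of "\<lambda>X. (dr X *v m) \<bullet> \<eta>" E X] z X(1) E(3) by simp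
      then show False using X(2) \<eta> by simp
    qed
    have cK: "compact (K \<times> sphere (0 :: real^'n) 1)" using K(1) by (intro compact_Times) auto
    have nK: "K \<times> sphere (0 :: real^'n) 1 \<noteq> {}"
    proof -
      have "axis undefined 1 \<in> sphere (0 :: real^'n) 1" by (simp add: norm_axis_1)
      then show ?thesis using False by blast
    qed
    from continuous_attains_inf[OF cK nK qc] obtain p0 where p0: "p0 \<in> K \<times> sphere 0 1"
      "\<forall>p\<in>K \<times> sphere 0 1. q (fst p0) (snd p0) \<le> q (fst p) (snd p)"
      by (elim bexE)
    define \<delta> where "\<delta> = q (fst p0) (snd p0)"
    have \<delta>: "\<delta> > 0" unfolding \<delta>_def using p0(1) K(2) by (intro qpos) auto
    have qlow: "q m \<eta> \<ge> \<delta> * (norm \<eta>)\<^sup>2" if m: "m \<in> K" for m \<eta>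
    proof (cases "\<eta> = 0")
      case False
      have "q m \<eta> = (norm \<eta>)\<^sup>2 * q m ((1 / norm \<eta>) *\<^sub>R \<eta>)"
        using False by (simp add: q_def sum_distrib_left power_mult_distrib power_divide)
      moreover have "q m ((1 / norm \<eta>) *\<^sub>R \<eta>) \<ge> \<delta>" using p0(2)[rule_format, of "(m, (1 / norm \<eta>) *\<^sub>R \<eta>)"] m False by (simp add: \<delta>_def)
      ultimately show ?thesis using mult_left_mono[of \<delta> "q m ((1 / norm \<eta>) *\<^sub>R \<eta>)" "(norm \<eta>)\<^sup>2"]
        by (simp add: mult.commute)
    qed (simp add: q_def)
    have "bounded ((\<lambda>p. dr (snd p) *v fst p) ` (K \<times> E))"
    proof -
      have "bounded ((\<lambda>m. dr b *v m) ` K)" for b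
        by (intro compact_imp_bounded compact_continuous_image continuous_on_subset[OF cont] K(1)) auto
      then have "bounded (\<Union>b\<in>E. (\<lambda>m. dr b *v m) ` K)" using fin by (intro bounded_UN) auto
      then show ?thesis by (rule bounded_subset) auto
    qed
    then obtain N where N: "\<And>m b. m \<in> K \<Longrightarrow> b \<in> E \<Longrightarrow> norm (dr b *v m) \<le> N"
      unfolding bounded_iff by fastforce
    have "\<exists>c. e = (\<Sum>b\<in>E. c b *\<^sub>R (dr b *v m)) \<and> (\<forall>b\<in>E. \<bar>c b\<bar> \<le> N * (1 / \<delta>))"
      if m: "m \<in> K" and e: "norm e \<le> 1" for m e
    proof -
      \<comment> \<open>The symmetric operator of the form \<open>q m\<close>; solving \<open>A v = e\<close> gives the coefficients
      \<open>(dr b *v m) \<bullet> v\<close>.\<close>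
      define A where "A \<eta> = (\<Sum>b\<in>E. ((dr b *v m) \<bullet> \<eta>) *\<^sub>R (dr b *v m))" for \<eta>
      have lin: "linear A"
        by (intro linearI) (simp_all add: A_def inner_add_right scaleR_add_left sum.distrib scaleR_sum_right)
      have Aq: "A \<eta> \<bullet> \<eta> = q m \<eta>" for \<eta> by (simp add: A_def q_def inner_sum_left power2_eq_square)
      have "inj A"
        unfolding linear_injective_0[OF lin]
      proof (intro allI impI)
        fix \<eta> assume "A \<eta> = 0"
        then have "\<delta> * (norm \<eta>)\<^sup>2 \<le> 0" using qlow[OF m, of \<eta>] Aq[of \<eta>] by simp
        then show "\<eta> = 0" using \<delta> by (simp add: mult_le_0_iff)
      qed
      then obtain v where v: "A v = e" using linear_injective_imp_surjective[OF lin] by (metis surjD)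
      have "\<delta> * (norm v)\<^sup>2 \<le> e \<bullet> v" using qlow[OF m, of v] Aq[of v] v by simp
      also have "\<dots> \<le> norm e * norm v" by (rule norm_cauchy_schwarz)
      also have "\<dots> \<le> 1 * norm v" using e by (intro mult_right_mono) auto
      finally have "\<delta> * norm v \<le> 1" by (cases "norm v = 0") (auto simp: power2_eq_square)
      then have nv: "norm v \<le> 1 / \<delta>" using \<delta> by (simp add: field_simps)
      have "\<bar>(dr b *v m) \<bullet> v\<bar> \<le> N * (1 / \<delta>)" if "b \<in> E" for b
        using Cauchy_Schwarz_ineq2[of "dr b *v m" v] mult_mono[OF N[OF m that] nv] N[OF m that] norm_ge_zero[of "dr b *v m"]
        by (smt (verit) norm_ge_zero)
      then show ?thesis using v by (intro exI[of _ "\<lambda>b. (dr b *v m) \<bullet> v"]) (auto simp: A_def)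
    qed
    then show ?thesis using fin E(1) by blast
  qed
qed

text \<open>Each coordinate of \<open>\<xi>\<close> is removed by one integration by parts. The function \<open>F\<close> changes to a left
derivative of an entry of \<open>rr\<close> times \<open>F\<close>, so the induction runs over the whole class.\<close>

lemma wave_integral_decay:
  assumes K: "compact K" "K \<subseteq> U"
  shows "F \<in> rapid_class \<Longrightarrow> \<exists>C. \<forall>m\<in>K. \<forall>\<xi>. norm \<xi> ^ N * norm (wave_integral F m \<xi>) \<le> C"
proof (induction N arbitrary: F)
  case 0
  have "norm (wave_integral F m \<xi>) \<le> (\<integral>g. norm (F g) \<partial>\<mu>)" for m \<xi>
    unfolding wave_integral_def by (rule order_trans[OF integral_norm_bound]) (simp add: norm_mult)
  then show ?case by auto
next
  case (Suc N)
  from uniform_spanning[OF K] obtain E M where E: "finite E" "E \<subseteq> lie"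
    "\<forall>m\<in>K. \<forall>e. norm e \<le> 1 \<longrightarrow> (\<exists>c. e = (\<Sum>b\<in>E. c b *\<^sub>R (dr b *v m)) \<and> (\<forall>b\<in>E. \<bar>c b\<bar> \<le> M))"
    by (elim exE conjE)
  define H where "H j k g = complex_of_real (rr g $ j $ k) * F g" for j k g
  have H: "H j k \<in> rapid_class" for j k unfolding H_def[abs_def] by (intro rapid_class.rr_coeff Suc)
  have "\<forall>b\<in>E. \<forall>j k. \<exists>F'. F' \<in> rapid_class \<and> (\<forall>g\<in>G. ((\<lambda>t. H j k (mat_exp (- t *\<^sub>R b) ** g)) has_vector_derivative F' g) (at 0))"
    using rapid_class_left_derivative[OF H] E(2) by blast
  then obtain H' where H': "\<And>b j k. b \<in> E \<Longrightarrow> H' b j k \<in> rapid_class"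
    "\<And>b j k g. b \<in> E \<Longrightarrow> g \<in> G \<Longrightarrow> ((\<lambda>t. H j k (mat_exp (- t *\<^sub>R b) ** g)) has_vector_derivative H' b j k g) (at 0)"
    by metis
  have "\<forall>b\<in>E. \<forall>j k. \<exists>C. \<forall>m\<in>K. \<forall>\<xi>. norm \<xi> ^ N * norm (wave_integral (H' b j k) m \<xi>) \<le> C"
    using Suc.IH[OF H'(1)] by blast
  then obtain C where C: "\<And>b j k m \<xi>. b \<in> E \<Longrightarrow> m \<in> K \<Longrightarrow> norm \<xi> ^ N * norm (wave_integral (H' b j k) m \<xi>) \<le> C b j k"
    by metis
  have comp: "\<bar>\<xi> $ k\<bar> * norm (wave_integral F m \<xi>) \<le> (\<Sum>j\<in>UNIV. \<Sum>b\<in>E. \<bar>M\<bar> * norm (wave_integral (H' b j k) m \<xi>))" if m: "m \<in> K" for m \<xi> k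
  proof -
    have "\<forall>j. \<exists>c. axis j 1 = (\<Sum>b\<in>E. c b *\<^sub>R (dr b *v m)) \<and> (\<forall>b\<in>E. \<bar>c b\<bar> \<le> M)"
      using E(3) m by (simp add: norm_axis_1)
    from choice[OF this] obtain c where
      "\<forall>j. axis j 1 = (\<Sum>b\<in>E. c j b *\<^sub>R (dr b *v m)) \<and> (\<forall>b\<in>E. \<bar>c j b\<bar> \<le> M)" by (elim exE)
    then have c: "\<And>j. axis j 1 = (\<Sum>b\<in>E. c j b *\<^sub>R (dr b *v m))" "\<And>j b. b \<in> E \<Longrightarrow> \<bar>c j b\<bar> \<le> M" by auto
    \<comment> \<open>The basis vector is pushed forward by \<open>rr g\<close>, expanded in the vectors \<open>dr b *v m\<close> at the fixed
    point \<open>m\<close>, and pulled back by \<open>ri g\<close>.\<close>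
    have xi: "\<xi> $ k = (\<Sum>j\<in>UNIV. \<Sum>b\<in>E. c j b * (rr g $ j $ k * ((ri g *v (dr b *v m)) \<bullet> \<xi>)))" if g: "g \<in> G" for g
    proof -
      have gR: "g \<in> GR" using g G_sub_GR by blast
      have lin: "linear (\<lambda>y. (ri g *v y) \<bullet> \<xi>)"
        by (intro linearI) (simp_all add: matrix_vector_right_distrib inner_add_left matrix_vector_mult_scaleR)
      have "\<xi> $ k = (ri g *v (rr g *v axis k 1)) \<bullet> \<xi>"
        by (simp add: matrix_vector_mul_assoc ri_def rr_inv(2)[OF gR] inner_axis' )
      also have "rr g *v axis k 1 = (\<Sum>j\<in>UNIV. rr g $ j $ k *\<^sub>R axis j 1)"
        by (simp add: vec_eq_iff matrix_vector_mult_def axis_def if_distrib[of "(*) _"] cong: if_cong)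
      also have "(ri g *v \<dots>) \<bullet> \<xi> = (\<Sum>j\<in>UNIV. rr g $ j $ k * ((ri g *v axis j 1) \<bullet> \<xi>))"
        using linear_sum[OF lin, of "\<lambda>j. rr g $ j $ k *\<^sub>R axis j 1" UNIV] linear_scale[OF lin] by simp
      also have "\<dots> = (\<Sum>j\<in>UNIV. rr g $ j $ k * (\<Sum>b\<in>E. c j b * ((ri g *v (dr b *v m)) \<bullet> \<xi>)))"
        using linear_sum[OF lin, of "\<lambda>b. c j b *\<^sub>R (dr b *v m)" E for j] linear_scale[OF lin]
        by (intro sum.cong refl) (simp add: c(1))
      finally show ?thesis by (simp add: sum_distrib_left mult_ac)
    qed
    let ?P = "\<lambda>b j g. complex_of_real ((ri g *v (dr b *v m)) \<bullet> \<xi>) * H j k g"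
    have "complex_of_real (\<xi> $ k) * wave_integral F m \<xi> = (\<integral>g. complex_of_real (\<xi> $ k) * (F g * wave m \<xi> g) \<partial>\<mu>)"
      by (simp add: wave_integral_def)
    also have "\<dots> = (\<integral>g. (\<Sum>j\<in>UNIV. \<Sum>b\<in>E. complex_of_real (c j b) * (?P b j g * wave m \<xi> g)) \<partial>\<mu>)"
    proof (intro Bochner_Integration.integral_cong refl)
      fix g assume "g \<in> space \<mu>"
      then have g: "g \<in> G" by (simp add: space_mu)
      have "complex_of_real (\<xi> $ k) = (\<Sum>j\<in>UNIV. \<Sum>b\<in>E. complex_of_real (c j b) *
          (complex_of_real (rr g $ j $ k) * complex_of_real ((ri g *v (dr b *v m)) \<bullet> \<xi>)))"
        by (subst xi[OF g]) simp
      then show "complex_of_real (\<xi> $ k) * (F g * wave m \<xi> g) =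
          (\<Sum>j\<in>UNIV. \<Sum>b\<in>E. complex_of_real (c j b) * (?P b j g * wave m \<xi> g))"
        by (simp add: H_def sum_distrib_left sum_distrib_right mult_ac)
    qed
    also have "\<dots> = (\<Sum>j\<in>UNIV. \<Sum>b\<in>E. complex_of_real (c j b) * wave_integral (?P b j) m \<xi>)"
      using wave_integrable[OF rapid_class_pairing[OF H]] by (simp add: wave_integral_def Bochner_Integration.integral_sum)
    also have "\<dots> = (\<Sum>j\<in>UNIV. \<Sum>b\<in>E. complex_of_real (c j b) * (\<i> * wave_integral (H' b j k) m \<xi>))"
      using integration_by_parts[OF H H'(1) _ H'(2)] E(2) by (intro sum.cong refl) auto
    finally have "norm (complex_of_real (\<xi> $ k) * wave_integral F m \<xi>) \<le> (\<Sum>j\<in>UNIV. \<Sum>b\<in>E. norm (complex_of_real (c j b) * (\<i> * wave_integral (H' b j k) m \<xi>)))"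
      by (simp only:) (intro order_trans[OF norm_sum] sum_mono norm_sum)
    also have "\<dots> \<le> (\<Sum>j\<in>UNIV. \<Sum>b\<in>E. \<bar>M\<bar> * norm (wave_integral (H' b j k) m \<xi>))"
    proof (intro sum_mono)
      fix j b assume "b \<in> E"
      then have "\<bar>c j b\<bar> \<le> \<bar>M\<bar>" using c(2)[of b j] by linarith
      then show "norm (complex_of_real (c j b) * (\<i> * wave_integral (H' b j k) m \<xi>)) \<le> \<bar>M\<bar> * norm (wave_integral (H' b j k) m \<xi>)"
        by (simp add: norm_mult mult_right_mono)
    qed
    finally show ?thesis by (simp add: norm_mult)
  qed
  have "norm \<xi> ^ Suc N * norm (wave_integral F m \<xi>) \<le> (\<Sum>k\<in>UNIV. \<Sum>j\<in>UNIV. \<Sum>b\<in>E. \<bar>M\<bar> * C b j k)" if m: "m \<in> K" for m \<xi>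
  proof -
    have "norm \<xi> ^ Suc N * norm (wave_integral F m \<xi>) \<le> norm \<xi> ^ N * ((\<Sum>k\<in>UNIV. \<bar>\<xi> $ k\<bar>) * norm (wave_integral F m \<xi>))"
    proof -
      have "norm \<xi> ^ N * (norm \<xi> * norm (wave_integral F m \<xi>)) \<le> norm \<xi> ^ N * ((\<Sum>k\<in>UNIV. \<bar>\<xi> $ k\<bar>) * norm (wave_integral F m \<xi>))"
        by (intro mult_left_mono mult_right_mono norm_le_l1_cart) auto
      then show ?thesis by (simp add: mult_ac)
    qed
    also have "\<dots> = norm \<xi> ^ N * (\<Sum>k\<in>UNIV. \<bar>\<xi> $ k\<bar> * norm (wave_integral F m \<xi>))" by (simp add: sum_distrib_right)
    also have "\<dots> \<le> norm \<xi> ^ N * (\<Sum>k\<in>UNIV. \<Sum>j\<in>UNIV. \<Sum>b\<in>E. \<bar>M\<bar> * norm (wave_integral (H' b j k) m \<xi>))"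
      by (intro mult_left_mono sum_mono comp m) auto
    also have "\<dots> = (\<Sum>k\<in>UNIV. \<Sum>j\<in>UNIV. \<Sum>b\<in>E. \<bar>M\<bar> * (norm \<xi> ^ N * norm (wave_integral (H' b j k) m \<xi>)))"
      by (simp add: sum_distrib_left mult_ac)
    also have "\<dots> \<le> (\<Sum>k\<in>UNIV. \<Sum>j\<in>UNIV. \<Sum>b\<in>E. \<bar>M\<bar> * C b j k)"
      by (intro sum_mono mult_left_mono C m) auto
    finally show ?thesis .
  qed
  then show ?case by blast
qed

section \<open>The symbol\<close>

text \<open>The phase of the symbol; it differs from \<^const>\<open>wave\<close> by a factor of modulus one that does not depend on
\<open>g\<close>.\<close>

definition phase :: "(real^'n) \<times> (real^'n) \<Rightarrow> real^'m^'m \<Rightarrow> complex" where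
  "phase p g = exp (\<i> * complex_of_real ((ri g *v fst p - fst p) \<bullet> snd p))"

definition phase_integral :: "(real^'m^'m \<Rightarrow> complex) \<Rightarrow> (real^'n) \<times> (real^'n) \<Rightarrow> complex" where
  "phase_integral F p = (\<integral>g. F g * phase p g \<partial>\<mu>)"

lemma phase_wave: "phase (m, \<xi>) g = exp (- \<i> * complex_of_real (m \<bullet> \<xi>)) * wave m \<xi> g"
  by (simp add: phase_def wave_def inner_diff_left algebra_simps flip: exp_add)

lemma phase_wave_mult:
  "F g * phase p g = exp (- \<i> * complex_of_real (fst p \<bullet> snd p)) * (F g * wave (fst p) (snd p) g)"
  using phase_wave[of "fst p" "snd p" g] by simp

lemma phase_integrable: "F \<in> rapid_class \<Longrightarrow> integrable \<mu> (\<lambda>g. F g * phase p g)"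
  unfolding phase_wave_mult by (intro integrable_mult_right wave_integrable)

lemma phase_integral_wave: "phase_integral F (m, \<xi>) = exp (- \<i> * complex_of_real (m \<bullet> \<xi>)) * wave_integral F m \<xi>"
  unfolding phase_integral_def wave_integral_def phase_wave_mult by simp

lemma norm_phase_integral: "norm (phase_integral F (m, \<xi>)) = norm (wave_integral F m \<xi>)"
  by (simp add: phase_integral_wave norm_mult)

lemma norm_phase [simp]: "norm (phase p g) = 1"
  by (simp add: phase_def)

lemma symbol_of_eq: "symbol_of \<rho> \<mu> f m \<xi> = phase_integral f (m, \<xi>)"
  by (simp add: symbol_of_def group_fourier_def phase_integral_wave wave_integral_def wave_def ri_def)

text \<open>The differential of the real phase at \<open>p\<close> in the direction \<open>w\<close>.\<close>

definition dphase :: "(real^'n) \<times> (real^'n) \<Rightarrow> (real^'n) \<times> (real^'n) \<Rightarrow> real^'m^'m \<Rightarrow> real" where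
  "dphase p w g = (ri g *v fst w - fst w) \<bullet> snd p + (ri g *v fst p - fst p) \<bullet> snd w"

lemma dphase_rapid_class:
  assumes "F \<in> rapid_class"
  shows "(\<lambda>g. \<i> * complex_of_real (dphase p w g) * F g) \<in> rapid_class"
proof -
  have "(\<lambda>g. \<i> * (complex_of_real ((ri g *v fst w) \<bullet> snd p) * F g + complex_of_real (- (fst w \<bullet> snd p)) * F g +
      (complex_of_real ((ri g *v fst p) \<bullet> snd w) * F g + complex_of_real (- (fst p \<bullet> snd w)) * F g))) \<in> rapid_class"
    by (intro rapid_class.scale rapid_class.add rapid_class_pairing assms)
  then show ?thesis by (simp add: dphase_def inner_diff_left algebra_simps)
qed

text \<open>The second-order remainder of the phase factor is bounded by the square of the norm of \<open>w\<close> times a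
quadratic polynomial in the norm of \<open>ri g\<close>, which the class absorbs.\<close>

lemma phase_integral_has_derivative:
  assumes F: "F \<in> rapid_class"
  shows "(phase_integral F has_derivative (\<lambda>w. phase_integral (\<lambda>g. \<i> * complex_of_real (dphase p w g) * F g) p)) (at p)"
proof -
  obtain K where K: "K > 0" "\<And>(A :: real^'n^'n) x. norm (A *v x) \<le> norm A * norm x * K"
    using bounded_bilinear.pos_bounded[OF bounded_bilinear_matrix_vector_mult] by blast
  define Z where "Z = (2 * norm p + 1)\<^sup>2"
  let ?r = "\<lambda>g. norm (ri g)"
  let ?A = "\<lambda>g. 1 + K * ?r g"
  define B where "B g = (Z * (?A g)\<^sup>2 + ?A g) * norm (F g)" for g
  show ?thesis
    unfolding phase_integral_def
  proof (rule has_derivative_integral)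
  have "integrable \<mu> (\<lambda>g. (Z + 1) * (?r g ^ 0 * norm (F g)) + (2 * Z * K + K) * (?r g ^ 1 * norm (F g)) + Z * K\<^sup>2 * (?r g ^ 2 * norm (F g)))"
    by (intro Bochner_Integration.integrable_add integrable_mult_right rapid_class_integrable_ri_power F)
  then show "integrable \<mu> B"
    by (rule Bochner_Integration.integrable_cong[THEN iffD1, rotated 2])
      (simp_all add: B_def power2_eq_square algebra_simps)
  show "integrable \<mu> (\<lambda>g. F g * phase z g)" for z by (rule phase_integrable[OF F])
  show "integrable \<mu> (\<lambda>g. (\<i> * complex_of_real (dphase p w g) * F g) * phase p g)" for w
    by (rule phase_integrable[OF dphase_rapid_class[OF F]])
  show "linear (\<lambda>w. (\<i> * complex_of_real (dphase p w g) * F g) * phase p g)" for g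
  proof -
    have "dphase p (u + v) g = dphase p u g + dphase p v g" for u v
      by (simp add: dphase_def matrix_vector_right_distrib inner_add_left inner_add_right inner_diff_left)
    moreover have "dphase p (r *\<^sub>R u) g = r * dphase p u g" for r u
      by (simp add: dphase_def matrix_vector_mult_scaleR inner_diff_left algebra_simps)
    ultimately show ?thesis by (intro linearI) (simp_all add: scaleR_conv_of_real algebra_simps)
  qed
  fix g :: "real^'m^'m" and w :: "(real^'n) \<times> (real^'n)"
  assume "g \<in> space \<mu>" and w: "norm w \<le> 1"
  define s where "s = dphase p w g + (ri g *v fst w - fst w) \<bullet> snd w"
  have disp: "norm (ri g *v h - h) \<le> ?A g * norm h" for h
    using order_trans[OF norm_triangle_ineq4 add_right_mono[OF K(2)]] by (simp add: algebra_simps)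
  have A0: "?A g \<ge> 0" using K(1) by simp
  have pair: "\<bar>(ri g *v h - h) \<bullet> \<eta>\<bar> \<le> ?A g * norm h * norm \<eta>" for h \<eta>
    using order_trans[OF Cauchy_Schwarz_ineq2 mult_right_mono[OF disp]] by simp
  have n: "norm (fst w) \<le> norm w" "norm (snd w) \<le> norm w" "norm (fst p) \<le> norm p" "norm (snd p) \<le> norm p"
    using norm_fst_le[of "fst w" "snd w"] norm_snd_le[of "snd w" "fst w"]
      norm_fst_le[of "fst p" "snd p"] norm_snd_le[of "snd p" "fst p"] by simp_all
  have bnd: "\<bar>(ri g *v h - h) \<bullet> \<eta>\<bar> \<le> ?A g * (a * b)" if "norm h \<le> a" "norm \<eta> \<le> b" "0 \<le> a" "0 \<le> b" for h \<eta> a b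
    using order_trans[OF pair, of h \<eta> "?A g * (a * b)"] mult_left_mono[OF mult_mono[OF that(1,2,3) norm_ge_zero] A0]
    by (simp add: mult.assoc)
  have q: "\<bar>(ri g *v fst w - fst w) \<bullet> snd w\<bar> \<le> ?A g * (norm w * norm w)" by (rule bnd) (use n in auto)
  have "\<bar>dphase p w g\<bar> \<le> ?A g * (norm w * norm p) + ?A g * (norm p * norm w)"
    unfolding dphase_def by (rule order_trans[OF abs_triangle_ineq add_mono[OF bnd bnd]]) (use n in auto)
  moreover have "norm w * norm w \<le> 1 * norm w" using w by (intro mult_right_mono) auto
  then have "?A g * (norm w * norm w) \<le> ?A g * norm w" using A0 by (intro mult_left_mono) auto
  ultimately have "\<bar>s\<bar> \<le> ?A g * (2 * norm p + 1) * norm w"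
    using q unfolding s_def by (simp add: algebra_simps)
  then have "s\<^sup>2 \<le> (?A g * (2 * norm p + 1) * norm w)\<^sup>2"
    by (metis abs_ge_zero power2_abs power_mono)
  then have s2: "s\<^sup>2 \<le> Z * (?A g)\<^sup>2 * (norm w)\<^sup>2" by (simp add: Z_def power_mult_distrib mult_ac)
  have ph: "phase (p + w) g = phase p g * exp (\<i> * complex_of_real s)"
    by (simp add: phase_def s_def dphase_def matrix_vector_right_distrib inner_add_left inner_add_right
        inner_diff_left algebra_simps flip: exp_add)
  have "F g * phase (p + w) g - F g * phase p g - \<i> * complex_of_real (dphase p w g) * F g * phase p g =
      F g * phase p g * ((exp (\<i> * complex_of_real s) - 1 - \<i> * complex_of_real s) +
        \<i> * complex_of_real ((ri g *v fst w - fst w) \<bullet> snd w))"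
    by (simp add: ph s_def algebra_simps)
  also have "norm \<dots> = norm (F g) * norm ((exp (\<i> * complex_of_real s) - 1 - \<i> * complex_of_real s) +
        \<i> * complex_of_real ((ri g *v fst w - fst w) \<bullet> snd w))" by (simp add: norm_mult)
  also have "\<dots> \<le> norm (F g) * (s\<^sup>2 + \<bar>(ri g *v fst w - fst w) \<bullet> snd w\<bar>)"
    by (intro mult_left_mono order_trans[OF norm_triangle_ineq] add_mono norm_exp_remainder) (auto simp: norm_mult)
  also have "\<dots> \<le> norm (F g) * (Z * (?A g)\<^sup>2 * (norm w)\<^sup>2 + ?A g * (norm w)\<^sup>2)"
    using s2 q by (intro mult_left_mono add_mono) (auto simp: power2_eq_square)
  also have "\<dots> = B g * (norm w)\<^sup>2" by (simp add: B_def algebra_simps)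
  finally show "norm (F g * phase (p + w) g - F g * phase p g - \<i> * complex_of_real (dphase p w g) * F g * phase p g) \<le> B g * (norm w)\<^sup>2" .
  qed
qed

text \<open>The module over the polynomials in position and frequency that is spanned by the integrals
over the class. It is closed under differentiation, and its members decay as fast as the integrals
themselves, because the decay is faster than any power.\<close>

inductive_set symbol_module :: "((real^'n) \<times> (real^'n) \<Rightarrow> complex) set" where
  base: "F \<in> rapid_class \<Longrightarrow> phase_integral F \<in> symbol_module"
| add: "A \<in> symbol_module \<Longrightarrow> A' \<in> symbol_module \<Longrightarrow> (\<lambda>p. A p + A' p) \<in> symbol_module"
| scale: "A \<in> symbol_module \<Longrightarrow> (\<lambda>p. c * A p) \<in> symbol_module"
| space: "A \<in> symbol_module \<Longrightarrow> (\<lambda>p. complex_of_real (fst p $ i) * A p) \<in> symbol_module"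
| frequency: "A \<in> symbol_module \<Longrightarrow> (\<lambda>p. complex_of_real (snd p $ i) * A p) \<in> symbol_module"

lemma symbol_module_sum: "(\<And>i. i \<in> I \<Longrightarrow> A i \<in> symbol_module) \<Longrightarrow> (\<lambda>p. \<Sum>i\<in>I. A i p) \<in> symbol_module"
proof (induction I rule: infinite_finite_induct)
  case (insert i I)
  then show ?case using symbol_module.add[of "A i" "\<lambda>p. \<Sum>i\<in>I. A i p"] by simp
qed (use symbol_module.scale[OF symbol_module.base[OF f_rapid_class], of 0] in simp_all)

text \<open>The differential of the phase is a combination of entries of \<open>ri\<close> with coefficients that are linear in
position and frequency; these come out of the integral.\<close>

lemma dphase_symbol_module:
  assumes F: "F \<in> rapid_class"
  shows "(\<lambda>p. phase_integral (\<lambda>g. \<i> * complex_of_real (dphase p w g) * F g) p) \<in> symbol_module"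
proof -
  define H1 where "H1 k g = \<i> * (complex_of_real ((ri g *v fst w) \<bullet> axis k 1) * F g)" for k g
  define H2 where "H2 k g = \<i> * (complex_of_real ((ri g *v axis k 1) \<bullet> snd w) * F g)" for k g
  have H: "H1 k \<in> rapid_class" "H2 k \<in> rapid_class" for k
    unfolding H1_def[abs_def] H2_def[abs_def] by (intro rapid_class.scale rapid_class_pairing F)+
  define N1 where "N1 k g = H1 k g + (- \<i> * complex_of_real (fst w $ k)) * F g" for k g
  define N2 where "N2 k g = H2 k g + (- \<i> * complex_of_real (snd w $ k)) * F g" for k g
  have N: "N1 k \<in> rapid_class" "N2 k \<in> rapid_class" for k
    unfolding N1_def[abs_def] N2_def[abs_def] by (intro rapid_class.scale rapid_class.add H F)+
  have e: "\<i> * complex_of_real (dphase p w g) * F g =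
      (\<Sum>k\<in>UNIV. complex_of_real (snd p $ k) * N1 k g) +
      (\<Sum>k\<in>UNIV. complex_of_real (fst p $ k) * N2 k g)" for p g
  proof -
    have 1: "(ri g *v fst w - fst w) \<bullet> snd p = (\<Sum>k\<in>UNIV. snd p $ k * ((ri g *v fst w) \<bullet> axis k 1 - fst w $ k))"
      by (simp add: inner_vec_def[of _ "snd p"] inner_axis mult.commute)
    have "linear (\<lambda>y. (ri g *v y - y) \<bullet> snd w)"
      by (intro linearI) (simp_all add: matrix_vector_right_distrib inner_add_left matrix_vector_mult_scaleR
          inner_diff_left algebra_simps)
    from linear_sum[OF this, of "\<lambda>k. fst p $ k *\<^sub>R axis k 1" UNIV] linear_scale[OF this]
    have "(ri g *v (\<Sum>k\<in>UNIV. fst p $ k *\<^sub>R axis k 1) - (\<Sum>k\<in>UNIV. fst p $ k *\<^sub>R axis k 1)) \<bullet> snd w =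
        (\<Sum>k\<in>UNIV. fst p $ k * ((ri g *v axis k 1 - axis k 1) \<bullet> snd w))" by simp
    moreover have "(\<Sum>k\<in>UNIV. fst p $ k *\<^sub>R axis k 1) = fst p"
      by (simp add: vec_eq_iff axis_def if_distrib[of "(*) _"] cong: if_cong)
    ultimately have 2: "(ri g *v fst p - fst p) \<bullet> snd w = (\<Sum>k\<in>UNIV. fst p $ k * ((ri g *v axis k 1) \<bullet> snd w - snd w $ k))"
      by (simp add: inner_diff_left inner_axis')
    show ?thesis
      unfolding dphase_def 1 2 N1_def N2_def H1_def H2_def
      by (simp add: sum_distrib_left sum_distrib_right sum.distrib algebra_simps sum_subtractf sum_negf)
  qed
  have i: "integrable \<mu> (\<lambda>g. (\<Sum>k\<in>UNIV. complex_of_real (snd p $ k) * N1 k g) * phase p g)"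
    "integrable \<mu> (\<lambda>g. (\<Sum>k\<in>UNIV. complex_of_real (fst p $ k) * N2 k g) * phase p g)" for p
    by (intro phase_integrable rapid_class_sum rapid_class.scale N)+
  have i': "integrable \<mu> (\<lambda>g. N1 k g * phase p g)"
    "integrable \<mu> (\<lambda>g. N2 k g * phase p g)" for k p
    by (intro phase_integrable N)+
  have "phase_integral (\<lambda>g. \<i> * complex_of_real (dphase p w g) * F g) p =
      (\<Sum>k\<in>UNIV. complex_of_real (snd p $ k) * phase_integral (N1 k) p) +
      (\<Sum>k\<in>UNIV. complex_of_real (fst p $ k) * phase_integral (N2 k) p)" for p
    unfolding phase_integral_def e distrib_right
    using i[of p] i'[where p=p]
    by (simp add: Bochner_Integration.integral_add Bochner_Integration.integral_sum sum_distrib_right mult.assoc)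
  then show ?thesis
    by (simp only:) (intro symbol_module.add symbol_module_sum symbol_module.space symbol_module.frequency symbol_module.base N)
qed

lemma symbol_module_derivative:
  assumes "A \<in> symbol_module"
  shows "\<exists>D. (\<forall>p. (A has_derivative D p) (at p)) \<and> (\<forall>w. (\<lambda>p. D p w) \<in> symbol_module)"
  using assms
proof (induction rule: symbol_module.induct)
  case (base F)
  then show ?case
    by (intro exI[of _ "\<lambda>p w. phase_integral (\<lambda>g. \<i> * complex_of_real (dphase p w g) * F g) p"] conjI allI
        phase_integral_has_derivative dphase_symbol_module)
next
  case (add A A')
  then obtain D D' where D: "\<And>p. (A has_derivative D p) (at p)" "\<And>w. (\<lambda>p. D p w) \<in> symbol_module"
    "\<And>p. (A' has_derivative D' p) (at p)" "\<And>w. (\<lambda>p. D' p w) \<in> symbol_module" by (elim exE conjE) blast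
  then show ?case
    by (intro exI[of _ "\<lambda>p w. D p w + D' p w"] conjI allI has_derivative_add symbol_module.add)
next
  case (scale A c)
  then obtain D where D: "\<And>p. (A has_derivative D p) (at p)" "\<And>w. (\<lambda>p. D p w) \<in> symbol_module" by (elim exE conjE) blast
  then show ?case
    by (intro exI[of _ "\<lambda>p w. c * D p w"] conjI allI has_derivative_mult_right symbol_module.scale)
next
  case (space A i)
  then obtain D where D: "\<And>p. (A has_derivative D p) (at p)" "\<And>w. (\<lambda>p. D p w) \<in> symbol_module" by (elim exE conjE) blast
  have "bounded_linear (\<lambda>p :: (real^'n) \<times> (real^'n). complex_of_real (fst p $ i))"
    by (intro bounded_linear_compose[OF bounded_linear_of_real] bounded_linear_compose[OF bounded_linear_vec_nth bounded_linear_fst])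
  from has_derivative_mult[OF bounded_linear_imp_has_derivative[OF this] D(1)]
  show ?case
    by (intro exI[of _ "\<lambda>p w. complex_of_real (fst p $ i) * D p w + complex_of_real (fst w $ i) * A p"] conjI allI
        symbol_module.add symbol_module.space symbol_module.scale D space)
next
  case (frequency A i)
  then obtain D where D: "\<And>p. (A has_derivative D p) (at p)" "\<And>w. (\<lambda>p. D p w) \<in> symbol_module" by (elim exE conjE) blast
  have "bounded_linear (\<lambda>p :: (real^'n) \<times> (real^'n). complex_of_real (snd p $ i))"
    by (intro bounded_linear_compose[OF bounded_linear_of_real] bounded_linear_compose[OF bounded_linear_vec_nth bounded_linear_snd])
  from has_derivative_mult[OF bounded_linear_imp_has_derivative[OF this] D(1)]
  show ?case
    by (intro exI[of _ "\<lambda>p w. complex_of_real (snd p $ i) * D p w + complex_of_real (snd w $ i) * A p"] conjI allI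
        symbol_module.add symbol_module.frequency symbol_module.scale D frequency)
qed

lemma symbol_module_decay:
  assumes K: "compact K" "K \<subseteq> U"
  shows "A \<in> symbol_module \<Longrightarrow> \<exists>C. \<forall>m\<in>K. \<forall>\<xi>. norm \<xi> ^ N * norm (A (m, \<xi>)) \<le> C"
proof (induction arbitrary: N rule: symbol_module.induct)
  case (base F)
  then show ?case using wave_integral_decay[OF K] by (simp add: norm_phase_integral)
next
  case (add A A')
  obtain C C' where C: "\<And>m \<xi>. m \<in> K \<Longrightarrow> norm \<xi> ^ N * norm (A (m, \<xi>)) \<le> C"
    "\<And>m \<xi>. m \<in> K \<Longrightarrow> norm \<xi> ^ N * norm (A' (m, \<xi>)) \<le> C'" using add.IH[of N] by (elim exE) blast
  have "norm \<xi> ^ N * norm (A (m, \<xi>) + A' (m, \<xi>)) \<le> C + C'" if "m \<in> K" for m \<xi>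
  proof -
    have "norm \<xi> ^ N * norm (A (m, \<xi>) + A' (m, \<xi>)) \<le> norm \<xi> ^ N * (norm (A (m, \<xi>)) + norm (A' (m, \<xi>)))"
      by (intro mult_left_mono norm_triangle_ineq) auto
    then show ?thesis using C[OF that, of \<xi>] by (simp add: distrib_left)
  qed
  then show ?case by blast
next
  case (scale A c)
  obtain C where C: "\<And>m \<xi>. m \<in> K \<Longrightarrow> norm \<xi> ^ N * norm (A (m, \<xi>)) \<le> C" using scale.IH[of N] by (elim exE) blast
  have "norm \<xi> ^ N * norm (c * A (m, \<xi>)) \<le> norm c * C" if "m \<in> K" for m \<xi>
    using mult_left_mono[OF C[OF that, of \<xi>], of "norm c"] by (simp add: norm_mult mult_ac)
  then show ?case by blast
next
  case (space A i)
  obtain C where C: "\<And>m \<xi>. m \<in> K \<Longrightarrow> norm \<xi> ^ N * norm (A (m, \<xi>)) \<le> C" using space.IH[of N] by (elim exE) blast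
  obtain b where b: "\<And>m. m \<in> K \<Longrightarrow> norm m \<le> b" using compact_imp_bounded[OF K(1)] by (auto simp: bounded_iff)
  have "norm \<xi> ^ N * norm (complex_of_real (fst (m, \<xi>) $ i) * A (m, \<xi>)) \<le> b * C" if m: "m \<in> K" for m \<xi>
  proof -
    have "\<bar>m $ i\<bar> \<le> b" using b[OF m] component_le_norm_cart[of m i] by linarith
    then have "\<bar>m $ i\<bar> * (norm \<xi> ^ N * norm (A (m, \<xi>))) \<le> b * C"
      using C[OF m, of \<xi>] by (intro mult_mono) auto
    then show ?thesis by (simp add: norm_mult mult_ac)
  qed
  then show ?case by blast
next
  case (frequency A i)
  obtain C where C: "\<And>m \<xi>. m \<in> K \<Longrightarrow> norm \<xi> ^ Suc N * norm (A (m, \<xi>)) \<le> C" using frequency.IH[of "Suc N"] by (elim exE) blast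
  have "norm \<xi> ^ N * norm (complex_of_real (snd (m, \<xi>) $ i) * A (m, \<xi>)) \<le> C" if m: "m \<in> K" for m \<xi>
  proof -
    have "norm \<xi> ^ N * norm (complex_of_real (snd (m, \<xi>) $ i) * A (m, \<xi>)) = \<bar>\<xi> $ i\<bar> * (norm \<xi> ^ N * norm (A (m, \<xi>)))"
      by (simp add: norm_mult mult_ac)
    also have "\<dots> \<le> norm \<xi> * (norm \<xi> ^ N * norm (A (m, \<xi>)))"
      by (intro mult_right_mono component_le_norm_cart) auto
    also have "\<dots> \<le> C" using C[OF m, of \<xi>] by (simp add: mult.assoc)
    finally show ?thesis .
  qed
  then show ?case by blast
qed

text \<open>Combining the bounds for the powers \<open>0\<close> and \<open>2 N\<close> of the norm.\<close>

lemma symbol_module_decay_powr: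
  assumes K: "compact K" "K \<subseteq> U" and A: "A \<in> symbol_module"
  shows "\<exists>C\<ge>0. \<forall>m\<in>K. \<forall>\<xi>. norm (A (m, \<xi>)) \<le> C * (1 + (norm \<xi>)\<^sup>2) powr s"
proof -
  obtain N :: nat where N: "- s \<le> real N" using real_arch_simple by blast
  obtain C0 where C0: "\<And>m \<xi>. m \<in> K \<Longrightarrow> norm (A (m, \<xi>)) \<le> C0"
    using symbol_module_decay[OF K A, of 0] by auto
  obtain C1 where C1: "\<And>m \<xi>. m \<in> K \<Longrightarrow> norm \<xi> ^ (2 * N) * norm (A (m, \<xi>)) \<le> C1"
    using symbol_module_decay[OF K A, of "2 * N"] by auto
  define C where "C = 2 ^ N * (\<bar>C0\<bar> + \<bar>C1\<bar>)"
  have "norm (A (m, \<xi>)) \<le> C * (1 + (norm \<xi>)\<^sup>2) powr s" if m: "m \<in> K" for m \<xi>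
  proof -
    let ?x = "(norm \<xi>)\<^sup>2"
    have "(1 + ?x) ^ N \<le> 2 ^ N * (1 + ?x ^ N)"
    proof (cases "?x \<le> 1")
      case True
      then have "(1 + ?x) ^ N \<le> 2 ^ N" by (intro power_mono) auto
      also have "\<dots> \<le> 2 ^ N * (1 + ?x ^ N)" by simp
      finally show ?thesis .
    next
      case False
      then have "(1 + ?x) ^ N \<le> (2 * ?x) ^ N" by (intro power_mono) auto
      also have "\<dots> \<le> 2 ^ N * (1 + ?x ^ N)" by (simp add: power_mult_distrib)
      finally show ?thesis .
    qed
    then have "(1 + ?x) ^ N * norm (A (m, \<xi>)) \<le> 2 ^ N * (1 + ?x ^ N) * norm (A (m, \<xi>))"
      by (rule mult_right_mono) simp
    also have "\<dots> = 2 ^ N * (norm (A (m, \<xi>)) + norm \<xi> ^ (2 * N) * norm (A (m, \<xi>)))"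
      by (simp only: power_mult) (simp add: algebra_simps)
    also have "\<dots> \<le> C"
      unfolding C_def using C0[OF m, of \<xi>] C1[OF m, of \<xi>] by (intro mult_left_mono add_mono) auto
    finally have "(1 + ?x) ^ N * norm (A (m, \<xi>)) \<le> C" .
    moreover have pos: "1 + ?x > 0" by (simp add: add_pos_nonneg)
    then have "(1 + ?x) ^ N = (1 + ?x) powr real N" by (simp add: powr_realpow)
    moreover have "(1 + ?x) powr (- s) \<le> (1 + ?x) powr real N" using N by (intro powr_mono) auto
    ultimately have "(1 + ?x) powr (- s) * norm (A (m, \<xi>)) \<le> C"
      using order_trans[OF mult_right_mono[OF _ norm_ge_zero]] by metis
    then show ?thesis using pos by (simp add: powr_minus field_simps)
  qed
  moreover have "C \<ge> 0" by (simp add: C_def)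
  ultimately show ?thesis by blast
qed

text \<open>The linear map \<open>P\<close> is the identity for the symbol and the projection to the first of two space variables for
the amplitude of the Fourier integral operator.\<close>

lemma symbol_module_symbol_class:
  fixes P :: "'a::euclidean_space \<Rightarrow> real^'n"
  assumes P: "bounded_linear P" and V: "open V" "P ` V \<subseteq> U" and A: "A \<in> symbol_module"
  shows "(\<lambda>x \<xi>. A (P x, \<xi>)) \<in> symbol_class V l"
proof -
  define T where "T p = (P (fst p), snd p)" for p :: "'a \<times> (real^'n)"
  have bT: "bounded_linear T"
    unfolding T_def[abs_def]
    by (intro bounded_linear_Pair bounded_linear_compose[OF P bounded_linear_fst] bounded_linear_snd)
  define S where "S = {\<lambda>p. A (T p) | A. A \<in> symbol_module}"
  have der: "\<exists>D. (\<forall>p. ((\<lambda>p. A (T p)) has_derivative D p) (at p)) \<and> (\<forall>w. (\<lambda>p. D p w) \<in> S)" if A: "A \<in> symbol_module" for A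
  proof -
    obtain D where D: "\<And>p. (A has_derivative D p) (at p)" "\<And>w. (\<lambda>p. D p w) \<in> symbol_module"
      using symbol_module_derivative[OF A] by (elim exE conjE) blast
    have "((\<lambda>p. A (T p)) has_derivative (\<lambda>w. D (T p) (T w))) (at p)" for p
      by (rule has_derivative_compose[OF bounded_linear_imp_has_derivative[OF bT] D(1)])
    moreover have "(\<lambda>p. D (T p) (T w)) \<in> S" for w
      unfolding S_def using D(2)[of "T w"] by (intro CollectI exI[of _ "\<lambda>p. D p (T w)"]) auto
    ultimately show ?thesis by (intro exI[of _ "\<lambda>p w. D (T p) (T w)"]) auto
  qed
  have derS: "\<exists>D. (\<forall>p. (H has_derivative D p) (at p)) \<and> (\<forall>w. (\<lambda>p. D p w) \<in> S)" if H: "H \<in> S" for H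
  proof -
    obtain A where "A \<in> symbol_module" "H = (\<lambda>p. A (T p))" using H by (auto simp: S_def)
    then show ?thesis using der by simp
  qed
  have d: "H differentiable (at x)" if "H \<in> S" for H x
    using derS[OF that] unfolding differentiable_def by blast
  have c: "\<exists>F'\<in>S. \<forall>x\<in>UNIV. partial_deriv b H x = F' x" if "H \<in> S" for H b
  proof -
    from derS[OF that] obtain D where D: "\<forall>p. (H has_derivative D p) (at p)" "\<forall>w. (\<lambda>p. D p w) \<in> S"
      by (elim exE conjE)
    show ?thesis
      by (rule bexI[of _ "\<lambda>p. D p b"]) (intro ballI partial_deriv_eq D(1)[rule_format] D(2)[rule_format])+
  qed
  have AS: "(\<lambda>p. A (T p)) \<in> S" using A by (auto simp: S_def)
  have eq: "(\<lambda>(x, \<xi>). A (P x, \<xi>)) = (\<lambda>p. A (T p))" by (auto simp: T_def fun_eq_iff)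
  have "smooth_on UNIV (\<lambda>p. A (T p))" by (rule smooth_on_coinduct(1)[OF open_UNIV d c AS])
  then have smooth: "smooth_on (V \<times> UNIV) (\<lambda>(x, \<xi>). A (P x, \<xi>))" unfolding eq by (auto simp: smooth_on_def)
  have "\<exists>C. \<forall>x\<in>K. \<forall>\<xi>. norm (partial_derivs (map (\<lambda>b. (0, b)) bs @ map (\<lambda>c. (c, 0)) cs) (\<lambda>(x, \<xi>). A (P x, \<xi>)) (x, \<xi>))
      \<le> C * (1 + (norm \<xi>)\<^sup>2) powr ((l - real (length bs)) / 2)"
    if bs: "set bs \<subseteq> Basis" "set cs \<subseteq> Basis" and K: "compact K" "K \<subseteq> V" for bs cs K
  proof -
    let ?ds = "map (\<lambda>b. (0, b)) bs @ map (\<lambda>c. (c, 0)) cs :: ('a \<times> (real^'n)) list"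
    have "set ?ds \<subseteq> Basis" using bs by (auto simp: Basis_prod_def)
    from smooth_on_coinduct(2)[OF open_UNIV d c AS this]
    obtain B where B: "B \<in> symbol_module" "\<And>p. partial_derivs ?ds (\<lambda>p. A (T p)) p = B (T p)" unfolding S_def by fast
    have "compact (P ` K)" "P ` K \<subseteq> U"
      using K V linear_continuous_on[OF P] by (auto intro: compact_continuous_image)
    from symbol_module_decay_powr[OF this B(1), of "(l - real (length bs)) / 2"]
    show ?thesis unfolding eq B(2) by (auto simp: T_def)
  qed
  then show ?thesis using smooth V(1) by (auto simp: symbol_class_def)
qed

end

section \<open>Fourier inversion against Gaussians\<close>

text \<open>Lebesgue measure is a product measure with respect to the standard basis.\<close>

lemma lborel_product_function:
  fixes u :: "'a::euclidean_space \<Rightarrow> real \<Rightarrow> 'f::{real_normed_field,banach,second_countable_topology}"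
  assumes "\<And>b. b \<in> Basis \<Longrightarrow> integrable lborel (u b)"
  shows "integrable lborel (\<lambda>z. \<Prod>b\<in>Basis. u b (z \<bullet> b))"
    and "(\<integral>z. (\<Prod>b\<in>Basis. u b (z \<bullet> b)) \<partial>lborel) = (\<Prod>b\<in>Basis. \<integral>x. u b x \<partial>lborel)"
proof -
  interpret product_sigma_finite "\<lambda>_ :: 'a. lborel :: real measure" ..
  let ?T = "\<lambda>f :: 'a \<Rightarrow> real. \<Sum>b\<in>Basis. f b *\<^sub>R b"
  let ?P = "\<Pi>\<^sub>M b\<in>(Basis :: 'a set). (lborel :: real measure)"
  have lb: "(lborel :: 'a measure) = distr ?P borel ?T" by (rule lborel_eq)
  have T: "?T \<in> measurable ?P borel" by measurable
  have [measurable]: "u b \<in> borel_measurable borel" if "b \<in> Basis" for b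
    using assms[OF that] by (auto dest: borel_measurable_integrable)
  have m: "(\<lambda>z. \<Prod>b\<in>Basis. u b (z \<bullet> b)) \<in> borel_measurable borel" by measurable
  have eq: "(\<Prod>b\<in>Basis. u b (?T f \<bullet> b)) = (\<Prod>b\<in>Basis. u b (f b))" for f
    by (intro prod.cong refl) simp
  have i: "integrable ?P (\<lambda>f. \<Prod>b\<in>Basis. u b (f b))"
    by (rule product_integrable_prod) (use assms in auto)
  show "integrable lborel (\<lambda>z. \<Prod>b\<in>Basis. u b (z \<bullet> b))"
    unfolding lb using i by (subst integrable_distr_eq[OF T m]) (simp only: eq)
  have "(\<integral>z. (\<Prod>b\<in>Basis. u b (z \<bullet> b)) \<partial>lborel) = (\<integral>f. (\<Prod>b\<in>Basis. u b (f b)) \<partial>?P)"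
    unfolding lb by (subst integral_distr[OF T m]) (simp only: eq)
  also have "\<dots> = (\<Prod>b\<in>Basis. \<integral>x. u b x \<partial>lborel)"
    by (rule product_integral_prod) (use assms in auto)
  finally show "(\<integral>z. (\<Prod>b\<in>Basis. u b (z \<bullet> b)) \<partial>lborel) = (\<Prod>b\<in>Basis. \<integral>x. u b x \<partial>lborel)" .
qed

definition gauss :: "'a::euclidean_space \<Rightarrow> real" where
  "gauss z = (\<Prod>b\<in>Basis. std_normal_density (z \<bullet> b))"

lemma gauss_eq: "gauss (z :: 'a::euclidean_space) = (1 / sqrt (2 * pi)) ^ DIM('a) * exp (- (norm z)\<^sup>2 / 2)"
proof -
  have "(\<Prod>b\<in>Basis. exp (- (z \<bullet> b)\<^sup>2 / 2)) = exp (\<Sum>b\<in>Basis. - (z \<bullet> b)\<^sup>2 / 2)" by (simp add: exp_sum)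
  also have "(\<Sum>b\<in>Basis. - (z \<bullet> b)\<^sup>2 / 2) = - (norm z)\<^sup>2 / 2"
    unfolding power2_norm_eq_inner euclidean_inner[of z z]
    by (simp add: power2_eq_square sum_negf flip: sum_divide_distrib)
  finally show ?thesis by (simp add: gauss_def std_normal_density_def prod.distrib prod_dividef power_divide)
qed

lemma gauss_nonneg: "gauss z \<ge> 0"
  by (simp add: gauss_eq)

lemma gauss_integrable: "integrable lborel (gauss :: 'a::euclidean_space \<Rightarrow> real)"
  unfolding gauss_def by (rule lborel_product_function) simp

lemma gauss_integral: "(\<integral>z. gauss (z :: 'a::euclidean_space) \<partial>lborel) = 1"
  unfolding gauss_def by (subst lborel_product_function) (simp_all add: integral_normal_density)

text \<open>Up to normalisation the Gaussian is its own Fourier transform, by reduction to the standard normal distribution in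
one dimension.\<close>

lemma gauss_fourier:
  fixes y :: "'a::euclidean_space"
  shows "(\<integral>z. gauss z *\<^sub>R exp (\<i> * complex_of_real (z \<bullet> y)) \<partial>lborel) = complex_of_real (exp (- (norm y)\<^sup>2 / 2))"
proof -
  define u where "u b x = std_normal_density x *\<^sub>R exp (\<i> * complex_of_real ((y \<bullet> b) * x))" for b and x :: real
  have i: "integrable lborel (u b)" for b
    unfolding u_def
    by (rule Bochner_Integration.integrable_bound[of _ "std_normal_density"]) auto
  have one: "(\<integral>x. u b x \<partial>lborel) = complex_of_real (exp (- (y \<bullet> b)\<^sup>2 / 2))" for b
  proof -
    have "char std_normal_distribution (y \<bullet> b) = (\<integral>x. u b x \<partial>lborel)"
      unfolding char_def u_def by (subst integral_density) auto
    then show ?thesis by (simp add: char_std_normal_distribution)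
  qed
  have "(\<Prod>b\<in>Basis. u b (z \<bullet> b)) = gauss z *\<^sub>R exp (\<i> * complex_of_real (z \<bullet> y))" for z
  proof -
    have "(\<Prod>b\<in>Basis. u b (z \<bullet> b)) = complex_of_real (gauss z) * (\<Prod>b\<in>Basis. exp (\<i> * complex_of_real ((y \<bullet> b) * (z \<bullet> b))))"
      by (simp add: u_def scaleR_conv_of_real prod.distrib gauss_def)
    also have "(\<Prod>b\<in>Basis. exp (\<i> * complex_of_real ((y \<bullet> b) * (z \<bullet> b)))) = exp (\<Sum>b\<in>Basis. \<i> * complex_of_real ((y \<bullet> b) * (z \<bullet> b)))"
      by (simp add: exp_sum)
    also have "(\<Sum>b\<in>Basis. \<i> * complex_of_real ((y \<bullet> b) * (z \<bullet> b))) = \<i> * complex_of_real (z \<bullet> y)"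
      by (simp add: euclidean_inner[of z y] sum_distrib_left mult.commute)
    finally show ?thesis by (simp add: scaleR_conv_of_real)
  qed
  then have "(\<integral>z. gauss z *\<^sub>R exp (\<i> * complex_of_real (z \<bullet> y)) \<partial>lborel) = (\<Prod>b\<in>Basis. \<integral>x. u b x \<partial>lborel)"
    using lborel_product_function(2)[of u, OF i] by simp
  also have "\<dots> = complex_of_real (\<Prod>b\<in>Basis. exp (- (y \<bullet> b)\<^sup>2 / 2))" by (simp add: one)
  also have "(\<Prod>b\<in>Basis. exp (- (y \<bullet> b)\<^sup>2 / 2)) = exp (\<Sum>b\<in>Basis. - (y \<bullet> b)\<^sup>2 / 2)" by (simp add: exp_sum)
  also have "(\<Sum>b\<in>Basis. - (y \<bullet> b)\<^sup>2 / 2) = - (norm y)\<^sup>2 / 2"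
    unfolding power2_norm_eq_inner euclidean_inner[of y y]
    by (simp add: power2_eq_square sum_negf flip: sum_divide_distrib)
  finally show ?thesis .
qed

lemma lborel_affine_integral:
  fixes h :: "'a::euclidean_space \<Rightarrow> complex"
  assumes "c \<noteq> 0" and [measurable]: "h \<in> borel_measurable borel"
  shows "(\<integral>x. h x \<partial>lborel) = \<bar>c\<bar> ^ DIM('a) *\<^sub>R (\<integral>x. h (t + c *\<^sub>R x) \<partial>lborel)"
    and "integrable lborel (\<lambda>x. h (t + c *\<^sub>R x)) \<longleftrightarrow> integrable lborel h"
proof -
  have m [measurable]: "(\<lambda>x :: 'a. t + c *\<^sub>R x) \<in> measurable lborel borel" by measurable
  have "(\<integral>x. h x \<partial>lborel) = (\<integral>x. h x \<partial>density (distr lborel borel (\<lambda>x. t + c *\<^sub>R x)) (\<lambda>_. \<bar>c\<bar> ^ DIM('a)))"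
    using lborel_affine[OF assms(1), of t] by simp
  also have "\<dots> = (\<integral>x. \<bar>c\<bar> ^ DIM('a) *\<^sub>R h x \<partial>distr lborel borel (\<lambda>x. t + c *\<^sub>R x))"
    by (subst integral_density) auto
  also have "\<dots> = \<bar>c\<bar> ^ DIM('a) *\<^sub>R (\<integral>x. h (t + c *\<^sub>R x) \<partial>lborel)"
    by (subst integral_distr) auto
  finally show "(\<integral>x. h x \<partial>lborel) = \<bar>c\<bar> ^ DIM('a) *\<^sub>R (\<integral>x. h (t + c *\<^sub>R x) \<partial>lborel)" .
  have "integrable lborel h \<longleftrightarrow> integrable (density (distr lborel borel (\<lambda>x. t + c *\<^sub>R x)) (\<lambda>_. \<bar>c\<bar> ^ DIM('a))) h"
    using lborel_affine[OF assms(1), of t] by simp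
  also have "\<dots> \<longleftrightarrow> integrable (distr lborel borel (\<lambda>x. t + c *\<^sub>R x)) (\<lambda>x. \<bar>c\<bar> ^ DIM('a) *\<^sub>R h x)"
    by (subst integrable_density) auto
  also have "\<dots> \<longleftrightarrow> integrable lborel (\<lambda>x. \<bar>c\<bar> ^ DIM('a) *\<^sub>R h (t + c *\<^sub>R x))"
    by (subst integrable_distr_eq) auto
  also have "\<dots> \<longleftrightarrow> integrable lborel (\<lambda>x. h (t + c *\<^sub>R x))"
    using assms(1) integrable_scaleR_right[of "inverse (\<bar>c\<bar> ^ DIM('a))" lborel "\<lambda>x. \<bar>c\<bar> ^ DIM('a) *\<^sub>R h (t + c *\<^sub>R x)"]
    by auto
  finally show "integrable lborel (\<lambda>x. h (t + c *\<^sub>R x)) \<longleftrightarrow> integrable lborel h" by simp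
qed

text \<open>A kernel that is dominated by a product of integrable functions is integrable; all applications of
Fubini below are of this kind.\<close>

lemma integrable_pair_bound:
  fixes k :: "'x \<times> 'y \<Rightarrow> complex"
  assumes "sigma_finite_measure M1" "sigma_finite_measure M2"
    and m: "k \<in> borel_measurable (M1 \<Otimes>\<^sub>M M2)" and u: "integrable M1 u" and v: "integrable M2 v"
    and bound: "\<And>x y. x \<in> space M1 \<Longrightarrow> y \<in> space M2 \<Longrightarrow> norm (k (x, y)) \<le> u x * v y"
  shows "integrable (M1 \<Otimes>\<^sub>M M2) k"
proof -
  interpret pair_sigma_finite M1 M2 using assms(1,2) by (simp add: pair_sigma_finite_def)
  have [measurable]: "u \<in> borel_measurable M1" "v \<in> borel_measurable M2" using u v by auto
  have "integrable (M1 \<Otimes>\<^sub>M M2) (\<lambda>p. u (fst p) * v (snd p))"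
  proof (rule Fubini_integrable)
    show "integrable M1 (\<lambda>x. \<integral>y. norm (u (fst (x, y)) * v (snd (x, y))) \<partial>M2)"
      using u by (simp add: abs_mult)
    show "AE x in M1. integrable M2 (\<lambda>y. u (fst (x, y)) * v (snd (x, y)))" using v by simp
  qed measurable
  then show ?thesis
  proof (rule Bochner_Integration.integrable_bound[OF _ m])
    show "AE p in M1 \<Otimes>\<^sub>M M2. norm (k p) \<le> norm (u (fst p) * v (snd p))"
    proof (rule AE_I2)
      fix p assume "p \<in> space (M1 \<Otimes>\<^sub>M M2)"
      then have "norm (k p) \<le> u (fst p) * v (snd p)" using bound[of "fst p" "snd p"] by (auto simp: space_pair_measure)
      then show "norm (k p) \<le> norm (u (fst p) * v (snd p))" by simp
    qed
  qed
qed

lemma Fubini_bound: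
  fixes k :: "'x \<Rightarrow> 'y \<Rightarrow> complex"
  assumes "sigma_finite_measure M1" "sigma_finite_measure M2"
    and "case_prod k \<in> borel_measurable (M1 \<Otimes>\<^sub>M M2)" "integrable M1 u" "integrable M2 v"
    and "\<And>x y. x \<in> space M1 \<Longrightarrow> y \<in> space M2 \<Longrightarrow> norm (k x y) \<le> u x * v y"
  shows "(\<integral>x. \<integral>y. k x y \<partial>M2 \<partial>M1) = (\<integral>y. \<integral>x. k x y \<partial>M1 \<partial>M2)"
proof -
  interpret pair_sigma_finite M1 M2 using assms(1,2) by (simp add: pair_sigma_finite_def)
  have "integrable (M1 \<Otimes>\<^sub>M M2) (case_prod k)"
    using integrable_pair_bound[OF assms(1-5)] assms(6) by simp
  from Fubini_integral[OF this] show ?thesis by simp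
qed

definition fourier_transform :: "('a::euclidean_space \<Rightarrow> complex) \<Rightarrow> 'a \<Rightarrow> complex" where
  "fourier_transform \<phi> \<xi> = (\<integral>x. exp (- \<i> * complex_of_real (x \<bullet> \<xi>)) * \<phi> x \<partial>lborel)"

lemma fourier_transform_measurable [measurable]:
  fixes \<phi> :: "'a::euclidean_space \<Rightarrow> complex"
  assumes [measurable]: "\<phi> \<in> borel_measurable borel"
  shows "fourier_transform \<phi> \<in> borel_measurable borel"
  unfolding fourier_transform_def[abs_def] by measurable

lemma norm_fourier_transform_le:
  "norm (fourier_transform \<phi> \<xi>) \<le> (\<integral>x. norm (\<phi> x) \<partial>lborel)"
  unfolding fourier_transform_def by (rule order_trans[OF integral_norm_bound]) (simp add: norm_mult)

lemma gaussian_cutoff_integrable: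
  assumes "s > 0"
  shows "integrable lborel (\<lambda>\<xi> :: 'a::euclidean_space. exp (- (s\<^sup>2 * (norm \<xi>)\<^sup>2) / 2))"
proof -
  have "integrable lborel (\<lambda>\<xi> :: 'a. complex_of_real (gauss (0 + s *\<^sub>R \<xi>)))"
    using assms gauss_integrable[where 'a='a] by (subst lborel_affine_integral(2)) auto
  then have "integrable lborel (\<lambda>\<xi> :: 'a. gauss (s *\<^sub>R \<xi>))" by (simp add: complex_of_real_integrable_eq)
  then have "integrable lborel (\<lambda>\<xi> :: 'a. sqrt (2 * pi) ^ DIM('a) * gauss (s *\<^sub>R \<xi>))" by simp
  then show ?thesis by (simp add: gauss_eq power_mult_distrib power_divide)
qed

text \<open>A Gaussian cutoff in the frequency is a convolution with a Gaussian in space. Both sides are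
integrals that converge absolutely, whatever the decay of the Fourier transform of \<open>\<phi>\<close>.\<close>

lemma regularised_inversion:
  fixes \<phi> :: "'a::euclidean_space \<Rightarrow> complex"
  assumes s: "s > 0" and \<phi>: "integrable lborel \<phi>"
  shows "complex_of_real ((2 * pi) powr - real DIM('a)) *
      (\<integral>\<xi>. exp (- (s\<^sup>2 * (norm \<xi>)\<^sup>2) / 2) *\<^sub>R (exp (\<i> * complex_of_real (y \<bullet> \<xi>)) * fourier_transform \<phi> \<xi>) \<partial>lborel) =
    (\<integral>z. gauss z *\<^sub>R \<phi> (y - s *\<^sub>R z) \<partial>lborel)"
proof -
  let ?N = "DIM('a)"
  let ?w = "\<lambda>\<xi> :: 'a. exp (- (s\<^sup>2 * (norm \<xi>)\<^sup>2) / 2)"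
  have [measurable]: "\<phi> \<in> borel_measurable borel" using \<phi> by (auto dest: borel_measurable_integrable)
  have gm [measurable]: "gauss \<in> borel_measurable (borel :: 'a measure)"
    using borel_measurable_integrable[OF gauss_integrable] by simp
  define c where "c = sqrt (2 * pi) ^ ?N"
  have c0: "c > 0" by (simp add: c_def)
  have cc: "(2 * pi) powr - real ?N = 1 / (c * c)"
  proof -
    have "c * c = (sqrt (2 * pi) * sqrt (2 * pi)) ^ ?N" unfolding c_def by (rule power_mult_distrib[symmetric])
    then have "c * c = (2 * pi) ^ ?N" by simp
    then show ?thesis by (simp add: powr_minus powr_realpow divide_inverse)
  qed
  have wg: "?w \<xi> = c * gauss (s *\<^sub>R \<xi>)" for \<xi>
    by (simp add: gauss_eq c_def power_mult_distrib power_divide)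
  have inner: "(\<integral>\<xi>. ?w \<xi> *\<^sub>R exp (\<i> * complex_of_real (x \<bullet> \<xi>)) \<partial>lborel) = complex_of_real (c * c / s ^ ?N * gauss ((1 / s) *\<^sub>R x))" for x
  proof -
    have "(\<integral>\<xi>. gauss \<xi> *\<^sub>R exp (\<i> * complex_of_real (\<xi> \<bullet> ((1 / s) *\<^sub>R x))) \<partial>lborel) =
        \<bar>s\<bar> ^ ?N *\<^sub>R (\<integral>\<xi>. gauss (0 + s *\<^sub>R \<xi>) *\<^sub>R exp (\<i> * complex_of_real ((0 + s *\<^sub>R \<xi>) \<bullet> ((1 / s) *\<^sub>R x))) \<partial>lborel)"
      by (rule lborel_affine_integral(1)) (use s in auto)
    moreover have "(0 + s *\<^sub>R \<xi>) \<bullet> ((1 / s) *\<^sub>R x) = x \<bullet> \<xi>" for \<xi> using s by (simp add: inner_commute)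
    ultimately have e: "complex_of_real (exp (- (norm ((1 / s) *\<^sub>R x))\<^sup>2 / 2)) =
        s ^ ?N *\<^sub>R (\<integral>\<xi>. gauss (s *\<^sub>R \<xi>) *\<^sub>R exp (\<i> * complex_of_real (x \<bullet> \<xi>)) \<partial>lborel)"
      unfolding gauss_fourier using s by (simp only: abs_of_pos add_0_left)
    have "exp (- (norm ((1 / s) *\<^sub>R x))\<^sup>2 / 2) = c * gauss ((1 / s) *\<^sub>R x)"
      unfolding gauss_eq c_def by (simp add: power_divide)
    then have "(\<integral>\<xi>. gauss (s *\<^sub>R \<xi>) *\<^sub>R exp (\<i> * complex_of_real (x \<bullet> \<xi>)) \<partial>lborel) = complex_of_real (c / s ^ ?N * gauss ((1 / s) *\<^sub>R x))"
      using e s by (simp add: scaleR_conv_of_real field_simps)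
    moreover have "(\<integral>\<xi>. ?w \<xi> *\<^sub>R exp (\<i> * complex_of_real (x \<bullet> \<xi>)) \<partial>lborel) = c *\<^sub>R (\<integral>\<xi>. gauss (s *\<^sub>R \<xi>) *\<^sub>R exp (\<i> * complex_of_real (x \<bullet> \<xi>)) \<partial>lborel)"
      unfolding wg by (simp flip: scaleR_scaleR)
    ultimately show ?thesis by (simp add: scaleR_conv_of_real)
  qed
  have "(\<integral>\<xi>. ?w \<xi> *\<^sub>R (exp (\<i> * complex_of_real (y \<bullet> \<xi>)) * fourier_transform \<phi> \<xi>) \<partial>lborel) =
      (\<integral>\<xi>. \<integral>x. ?w \<xi> *\<^sub>R (exp (\<i> * complex_of_real ((y - x) \<bullet> \<xi>)) * \<phi> x) \<partial>lborel \<partial>lborel)"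
  proof (intro Bochner_Integration.integral_cong refl)
    fix \<xi>
    have "exp (\<i> * complex_of_real ((y - x) \<bullet> \<xi>)) * \<phi> x = exp (\<i> * complex_of_real (y \<bullet> \<xi>)) * (exp (- \<i> * complex_of_real (x \<bullet> \<xi>)) * \<phi> x)" for x
      by (simp add: inner_diff_left algebra_simps flip: exp_add)
    then have "?w \<xi> *\<^sub>R (exp (\<i> * complex_of_real ((y - x) \<bullet> \<xi>)) * \<phi> x) =
        (?w \<xi> *\<^sub>R exp (\<i> * complex_of_real (y \<bullet> \<xi>))) * (exp (- \<i> * complex_of_real (x \<bullet> \<xi>)) * \<phi> x)" for x
      by (simp only: mult_scaleR_left)
    then show "?w \<xi> *\<^sub>R (exp (\<i> * complex_of_real (y \<bullet> \<xi>)) * fourier_transform \<phi> \<xi>) =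
        (\<integral>x. ?w \<xi> *\<^sub>R (exp (\<i> * complex_of_real ((y - x) \<bullet> \<xi>)) * \<phi> x) \<partial>lborel)"
      by (simp only: fourier_transform_def integral_mult_right_zero integral_scaleR_right mult_scaleR_left)
  qed
  also have "\<dots> = (\<integral>x. \<integral>\<xi>. ?w \<xi> *\<^sub>R (exp (\<i> * complex_of_real ((y - x) \<bullet> \<xi>)) * \<phi> x) \<partial>lborel \<partial>lborel)"
    by (rule Fubini_bound[where u="?w" and v="\<lambda>x. norm (\<phi> x)"])
      (use \<phi> gaussian_cutoff_integrable[OF s] in \<open>auto simp: norm_mult lborel.sigma_finite_measure_axioms\<close>)
  also have "\<dots> = (\<integral>x. complex_of_real (c * c / s ^ ?N * gauss ((1 / s) *\<^sub>R (y - x))) * \<phi> x \<partial>lborel)"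
    by (simp only: mult_scaleR_left[symmetric] integral_mult_left_zero inner)
  also have "\<dots> = \<bar>- s\<bar> ^ ?N *\<^sub>R (\<integral>z. complex_of_real (c * c / s ^ ?N * gauss ((1 / s) *\<^sub>R (y - (y + - s *\<^sub>R z)))) * \<phi> (y + - s *\<^sub>R z) \<partial>lborel)"
    by (rule lborel_affine_integral(1)) (use s in auto)
  also have "\<dots> = complex_of_real (c * c) * (\<integral>z. gauss z *\<^sub>R \<phi> (y - s *\<^sub>R z) \<partial>lborel)"
  proof -
    have "complex_of_real (c * c / s ^ ?N * gauss ((1 / s) *\<^sub>R (y - (y + - s *\<^sub>R z)))) * \<phi> (y + - s *\<^sub>R z) =
        complex_of_real (c * c / s ^ ?N) * (gauss z *\<^sub>R \<phi> (y - s *\<^sub>R z))" for z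
      using s by (simp add: scaleR_conv_of_real)
    then show ?thesis
      using s by (simp only: integral_mult_right_zero) (simp add: scaleR_conv_of_real)
  qed
  finally show ?thesis using c0 by (simp add: cc)
qed

lemma gaussian_approximation:
  fixes \<phi> :: "'a::euclidean_space \<Rightarrow> complex"
  assumes \<phi>: "continuous_on UNIV \<phi>" and b: "\<And>x. norm (\<phi> x) \<le> b" and s: "s \<longlonglongrightarrow> 0"
  shows "(\<lambda>k. \<integral>z. gauss z *\<^sub>R \<phi> (y - s k *\<^sub>R z) \<partial>lborel) \<longlonglongrightarrow> \<phi> y"
    and "norm (\<integral>z. gauss z *\<^sub>R \<phi> (y - r *\<^sub>R z) \<partial>lborel) \<le> b"
proof -
  have [measurable]: "\<phi> \<in> borel_measurable borel" using \<phi> by (rule borel_measurable_continuous_onI)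
  have [measurable]: "gauss \<in> borel_measurable (borel :: 'a measure)"
    using borel_measurable_integrable[OF gauss_integrable] by simp
  have ib: "integrable lborel (\<lambda>z :: 'a. gauss z * b)" using gauss_integrable[where 'a='a] by simp
  have nb: "norm (gauss z *\<^sub>R \<phi> w) \<le> gauss z * b" for z w
    using b[of w] gauss_nonneg[of z] by (simp add: mult_left_mono)
  have "(\<lambda>k. \<integral>z. gauss z *\<^sub>R \<phi> (y - s k *\<^sub>R z) \<partial>lborel) \<longlonglongrightarrow> (\<integral>z. gauss (z :: 'a) *\<^sub>R \<phi> y \<partial>lborel)"
  proof (rule integral_dominated_convergence[where w="\<lambda>z :: 'a. gauss z * b"])
    show "integrable lborel (\<lambda>z :: 'a. gauss z * b)" by (rule ib)
    show "AE z in lborel. (\<lambda>k. gauss z *\<^sub>R \<phi> (y - s k *\<^sub>R z)) \<longlonglongrightarrow> gauss z *\<^sub>R \<phi> y"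
    proof (intro AE_I2)
      fix z
      have "(\<lambda>k. y - s k *\<^sub>R z) \<longlonglongrightarrow> y - 0 *\<^sub>R z" by (intro tendsto_intros s)
      then have "(\<lambda>k. y - s k *\<^sub>R z) \<longlonglongrightarrow> y" by simp
      moreover have "isCont \<phi> y" using \<phi> by (simp add: continuous_on_eq_continuous_at)
      ultimately have "(\<lambda>k. \<phi> (y - s k *\<^sub>R z)) \<longlonglongrightarrow> \<phi> y" by (rule isCont_tendsto_compose[rotated])
      then show "(\<lambda>k. gauss z *\<^sub>R \<phi> (y - s k *\<^sub>R z)) \<longlonglongrightarrow> gauss z *\<^sub>R \<phi> y" by (intro tendsto_intros)
    qed
  qed (use nb in auto)
  also have "(\<integral>z. gauss (z :: 'a) *\<^sub>R \<phi> y \<partial>lborel) = \<phi> y"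
    using gauss_integrable[where 'a='a] gauss_integral[where 'a='a] by (subst integral_scaleR_left) auto
  finally show "(\<lambda>k. \<integral>z. gauss z *\<^sub>R \<phi> (y - s k *\<^sub>R z) \<partial>lborel) \<longlonglongrightarrow> \<phi> y" .
  have "norm (\<integral>z. gauss z *\<^sub>R \<phi> (y - r *\<^sub>R z) \<partial>lborel) \<le> (\<integral>z. gauss (z :: 'a) * b \<partial>lborel)"
  proof (rule order_trans[OF integral_norm_bound], rule integral_mono[OF _ ib])
    have "norm (gauss z *\<^sub>R \<phi> (y - r *\<^sub>R z)) \<le> norm (gauss z * b)" for z
      using nb[of z "y - r *\<^sub>R z"] unfolding real_norm_def by linarith
    then show "integrable lborel (\<lambda>z. norm (gauss z *\<^sub>R \<phi> (y - r *\<^sub>R z)))"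
      by (intro integrable_norm Bochner_Integration.integrable_bound[OF ib] AE_I2) auto
    show "norm (gauss z *\<^sub>R \<phi> (y - r *\<^sub>R z)) \<le> gauss z * b" for z by (rule nb)
  qed
  then show "norm (\<integral>z. gauss z *\<^sub>R \<phi> (y - r *\<^sub>R z) \<partial>lborel) \<le> b" using gauss_integral[where 'a='a] by simp
qed

text \<open>Parseval's formula for a function \<open>A\<close> that is the Fourier transform of the image of a
complex measure under \<open>p\<close>. With a Gaussian cutoff it is Fubini together with \<open>regularised_inversion\<close>; the
cutoff is removed by dominated convergence, on the left since \<open>\<phi>\<close> is bounded and
continuous and on the right since \<open>A\<close> is integrable.\<close>

lemma fourier_parseval:
  fixes \<phi> :: "'a::euclidean_space \<Rightarrow> complex" and F :: "'g \<Rightarrow> complex" and p :: "'g \<Rightarrow> 'a"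
  assumes M: "sigma_finite_measure M" and F: "integrable M F" and p [measurable]: "p \<in> borel_measurable M"
    and \<phi>: "continuous_on UNIV \<phi>" "\<And>x. norm (\<phi> x) \<le> b" "integrable lborel \<phi>"
    and A: "\<And>\<xi>. A \<xi> = (\<integral>g. F g * exp (\<i> * complex_of_real (p g \<bullet> \<xi>)) \<partial>M)" "integrable lborel A"
  shows "(\<integral>g. F g * \<phi> (p g) \<partial>M) =
    complex_of_real ((2 * pi) powr - real DIM('a)) * (\<integral>\<xi>. A \<xi> * fourier_transform \<phi> \<xi> \<partial>lborel)"
proof -
  interpret sigma_finite_measure M by (rule M)
  let ?c = "complex_of_real ((2 * pi) powr - real DIM('a))"
  let ?w = "\<lambda>s (\<xi> :: 'a). exp (- (s\<^sup>2 * (norm \<xi>)\<^sup>2) / 2)"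
  have [measurable]: "\<phi> \<in> borel_measurable borel" using \<phi>(1) by (rule borel_measurable_continuous_onI)
  have [measurable]: "F \<in> borel_measurable M" using F by auto
  have [measurable]: "A \<in> borel_measurable borel" using A(2) by (auto dest: borel_measurable_integrable)
  define b1 where "b1 = (\<integral>x. norm (\<phi> x) \<partial>lborel)"
  have b1: "norm (fourier_transform \<phi> \<xi>) \<le> b1" for \<xi> unfolding b1_def by (rule norm_fourier_transform_le)
  have b10: "b1 \<ge> 0" by (simp add: b1_def)
  define s where "s k = inverse (real (Suc k))" for k
  have s: "s k > 0" for k by (simp add: s_def)
  have s0: "s \<longlonglongrightarrow> 0" unfolding s_def by (rule LIMSEQ_inverse_real_of_nat)
  define H where "H k y = (\<integral>z. gauss z *\<^sub>R \<phi> (y - s k *\<^sub>R z) \<partial>lborel)" for k y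
  have Hm [measurable]: "H k \<in> borel_measurable borel" for k
  proof -
    have [measurable]: "gauss \<in> borel_measurable (borel :: 'a measure)"
      using borel_measurable_integrable[OF gauss_integrable] by simp
    show ?thesis unfolding H_def by measurable
  qed
  have step: "?c * (\<integral>\<xi>. ?w (s k) \<xi> *\<^sub>R (A \<xi> * fourier_transform \<phi> \<xi>) \<partial>lborel) = (\<integral>g. F g * H k (p g) \<partial>M)" for k
  proof -
    have "(\<integral>\<xi>. ?w (s k) \<xi> *\<^sub>R (A \<xi> * fourier_transform \<phi> \<xi>) \<partial>lborel) =
        (\<integral>\<xi>. \<integral>g. F g * (?w (s k) \<xi> *\<^sub>R (exp (\<i> * complex_of_real (p g \<bullet> \<xi>)) * fourier_transform \<phi> \<xi>)) \<partial>M \<partial>lborel)"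
    proof (intro Bochner_Integration.integral_cong refl)
      fix \<xi>
      have "(\<integral>g. F g * (?w (s k) \<xi> *\<^sub>R (exp (\<i> * complex_of_real (p g \<bullet> \<xi>)) * fourier_transform \<phi> \<xi>)) \<partial>M) =
          (\<integral>g. (?w (s k) \<xi> *\<^sub>R fourier_transform \<phi> \<xi>) * (F g * exp (\<i> * complex_of_real (p g \<bullet> \<xi>))) \<partial>M)"
        by (intro Bochner_Integration.integral_cong refl) (simp add: mult_ac)
      also have "\<dots> = (?w (s k) \<xi> *\<^sub>R fourier_transform \<phi> \<xi>) * A \<xi>"
        unfolding A(1) by (rule integral_mult_right_zero)
      finally show "?w (s k) \<xi> *\<^sub>R (A \<xi> * fourier_transform \<phi> \<xi>) =
          (\<integral>g. F g * (?w (s k) \<xi> *\<^sub>R (exp (\<i> * complex_of_real (p g \<bullet> \<xi>)) * fourier_transform \<phi> \<xi>)) \<partial>M)"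
        by (simp add: mult_ac)
    qed
    also have "\<dots> = (\<integral>g. \<integral>\<xi>. F g * (?w (s k) \<xi> *\<^sub>R (exp (\<i> * complex_of_real (p g \<bullet> \<xi>)) * fourier_transform \<phi> \<xi>)) \<partial>lborel \<partial>M)"
    proof (rule Fubini_bound[where u="\<lambda>\<xi>. ?w (s k) \<xi> * b1" and v="\<lambda>g. norm (F g)"])
      show "integrable lborel (\<lambda>\<xi> :: 'a. ?w (s k) \<xi> * b1)"
        by (rule integrable_mult_left[OF gaussian_cutoff_integrable[OF s]])
      fix \<xi> g
      show "norm (F g * (?w (s k) \<xi> *\<^sub>R (exp (\<i> * complex_of_real (p g \<bullet> \<xi>)) * fourier_transform \<phi> \<xi>))) \<le> ?w (s k) \<xi> * b1 * norm (F g)"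
      proof -
        have "norm (F g) * (?w (s k) \<xi> * norm (fourier_transform \<phi> \<xi>)) \<le> norm (F g) * (?w (s k) \<xi> * b1)"
          by (intro mult_left_mono b1) auto
        then show ?thesis by (simp add: norm_mult mult_ac)
      qed
    qed (use F M in \<open>auto simp: lborel.sigma_finite_measure_axioms\<close>)
    also have "?c * \<dots> = (\<integral>g. F g * (?c * (\<integral>\<xi>. ?w (s k) \<xi> *\<^sub>R (exp (\<i> * complex_of_real (p g \<bullet> \<xi>)) * fourier_transform \<phi> \<xi>) \<partial>lborel)) \<partial>M)"
      by (simp add: mult.left_commute flip: integral_mult_right_zero)
    finally show ?thesis unfolding regularised_inversion[OF s \<phi>(3)] H_def .
  qed
  have "(\<lambda>k. \<integral>g. F g * H k (p g) \<partial>M) \<longlonglongrightarrow> (\<integral>g. F g * \<phi> (p g) \<partial>M)"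
  proof (rule integral_dominated_convergence)
    show "integrable M (\<lambda>g. norm (F g) * b)" using F by simp
    show "AE g in M. norm (F g * H k (p g)) \<le> norm (F g) * b" for k
      using gaussian_approximation(2)[OF \<phi>(1,2) s0] by (intro AE_I2) (simp add: norm_mult H_def mult_left_mono)
    show "AE g in M. (\<lambda>k. F g * H k (p g)) \<longlonglongrightarrow> F g * \<phi> (p g)"
      using gaussian_approximation(1)[OF \<phi>(1,2) s0] by (intro AE_I2 tendsto_intros) (simp add: H_def)
  qed measurable
  moreover have "(\<lambda>k. \<integral>\<xi>. ?w (s k) \<xi> *\<^sub>R (A \<xi> * fourier_transform \<phi> \<xi>) \<partial>lborel) \<longlonglongrightarrow> (\<integral>\<xi>. A \<xi> * fourier_transform \<phi> \<xi> \<partial>lborel)"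
  proof (rule integral_dominated_convergence)
    show "integrable lborel (\<lambda>\<xi>. norm (A \<xi>) * b1)" using A(2) by simp
    show "AE \<xi> in lborel. norm (?w (s k) \<xi> *\<^sub>R (A \<xi> * fourier_transform \<phi> \<xi>)) \<le> norm (A \<xi>) * b1" for k
    proof (intro AE_I2)
      fix \<xi>
      have "?w (s k) \<xi> * (norm (A \<xi>) * norm (fourier_transform \<phi> \<xi>)) \<le> 1 * (norm (A \<xi>) * b1)"
        using b1[of \<xi>] b10 by (intro mult_mono mult_left_mono) auto
      then show "norm (?w (s k) \<xi> *\<^sub>R (A \<xi> * fourier_transform \<phi> \<xi>)) \<le> norm (A \<xi>) * b1" by (simp add: norm_mult)
    qed
    show "AE \<xi> in lborel. (\<lambda>k. ?w (s k) \<xi> *\<^sub>R (A \<xi> * fourier_transform \<phi> \<xi>)) \<longlonglongrightarrow> A \<xi> * fourier_transform \<phi> \<xi>"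
    proof (intro AE_I2)
      fix \<xi> :: 'a
      have "(\<lambda>k. exp (- ((s k)\<^sup>2 * (norm \<xi>)\<^sup>2) / 2)) \<longlonglongrightarrow> exp (- (0\<^sup>2 * (norm \<xi>)\<^sup>2) / 2)" by (intro tendsto_intros s0) simp
      from tendsto_scaleR[OF this tendsto_const, of "A \<xi> * fourier_transform \<phi> \<xi>"]
      show "(\<lambda>k. ?w (s k) \<xi> *\<^sub>R (A \<xi> * fourier_transform \<phi> \<xi>)) \<longlonglongrightarrow> A \<xi> * fourier_transform \<phi> \<xi>" by simp
    qed
  qed measurable
  then have "(\<lambda>k. ?c * (\<integral>\<xi>. ?w (s k) \<xi> *\<^sub>R (A \<xi> * fourier_transform \<phi> \<xi>) \<partial>lborel)) \<longlonglongrightarrow> ?c * (\<integral>\<xi>. A \<xi> * fourier_transform \<phi> \<xi> \<partial>lborel)"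
    by (intro tendsto_intros)
  ultimately show ?thesis unfolding step by (rule LIMSEQ_unique)
qed

text \<open>With \<open>N\<close> the dimension, the \<open>N\<close>-th power of \<open>1 + (norm \<xi>)\<^sup>2\<close> dominates the product over the coordinates of \<open>1 + (\<xi> \<bullet> b)\<^sup>2\<close>, so
the integral is bounded by a product of one-dimensional ones.\<close>

lemma integrable_of_decay:
  fixes A :: "'a::euclidean_space \<Rightarrow> 'b::{banach,second_countable_topology}"
  assumes [measurable]: "A \<in> borel_measurable borel"
    and bound: "\<And>\<xi>. norm (A \<xi>) \<le> C * (1 + (norm \<xi>)\<^sup>2) powr - real DIM('a)"
  shows "integrable lborel A"
proof (rule Bochner_Integration.integrable_bound)
  have "integrable lborel (\<lambda>x :: real. inverse (1 + x\<^sup>2))"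
    using integrable_inverse_1_plus_square by (simp add: set_integrable_def einterval_def)
  from lborel_product_function(1)[of "\<lambda>(_ :: 'a) x. inverse (1 + x\<^sup>2)", OF this]
  show "integrable lborel (\<lambda>\<xi> :: 'a. \<bar>C\<bar> * (\<Prod>b\<in>Basis. inverse (1 + (\<xi> \<bullet> b)\<^sup>2)))" by simp
  show "AE \<xi> in lborel. norm (A \<xi>) \<le> norm (\<bar>C\<bar> * (\<Prod>b\<in>Basis. inverse (1 + (\<xi> \<bullet> b)\<^sup>2)))"
  proof (intro AE_I2)
    fix \<xi> :: 'a
    have pos: "1 + (norm \<xi>)\<^sup>2 > 0" by (simp add: add_pos_nonneg)
    have "(\<Prod>b\<in>Basis. 1 + (\<xi> \<bullet> b)\<^sup>2) \<le> (\<Prod>b\<in>(Basis :: 'a set). 1 + (norm \<xi>)\<^sup>2)"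
    proof (rule prod_mono)
      fix b :: 'a assume "b \<in> Basis"
      then have "\<bar>\<xi> \<bullet> b\<bar> \<le> norm \<xi>" by (rule Basis_le_norm)
      then have "(\<xi> \<bullet> b)\<^sup>2 \<le> (norm \<xi>)\<^sup>2" by (metis abs_ge_zero power2_abs power_mono)
      then show "0 \<le> 1 + (\<xi> \<bullet> b)\<^sup>2 \<and> 1 + (\<xi> \<bullet> b)\<^sup>2 \<le> 1 + (norm \<xi>)\<^sup>2" by simp
    qed
    then have le: "(\<Prod>b\<in>Basis. 1 + (\<xi> \<bullet> b)\<^sup>2) \<le> (1 + (norm \<xi>)\<^sup>2) ^ DIM('a)" by simp
    have pp: "(\<Prod>b\<in>Basis. 1 + (\<xi> \<bullet> b)\<^sup>2) > 0" by (intro prod_pos) (simp add: add_pos_nonneg)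
    have "norm (A \<xi>) \<le> \<bar>C\<bar> * (1 + (norm \<xi>)\<^sup>2) powr - real DIM('a)"
      by (rule order_trans[OF bound]) (simp add: mult_right_mono)
    also have "(1 + (norm \<xi>)\<^sup>2) powr - real DIM('a) = inverse ((1 + (norm \<xi>)\<^sup>2) ^ DIM('a))"
      using pos by (simp add: powr_minus powr_realpow)
    also have "\<dots> \<le> inverse (\<Prod>b\<in>Basis. 1 + (\<xi> \<bullet> b)\<^sup>2)" using le pp by (intro le_imp_inverse_le) auto
    finally have "norm (A \<xi>) \<le> \<bar>C\<bar> * inverse (\<Prod>b\<in>Basis. 1 + (\<xi> \<bullet> b)\<^sup>2)" by (simp add: mult_left_mono)
    moreover have "(\<Prod>b\<in>Basis. inverse (1 + (\<xi> \<bullet> b)\<^sup>2)) = inverse (\<Prod>b\<in>Basis. 1 + (\<xi> \<bullet> b)\<^sup>2)"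
      using prod_inversef[of "\<lambda>b. 1 + (\<xi> \<bullet> b)\<^sup>2" Basis] by (simp add: o_def)
    ultimately show "norm (A \<xi>) \<le> norm (\<bar>C\<bar> * (\<Prod>b\<in>Basis. inverse (1 + (\<xi> \<bullet> b)\<^sup>2)))"
      using pp by (simp add: abs_mult)
  qed
qed measurable

section \<open>Test functions\<close>

lemma test_function_continuous: "u \<in> test_functions V \<Longrightarrow> continuous_on UNIV u"
  using smooth_on_differentiable[of UNIV u]
  by (auto simp: test_functions_def intro!: continuous_at_imp_continuous_on differentiable_imp_continuous_within)

lemma test_function_bounded:
  assumes "u \<in> test_functions V"
  shows "\<exists>b. \<forall>x. norm (u x) \<le> b"
proof -
  let ?K = "closure {x. u x \<noteq> 0}"
  have "compact ?K" using assms by (simp add: test_functions_def)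
  then have "bounded (u ` ?K)"
    by (intro compact_imp_bounded compact_continuous_image continuous_on_subset[OF test_function_continuous[OF assms]]) auto
  then obtain b where b: "\<And>x. x \<in> ?K \<Longrightarrow> norm (u x) \<le> b" unfolding bounded_iff by auto
  have "norm (u x) \<le> max b 0" for x
  proof (cases "u x = 0")
    case False
    then have "x \<in> ?K" using closure_subset[of "{x. u x \<noteq> 0}"] by auto
    then show ?thesis using b by fastforce
  qed simp
  then show ?thesis by blast
qed

lemma compact_support_integrable:
  fixes u :: "'a::euclidean_space \<Rightarrow> complex"
  assumes K: "compact K" and [measurable]: "u \<in> borel_measurable borel"
    and b: "\<And>x. norm (u x) \<le> b * indicator K x"
  shows "integrable lborel u" "(\<integral>x. norm (u x) \<partial>lborel) \<le> b * measure lborel K"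
proof -
  have [measurable]: "K \<in> sets borel" using K by (simp add: compact_imp_closed borel_closed)
  have i: "integrable lborel (\<lambda>x. b * indicator K x :: real)"
    using emeasure_compact_finite[OF K] by (simp add: integrable_indicator_iff)
  show iu: "integrable lborel u"
    by (rule Bochner_Integration.integrable_bound[OF i])
      (use b in \<open>auto intro!: AE_I2 order_trans[OF b]\<close>)
  have "(\<integral>x. norm (u x) \<partial>lborel) \<le> (\<integral>x. b * indicator K x \<partial>lborel)"
    by (rule integral_mono) (use iu i b in auto)
  then show "(\<integral>x. norm (u x) \<partial>lborel) \<le> b * measure lborel K" by simp
qed

lemma test_function_integrable:
  fixes u :: "'a::euclidean_space \<Rightarrow> complex"
  assumes u: "u \<in> test_functions V"
  shows "integrable lborel u"
proof -
  obtain b where b: "\<And>x. norm (u x) \<le> b" using test_function_bounded[OF u] by blast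
  let ?K = "closure {x. u x \<noteq> 0}"
  have "norm (u x) \<le> b * indicator ?K x" for x
    using b[of x] closure_subset[of "{x. u x \<noteq> 0}"] by (cases "u x = 0") (auto simp: indicator_def)
  moreover have "compact ?K" using u by (simp add: test_functions_def)
  ultimately show ?thesis
    using compact_support_integrable(1) borel_measurable_continuous_onI[OF test_function_continuous[OF u]] by blast
qed

lemma test_function_partial_deriv:
  assumes u: "u \<in> test_functions V" and b: "b \<in> Basis"
  shows "partial_deriv b u \<in> test_functions V"
proof -
  let ?K = "closure {x. u x \<noteq> 0}"
  have "partial_deriv b u x = 0" if x: "x \<notin> ?K" for x
  proof -
    have "((\<lambda>x. 0) has_derivative (\<lambda>h. 0)) (at x)" by simp
    then have "(u has_derivative (\<lambda>h. 0)) (at x)"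
      by (rule has_derivative_transform_within_open[of _ _ _ _ "- ?K"])
        (use x closure_subset[of "{x. u x \<noteq> 0}"] in auto)
    then show ?thesis using partial_deriv_eq by metis
  qed
  then have sub: "closure {x. partial_deriv b u x \<noteq> 0} \<subseteq> ?K" by (intro closure_minimal) auto
  have K: "compact ?K" "?K \<subseteq> V" using u by (auto simp: test_functions_def)
  have "closure {x. partial_deriv b u x \<noteq> 0} = ?K \<inter> closure {x. partial_deriv b u x \<noteq> 0}" using sub by blast
  then have "compact (closure {x. partial_deriv b u x \<noteq> 0})"
    using compact_Int_closed[OF K(1) closed_closure, of "{x. partial_deriv b u x \<noteq> 0}"] by metis
  then show ?thesis
    using u smooth_on_partial_deriv[OF _ b, of UNIV u] sub K(2) by (auto simp: test_functions_def)
qed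

lemma test_function_derivative:
  assumes u: "u \<in> test_functions V"
  shows "(u has_derivative (\<lambda>v. \<Sum>b\<in>Basis. (v \<bullet> b) *\<^sub>R partial_deriv b u x)) (at x)"
  using differentiable_imp_partial_derivs smooth_on_differentiable[of UNIV u x] u
  by (auto simp: test_functions_def)

lemma test_function_lipschitz:
  fixes u :: "'a::euclidean_space \<Rightarrow> complex"
  assumes u: "u \<in> test_functions V"
  shows "\<exists>L\<ge>0. \<forall>x y. norm (u x - u y) \<le> L * norm (x - y)"
proof -
  have "\<forall>b\<in>Basis. \<exists>c. \<forall>x. norm (partial_deriv b u x) \<le> c"
    using test_function_bounded[OF test_function_partial_deriv[OF u]] by blast
  then obtain c where c: "\<And>b x. b \<in> Basis \<Longrightarrow> norm (partial_deriv b u x) \<le> c b" by metis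
  define L where "L = (\<Sum>b\<in>(Basis :: 'a set). c b)"
  have c0: "c b \<ge> 0" if "b \<in> Basis" for b using order_trans[OF norm_ge_zero c[OF that]] .
  have on: "onorm (\<lambda>v. \<Sum>b\<in>Basis. (v \<bullet> b) *\<^sub>R partial_deriv b u x) \<le> L" for x
  proof (rule onorm_le)
    fix v :: 'a
    have "norm (\<Sum>b\<in>Basis. (v \<bullet> b) *\<^sub>R partial_deriv b u x) \<le> (\<Sum>b\<in>Basis. norm v * c b)"
      by (rule sum_norm_le) (auto intro!: mult_mono c Basis_le_norm)
    then show "norm (\<Sum>b\<in>Basis. (v \<bullet> b) *\<^sub>R partial_deriv b u x) \<le> L * norm v"
      by (simp add: L_def sum_distrib_left mult.commute)
  qed
  have "norm (u x - u y) \<le> L * norm (x - y)" for x y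
    by (rule differentiable_bound[of UNIV u "\<lambda>x v. \<Sum>b\<in>Basis. (v \<bullet> b) *\<^sub>R partial_deriv b u x"])
      (auto intro: on test_function_derivative[OF u])
  moreover have "L \<ge> 0" unfolding L_def using c0 by (intro sum_nonneg) auto
  ultimately show ?thesis by blast
qed

text \<open>The remainder has a Lipschitz derivative that vanishes at the base point, so the mean value
inequality applies on the ball of radius \<open>norm k\<close>.\<close>

lemma test_function_taylor:
  fixes u :: "'a::euclidean_space \<Rightarrow> complex"
  assumes u: "u \<in> test_functions V"
  shows "\<exists>C\<ge>0. \<forall>x k. norm (u (x + k) - u x - (\<Sum>b\<in>Basis. (k \<bullet> b) *\<^sub>R partial_deriv b u x)) \<le> C * (norm k)\<^sup>2"
proof -
  have "\<forall>b\<in>Basis. \<exists>l\<ge>0. \<forall>x y. norm (partial_deriv b u x - partial_deriv b u y) \<le> l * norm (x - y)"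
    using test_function_lipschitz[OF test_function_partial_deriv[OF u]] by blast
  then obtain l where l: "\<And>b. b \<in> Basis \<Longrightarrow> l b \<ge> 0"
    "\<And>b x y. b \<in> Basis \<Longrightarrow> norm (partial_deriv b u x - partial_deriv b u y) \<le> l b * norm (x - y)" by metis
  define C where "C = (\<Sum>b\<in>(Basis :: 'a set). l b)"
  have C0: "C \<ge> 0" unfolding C_def using l(1) by (intro sum_nonneg) auto
  have "norm (u (x + k) - u x - (\<Sum>b\<in>Basis. (k \<bullet> b) *\<^sub>R partial_deriv b u x)) \<le> C * (norm k)\<^sup>2" for x k
  proof -
    let ?D = "\<lambda>y v. \<Sum>b\<in>Basis. (v \<bullet> b) *\<^sub>R partial_deriv b u y"
    define h where "h y = u y - ?D x (y - x)" for y
    have bl: "bounded_linear (?D x)"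
      by (intro bounded_linear_sum bounded_linear_scaleR_const bounded_linear_inner_left)
    have d: "(h has_derivative (\<lambda>v. ?D y v - ?D x v)) (at y)" for y
    proof -
      have "((\<lambda>y. ?D x (y - x)) has_derivative (\<lambda>v. ?D x (v - 0))) (at y)"
        by (rule bounded_linear.has_derivative[OF bl]) (intro has_derivative_diff has_derivative_ident has_derivative_const)
      from has_derivative_diff[OF test_function_derivative[OF u] this]
      show ?thesis by (simp add: h_def[abs_def])
    qed
    have "norm (h (x + k) - h x) \<le> (C * norm k) * norm ((x + k) - x)"
    proof (rule differentiable_bound[of "cball x (norm k)" h "\<lambda>y v. ?D y v - ?D x v"])
      fix y assume y: "y \<in> cball x (norm k)"
      show "(h has_derivative (\<lambda>v. ?D y v - ?D x v)) (at y within cball x (norm k))"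
        by (rule has_derivative_at_withinI[OF d])
      show "onorm (\<lambda>v. ?D y v - ?D x v) \<le> C * norm k"
      proof (rule onorm_le)
        fix v :: 'a
        have "?D y v - ?D x v = (\<Sum>b\<in>Basis. (v \<bullet> b) *\<^sub>R (partial_deriv b u y - partial_deriv b u x))"
          by (simp add: scaleR_diff_right sum_subtractf)
        also have "norm \<dots> \<le> (\<Sum>b\<in>Basis. norm v * (l b * norm k))"
        proof (rule sum_norm_le)
          fix b :: 'a assume b: "b \<in> Basis"
          have "norm (partial_deriv b u y - partial_deriv b u x) \<le> l b * norm (y - x)" by (rule l(2)[OF b])
          also have "\<dots> \<le> l b * norm k" using y l(1)[OF b] by (intro mult_left_mono) (auto simp: dist_norm norm_minus_commute)
          finally have "norm (partial_deriv b u y - partial_deriv b u x) \<le> l b * norm k" .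
          then show "norm ((v \<bullet> b) *\<^sub>R (partial_deriv b u y - partial_deriv b u x)) \<le> norm v * (l b * norm k)"
            using Basis_le_norm[OF b, of v] by (auto intro!: mult_mono)
        qed
        finally show "norm (?D y v - ?D x v) \<le> C * norm k * norm v"
          by (simp add: C_def sum_distrib_left sum_distrib_right mult_ac)
      qed
    qed (auto simp: dist_norm)
    then show ?thesis by (simp add: h_def power2_eq_square mult.assoc diff_diff_eq add.commute)
  qed
  then show ?thesis using C0 by blast
qed

lemma phase_has_derivative:
  fixes p :: "('a::euclidean_space \<times> 'a) \<times> 'a"
  shows "((\<lambda>(z, \<xi>). case z of (m, m') \<Rightarrow> (m - m') \<bullet> \<xi>) has_derivative
    (\<lambda>w. (fst (fst p) - snd (fst p)) \<bullet> snd w + (fst (fst w) - snd (fst w)) \<bullet> snd p)) (at p)"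
proof -
  have eq: "(\<lambda>(z, \<xi>). case z of (m, m') \<Rightarrow> (m - m') \<bullet> \<xi>) = (\<lambda>p :: ('a \<times> 'a) \<times> 'a. (fst (fst p) - snd (fst p)) \<bullet> snd p)"
    by (auto simp: fun_eq_iff split: prod.splits)
  show ?thesis
    unfolding eq
    by (intro has_derivative_inner has_derivative_diff has_derivative_fst has_derivative_snd has_derivative_ident)
qed

text \<open>A partial derivative of a bilinear form is linear, and a partial derivative of a linear form is
constant.\<close>

lemma smooth_bilinear_phase:
  fixes W :: "(('a::euclidean_space \<times> 'a) \<times> 'a) set"
  shows "smooth_on W (\<lambda>(z, \<xi>). case z of (m, m') \<Rightarrow> (m - m') \<bullet> \<xi>)" (is "smooth_on W ?\<psi>")
proof -
  note d = phase_has_derivative[where 'a = 'a]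
  define S :: "(('a \<times> 'a) \<times> 'a \<Rightarrow> real) set" where "S = {?\<psi>} \<union> Collect bounded_linear \<union> range (\<lambda>c _. c)"
  have "smooth_on UNIV ?\<psi>"
  proof (rule smooth_on_coinduct(1)[OF open_UNIV, of S])
    fix F and x :: "('a \<times> 'a) \<times> 'a" assume "F \<in> S"
    then consider "F = ?\<psi>" | "bounded_linear F" | c where "F = (\<lambda>_. c)" by (auto simp: S_def)
    then show "F differentiable (at x)"
      unfolding differentiable_def
      by cases (use d[of x] in \<open>auto intro: bounded_linear_imp_has_derivative has_derivative_const\<close>)
  next
    fix F and b :: "('a \<times> 'a) \<times> 'a" assume "F \<in> S"
    then consider "F = ?\<psi>" | "bounded_linear F" | c where "F = (\<lambda>_. c)" by (auto simp: S_def)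
    then show "\<exists>F'\<in>S. \<forall>x\<in>UNIV. partial_deriv b F x = F' x"
    proof cases
      case 1
      have "bounded_linear (\<lambda>p :: ('a \<times> 'a) \<times> 'a. (fst (fst p) - snd (fst p)) \<bullet> snd b + (fst (fst b) - snd (fst b)) \<bullet> snd p)"
        by (intro bounded_linear_add bounded_linear_compose[OF bounded_linear_inner_left]
            bounded_linear_compose[OF bounded_linear_inner_right] bounded_linear_sub
            bounded_linear_compose[OF bounded_linear_fst] bounded_linear_compose[OF bounded_linear_snd]
            bounded_linear_fst bounded_linear_snd)
      then show ?thesis
        using partial_deriv_eq[OF d, of b] 1
        by (intro bexI[of _ "\<lambda>p. (fst (fst p) - snd (fst p)) \<bullet> snd b + (fst (fst b) - snd (fst b)) \<bullet> snd p"]) (auto simp: S_def)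
    next
      case 2
      then show ?thesis using partial_deriv_eq[OF bounded_linear_imp_has_derivative[OF 2], of b]
        by (intro bexI[of _ "\<lambda>_. F b"]) (auto simp: S_def)
    next
      case 3
      then show ?thesis using partial_deriv_eq[OF has_derivative_const, of b c]
        by (intro bexI[of _ "\<lambda>_. 0"]) (auto simp: S_def)
    qed
  qed (simp add: S_def)
  then show "smooth_on W ?\<psi>" by (auto simp: smooth_on_def)
qed

section \<open>The integrated representation on test functions\<close>

context rapid_rep
begin

text \<open>For \<open>F = f\<close> this is the operator \<open>\<pi>(f)\<close> applied to \<open>w\<close> (\<open>integrated_rep_eq\<close>). A partial derivative in
\<open>m\<close> falls on \<open>w\<close> and multiplies \<open>F\<close> by entries of \<open>ri\<close>, whence the general \<open>F\<close>.\<close>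

definition orbit_average :: "(real^'m^'m \<Rightarrow> complex) \<Rightarrow> (real^'n \<Rightarrow> complex) \<Rightarrow> real^'n \<Rightarrow> complex" where
  "orbit_average F w m = (\<integral>g. F g * w (ri g *v m) \<partial>\<mu>)"

lemma integrated_rep_eq: "integrated_rep \<rho> \<mu> f u m = orbit_average f u m"
  by (simp add: integrated_rep_def left_regular_def orbit_average_def ri_def)

lemma ri_orbit_measurable [measurable]: "(\<lambda>g. ri g *v m) \<in> borel_measurable \<mu>"
  by (intro continuous_measurable bounded_bilinear.continuous_on[OF bounded_bilinear_matrix_vector_mult] ri_continuous_G
      continuous_on_const)

lemma orbit_average_integrable:
  assumes F: "F \<in> rapid_class" and w: "w \<in> test_functions V"
  shows "integrable \<mu> (\<lambda>g. F g * w (ri g *v m))"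
proof -
  obtain b where b: "\<And>x. norm (w x) \<le> b" using test_function_bounded[OF w] by blast
  have [measurable]: "w \<in> borel_measurable borel"
    by (rule borel_measurable_continuous_onI[OF test_function_continuous[OF w]])
  have "integrable \<mu> (\<lambda>g. norm (F g) * b)" using rapid_class_integrable[OF F] by simp
  then show ?thesis
  proof (rule Bochner_Integration.integrable_bound)
    show "(\<lambda>g. F g * w (ri g *v m)) \<in> borel_measurable \<mu>" using F by measurable
    have "norm (F g * w (ri g *v m)) \<le> norm (norm (F g) * b)" for g
      using b[of "ri g *v m"] mult_left_mono[OF b[of "ri g *v m"], of "norm (F g)"] by (simp add: norm_mult)
    then show "AE g in \<mu>. norm (F g * w (ri g *v m)) \<le> norm (norm (F g) * b)" by simp
  qed
qed

lemma orbit_average_bounded: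
  assumes w: "w \<in> test_functions V"
  shows "\<exists>b. \<forall>m. norm (orbit_average f w m) \<le> b"
proof -
  obtain b where b: "\<And>x. norm (w x) \<le> b" using test_function_bounded[OF w] by blast
  have "norm (orbit_average f w m) \<le> (\<integral>g. norm (f g) * b \<partial>\<mu>)" for m
    unfolding orbit_average_def
    by (rule order_trans[OF integral_norm_bound], rule integral_mono)
      (use integrable_norm[OF orbit_average_integrable[OF f_rapid_class w]] rapid_class_integrable[OF f_rapid_class] b in \<open>auto simp: norm_mult mult_left_mono\<close>)
  then show ?thesis by blast
qed

lemma orbit_average_has_derivative:
  assumes F: "F \<in> rapid_class" and w: "w \<in> test_functions UNIV"
  shows "(orbit_average F w has_derivative (\<lambda>h. \<Sum>b\<in>Basis. orbit_average (\<lambda>g. complex_of_real ((ri g *v h) \<bullet> b) * F g) (partial_deriv b w) m)) (at m)"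
proof -
  obtain K where K: "K > 0" "\<And>(A :: real^'n^'n) x. norm (A *v x) \<le> norm A * norm x * K"
    using bounded_bilinear.pos_bounded[OF bounded_bilinear_matrix_vector_mult] by blast
  obtain C where C: "C \<ge> 0" "\<And>x k. norm (w (x + k) - w x - (\<Sum>b\<in>Basis. (k \<bullet> b) *\<^sub>R partial_deriv b w x)) \<le> C * (norm k)\<^sup>2"
    using test_function_taylor[OF w] by blast
  define L where "L g h = (\<Sum>b\<in>Basis. (complex_of_real ((ri g *v h) \<bullet> b) * F g) * partial_deriv b w (ri g *v m))" for g h
  have Leq: "L g h = F g * (\<Sum>b\<in>Basis. ((ri g *v h) \<bullet> b) *\<^sub>R partial_deriv b w (ri g *v m))" for g h
    by (simp add: L_def sum_distrib_left scaleR_conv_of_real mult_ac)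
  have iL: "integrable \<mu> (\<lambda>g. (complex_of_real ((ri g *v h) \<bullet> b) * F g) * partial_deriv b w (ri g *v m))" if "b \<in> Basis" for h b
    by (rule orbit_average_integrable[OF rapid_class_pairing[OF F] test_function_partial_deriv[OF w that]])
  have "(orbit_average F w has_derivative (\<lambda>h. \<integral>g. L g h \<partial>\<mu>)) (at m)"
    unfolding orbit_average_def[abs_def]
  proof (rule has_derivative_integral[where B="\<lambda>g. C * K\<^sup>2 * (norm (ri g) ^ 2 * norm (F g))"])
    show "integrable \<mu> (\<lambda>g. F g * w (ri g *v z))" for z by (rule orbit_average_integrable[OF F w])
    show "integrable \<mu> (\<lambda>g. L g h)" for h unfolding L_def using iL by auto
    show "linear (L g)" for g
    proof (rule linearI)
      show "L g (x + y) = L g x + L g y" for x y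
        by (simp add: Leq matrix_vector_right_distrib inner_add_left scaleR_add_left sum.distrib distrib_left)
      show "L g (c *\<^sub>R x) = c *\<^sub>R L g x" for c x
        by (simp add: Leq matrix_vector_mult_scaleR scaleR_sum_right flip: scaleR_scaleR mult_scaleR_right)
    qed
    show "integrable \<mu> (\<lambda>g. C * K\<^sup>2 * (norm (ri g) ^ 2 * norm (F g)))"
      by (intro integrable_mult_right rapid_class_integrable_ri_power F)
    fix g and h :: "real^'n"
    have "F g * w (ri g *v (m + h)) - F g * w (ri g *v m) - L g h =
        F g * (w (ri g *v m + ri g *v h) - w (ri g *v m) - (\<Sum>b\<in>Basis. ((ri g *v h) \<bullet> b) *\<^sub>R partial_deriv b w (ri g *v m)))"
      by (simp add: Leq matrix_vector_right_distrib algebra_simps)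
    also have "norm \<dots> \<le> norm (F g) * (C * (norm (ri g *v h))\<^sup>2)"
      unfolding norm_mult by (intro mult_left_mono C(2)) auto
    also have "\<dots> \<le> norm (F g) * (C * (norm (ri g) * norm h * K)\<^sup>2)"
      using C(1) by (intro mult_left_mono power_mono K(2)) auto
    also have "\<dots> = C * K\<^sup>2 * (norm (ri g) ^ 2 * norm (F g)) * (norm h)\<^sup>2"
      by (simp add: power_mult_distrib mult_ac)
    finally show "norm (F g * w (ri g *v (m + h)) - F g * w (ri g *v m) - L g h) \<le> C * K\<^sup>2 * (norm (ri g) ^ 2 * norm (F g)) * (norm h)\<^sup>2" .
  qed
  moreover have "(\<integral>g. L g h \<partial>\<mu>) = (\<Sum>b\<in>Basis. orbit_average (\<lambda>g. complex_of_real ((ri g *v h) \<bullet> b) * F g) (partial_deriv b w) m)" for h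
    unfolding L_def orbit_average_def using iL by (intro Bochner_Integration.integral_sum) auto
  ultimately show ?thesis by simp
qed

inductive_set orbit_average_span :: "(real^'n \<Rightarrow> complex) set" where
  base: "F \<in> rapid_class \<Longrightarrow> w \<in> test_functions UNIV \<Longrightarrow> orbit_average F w \<in> orbit_average_span"
| add: "A \<in> orbit_average_span \<Longrightarrow> B \<in> orbit_average_span \<Longrightarrow> (\<lambda>m. A m + B m) \<in> orbit_average_span"

lemma orbit_average_span_derivative:
  assumes "A \<in> orbit_average_span"
  shows "\<exists>D. (\<forall>p. (A has_derivative D p) (at p)) \<and> (\<forall>h. (\<lambda>p. D p h) \<in> orbit_average_span)"
  using assms
proof (induction rule: orbit_average_span.induct)
  case (base F w)
  have sum: "(\<lambda>m. \<Sum>b\<in>I. orbit_average (H b) (partial_deriv b w) m) \<in> orbit_average_span"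
    if "finite I" "I \<noteq> {}" "I \<subseteq> Basis" "\<And>b. H b \<in> rapid_class" for I H
    using that(1,2,3)
  proof (induction I rule: finite_ne_induct)
    case (singleton b)
    then show ?case using orbit_average_span.base[OF that(4)[of b] test_function_partial_deriv[OF base(2), of b]] by simp
  next
    case (insert b I)
    then have "(\<lambda>m. orbit_average (H b) (partial_deriv b w) m + (\<Sum>b\<in>I. orbit_average (H b) (partial_deriv b w) m)) \<in> orbit_average_span"
      using orbit_average_span.base[OF that(4)[of b] test_function_partial_deriv[OF base(2), of b]] by (intro orbit_average_span.add) auto
    then show ?case using insert by simp
  qed
  show ?case
    by (intro exI[of _ "\<lambda>m h. \<Sum>b\<in>Basis. orbit_average (\<lambda>g. complex_of_real ((ri g *v h) \<bullet> b) * F g) (partial_deriv b w) m"]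
        conjI allI orbit_average_has_derivative base sum rapid_class_pairing) auto
next
  case (add A B)
  then obtain D D' where D: "\<And>p. (A has_derivative D p) (at p)" "\<And>w. (\<lambda>p. D p w) \<in> orbit_average_span"
    "\<And>p. (B has_derivative D' p) (at p)" "\<And>w. (\<lambda>p. D' p w) \<in> orbit_average_span" by (elim exE conjE) blast
  then show ?case
    by (intro exI[of _ "\<lambda>p w. D p w + D' p w"] conjI allI has_derivative_add orbit_average_span.add)
qed

text \<open>Smoothness holds on the whole space, by differentiation under the integral, whereas the
representation by an integrable symbol needs the complement of the singular set.\<close>

lemma orbit_average_smooth:
  assumes w: "w \<in> test_functions UNIV"
  shows "smooth_on V (orbit_average f w)" "continuous_on UNIV (orbit_average f w)"
proof -
  have d: "A differentiable (at x)" if "A \<in> orbit_average_span" for A x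
    using orbit_average_span_derivative[OF that] unfolding differentiable_def by blast
  have c: "\<exists>F'\<in>orbit_average_span. \<forall>x\<in>UNIV. partial_deriv b A x = F' x" if "A \<in> orbit_average_span" for A b
  proof -
    from orbit_average_span_derivative[OF that] obtain D where D: "\<forall>p. (A has_derivative D p) (at p)" "\<forall>w. (\<lambda>p. D p w) \<in> orbit_average_span"
      by (elim exE conjE)
    show ?thesis
      by (rule bexI[of _ "\<lambda>p. D p b"]) (intro ballI partial_deriv_eq D(1)[rule_format] D(2)[rule_format])+
  qed
  have "smooth_on UNIV (orbit_average f w)" by (rule smooth_on_coinduct(1)[OF open_UNIV d c orbit_average_span.base[OF f_rapid_class w]])
  then show "smooth_on V (orbit_average f w)" by (auto simp: smooth_on_def)
  show "continuous_on UNIV (orbit_average f w)"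
    using d[OF orbit_average_span.base[OF f_rapid_class w]]
    by (intro continuous_at_imp_continuous_on ballI differentiable_imp_continuous_within) auto
qed

lemma symbol_module_continuous: "A \<in> symbol_module \<Longrightarrow> continuous_on UNIV A"
  using symbol_module_derivative[of A] has_derivative_continuous
  by (intro continuous_at_imp_continuous_on) blast

abbreviation af :: "real^'n \<Rightarrow> real^'n \<Rightarrow> complex" where "af \<equiv> symbol_of \<rho> \<mu> f"

lemma af_eq: "af m \<xi> = phase_integral f (m, \<xi>)" by (rule symbol_of_eq)

lemma af_measurable [measurable]: "(\<lambda>p. af (fst p) (snd p)) \<in> borel_measurable borel"
  using borel_measurable_continuous_onI[OF symbol_module_continuous[OF symbol_module.base[OF f_rapid_class]]] by (simp add: af_eq)

lemma af_measurable_frequency [measurable]: "af m \<in> borel_measurable borel"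
proof -
  have "continuous_on UNIV (\<lambda>\<xi>. phase_integral f (m, \<xi>))"
    by (rule continuous_on_compose2[OF symbol_module_continuous[OF symbol_module.base[OF f_rapid_class]]]) (auto intro!: continuous_intros)
  then show ?thesis using borel_measurable_continuous_onI by (simp add: af_eq[abs_def])
qed

lemma af_decay:
  assumes "compact K" "K \<subseteq> U"
  shows "\<exists>C\<ge>0. \<forall>m\<in>K. \<forall>\<xi>. norm (af m \<xi>) \<le> C * (1 + (norm \<xi>)\<^sup>2) powr - real CARD('n)"
  using symbol_module_decay_powr[OF assms symbol_module.base[OF f_rapid_class]] by (simp add: af_eq)

lemma af_integrable:
  assumes "m \<in> U"
  shows "integrable lborel (af m)"
proof -
  obtain C where "\<And>\<xi>. norm (af m \<xi>) \<le> C * (1 + (norm \<xi>)\<^sup>2) powr - real CARD('n)"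
    using af_decay[of "{m}"] assms by auto
  then show ?thesis by (intro integrable_of_decay[of _ C]) auto
qed

lemma kernel_integrable:
  assumes \<phi>: "\<phi> \<in> test_functions UNIV" and m: "m \<in> U"
  shows "integrable lborel (\<lambda>(m', \<xi>). exp (\<i> * complex_of_real ((m - m') \<bullet> \<xi>)) * af m \<xi> * \<phi> m')"
proof -
  have [measurable]: "\<phi> \<in> borel_measurable borel"
    by (rule borel_measurable_continuous_onI[OF test_function_continuous[OF \<phi>]])
  have "integrable (lborel \<Otimes>\<^sub>M lborel) (\<lambda>(m', \<xi>). exp (\<i> * complex_of_real ((m - m') \<bullet> \<xi>)) * af m \<xi> * \<phi> m')"
    by (rule integrable_pair_bound[where u="\<lambda>m'. norm (\<phi> m')" and v="\<lambda>\<xi>. norm (af m \<xi>)"])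
      (use test_function_integrable[OF \<phi>] af_integrable[OF m] in \<open>auto simp: norm_mult lborel.sigma_finite_measure_axioms\<close>)
  then show ?thesis by (simp add: lborel_prod)
qed

text \<open>The wave integral is the Fourier transform of the image of \<open>f\<close> under the orbit map \<open>g \<mapsto> ri g *v m\<close>,
so Parseval's formula applies.\<close>

lemma fourier_representation:
  assumes \<phi>: "\<phi> \<in> test_functions UNIV" and m: "m \<in> U"
  shows "orbit_average f \<phi> m = complex_of_real ((2 * pi) powr - real CARD('n)) *
    (\<integral>\<xi>. (\<integral>m'. exp (\<i> * complex_of_real ((m - m') \<bullet> \<xi>)) * af m \<xi> * \<phi> m' \<partial>lborel) \<partial>lborel)"
proof -
  obtain b where b: "\<And>x. norm (\<phi> x) \<le> b" using test_function_bounded[OF \<phi>] by blast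
  have wave_integral_eq: "wave_integral f m \<xi> = exp (\<i> * complex_of_real (m \<bullet> \<xi>)) * af m \<xi>" for \<xi>
    by (simp add: af_eq phase_integral_wave flip: mult.assoc exp_add)
  have "integrable lborel (\<lambda>\<xi>. wave_integral f m \<xi>)"
  proof (rule Bochner_Integration.integrable_bound[OF af_integrable[OF m]])
    show "(\<lambda>\<xi>. wave_integral f m \<xi>) \<in> borel_measurable lborel" unfolding wave_integral_eq by measurable
  qed (simp add: wave_integral_eq norm_mult)
  then have "orbit_average f \<phi> m = complex_of_real ((2 * pi) powr - real DIM(real^'n)) * (\<integral>\<xi>. wave_integral f m \<xi> * fourier_transform \<phi> \<xi> \<partial>lborel)"
    unfolding orbit_average_def
    by (intro fourier_parseval[OF sigma_finite_mu rapid_class_integrable[OF f_rapid_class] ri_orbit_measurable test_function_continuous[OF \<phi>] b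
          test_function_integrable[OF \<phi>]]) (simp add: wave_integral_def wave_def)
  also have "(\<integral>\<xi>. wave_integral f m \<xi> * fourier_transform \<phi> \<xi> \<partial>lborel) =
      (\<integral>\<xi>. (\<integral>m'. exp (\<i> * complex_of_real ((m - m') \<bullet> \<xi>)) * af m \<xi> * \<phi> m' \<partial>lborel) \<partial>lborel)"
  proof (intro Bochner_Integration.integral_cong refl)
    fix \<xi>
    have "exp (\<i> * complex_of_real ((m - m') \<bullet> \<xi>)) * af m \<xi> * \<phi> m' = wave_integral f m \<xi> * (exp (- \<i> * complex_of_real (m' \<bullet> \<xi>)) * \<phi> m')" for m'
    proof -
      have "exp (\<i> * complex_of_real ((m - m') \<bullet> \<xi>)) = exp (\<i> * complex_of_real (m \<bullet> \<xi>)) * exp (- \<i> * complex_of_real (m' \<bullet> \<xi>))"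
        by (simp add: inner_diff_left algebra_simps flip: exp_add)
      then show ?thesis by (simp add: wave_integral_eq)
    qed
    then show "wave_integral f m \<xi> * fourier_transform \<phi> \<xi> = (\<integral>m'. exp (\<i> * complex_of_real ((m - m') \<bullet> \<xi>)) * af m \<xi> * \<phi> m' \<partial>lborel)"
      by (simp only: fourier_transform_def integral_mult_right_zero)
  qed
  finally show ?thesis by simp
qed

lemma af_symbol: "af \<in> symbol_class U l"
  using symbol_module_symbol_class[OF bounded_linear_ident open_U _ symbol_module.base[OF f_rapid_class], of l] by (simp add: af_eq[abs_def])

lemma af_amplitude: "(\<lambda>(m, m') \<xi>. af m \<xi>) \<in> symbol_class (U \<times> (UNIV :: (real^'n) set)) l"
proof -
  have "(\<lambda>(m, m' :: real^'n) \<xi>. af m \<xi>) = (\<lambda>x \<xi>. phase_integral f (fst x, \<xi>))" by (auto simp: af_eq fun_eq_iff)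
  then show ?thesis
    using symbol_module_symbol_class[OF bounded_linear_fst, of "U \<times> UNIV" "phase_integral f" l] symbol_module.base[OF f_rapid_class] open_U
    by (simp add: open_Times)
qed

lemma pseudodifferential: "integrated_rep \<rho> \<mu> f \<in> pseudodiff_class U l"
proof -
  have "u \<in> test_functions UNIV" if "u \<in> test_functions U" for u
    using that by (auto simp: test_functions_def)
  then show ?thesis
    unfolding pseudodiff_class_def
    by (intro CollectI bexI[OF _ af_symbol] ballI conjI)
      (simp_all add: integrated_rep_eq[abs_def] orbit_average_smooth fourier_representation)
qed

lemma pairing_integrable:
  assumes u: "u \<in> test_functions UNIV" and v: "v \<in> test_functions V"
  shows "integrable lborel (\<lambda>m. orbit_average f u m * v m)"
proof -
  obtain b where b: "\<And>m. norm (orbit_average f u m) \<le> b" using orbit_average_bounded[OF u] by blast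
  have [measurable]: "orbit_average f u \<in> borel_measurable borel" "v \<in> borel_measurable borel"
    using orbit_average_smooth(2)[OF u] test_function_continuous[OF v] by (auto intro: borel_measurable_continuous_onI)
  have "integrable lborel (\<lambda>m. b * norm (v m))" using test_function_integrable[OF v] by simp
  then show ?thesis
  proof (rule Bochner_Integration.integrable_bound)
    have "norm (orbit_average f u m * v m) \<le> norm (b * norm (v m))" for m
      using mult_right_mono[OF b[of m], of "norm (v m)"] by (simp add: norm_mult)
    then show "AE m in lborel. norm (orbit_average f u m * v m) \<le> norm (b * norm (v m))" by simp
  qed measurable
qed

text \<open>The pairing is continuous of order zero, since \<open>\<pi>(f) u\<close> is a bounded function.\<close>

lemma pairing_distribution:
  assumes u: "u \<in> test_functions UNIV"
  shows "distribution_on U (\<lambda>v. \<integral>m. orbit_average f u m * v m \<partial>lborel)"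
  unfolding distribution_on_def
proof (intro conjI allI impI ballI)
  fix v w a b assume v: "v \<in> test_functions U" and w: "w \<in> test_functions U"
  have "(\<integral>m. orbit_average f u m * (a * v m + b * w m) \<partial>lborel) = (\<integral>m. a * (orbit_average f u m * v m) + b * (orbit_average f u m * w m) \<partial>lborel)"
    by (intro Bochner_Integration.integral_cong refl) (simp add: algebra_simps)
  also have "\<dots> = a * (\<integral>m. orbit_average f u m * v m \<partial>lborel) + b * (\<integral>m. orbit_average f u m * w m \<partial>lborel)"
    using pairing_integrable[OF u v] pairing_integrable[OF u w] by simp
  finally show "(\<integral>m. orbit_average f u m * (a * v m + b * w m) \<partial>lborel) = a * (\<integral>m. orbit_average f u m * v m \<partial>lborel) + b * (\<integral>m. orbit_average f u m * w m \<partial>lborel)" .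
next
  fix K assume K: "compact K \<and> K \<subseteq> U"
  obtain c where c: "\<And>m. norm (orbit_average f u m) \<le> c" using orbit_average_bounded[OF u] by blast
  have c0: "c \<ge> 0" using order_trans[OF norm_ge_zero c] .
  have "norm (\<integral>m. orbit_average f u m * v m \<partial>lborel) \<le> (c * measure lborel K) * B"
    if v: "v \<in> test_functions K" and B: "\<And>bs x. set bs \<subseteq> Basis \<and> length bs \<le> 0 \<Longrightarrow> norm (partial_derivs bs v x) \<le> B" for v B
  proof -
    have vB: "norm (v x) \<le> B" for x using B[of "[]" x] by (simp add: partial_derivs_def)
    have sup: "v x = 0" if "x \<notin> K" for x
      using v that closure_subset[of "{x. v x \<noteq> 0}"] by (auto simp: test_functions_def)
    have bound: "norm (orbit_average f u x * v x) \<le> (c * B) * indicator K x" for x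
      using mult_mono[OF c[of x] vB[of x] c0] sup[of x] by (auto simp: norm_mult indicator_def)
    have "norm (\<integral>m. orbit_average f u m * v m \<partial>lborel) \<le> (\<integral>m. norm (orbit_average f u m * v m) \<partial>lborel)" by (rule integral_norm_bound)
    also have "\<dots> \<le> (c * B) * measure lborel K"
      by (rule compact_support_integrable(2)[OF _ _ bound])
        (use K borel_measurable_integrable[OF pairing_integrable[OF u v]] in auto)
    finally show ?thesis by (simp add: mult_ac)
  qed
  then show "\<exists>C N. \<forall>v\<in>test_functions K. \<forall>B. (\<forall>bs x. set bs \<subseteq> Basis \<and> length bs \<le> N \<longrightarrow> norm (partial_derivs bs v x) \<le> B) \<longrightarrow>
      norm (\<integral>m. orbit_average f u m * v m \<partial>lborel) \<le> C * B"
    by (intro exI[of _ "c * measure lborel K"] exI[of _ 0] ballI allI impI) blast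
qed

text \<open>On the support of \<open>v\<close> the amplitude decays uniformly, so the integrand without cutoff is
absolutely integrable; the cutoff is bounded and tends to \<open>1\<close> pointwise.\<close>

lemma oscillatory_limit:
  fixes \<theta> :: "real^'n \<Rightarrow> complex"
  assumes u: "u \<in> test_functions UNIV" and v: "v \<in> test_functions U" and \<theta>: "\<theta> \<in> test_functions UNIV"
    and one: "\<forall>\<^sub>F \<xi> in nhds 0. \<theta> \<xi> = 1"
  shows "((\<lambda>\<epsilon>. complex_of_real ((2 * pi) powr - real CARD('n)) *
      (\<integral>p. (case p of ((x, y), \<xi>) \<Rightarrow> \<theta> (\<epsilon> *\<^sub>R \<xi>) * exp (\<i> * complex_of_real ((x - y) \<bullet> \<xi>)) * af x \<xi> * u y * v x) \<partial>lborel))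
    \<longlongrightarrow> (\<integral>m. orbit_average f u m * v m \<partial>lborel)) (at_right 0)"
proof -
  let ?c = "complex_of_real ((2 * pi) powr - real CARD('n))"
  define k where "k p = (case p of ((x, y), \<xi>) \<Rightarrow> exp (\<i> * complex_of_real ((x - y) \<bullet> \<xi>)) * af x \<xi> * u y * v x)"
    for p :: "((real^'n) \<times> (real^'n)) \<times> (real^'n)"
  define K where "K = closure {x. v x \<noteq> 0}"
  have K: "compact K" "K \<subseteq> U" using v by (auto simp: K_def test_functions_def)
  have vK: "x \<in> K" if "v x \<noteq> 0" for x
    using that closure_subset[of "{x. v x \<noteq> 0}"] by (auto simp: K_def)
  obtain C where C: "C \<ge> 0" "\<And>m \<xi>. m \<in> K \<Longrightarrow> norm (af m \<xi>) \<le> C * (1 + (norm \<xi>)\<^sup>2) powr - real CARD('n)"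
    using af_decay[OF K] by blast
  define w where "w \<xi> = C * (1 + (norm \<xi>)\<^sup>2) powr - real CARD('n)" for \<xi> :: "real^'n"
  have wi: "integrable lborel w"
    unfolding w_def by (rule integrable_of_decay[of _ C]) (use C(1) in auto)
  have w0: "w \<xi> \<ge> 0" for \<xi> using C(1) by (simp add: w_def)
  obtain b where b: "\<And>x. norm (\<theta> x) \<le> b" using test_function_bounded[OF \<theta>] by blast
  have [measurable]: "u \<in> borel_measurable borel" "v \<in> borel_measurable borel" "\<theta> \<in> borel_measurable borel"
    using test_function_continuous[OF u] test_function_continuous[OF v] test_function_continuous[OF \<theta>]
    by (auto intro: borel_measurable_continuous_onI)
  have keq: "k p = exp (\<i> * complex_of_real ((fst (fst p) - snd (fst p)) \<bullet> snd p)) * af (fst (fst p)) (snd p) * u (snd (fst p)) * v (fst (fst p))" for p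
    by (simp add: k_def split: prod.splits)
  have afm [measurable]: "(\<lambda>p :: ((real^'n) \<times> (real^'n)) \<times> (real^'n). af (fst (fst p)) (snd p)) \<in> borel_measurable borel"
  proof -
    have "(\<lambda>p :: ((real^'n) \<times> (real^'n)) \<times> (real^'n). (fst (fst p), snd p)) \<in> borel_measurable borel"
      by (intro borel_measurable_continuous_onI continuous_intros)
    from measurable_compose[OF this af_measurable] show ?thesis by simp
  qed
  have comp [measurable]: "(\<lambda>p :: ((real^'n) \<times> (real^'n)) \<times> (real^'n). v (fst (fst p))) \<in> borel_measurable borel"
    "(\<lambda>p :: ((real^'n) \<times> (real^'n)) \<times> (real^'n). u (snd (fst p))) \<in> borel_measurable borel"
    "(\<lambda>p :: ((real^'n) \<times> (real^'n)) \<times> (real^'n). exp (\<i> * complex_of_real ((fst (fst p) - snd (fst p)) \<bullet> snd p))) \<in> borel_measurable borel"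
    using test_function_continuous[OF u] test_function_continuous[OF v]
    by (auto intro!: borel_measurable_continuous_onI continuous_intros intro: continuous_on_compose2)
  have km [measurable]: "k \<in> borel_measurable borel"
    unfolding keq[abs_def] by (intro borel_measurable_times afm comp)
  have tm [measurable]: "(\<lambda>p :: ((real^'n) \<times> (real^'n)) \<times> (real^'n). \<theta> (\<epsilon> *\<^sub>R snd p)) \<in> borel_measurable borel" for \<epsilon>
    by (intro borel_measurable_continuous_onI continuous_on_compose2[OF test_function_continuous[OF \<theta>]] continuous_intros) auto
  define W where "W p = norm (v (fst (fst p))) * norm (u (snd (fst p))) * w (snd p)" for p :: "((real^'n) \<times> (real^'n)) \<times> (real^'n)"
  have kW: "norm (k p) \<le> W p" for p
  proof (cases "v (fst (fst p)) = 0")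
    case False
    have "norm (k p) = (norm (v (fst (fst p))) * norm (u (snd (fst p)))) * norm (af (fst (fst p)) (snd p))"
      by (simp add: keq norm_mult)
    also have "\<dots> \<le> W p" unfolding W_def w_def using C(2)[OF vK[OF False]] by (intro mult_left_mono) auto
    finally show ?thesis .
  qed (simp add: keq W_def)
  have Wi: "integrable lborel W"
  proof -
    have 1: "integrable (lborel \<Otimes>\<^sub>M lborel) (\<lambda>q :: (real^'n) \<times> (real^'n). complex_of_real (norm (v (fst q)) * norm (u (snd q))))"
      by (rule integrable_pair_bound[where u="\<lambda>x. norm (v x)" and v="\<lambda>y. norm (u y)"])
        (use test_function_integrable[OF u] test_function_integrable[OF v] in \<open>auto simp: norm_mult lborel.sigma_finite_measure_axioms\<close>)
    then have 1: "integrable lborel (\<lambda>q :: (real^'n) \<times> (real^'n). norm (v (fst q)) * norm (u (snd q)))"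
      by (simp add: lborel_prod complex_of_real_integrable_eq del: of_real_mult)
    have [measurable]: "w \<in> borel_measurable borel" using wi by (auto dest: borel_measurable_integrable)
    have "(\<lambda>p :: ((real^'n) \<times> (real^'n)) \<times> (real^'n). w (snd p)) \<in> borel_measurable borel"
      by (rule measurable_compose[OF borel_measurable_continuous_onI[OF continuous_on_snd[OF continuous_on_id]]]) measurable
    then have Wm: "W \<in> borel_measurable (lborel \<Otimes>\<^sub>M lborel)"
      unfolding W_def[abs_def] lborel_prod measurable_lborel2
      by (intro borel_measurable_times borel_measurable_norm comp) auto
    have "integrable (lborel \<Otimes>\<^sub>M lborel) (\<lambda>p. complex_of_real (W p))"
      by (rule integrable_pair_bound[where u="\<lambda>q. norm (v (fst q)) * norm (u (snd q))" and v=w])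
        (use measurable_compose[OF Wm borel_measurable_of_real] 1 wi w0 in \<open>auto simp: W_def norm_mult lborel.sigma_finite_measure_axioms\<close>)
    then show ?thesis by (simp add: lborel_prod complex_of_real_integrable_eq)
  qed
  have ki: "integrable lborel k"
    by (rule Bochner_Integration.integrable_bound[OF Wi]) (use kW km in \<open>auto intro!: AE_I2 order_trans[OF kW]\<close>)
  \<comment> \<open>For fixed \<open>x\<close> the integrals over \<open>y\<close> and \<open>\<xi>\<close> give the representation of \<open>\<pi>(f) u\<close>; off the support of \<open>v\<close> both sides
  vanish.\<close>
  have inner: "?c * (\<integral>y. \<integral>\<xi>. k ((x, y), \<xi>) \<partial>lborel \<partial>lborel) = orbit_average f u x * v x" for x
  proof (cases "v x = 0")
    case True
    then show ?thesis by (simp add: k_def)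
  next
    case False
    then have x: "x \<in> U" using vK K(2) by blast
    have "(\<integral>y. \<integral>\<xi>. k ((x, y), \<xi>) \<partial>lborel \<partial>lborel) = (\<integral>y. \<integral>\<xi>. exp (\<i> * complex_of_real ((x - y) \<bullet> \<xi>)) * af x \<xi> * u y \<partial>lborel \<partial>lborel) * v x"
      by (simp add: k_def)
    also have "(\<integral>y. \<integral>\<xi>. exp (\<i> * complex_of_real ((x - y) \<bullet> \<xi>)) * af x \<xi> * u y \<partial>lborel \<partial>lborel) =
        (\<integral>\<xi>. \<integral>y. exp (\<i> * complex_of_real ((x - y) \<bullet> \<xi>)) * af x \<xi> * u y \<partial>lborel \<partial>lborel)"
      by (rule Fubini_bound[where u="\<lambda>y. norm (u y)" and v="\<lambda>\<xi>. norm (af x \<xi>)"])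
        (use test_function_integrable[OF u] af_integrable[OF x] in \<open>auto simp: norm_mult lborel.sigma_finite_measure_axioms\<close>)
    finally show ?thesis by (simp add: fourier_representation[OF u x] mult.assoc)
  qed
  have total: "?c * (\<integral>p. k p \<partial>lborel) = (\<integral>m. orbit_average f u m * v m \<partial>lborel)"
  proof -
    have k1: "integrable (lborel \<Otimes>\<^sub>M lborel) k" using ki by (simp add: lborel_prod)
    have k2: "integrable (lborel \<Otimes>\<^sub>M lborel) (\<lambda>q. \<integral>\<xi>. k (q, \<xi>) \<partial>lborel)"
      using lborel_pair.integrable_fst'[OF k1] by (simp add: lborel_prod)
    have "(\<integral>p. k p \<partial>lborel) = (\<integral>q. \<integral>\<xi>. k (q, \<xi>) \<partial>lborel \<partial>lborel)"
      using lborel_pair.integral_fst'[OF k1] by (simp add: lborel_prod)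
    also have "\<dots> = (\<integral>x. \<integral>y. \<integral>\<xi>. k ((x, y), \<xi>) \<partial>lborel \<partial>lborel \<partial>lborel)"
      using lborel_pair.integral_fst'[OF k2] by (simp add: lborel_prod)
    finally have "?c * (\<integral>p. k p \<partial>lborel) = (\<integral>x. ?c * (\<integral>y. \<integral>\<xi>. k ((x, y), \<xi>) \<partial>lborel \<partial>lborel) \<partial>lborel)"
      by (simp only: integral_mult_right_zero)
    then show ?thesis by (simp only: inner)
  qed
  have th: "(case p of ((x, y), \<xi>) \<Rightarrow> \<theta> (\<epsilon> *\<^sub>R \<xi>) * exp (\<i> * complex_of_real ((x - y) \<bullet> \<xi>)) * af x \<xi> * u y * v x) = \<theta> (\<epsilon> *\<^sub>R snd p) * k p" for p \<epsilon>
    by (simp add: k_def mult.assoc split: prod.splits)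
  have \<theta>0: "\<theta> 0 = 1" using one by (rule eventually_nhds_x_imp_x)
  have "((\<lambda>\<epsilon>. \<integral>p. \<theta> (\<epsilon> *\<^sub>R snd p) * k p \<partial>lborel) \<longlongrightarrow> (\<integral>p. k p \<partial>lborel)) (at_right 0)"
    unfolding tendsto_at_iff_sequentially o_def
  proof (intro allI impI)
    fix X :: "nat \<Rightarrow> real" assume "X \<longlonglongrightarrow> 0"
    show "(\<lambda>j. \<integral>p. \<theta> (X j *\<^sub>R snd p) * k p \<partial>lborel) \<longlonglongrightarrow> (\<integral>p. k p \<partial>lborel)"
    proof (rule integral_dominated_convergence[where w="\<lambda>p. b * W p"])
      show "integrable lborel (\<lambda>p. b * W p)" using Wi by simp
      show "AE p in lborel. norm (\<theta> (X j *\<^sub>R snd p) * k p) \<le> b * W p" for j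
        unfolding norm_mult by (intro AE_I2 mult_mono b kW) (use order_trans[OF norm_ge_zero b] in auto)
      show "AE p in lborel. (\<lambda>j. \<theta> (X j *\<^sub>R snd p) * k p) \<longlonglongrightarrow> k p"
      proof (intro AE_I2)
        fix p :: "((real^'n) \<times> (real^'n)) \<times> (real^'n)"
        have "(\<lambda>j. X j *\<^sub>R snd p) \<longlonglongrightarrow> 0 *\<^sub>R snd p" by (intro tendsto_intros \<open>X \<longlonglongrightarrow> 0\<close>)
        then have "(\<lambda>j. X j *\<^sub>R snd p) \<longlonglongrightarrow> 0" by simp
        moreover have "isCont \<theta> 0" using test_function_continuous[OF \<theta>] by (simp add: continuous_on_eq_continuous_at)
        ultimately have "(\<lambda>j. \<theta> (X j *\<^sub>R snd p)) \<longlonglongrightarrow> \<theta> 0" by (rule isCont_tendsto_compose[rotated])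
        from tendsto_mult[OF this tendsto_const, of "k p"]
        show "(\<lambda>j. \<theta> (X j *\<^sub>R snd p) * k p) \<longlonglongrightarrow> k p" by (simp add: \<theta>0)
      qed
    qed (use km tm in measurable)
  qed
  from tendsto_mult[OF tendsto_const this, of ?c]
  show ?thesis unfolding th total .
qed

text \<open>The phase has no critical points away from \<open>\<xi> = 0\<close>: its derivative in the direction \<open>m\<close> is
\<open>\<xi>\<close> itself.\<close>

lemma fourier_integral_representation:
  "fourier_integral_operator U UNIV (\<lambda>(m, m') \<xi>. (m - m') \<bullet> \<xi>) l (\<lambda>(m, m') \<xi>. af m \<xi>)
     (\<lambda>\<phi> v. \<integral>m. integrated_rep \<rho> \<mu> f \<phi> m * v m \<partial>lborel)"
proof -
  have ph: "(\<lambda>(z, \<xi>). (case z of (m, m') \<Rightarrow> \<lambda>\<xi>. (m - m') \<bullet> \<xi>) \<xi>) = (\<lambda>(z, \<xi> :: real^'n). case z of (m, m') \<Rightarrow> (m - m') \<bullet> \<xi>)"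
    by (auto simp: fun_eq_iff split: prod.splits)
  have "phase_function (U \<times> UNIV) (\<lambda>(m, m') (\<xi> :: real^'n). (m - m') \<bullet> \<xi>)"
    unfolding phase_function_def ph
  proof (intro conjI ballI allI impI)
    show "smooth_on ((U \<times> UNIV) \<times> - {0}) (\<lambda>(z, \<xi> :: real^'n). case z of (m, m') \<Rightarrow> (m - m') \<bullet> \<xi>)"
      by (rule smooth_bilinear_phase)
    fix z and \<xi> :: "real^'n" assume \<xi>: "\<xi> \<noteq> 0"
    show "(case z of (m, m') \<Rightarrow> \<lambda>\<xi>. (m - m') \<bullet> \<xi>) (t *\<^sub>R \<xi>) = t * (case z of (m, m') \<Rightarrow> \<lambda>\<xi>. (m - m') \<bullet> \<xi>) \<xi>" for t
      by (simp split: prod.splits)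
    have "frechet_derivative (\<lambda>(z, \<xi> :: real^'n). case z of (m, m') \<Rightarrow> (m - m') \<bullet> \<xi>) (at (z, \<xi>)) ((\<xi>, 0), 0) = \<xi> \<bullet> \<xi>"
      by (subst frechet_derivative_at[OF phase_has_derivative, symmetric]) simp
    then show "\<exists>v. frechet_derivative (\<lambda>(z, \<xi> :: real^'n). case z of (m, m') \<Rightarrow> (m - m') \<bullet> \<xi>) (at (z, \<xi>)) v \<noteq> 0"
      using \<xi> by (intro exI[of _ "((\<xi>, 0), 0)"]) simp
  qed
  then show ?thesis
    unfolding fourier_integral_operator_def
    using open_U af_amplitude[of l] pairing_distribution oscillatory_limit
    by (simp add: integrated_rep_eq)
qed

end

theorem theorem2:
  fixes GC :: "(complex^'m^'m) set"
    and \<rho> :: "complex^'m^'m \<Rightarrow> complex^'n^'n"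
    and SC :: "(complex^'n) set"
    and SR U :: "(real^'n) set"
    and GR G :: "(real^'m^'m) set"
    and R :: "real^'m^'m \<Rightarrow> real^'m^'m \<Rightarrow> real^'m^'m \<Rightarrow> real"
    and \<mu> :: "(real^'m^'m) measure"
    and f :: "real^'m^'m \<Rightarrow> complex"
    and a\<^sub>f :: "real^'n \<Rightarrow> real^'n \<Rightarrow> complex"
  assumes "prehomogeneous_over_reals GC \<rho>"
    and "singular_set GC \<rho> SC"
    and "SR = real_points SC"
    and "U = UNIV - SR"
    and "GR = real_points_group GC"
    and "G = identity_component GR"
    and "left_invariant_metric GR R"
    and "left_haar_measure G \<mu>"
    and "f \<in> rapidly_decreasing GR R \<mu>"
    and "a\<^sub>f = symbol_of \<rho> \<mu> f"
  shows "a\<^sub>f \<in> smoothing_symbol_class U \<and>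
    (\<forall>l. fourier_integral_operator U UNIV
           (\<lambda>(m, m') \<xi>. (m - m') \<bullet> \<xi>) l (\<lambda>(m, m') \<xi>. a\<^sub>f m \<xi>)
           (\<lambda>\<phi> v. \<integral>m. integrated_rep \<rho> \<mu> f \<phi> m * v m \<partial>lborel)) \<and>
    (\<forall>\<phi>\<in>test_functions UNIV. \<forall>m\<in>U.
       integrable lborel
         (\<lambda>(m', \<xi>). exp (\<i> * complex_of_real ((m - m') \<bullet> \<xi>)) * a\<^sub>f m \<xi> * \<phi> m') \<and>
       integrated_rep \<rho> \<mu> f \<phi> m =
         complex_of_real ((2 * pi) powr - real CARD('n)) *
         (\<integral>\<xi>. (\<integral>m'. exp (\<i> * complex_of_real ((m - m') \<bullet> \<xi>)) * a\<^sub>f m \<xi> * \<phi> m' \<partial>lborel) \<partial>lborel)) \<and>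
    integrated_rep \<rho> \<mu> f \<in> smoothing_pseudodiff_class U"
proof -
  obtain \<Omega> where \<Omega>: "dense_orbit GC \<rho> \<Omega>" "SC = - \<Omega>" using assms(2) by (auto simp: singular_set_def)
  interpret A: alg_rep GC \<rho>
    using assms(1) by unfold_locales (simp_all add: prehomogeneous_over_reals_def)
  have G: "A.GR = GR" "A.G = G" by (simp_all add: A.GR_def A.G_def assms(5,6))
  interpret A: rapid_rep GC \<rho> \<mu> R f \<Omega>
    by unfold_locales (use assms(7-9) \<Omega>(1) in \<open>simp_all add: G\<close>)
  have U: "U = A.U" using \<Omega>(2) by (auto simp: A.U_def assms(3,4) real_points_def)
  show ?thesis
    unfolding assms(10) U smoothing_symbol_class_def smoothing_pseudodiff_class_def
    using A.af_symbol A.fourier_integral_representation A.kernel_integrable A.fourier_representation A.pseudodifferential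
    by (simp add: A.integrated_rep_eq)
qed

end
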